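(* Let $\Lambda$ be a directed set and $\{(\mathcal{C}_\lambda,\mathcal{D}_\lambda,\alpha_{\lambda\mu}):\lambda\geq\mu\}$ a system of pseudo-Cartan inclusions directed by $\Lambda$. Let $\mathcal{C}:=\varinjlim\mathcal{C}_\lambda$, $\mathcal{D}:=\varinjlim\mathcal{D}_\lambda$, and let $\underrightarrow{\alpha_\lambda}:\mathcal{C}_\lambda\to\mathcal{C}$ be the canonical embeddings. Then: (a) $(\mathcal{C},\mathcal{D})$ is a pseudo-Cartan inclusion, and for each $\lambda$, $(\mathcal{C},\mathcal{D},\underrightarrow{\alpha_\lambda})$ is a regular and essential expansion of $(\mathcal{C}_\lambda,\mathcal{D}_\lambda)$; (b) if each $(\mathcal{C}_\lambda,\mathcal{D}_\lambda)$ is a Cartan inclusion with conditional expectation $\Delta_\lambda:\mathcal{C}_\lambda\to\mathcal{D}_\lambda$, then $(\mathcal{C},\mathcal{D})$ is a Cartan inclusion and its conditional expectation $\Delta:\mathcal{C}\to\mathcal{D}$ satisfies $\Delta\circ\underrightarrow{\alpha_\lambda}=\underrightarrow{\alpha_\lambda}\circ\Delta_\lambda$ for every $\lambda$.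
   Context: Inclusion: C*-algebra with C*-subalgebra. $\mathcal{N}(\mathcal{C},\mathcal{D})=\{v: v\mathcal{D}v^*\cup v^*\mathcal{D}v\subseteq\mathcal{D}\}$; regular: span dense. $\mathcal{D}^c$: relative commutant. Ideal intersection property: every nonzero closed ideal of the larger algebra meets the subalgebra nontrivially. Pseudo-Cartan inclusion: regular, $\mathcal{D}$ and $\mathcal{D}^c$ abelian, $(\mathcal{C},\mathcal{D}^c)$ and $(\mathcal{D}^c,\mathcal{D})$ with the ideal intersection property. Cartan inclusion: regular, $\mathcal{D}$ maximal abelian, faithful conditional expectation onto $\mathcal{D}$. Expansion of $(\mathcal{C}_\mu,\mathcal{D}_\mu)$: $(\mathcal{C}_\lambda,\mathcal{D}_\lambda,\alpha)$ with $\alpha:\mathcal{C}_\mu\to\mathcal{C}_\lambda$ a $*$-monomorphism, $\alpha(\mathcal{D}_\mu)\subseteq\mathcal{D}_\lambda$; essential if $(\mathcal{D}_\lambda,\alpha(\mathcal{D}_\mu))$ has the ideal intersection property; regular if $\alpha(\mathcal{N}(\mathcal{C}_\mu,\mathcal{D}_\mu))\subseteq\mathcal{N}(\mathcal{C}_\lambda,\mathcal{D}_\lambda)$. A system of pseudo-Cartan inclusions directed by $\Lambda$: pseudo-Cartan inclusions $(\mathcal{C}_\lambda,\mathcal{D}_\lambda)$, $\lambda\in\Lambda$, and for each $\lambda\geq\mu$ a regular essential expansion $(\mathcal{C}_\lambda,\mathcal{D}_\lambda,\alpha_{\lambda\mu})$ of $(\mathcal{C}_\mu,\mathcal{D}_\mu)$,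 with $\alpha_{\lambda\nu}=\alpha_{\lambda\mu}\circ\alpha_{\mu\nu}$ for $\lambda\geq\mu\geq\nu$. The inductive limits are the C*-algebraic ones, with $\varinjlim\mathcal{D}_\lambda\subseteq\varinjlim\mathcal{C}_\lambda$ and $\underrightarrow{\alpha_\lambda}\circ\alpha_{\lambda\mu}=\underrightarrow{\alpha_\mu}$. *)

theory Defs
  imports Complex_Main
begin

record 'a cstar =
  cs_carrier :: "'a set"
  cs_zero :: 'a
  cs_add :: "'a \<Rightarrow> 'a \<Rightarrow> 'a"
  cs_smult :: "complex \<Rightarrow> 'a \<Rightarrow> 'a"
  cs_mult :: "'a \<Rightarrow> 'a \<Rightarrow> 'a"
  cs_star :: "'a \<Rightarrow> 'a"
  cs_norm :: "'a \<Rightarrow> real"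

definition cs_diff :: "'a cstar \<Rightarrow> 'a \<Rightarrow> 'a \<Rightarrow> 'a" where
  "cs_diff A x y = cs_add A x (cs_smult A (-1) y)"

definition cs_dist :: "'a cstar \<Rightarrow> 'a \<Rightarrow> 'a \<Rightarrow> real" where
  "cs_dist A x y = cs_norm A (cs_diff A x y)"

definition cs_complete :: "'a cstar \<Rightarrow> bool" where
  "cs_complete A \<longleftrightarrow>
     (\<forall>s :: nat \<Rightarrow> 'a. (\<forall>n. s n \<in> cs_carrier A) \<longrightarrow>
        (\<forall>e>0. \<exists>N. \<forall>m\<ge>N. \<forall>n\<ge>N. cs_dist A (s m) (s n) < e) \<longrightarrow>
        (\<exists>y\<in>cs_carrier A. \<forall>e>0. \<exists>N. \<forall>n\<ge>N. cs_dist A (s n) y < e))"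

definition cstar_alg :: "'a cstar \<Rightarrow> bool" where
  "cstar_alg A \<longleftrightarrow>
    (let C = cs_carrier A; add = cs_add A; sm = cs_smult A; mul = cs_mult A;
         st = cs_star A; nm = cs_norm A; z = cs_zero A in
     z \<in> C \<and>
     (\<forall>x\<in>C. \<forall>y\<in>C. add x y \<in> C \<and> mul x y \<in> C) \<and>
     (\<forall>c. \<forall>x\<in>C. sm c x \<in> C) \<and> (\<forall>x\<in>C. st x \<in> C) \<and>
     (\<forall>x\<in>C. \<forall>y\<in>C. \<forall>w\<in>C. add (add x y) w = add x (add y w)) \<and>
     (\<forall>x\<in>C. \<forall>y\<in>C. add x y = add y x) \<and>
     (\<forall>x\<in>C. add z x = x) \<and>
     (\<forall>x\<in>C. add x (sm (-1) x) = z) \<and>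
     (\<forall>a. \<forall>x\<in>C. \<forall>y\<in>C. sm a (add x y) = add (sm a x) (sm a y)) \<and>
     (\<forall>a b. \<forall>x\<in>C. sm (a + b) x = add (sm a x) (sm b x)) \<and>
     (\<forall>a b. \<forall>x\<in>C. sm (a * b) x = sm a (sm b x)) \<and>
     (\<forall>x\<in>C. sm 1 x = x) \<and>
     (\<forall>x\<in>C. \<forall>y\<in>C. \<forall>w\<in>C. mul (mul x y) w = mul x (mul y w)) \<and>
     (\<forall>x\<in>C. \<forall>y\<in>C. \<forall>w\<in>C. mul (add x y) w = add (mul x w) (mul y w)) \<and>
     (\<forall>x\<in>C. \<forall>y\<in>C. \<forall>w\<in>C. mul x (add y w) = add (mul x y) (mul x w)) \<and>
     (\<forall>a. \<forall>x\<in>C. \<forall>y\<in>C. sm a (mul x y) = mul (sm a x) y \<and> sm a (mul x y) = mul x (sm a y)) \<and>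
     (\<forall>x\<in>C. st (st x) = x) \<and>
     (\<forall>x\<in>C. \<forall>y\<in>C. st (add x y) = add (st x) (st y)) \<and>
     (\<forall>a. \<forall>x\<in>C. st (sm a x) = sm (cnj a) (st x)) \<and>
     (\<forall>x\<in>C. \<forall>y\<in>C. st (mul x y) = mul (st y) (st x)) \<and>
     (\<forall>x\<in>C. nm x \<ge> 0 \<and> (nm x = 0 \<longleftrightarrow> x = z)) \<and>
     (\<forall>x\<in>C. \<forall>y\<in>C. nm (add x y) \<le> nm x + nm y) \<and>
     (\<forall>a. \<forall>x\<in>C. nm (sm a x) = cmod a * nm x) \<and>
     (\<forall>x\<in>C. \<forall>y\<in>C. nm (mul x y) \<le> nm x * nm y) \<and>
     (\<forall>x\<in>C. nm (mul (st x) x) = (nm x)\<^sup>2) \<and>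
     cs_complete A)"

definition cs_closure :: "'a cstar \<Rightarrow> 'a set \<Rightarrow> 'a set" where
  "cs_closure A S = {x \<in> cs_carrier A. \<forall>e>0. \<exists>s\<in>S. cs_dist A x s < e}"

inductive_set cs_span :: "'a cstar \<Rightarrow> 'a set \<Rightarrow> 'a set" for A S where
  span_zero: "cs_zero A \<in> cs_span A S"
| span_base: "s \<in> S \<Longrightarrow> s \<in> cs_span A S"
| span_add: "x \<in> cs_span A S \<Longrightarrow> y \<in> cs_span A S \<Longrightarrow> cs_add A x y \<in> cs_span A S"
| span_smult: "x \<in> cs_span A S \<Longrightarrow> cs_smult A c x \<in> cs_span A S"

definition cs_subalg :: "'a cstar \<Rightarrow> 'a set \<Rightarrow> bool" where
  "cs_subalg A D \<longleftrightarrow> D \<subseteq> cs_carrier A \<and> cs_zero A \<in> D \<and>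
     (\<forall>x\<in>D. \<forall>y\<in>D. cs_add A x y \<in> D \<and> cs_mult A x y \<in> D) \<and>
     (\<forall>c. \<forall>x\<in>D. cs_smult A c x \<in> D) \<and> (\<forall>x\<in>D. cs_star A x \<in> D) \<and>
     cs_closure A D = D"

definition cs_abelian :: "'a cstar \<Rightarrow> 'a set \<Rightarrow> bool" where
  "cs_abelian A S \<longleftrightarrow> (\<forall>x\<in>S. \<forall>y\<in>S. cs_mult A x y = cs_mult A y x)"

definition normalizers :: "'a cstar \<Rightarrow> 'a set \<Rightarrow> 'a set" where
  "normalizers A D = {v \<in> cs_carrier A. \<forall>d\<in>D.
      cs_mult A (cs_mult A v d) (cs_star A v) \<in> D \<and>
      cs_mult A (cs_mult A (cs_star A v) d) v \<in> D}"

definition regular_incl :: "'a cstar \<Rightarrow> 'a set \<Rightarrow> bool" where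
  "regular_incl A D \<longleftrightarrow> cs_closure A (cs_span A (normalizers A D)) = cs_carrier A"

definition relcomm :: "'a cstar \<Rightarrow> 'a set \<Rightarrow> 'a set" where
  "relcomm A D = {x \<in> cs_carrier A. \<forall>d\<in>D. cs_mult A x d = cs_mult A d x}"

definition closed_ideal_in :: "'a cstar \<Rightarrow> 'a set \<Rightarrow> 'a set \<Rightarrow> bool" where
  "closed_ideal_in A B J \<longleftrightarrow> J \<subseteq> B \<and> cs_zero A \<in> J \<and>
     (\<forall>x\<in>J. \<forall>y\<in>J. cs_add A x y \<in> J) \<and> (\<forall>c. \<forall>x\<in>J. cs_smult A c x \<in> J) \<and>
     (\<forall>x\<in>J. \<forall>b\<in>B. cs_mult A b x \<in> J \<and> cs_mult A x b \<in> J) \<and>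
     cs_closure A J = J"

definition iip :: "'a cstar \<Rightarrow> 'a set \<Rightarrow> 'a set \<Rightarrow> bool" where
  "iip A B D \<longleftrightarrow> (\<forall>J. closed_ideal_in A B J \<and> J \<noteq> {cs_zero A} \<longrightarrow> J \<inter> D \<noteq> {cs_zero A})"

definition pseudo_cartan :: "'a cstar \<Rightarrow> 'a set \<Rightarrow> bool" where
  "pseudo_cartan A D \<longleftrightarrow> cstar_alg A \<and> cs_subalg A D \<and> regular_incl A D \<and>
     cs_abelian A D \<and> cs_abelian A (relcomm A D) \<and>
     iip A (cs_carrier A) (relcomm A D) \<and> iip A (relcomm A D) D"

definition max_abelian :: "'a cstar \<Rightarrow> 'a set \<Rightarrow> bool" where
  "max_abelian A D \<longleftrightarrow> cs_abelian A D \<and>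
     (\<forall>E. cs_subalg A E \<and> cs_abelian A E \<and> D \<subseteq> E \<longrightarrow> E = D)"

definition cs_positive :: "'a cstar \<Rightarrow> 'a \<Rightarrow> bool" where
  "cs_positive A p \<longleftrightarrow> (\<exists>y\<in>cs_carrier A. p = cs_mult A (cs_star A y) y)"

definition cond_exp :: "'a cstar \<Rightarrow> 'a set \<Rightarrow> ('a \<Rightarrow> 'a) \<Rightarrow> bool" where
  "cond_exp A D E \<longleftrightarrow> E ` cs_carrier A \<subseteq> D \<and> (\<forall>d\<in>D. E d = d) \<and>
     (\<forall>x\<in>cs_carrier A. \<forall>y\<in>cs_carrier A. E (cs_add A x y) = cs_add A (E x) (E y)) \<and>
     (\<forall>c. \<forall>x\<in>cs_carrier A. E (cs_smult A c x) = cs_smult A c (E x)) \<and>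
     (\<forall>x\<in>cs_carrier A. \<forall>d\<in>D. \<forall>d'\<in>D.
        E (cs_mult A (cs_mult A d x) d') = cs_mult A (cs_mult A d (E x)) d') \<and>
     (\<forall>x\<in>cs_carrier A. cs_positive A x \<longrightarrow> cs_positive A (E x)) \<and>
     (\<forall>x\<in>cs_carrier A. cs_norm A (E x) \<le> cs_norm A x)"

definition faithful_cond_exp :: "'a cstar \<Rightarrow> 'a set \<Rightarrow> ('a \<Rightarrow> 'a) \<Rightarrow> bool" where
  "faithful_cond_exp A D E \<longleftrightarrow> cond_exp A D E \<and>
     (\<forall>x\<in>cs_carrier A. E (cs_mult A (cs_star A x) x) = cs_zero A \<longrightarrow> x = cs_zero A)"

definition cartan :: "'a cstar \<Rightarrow> 'a set \<Rightarrow> bool" where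
  "cartan A D \<longleftrightarrow> cstar_alg A \<and> cs_subalg A D \<and> regular_incl A D \<and> max_abelian A D \<and>
     (\<exists>E. faithful_cond_exp A D E)"

definition star_hom :: "'a cstar \<Rightarrow> 'b cstar \<Rightarrow> ('a \<Rightarrow> 'b) \<Rightarrow> bool" where
  "star_hom A B f \<longleftrightarrow> f ` cs_carrier A \<subseteq> cs_carrier B \<and>
     (\<forall>x\<in>cs_carrier A. \<forall>y\<in>cs_carrier A.
        f (cs_add A x y) = cs_add B (f x) (f y) \<and> f (cs_mult A x y) = cs_mult B (f x) (f y)) \<and>
     (\<forall>c. \<forall>x\<in>cs_carrier A. f (cs_smult A c x) = cs_smult B c (f x)) \<and>
     (\<forall>x\<in>cs_carrier A. f (cs_star A x) = cs_star B (f x))"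

definition star_mono :: "'a cstar \<Rightarrow> 'b cstar \<Rightarrow> ('a \<Rightarrow> 'b) \<Rightarrow> bool" where
  "star_mono A B f \<longleftrightarrow> star_hom A B f \<and> inj_on f (cs_carrier A)"

definition expansion :: "'b cstar \<Rightarrow> 'b set \<Rightarrow> ('a \<Rightarrow> 'b) \<Rightarrow> 'a cstar \<Rightarrow> 'a set \<Rightarrow> bool" where
  "expansion B DB f A DA \<longleftrightarrow> star_mono A B f \<and> f ` DA \<subseteq> DB"

definition essential_exp :: "'b cstar \<Rightarrow> 'b set \<Rightarrow> ('a \<Rightarrow> 'b) \<Rightarrow> 'a cstar \<Rightarrow> 'a set \<Rightarrow> bool" where
  "essential_exp B DB f A DA \<longleftrightarrow> expansion B DB f A DA \<and> iip B DB (f ` DA)"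

definition regular_exp :: "'b cstar \<Rightarrow> 'b set \<Rightarrow> ('a \<Rightarrow> 'b) \<Rightarrow> 'a cstar \<Rightarrow> 'a set \<Rightarrow> bool" where
  "regular_exp B DB f A DA \<longleftrightarrow> expansion B DB f A DA \<and>
     f ` normalizers A DA \<subseteq> normalizers B DB"

definition directed_set :: "'i set \<Rightarrow> ('i \<Rightarrow> 'i \<Rightarrow> bool) \<Rightarrow> bool" where
  "directed_set I le \<longleftrightarrow> I \<noteq> {} \<and> (\<forall>i\<in>I. le i i) \<and>
     (\<forall>i\<in>I. \<forall>j\<in>I. \<forall>k\<in>I. le i j \<and> le j k \<longrightarrow> le i k) \<and>
     (\<forall>i\<in>I. \<forall>j\<in>I. \<exists>k\<in>I. le i k \<and> le j k)"

text \<open>System of pseudo-Cartan inclusions directed by (I, le); \<open>le \<mu> \<lambda>\<close> means \<mu> \<le> \<lambda>,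
and \<open>\<alpha> \<lambda> \<mu>\<close> is the connecting map from C \<mu> to C \<lambda>.\<close>
definition pc_system :: "'i set \<Rightarrow> ('i \<Rightarrow> 'i \<Rightarrow> bool) \<Rightarrow> ('i \<Rightarrow> 'a cstar) \<Rightarrow> ('i \<Rightarrow> 'a set)
    \<Rightarrow> ('i \<Rightarrow> 'i \<Rightarrow> 'a \<Rightarrow> 'a) \<Rightarrow> bool" where
  "pc_system I le C D \<alpha> \<longleftrightarrow> directed_set I le \<and>
     (\<forall>l\<in>I. pseudo_cartan (C l) (D l)) \<and>
     (\<forall>l\<in>I. \<forall>m\<in>I. le m l \<longrightarrow>
        regular_exp (C l) (D l) (\<alpha> l m) (C m) (D m) \<and> essential_exp (C l) (D l) (\<alpha> l m) (C m) (D m)) \<and>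
     (\<forall>l\<in>I. \<forall>m\<in>I. \<forall>n\<in>I. le n m \<and> le m l \<longrightarrow>
        (\<forall>x\<in>cs_carrier (C n). \<alpha> l n x = \<alpha> l m (\<alpha> m n x)))"

text \<open>(L, \<beta>) is the C*-inductive limit of the system: L is a C*-algebra, the canonical maps
\<beta> \<lambda> are compatible *-monomorphisms, and the union of their ranges is dense.  Since the
connecting maps are injective, this characterizes the inductive limit up to isomorphism.\<close>
definition is_ind_limit :: "'i set \<Rightarrow> ('i \<Rightarrow> 'i \<Rightarrow> bool) \<Rightarrow> ('i \<Rightarrow> 'a cstar)
    \<Rightarrow> ('i \<Rightarrow> 'i \<Rightarrow> 'a \<Rightarrow> 'a) \<Rightarrow> 'b cstar \<Rightarrow> ('i \<Rightarrow> 'a \<Rightarrow> 'b) \<Rightarrow> bool" where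
  "is_ind_limit I le C \<alpha> L \<beta> \<longleftrightarrow> cstar_alg L \<and>
     (\<forall>l\<in>I. star_mono (C l) L (\<beta> l)) \<and>
     (\<forall>l\<in>I. \<forall>m\<in>I. le m l \<longrightarrow> (\<forall>x\<in>cs_carrier (C m). \<beta> l (\<alpha> l m x) = \<beta> m x)) \<and>
     cs_closure L (\<Union>l\<in>I. \<beta> l ` cs_carrier (C l)) = cs_carrier L"

definition limit_sub :: "'i set \<Rightarrow> ('i \<Rightarrow> 'a set) \<Rightarrow> 'b cstar \<Rightarrow> ('i \<Rightarrow> 'a \<Rightarrow> 'b) \<Rightarrow> 'b set" where
  "limit_sub I D L \<beta> = cs_closure L (\<Union>l\<in>I. \<beta> l ` D l)"

end

theory Submission
  imports Defs "HOL-Complex_Analysis.Complex_Analysis"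
begin

text \<open>Everything is moved, by the isometric injective homomorphisms \<open>\<beta> i\<close>, into the unitization \<open>U\<close> of the
limit algebra, where \<open>C\<close> and \<open>D\<close> are closures of increasing unions of \<open>C\<^sub>i\<close> and \<open>D\<^sub>i\<close>. Call \<open>x\<close> locally
scalar if every nonzero closed ideal of \<open>D\<close> contains a nonzero closed ideal \<open>K\<close> with
\<open>k x k' \<approx> c k k'\<close> on \<open>K\<close>; the constants \<open>c\<close> play the role of a pseudo-expectation with values in
the injective envelope of \<open>D\<close>. A normalizer in \<open>C\<^sub>i\<close> is locally scalar over \<open>D\<^sub>i\<close>: locally it either moves
points, and is compressed to zero, or lies in the abelian relative commutant, in which \<open>D\<^sub>i\<close> is
essential. Regularity, essentiality of \<open>D\<^sub>i\<close> in \<open>D\<close> and density make all of \<open>C\<close> locally scalar over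
\<open>D\<close>. The elements that are locally small form a closed two-sided ideal of \<open>C\<close> meeting \<open>D\<close> in zero.
Nonzero ideals of \<open>C\<close> meet some \<open>C\<^sub>i\<close>, hence \<open>D\<close>, so this ideal vanishes; commutativity of the relative
commutant, its ideal intersection property, and existence and uniqueness of the expectation in the
Cartan case all follow from this.\<close>

section \<open>Seminorms on polynomials satisfying the C*-identity\<close>

text \<open>The one analytic tool is functional calculus for a single self-adjoint element. It is
  obtained without spectra, from the fact that a C*-seminorm of a polynomial is at most its supremum
  on an interval; Chebyshev polynomials give this. The algebras need not have units, nor do their
  ideals. Hence the ambient unital algebra, where subtracting a scalar makes sense, and the elements
  \<open>bu h\<close>, which act as a unit on a smaller ideal. Two notions of smallness are needed.
  A normalizer that moves points is small only in compressions \<open>k x k'\<close>, so scalars can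
  be assigned only to two-sided compressions. Two-sided smallness is not stable under products, so
  the ideal that has to vanish is defined by one-sided products \<open>x k\<close>. The bridge
  between the two is available for elements commuting with \<open>D\<close>, where a local unit
  moves across, and for products \<open>x\<^sup>\<star> \<otimes> x\<close>, whose compression by
  \<open>k\<close> is the square of \<open>x k\<close>.\<close>

lemma poly_ext: "(\<And>x. poly p x = poly q x) \<Longrightarrow> p = q" for p q :: "complex poly"
  using poly_eq_poly_eq_iff by blast

lemma cnjp_mult: "map_poly cnj (p * q) = map_poly cnj p * map_poly cnj q"
  by (rule poly_ext) simp

lemma cnjp_add: "map_poly cnj (p + q) = map_poly cnj p + map_poly cnj q"
  by (rule poly_ext) simp

lemma cnjp_diff: "map_poly cnj (p - q) = map_poly cnj p - map_poly cnj q"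
  by (rule poly_ext) simp

lemma cnjp_smult: "map_poly cnj (smult c q) = smult (cnj c) (map_poly cnj q)"
  by (rule poly_ext) simp

lemma cnjp_cnjp [simp]: "map_poly cnj (map_poly cnj p) = p"
  by (rule poly_ext) simp

lemma cnjp_pCons: "map_poly cnj (pCons a p) = pCons (cnj a) (map_poly cnj p)"
  by (rule poly_ext) simp

text \<open>The pair encodes \<open>cos (k t)\<close> and \<open>sin (k t) / sin t\<close> as
  polynomials in \<open>cos t\<close>, and the recursion is the addition theorem. The second
  component is thus the Chebyshev polynomial of the second kind of index \<open>k - 1\<close>, which
  is why it starts with 0.\<close>

fun cheb :: "nat \<Rightarrow> complex poly \<times> complex poly" where
  "cheb 0 = (1, 0)"
| "cheb (Suc k) = ([:0,1:] * fst (cheb k) - (1 - [:0,1:]\<^sup>2) * snd (cheb k), [:0,1:] * snd (cheb k) + fst (cheb k))"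

abbreviation "chT k \<equiv> fst (cheb k)"
abbreviation "chU k \<equiv> snd (cheb k)"

lemma cnjp_cheb: "map_poly cnj (chT k) = chT k \<and> map_poly cnj (chU k) = chU k"
proof (induction k)
  case (Suc k)
  have "map_poly cnj ([:0,1:]\<^sup>2) = [:0,1:]\<^sup>2"
    by (rule poly_ext) simp
  with Suc show ?case
    by (simp add: cnjp_mult cnjp_add cnjp_diff cnjp_pCons)
qed simp

lemma cheb_pythagoras: "chT k * chT k + (1 - [:0,1:]\<^sup>2) * (chU k * chU k) = 1"
proof (induction k)
  case (Suc k)
  have "(X * T - (1 - X\<^sup>2) * U) * (X * T - (1 - X\<^sup>2) * U) + (1 - X\<^sup>2) * ((X * U + T) * (X * U + T))
      = T * T + (1 - X\<^sup>2) * (U * U)" for X T U :: "complex poly"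
    by algebra
  from this[of "[:0,1:]" "chT k" "chU k"] Suc show ?case by simp
qed simp

text \<open>For \<open>z = exp (i t)\<close> one gets \<open>x = cos t\<close> and
  \<open>d = i sin t\<close>, so this is de Moivre's formula. The induction uses only
  \<open>d * d = x\<^sup>2 - 1\<close>, \<open>x + d = z\<close> and
  \<open>x - d = 1/z\<close>.\<close>

lemma cheb_joukowski:
  assumes "z \<noteq> 0"
  defines "x \<equiv> (z + 1/z)/2" and "d \<equiv> (z - 1/z)/2"
  shows "poly (chT k) x + d * poly (chU k) x = z ^ k \<and> poly (chT k) x - d * poly (chU k) x = (1/z) ^ k"
proof (induction k)
  case (Suc k)
  have d2: "1 - x\<^sup>2 = - (d * d)"
    using assms(1) by (simp add: x_def d_def field_simps power2_eq_square)
  have z: "x + d = z" "x - d = 1/z"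
    by (simp_all add: x_def d_def field_simps)
  have T: "poly (chT (Suc k)) x = x * poly (chT k) x + d * d * poly (chU k) x"
    using d2 by (simp add: power2_eq_square)
  have U: "poly (chU (Suc k)) x = x * poly (chU k) x + poly (chT k) x"
    by simp
  have "poly (chT (Suc k)) x + d * poly (chU (Suc k)) x = (x + d) * (poly (chT k) x + d * poly (chU k) x)"
    unfolding T U by (simp add: algebra_simps)
  moreover have "poly (chT (Suc k)) x - d * poly (chU (Suc k)) x = (x - d) * (poly (chT k) x - d * poly (chU k) x)"
    unfolding T U by (simp add: algebra_simps)
  ultimately show ?case using Suc z by simp
qed simp

lemma cheb_unit_circle:
  assumes "cmod z = 1"
  shows "poly (chT k) (of_real (Re z)) = (z ^ k + cnj z ^ k) / 2"
proof -
  have z0: "z \<noteq> 0" using assms by auto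
  have inv: "1 / z = cnj z"
    using assms z0 by (simp add: field_simps complex_norm_square[symmetric])
  have "(z + 1/z)/2 = of_real (Re z)"
    unfolding inv by (simp add: complex_add_cnj)
  moreover have "t = (a + b) / 2" if "t + d = a \<and> t - d = b" for t d a b :: complex
    using that by auto
  ultimately show ?thesis
    using cheb_joukowski[OF z0, of k] unfolding inv by metis
qed

text \<open>Product formula for cosines. At \<open>k = 0\<close> the lower neighbour has index 1,
  because the cosine is even.\<close>

lemma cheb_X: "[:0,1:] * chT k = smult (1/2) (chT (Suc k) + chT (if k = 0 then 1 else k - 1))"
proof (cases k)
  case 0
  then show ?thesis by (simp flip: smult_add_left)
next
  case (Suc j)
  have "[:0,1:] * chT (Suc j) = smult (1/2) (chT (Suc (Suc j)) + chT j)"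
    by (rule poly_ext) (simp add: algebra_simps power2_eq_square)
  with Suc show ?thesis by simp
qed

definition cheb_span :: "nat \<Rightarrow> complex poly set" where
  "cheb_span m = {\<Sum>k\<le>m. smult (a k) (chT k) | a. True}"

lemma cheb_span_add: "p \<in> cheb_span m \<Longrightarrow> q \<in> cheb_span m \<Longrightarrow> p + q \<in> cheb_span m"
proof -
  assume "p \<in> cheb_span m" "q \<in> cheb_span m"
  then obtain a b where "p = (\<Sum>k\<le>m. smult (a k) (chT k))" "q = (\<Sum>k\<le>m. smult (b k) (chT k))"
    unfolding cheb_span_def by blast
  then have "p + q = (\<Sum>k\<le>m. smult (a k + b k) (chT k))"
    by (simp add: smult_add_left sum.distrib)
  then show ?thesis unfolding cheb_span_def by (auto intro!: exI[of _ "\<lambda>k. a k + b k"])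
qed

lemma cheb_span_smult: "p \<in> cheb_span m \<Longrightarrow> smult c p \<in> cheb_span m"
proof -
  assume "p \<in> cheb_span m"
  then obtain a where "p = (\<Sum>k\<le>m. smult (a k) (chT k))"
    unfolding cheb_span_def by blast
  then have "smult c p = (\<Sum>k\<le>m. smult (c * a k) (chT k))"
    by (simp add: poly_ext poly_sum sum_distrib_left mult.assoc)
  then show ?thesis unfolding cheb_span_def by (auto intro!: exI[of _ "\<lambda>k. c * a k"])
qed

lemma cheb_span_0: "0 \<in> cheb_span m"
  unfolding cheb_span_def by (auto intro!: exI[of _ "\<lambda>k. 0"])

lemma cheb_span_sum: "finite A \<Longrightarrow> (\<And>k. k \<in> A \<Longrightarrow> f k \<in> cheb_span m) \<Longrightarrow> sum f A \<in> cheb_span m"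
  by (induction rule: finite_induct) (auto intro: cheb_span_add cheb_span_0)

lemma cheb_span_base: "j \<le> m \<Longrightarrow> chT j \<in> cheb_span m"
proof -
  assume "j \<le> m"
  have "(\<Sum>k\<le>m. smult (if k = j then 1 else 0) (chT k)) = (\<Sum>k\<le>m. if k = j then chT k else 0)"
    by (rule sum.cong) auto
  also have "\<dots> = chT j" using \<open>j \<le> m\<close> by simp
  finally show ?thesis unfolding cheb_span_def
    by (auto intro!: exI[of _ "\<lambda>k. if k = j then 1 else 0"])
qed

text \<open>Horner form reduces this to multiplication by the variable, which by
  \<open>cheb_X\<close> raises the largest index by one.\<close>

lemma poly_in_cheb_span: "degree q \<le> m \<Longrightarrow> q \<in> cheb_span m"
proof (induction m arbitrary: q)
  case 0
  then obtain c where "q = [:c:]" by (metis degree_eq_zeroE le_zero_eq)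
  then have "q = smult c (chT 0)" by simp
  then show ?case by (simp only:) (intro cheb_span_smult cheb_span_base, simp)
next
  case (Suc m)
  obtain c q' where q: "q = pCons c q'" by (cases q)
  have "degree q' \<le> m"
  proof (cases "q' = 0")
    case False
    then show ?thesis using Suc.prems q by simp
  qed simp
  then obtain a where a: "q' = (\<Sum>k\<le>m. smult (a k) (chT k))"
    using Suc.IH unfolding cheb_span_def by blast
  have "q = smult c (chT 0) + [:0,1:] * q'"
    unfolding q by simp
  also have "[:0,1:] * q' = (\<Sum>k\<le>m. smult (a k) (smult (1/2) (chT (Suc k) + chT (if k = 0 then 1 else k - 1))))"
    unfolding a sum_distrib_left cheb_X[symmetric] by (simp add: mult_smult_right)
  finally show ?case
    by (auto intro!: cheb_span_add cheb_span_smult cheb_span_base cheb_span_sum simp del: cheb.simps)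
qed

section \<open>Coefficient estimates from the unit circle\<close>

lemma coeff_le_sup_circle:
  assumes "\<And>z. cmod z = 1 \<Longrightarrow> cmod (poly p z) \<le> B"
  shows "cmod (coeff p n) \<le> B"
proof -
  have "norm ((deriv ^^ n) (poly p) 0) \<le> fact n * B / 1 ^ n"
    by (rule Cauchy_inequality) (auto intro!: holomorphic_intros continuous_intros assms)
  moreover have "(deriv ^^ n) (poly p) = poly ((pderiv ^^ n) p)" for n
  proof (induction n)
    case (Suc n)
    have "deriv (poly q) = poly (pderiv q)" for q :: "complex poly"
      by (rule ext) (rule DERIV_imp_deriv, rule poly_DERIV)
    with Suc show ?case by simp
  qed simp
  moreover have "poly ((pderiv ^^ n) p) 0 = fact n * coeff p n"
    by (simp add: poly_0_coeff_0 coeff_higher_pderiv pochhammer_fact)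
  ultimately have "fact n * cmod (coeff p n) \<le> fact n * B"
    by (simp add: norm_mult)
  then show ?thesis by simp
qed

text \<open>On the unit circle the auxiliary polynomial \<open>P\<close> equals \<open>z ^ m\<close>
  times the given combination at \<open>Re z\<close>, so the bound on the interval holds on the
  circle and Cauchy's estimate controls the coefficients of \<open>P\<close>. The coefficient at
  \<open>m + j\<close> is \<open>a j / 2\<close>, except that both monomials meet at
  \<open>j = 0\<close>; hence the factor 2.\<close>

lemma cheb_coeff_bound:
  fixes a :: "nat \<Rightarrow> complex"
  assumes S: "\<And>x::real. \<bar>x\<bar> \<le> 1 \<Longrightarrow> cmod (poly (\<Sum>k\<le>m. smult (a k) (chT k)) (of_real x)) \<le> S"
    and "j \<le> m"
  shows "cmod (a j) \<le> 2 * S"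
proof -
  define P where "P = (\<Sum>k\<le>m. smult (a k / 2) (monom 1 (m+k) + monom 1 (m-k)))"
  have "cmod (poly P z) \<le> S" if z: "cmod z = 1" for z
  proof -
    have zc: "z * cnj z = 1" using z by (simp add: complex_norm_square[symmetric])
    have *: "z ^ (m - k) = z ^ m * cnj z ^ k" if "k \<le> m" for k
    proof -
      have "z ^ m * cnj z ^ k = z ^ (m - k) * (z * cnj z) ^ k"
        using that by (simp add: power_mult_distrib flip: power_add mult.assoc)
      then show ?thesis by (simp add: zc)
    qed
    have "poly P z = (\<Sum>k\<le>m. z ^ m * (a k * poly (chT k) (of_real (Re z))))"
      unfolding P_def poly_sum cheb_unit_circle[OF z]
      by (rule sum.cong) (auto simp: poly_monom * power_add algebra_simps)
    also have "\<dots> = z ^ m * poly (\<Sum>k\<le>m. smult (a k) (chT k)) (of_real (Re z))"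
      by (simp add: poly_sum sum_distrib_left)
    finally have "cmod (poly P z) = cmod (poly (\<Sum>k\<le>m. smult (a k) (chT k)) (of_real (Re z)))"
      by (simp add: norm_mult norm_power z)
    also have "\<dots> \<le> S"
      using S[of "Re z"] z abs_Re_le_cmod[of z] by simp
    finally show ?thesis .
  qed
  then have c: "cmod (coeff P (m+j)) \<le> S" by (rule coeff_le_sup_circle)
  have S0: "S \<ge> 0" using order_trans[OF norm_ge_zero S[of 0]] by simp
  have "coeff P (m+j) = (\<Sum>k\<le>m. if k = j then (if j = 0 then a j else a j / 2) else 0)"
    unfolding P_def coeff_sum by (rule sum.cong) (use \<open>j \<le> m\<close> in auto)
  also have "\<dots> = (if j = 0 then a j else a j / 2)"
    using \<open>j \<le> m\<close> by simp
  finally show ?thesis using c S0 by (auto simp: norm_divide split: if_splits)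
qed

text \<open>The intended instance is the norm of \<open>p\<close> evaluated at a self-adjoint
  element, with \<open>map_poly cnj\<close> as involution. The bound 1/2 on the variable, instead of
  1, makes the square root iteration below converge geometrically; later it is paid for by
  rescaling.\<close>

locale poly_cnorm =
  fixes N :: "complex poly \<Rightarrow> real"
  assumes N_add: "N (p + q) \<le> N p + N q"
    and N_mult: "N (p * q) \<le> N p * N q"
    and N_smult: "N (smult c p) = cmod c * N p"
    and N_star: "N (map_poly cnj p * p) = (N p)\<^sup>2"
    and N_one: "N 1 \<le> 1"
    and N_X: "N [:0,1:] \<le> 1/2"
begin

lemma N_0: "N 0 = 0"
  using N_smult[of 0 0] by simp

lemma N_minus: "N (- p) = N p"
  using N_smult[of "-1" p] by simp

lemma N_nonneg: "N p \<ge> 0"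
  using N_add[of p "-p"] by (simp add: N_0 N_minus)

lemma N_cnjp: "N (map_poly cnj p) = N p"
proof -
  have le: "N p \<le> N (map_poly cnj p)" for p
  proof (cases "N p = 0")
    case False
    then have "N p > 0" using N_nonneg[of p] by simp
    moreover have "N p * N p \<le> N (map_poly cnj p) * N p"
      using N_star[of p] N_mult[of "map_poly cnj p" p] by (simp add: power2_eq_square)
    ultimately show ?thesis by simp
  qed (simp add: N_nonneg)
  show ?thesis using le[of p] le[of "map_poly cnj p"] by simp
qed

lemma N_sum: "finite A \<Longrightarrow> N (sum f A) \<le> (\<Sum>k\<in>A. N (f k))"
  by (induction rule: finite_induct) (auto simp: N_0 intro: order_trans[OF N_add])

text \<open>Fixed point iteration for \<open>y = 1 - sqrt (1 - X\<^sup>2)\<close>, the solution of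
  \<open>y = (X\<^sup>2 + y\<^sup>2) / 2\<close>. The recursion says that the square of
  \<open>1 - ysq n\<close> misses \<open>1 - X\<^sup>2\<close> by exactly twice the next increment,
  so small increments give good square roots.\<close>

fun ysq :: "nat \<Rightarrow> complex poly" where
  "ysq 0 = 0"
| "ysq (Suc n) = smult (1/2) ([:0,1:]\<^sup>2 + ysq n * ysq n)"

lemma cnjp_ysq: "map_poly cnj (ysq n) = ysq n"
proof (induction n)
  case (Suc n)
  have "map_poly cnj ([:0,1:]\<^sup>2) = [:0,1:]\<^sup>2"
    by (rule poly_ext) simp
  with Suc show ?case by (simp add: cnjp_smult cnjp_add cnjp_mult)
qed simp

lemma N_X2: "N ([:0,1:]\<^sup>2) \<le> 1/4"
proof -
  have "N ([:0,1:] * [:0,1:]) \<le> N [:0,1:] * N [:0,1:]" by (rule N_mult)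
  also have "\<dots> \<le> 1/2 * (1/2)"
    by (intro mult_mono N_X N_nonneg) auto
  finally show ?thesis by (simp add: power2_eq_square)
qed

lemma N_ysq: "N (ysq n) \<le> 1/2"
proof (induction n)
  case (Suc n)
  have "N (ysq n * ysq n) \<le> 1/2 * (1/2)"
    using N_mult[of "ysq n" "ysq n"] mult_mono[OF Suc Suc] N_nonneg[of "ysq n"] by linarith
  then have "N ([:0,1:]\<^sup>2 + ysq n * ysq n) \<le> 1/2"
    using N_add[of "[:0,1:]\<^sup>2" "ysq n * ysq n"] N_X2 by linarith
  then show ?case by (simp add: N_smult)
qed (simp add: N_0)

lemma N_ysq_diff: "N (ysq (Suc n) - ysq n) \<le> (1/2) ^ n"
proof (induction n)
  case 0
  then show ?case using N_X2 by (simp add: N_smult)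
next
  case (Suc n)
  have "ysq (Suc (Suc n)) - ysq (Suc n) = smult (1/2) ((ysq (Suc n) - ysq n) * (ysq (Suc n) + ysq n))"
    unfolding ysq.simps(2)[of "Suc n"] ysq.simps(2)[of n, symmetric]
    by (rule poly_ext) (simp add: algebra_simps)
  moreover have "N ((ysq (Suc n) - ysq n) * (ysq (Suc n) + ysq n)) \<le> (1/2) ^ n * 1"
  proof -
    have "N (ysq (Suc n) + ysq n) \<le> 1"
      using N_add[of "ysq (Suc n)" "ysq n"] N_ysq[of n] N_ysq[of "Suc n"] by linarith
    then have "N (ysq (Suc n) - ysq n) * N (ysq (Suc n) + ysq n) \<le> (1/2) ^ n * 1"
      by (intro mult_mono Suc N_nonneg) auto
    then show ?thesis
      by (rule order_trans[OF N_mult])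
  qed
  ultimately show ?case by (simp add: N_smult del: ysq.simps)
qed

text \<open>With \<open>s \<approx> sqrt (1 - X\<^sup>2)\<close>, the polynomial \<open>T\<^sub>k + i s U\<^sub>k\<close> is approximately unitary.\<close>
lemma N_cheb: "N (chT k) \<le> 1"
proof -
  have "(N (chT k))\<^sup>2 \<le> 1 + (1/2) ^ n * (2 * (N (chU k))\<^sup>2)" for n
  proof -
    define s where "s = 1 - ysq n"
    define e where "e = smult 2 (ysq (Suc n) - ysq n)"
    define w where "w = chT k + smult \<i> (s * chU k)"
    have cs: "map_poly cnj s = s"
      by (simp add: s_def cnjp_diff cnjp_ysq)
    have w': "map_poly cnj w = chT k - smult \<i> (s * chU k)"
      by (simp add: w_def cnjp_add cnjp_smult cnjp_mult cs cnjp_cheb)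
    have "s * s = 1 - [:0,1:]\<^sup>2 + e"
      unfolding s_def e_def by (rule poly_ext) (simp add: algebra_simps)
    have "map_poly cnj w * w = chT k * chT k + s * s * (chU k * chU k)"
    proof (rule poly_ext)
      fix x
      have "(t - \<i> * u) * (t + \<i> * u) = t * t + u * u" for t u :: complex
        by (simp add: algebra_simps)
      from this[of "poly (chT k) x" "poly (s * chU k) x"]
      show "poly (map_poly cnj w * w) x = poly (chT k * chT k + s * s * (chU k * chU k)) x"
        unfolding w' unfolding w_def by (simp add: mult_ac)
    qed
    also have "\<dots> = (chT k * chT k + (1 - [:0,1:]\<^sup>2) * (chU k * chU k)) + e * (chU k * chU k)"
      unfolding \<open>s * s = _\<close> by (simp add: algebra_simps)
    also have "\<dots> = 1 + e * (chU k * chU k)"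
      by (simp add: cheb_pythagoras)
    finally have "(N w)\<^sup>2 = N (1 + e * (chU k * chU k))"
      by (metis N_star)
    also have "\<dots> \<le> 1 + N (e * (chU k * chU k))"
      using N_add[of 1 "e * (chU k * chU k)"] N_one by linarith
    also have "N (e * (chU k * chU k)) \<le> N e * (N (chU k))\<^sup>2"
      using N_mult[of e "chU k * chU k"] mult_left_mono[OF N_mult[of "chU k" "chU k"] N_nonneg[of e]]
      by (simp add: power2_eq_square)
    also have "N e \<le> 2 * (1/2) ^ n"
      unfolding e_def N_smult using N_ysq_diff[of n] by simp
    finally have Nw: "(N w)\<^sup>2 \<le> 1 + (2 * (1/2) ^ n) * (N (chU k))\<^sup>2"
      by (simp add: mult_right_mono)
    have "chT k = smult (1/2) (w + map_poly cnj w)"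
      unfolding w' unfolding w_def by (rule poly_ext) (simp add: algebra_simps)
    then have "N (chT k) = 1/2 * N (w + map_poly cnj w)"
      by (metis N_smult norm_divide norm_one norm_numeral)
    then have "N (chT k) \<le> N w"
      using N_add[of w "map_poly cnj w"] N_cnjp[of w] by simp
    then have "(N (chT k))\<^sup>2 \<le> (N w)\<^sup>2"
      using N_nonneg by (intro power_mono)
    with Nw show ?thesis by (simp add: mult_ac)
  qed
  moreover have "(\<lambda>n. 1 + (1/2) ^ n * (2 * (N (chU k))\<^sup>2)) \<longlonglongrightarrow> 1 + 0 * (2 * (N (chU k))\<^sup>2)"
    by (intro tendsto_intros LIMSEQ_power_zero) auto
  ultimately have "(N (chT k))\<^sup>2 \<le> 1"
    by (intro LIMSEQ_le_const[of _ 1]) auto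
  then show ?thesis by (simp add: abs_square_le_1 N_nonneg)
qed

text \<open>In the Chebyshev basis each of the \<open>m + 1\<close> terms has a coefficient of size
  at most \<open>2 * S\<close> and a basis element of seminorm at most 1. Only the linear growth in
  the degree matters.\<close>

lemma N_poly_growth:
  assumes S: "\<And>x::real. \<bar>x\<bar> \<le> 1 \<Longrightarrow> cmod (poly q (of_real x)) \<le> S"
    and deg: "degree q \<le> m"
  shows "N q \<le> 2 * (real m + 1) * S"
proof -
  obtain a where a: "q = (\<Sum>k\<le>m. smult (a k) (chT k))"
    using poly_in_cheb_span[OF deg] unfolding cheb_span_def by blast
  have "N q \<le> (\<Sum>k\<le>m. N (smult (a k) (chT k)))"
    unfolding a by (rule N_sum) simp
  also have "\<dots> \<le> (\<Sum>k\<le>m. 2 * S)"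
  proof (rule sum_mono)
    fix k assume "k \<in> {..m}"
    then have "cmod (a k) \<le> 2 * S" using cheb_coeff_bound[of a m S k] S a by simp
    moreover have "cmod (a k) * N (chT k) \<le> cmod (a k) * 1"
      using N_cheb by (intro mult_left_mono) auto
    ultimately show "N (smult (a k) (chT k)) \<le> 2 * S"
      unfolding N_smult by linarith
  qed
  finally show ?thesis by (simp add: algebra_simps)
qed

lemma N_selfadjoint_power:
  assumes "map_poly cnj q = q"
  shows "N (q ^ (2 ^ n)) = N q ^ (2 ^ n) \<and> map_poly cnj (q ^ (2 ^ n)) = q ^ (2 ^ n)"
proof (induction n)
  case (Suc n)
  have *: "q ^ (2 ^ Suc n) = q ^ (2 ^ n) * q ^ (2 ^ n)"
    by (simp add: power_mult power2_eq_square mult.commute[of 2])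
  show ?case
    using Suc N_star[of "q ^ (2 ^ n)"] unfolding * cnjp_mult
    by (simp add: power_mult power_mult_distrib power2_eq_square mult.commute[of 2])
qed (use assms in simp)

text \<open>The previous bound is applied to \<open>q ^ (2 ^ n)\<close>. By the C*-identity its left
  side is exactly \<open>N q ^ (2 ^ n)\<close>, while the factor from the degree grows only linearly
  in the exponent. If \<open>N q\<close> exceeded \<open>S\<close>, the quotient of the powers would
  grow exponentially.\<close>

lemma N_le_sup_selfadjoint:
  assumes S: "\<And>x::real. \<bar>x\<bar> \<le> 1 \<Longrightarrow> cmod (poly q (of_real x)) \<le> S"
    and sa: "map_poly cnj q = q"
  shows "N q \<le> S"
proof (rule ccontr)
  assume "\<not> N q \<le> S"
  have S0: "S \<ge> 0" using order_trans[OF norm_ge_zero S[of 0]] by simp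
  define m where "m = degree q"
  have bound: "N q ^ j \<le> 2 * (real (m * j) + 1) * S ^ j" if "j = 2 ^ n" for j n
  proof -
    have "N (q ^ j) \<le> 2 * (real (m * j) + 1) * S ^ j"
    proof (rule N_poly_growth)
      show "cmod (poly (q ^ j) (of_real x)) \<le> S ^ j" if "\<bar>x\<bar> \<le> 1" for x
        using S[OF that] by (simp add: norm_power power_mono)
      show "degree (q ^ j) \<le> m * j"
        unfolding m_def by (rule degree_power_le)
    qed
    then show ?thesis using N_selfadjoint_power[OF sa, of n] that by simp
  qed
  have "S > 0"
    using bound[of 1 0] S0 \<open>\<not> N q \<le> S\<close> by (cases "S = 0") auto
  \<comment> \<open>Bernoulli's inequality gives only linear growth of \<open>r ^ j\<close>.
    Starting from the square root, the square of that estimate is quadratic in \<open>j\<close> and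
    beats the linear right side; the choice of \<open>n\<close> below is what makes the final
    comparison fail.\<close>
  define r where "r = sqrt (N q / S)"
  have r: "r > 1" using \<open>S > 0\<close> \<open>\<not> N q \<le> S\<close> by (simp add: r_def)
  define c where "c = r - 1"
  have c: "c > 0" using r by (simp add: c_def)
  obtain n where n: "2 ^ n > (2 * real m + 2) / c\<^sup>2"
    using real_arch_pow[of 2] by auto
  define j :: nat where "j = 2 ^ n"
  have j: "real j > (2 * real m + 2) / c\<^sup>2" "j \<ge> 1" using n by (simp_all add: j_def)
  have "N q ^ j / S ^ j \<le> 2 * (real (m * j) + 1)"
    using bound[OF j_def] \<open>S > 0\<close> by (simp add: divide_le_eq)
  moreover have "N q ^ j / S ^ j = (r ^ j)\<^sup>2"
  proof -
    have "r\<^sup>2 = N q / S" unfolding r_def using N_nonneg \<open>S > 0\<close> by simp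
    have "(r ^ j)\<^sup>2 = (r\<^sup>2) ^ j" by (simp only: power_mult[symmetric] mult.commute)
    then show ?thesis unfolding \<open>r\<^sup>2 = N q / S\<close> by (simp add: power_divide)
  qed
  moreover have "(r ^ j)\<^sup>2 \<ge> (real j * c)\<^sup>2"
  proof (rule power_mono)
    have "1 + real j * c \<le> (1 + c) ^ j"
      using c by (intro Bernoulli_inequality) auto
    then show "real j * c \<le> r ^ j" by (simp add: c_def)
  qed (use c in simp)
  ultimately have "real j * real j * c\<^sup>2 \<le> 2 * (real m * real j + 1)"
    by (simp add: power2_eq_square mult_ac)
  also have "\<dots> \<le> (2 * real m + 2) * real j"
    using j(2) by (simp add: algebra_simps)
  finally have "real j * (real j * c\<^sup>2) \<le> real j * (2 * real m + 2)"
    by (simp add: mult_ac)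
  then have "real j * c\<^sup>2 \<le> 2 * real m + 2"
    using j(2) by simp
  with j(1) c show False by (simp add: divide_less_eq)
qed

text \<open>The C*-identity reduces the claim to the self-adjoint polynomial
  \<open>map_poly cnj q * q\<close>, whose value at a real point is the squared modulus of the value
  of \<open>q\<close>.\<close>

theorem N_le_sup:
  assumes S: "\<And>x::real. \<bar>x\<bar> \<le> 1 \<Longrightarrow> cmod (poly q (of_real x)) \<le> S"
  shows "N q \<le> S"
proof -
  have S0: "S \<ge> 0" using order_trans[OF norm_ge_zero S[of 0]] by simp
  have "N (map_poly cnj q * q) \<le> S\<^sup>2"
  proof (rule N_le_sup_selfadjoint)
    show "cmod (poly (map_poly cnj q * q) (of_real x)) \<le> S\<^sup>2" if "\<bar>x\<bar> \<le> 1" for x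
      using power_mono[OF S[OF that], of 2] by (simp add: norm_mult power2_eq_square)
  qed (simp add: cnjp_mult mult.commute)
  then have "(N q)\<^sup>2 \<le> S\<^sup>2" by (simp add: N_star)
  then show ?thesis using S0 by (rule power2_le_imp_le)
qed

end

section \<open>Elementary C*-algebra\<close>

locale cst =
  fixes A :: "'a cstar"
  assumes cstar: "cstar_alg A"
begin

abbreviation "Cr \<equiv> cs_carrier A"
abbreviation zero ("\<zero>") where "\<zero> \<equiv> cs_zero A"
abbreviation add (infixl "\<oplus>" 65) where "x \<oplus> y \<equiv> cs_add A x y"
abbreviation diff (infixl "\<ominus>" 65) where "x \<ominus> y \<equiv> cs_diff A x y"
abbreviation mul (infixl "\<otimes>" 70) where "x \<otimes> y \<equiv> cs_mult A x y"
abbreviation sm (infixr "\<odot>" 75) where "c \<odot> x \<equiv> cs_smult A c x"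
abbreviation star ("_\<^sup>\<star>" [1000] 1000) where "x\<^sup>\<star> \<equiv> cs_star A x"
abbreviation "nm \<equiv> cs_norm A"

text \<open>Each of the following facts is picked by its position among the conjuncts of
  \<open>cstar_alg\<close>; the chains of \<open>conjunct2\<close> are merely indices.\<close>

lemmas ax = cstar[unfolded cstar_alg_def Let_def]

lemmas zero_cl [simp] = ax[THEN conjunct1, rule_format]
lemmas add_mul_cl = ax[THEN conjunct2, THEN conjunct1, rule_format]
lemmas sm_cl [simp] = ax[THEN conjunct2, THEN conjunct2, THEN conjunct1, rule_format]
lemmas star_cl [simp] = ax[THEN conjunct2, THEN conjunct2, THEN conjunct2, THEN conjunct1, rule_format]
lemmas add_assoc = ax[THEN conjunct2, THEN conjunct2, THEN conjunct2, THEN conjunct2, THEN conjunct1, rule_format]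
lemmas add_comm = ax[THEN conjunct2, THEN conjunct2, THEN conjunct2, THEN conjunct2, THEN conjunct2, THEN conjunct1, rule_format]
lemmas zero_add [simp] = ax[THEN conjunct2, THEN conjunct2, THEN conjunct2, THEN conjunct2, THEN conjunct2, THEN conjunct2, THEN conjunct1, rule_format]
lemmas add_neg = ax[THEN conjunct2, THEN conjunct2, THEN conjunct2, THEN conjunct2, THEN conjunct2, THEN conjunct2, THEN conjunct2, THEN conjunct1, rule_format]
lemmas sm_add = ax[THEN conjunct2, THEN conjunct2, THEN conjunct2, THEN conjunct2, THEN conjunct2, THEN conjunct2, THEN conjunct2, THEN conjunct2, THEN conjunct1, rule_format]
lemmas add_sm = ax[THEN conjunct2, THEN conjunct2, THEN conjunct2, THEN conjunct2, THEN conjunct2, THEN conjunct2, THEN conjunct2, THEN conjunct2, THEN conjunct2, THEN conjunct1, rule_format]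
lemmas sm_mult = ax[THEN conjunct2, THEN conjunct2, THEN conjunct2, THEN conjunct2, THEN conjunct2, THEN conjunct2, THEN conjunct2, THEN conjunct2, THEN conjunct2, THEN conjunct2, THEN conjunct1, rule_format]
lemmas sm_1 [simp] = ax[THEN conjunct2, THEN conjunct2, THEN conjunct2, THEN conjunct2, THEN conjunct2, THEN conjunct2, THEN conjunct2, THEN conjunct2, THEN conjunct2, THEN conjunct2, THEN conjunct2, THEN conjunct1, rule_format]
lemmas mul_assoc = ax[THEN conjunct2, THEN conjunct2, THEN conjunct2, THEN conjunct2, THEN conjunct2, THEN conjunct2, THEN conjunct2, THEN conjunct2, THEN conjunct2, THEN conjunct2, THEN conjunct2, THEN conjunct2, THEN conjunct1, rule_format]
lemmas add_mul = ax[THEN conjunct2, THEN conjunct2, THEN conjunct2, THEN conjunct2, THEN conjunct2, THEN conjunct2, THEN conjunct2, THEN conjunct2, THEN conjunct2, THEN conjunct2, THEN conjunct2, THEN conjunct2, THEN conjunct2, THEN conjunct1, rule_format]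
lemmas mul_add = ax[THEN conjunct2, THEN conjunct2, THEN conjunct2, THEN conjunct2, THEN conjunct2, THEN conjunct2, THEN conjunct2, THEN conjunct2, THEN conjunct2, THEN conjunct2, THEN conjunct2, THEN conjunct2, THEN conjunct2, THEN conjunct2, THEN conjunct1, rule_format]
lemmas sm_mul_mul_sm = ax[THEN conjunct2, THEN conjunct2, THEN conjunct2, THEN conjunct2, THEN conjunct2, THEN conjunct2, THEN conjunct2, THEN conjunct2, THEN conjunct2, THEN conjunct2, THEN conjunct2, THEN conjunct2, THEN conjunct2, THEN conjunct2, THEN conjunct2, THEN conjunct1, rule_format]
lemmas star_star [simp] = ax[THEN conjunct2, THEN conjunct2, THEN conjunct2, THEN conjunct2, THEN conjunct2, THEN conjunct2, THEN conjunct2, THEN conjunct2, THEN conjunct2, THEN conjunct2, THEN conjunct2, THEN conjunct2, THEN conjunct2, THEN conjunct2, THEN conjunct2, THEN conjunct2, THEN conjunct1, rule_format]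
lemmas star_add = ax[THEN conjunct2, THEN conjunct2, THEN conjunct2, THEN conjunct2, THEN conjunct2, THEN conjunct2, THEN conjunct2, THEN conjunct2, THEN conjunct2, THEN conjunct2, THEN conjunct2, THEN conjunct2, THEN conjunct2, THEN conjunct2, THEN conjunct2, THEN conjunct2, THEN conjunct2, THEN conjunct1, rule_format]
lemmas star_sm = ax[THEN conjunct2, THEN conjunct2, THEN conjunct2, THEN conjunct2, THEN conjunct2, THEN conjunct2, THEN conjunct2, THEN conjunct2, THEN conjunct2, THEN conjunct2, THEN conjunct2, THEN conjunct2, THEN conjunct2, THEN conjunct2, THEN conjunct2, THEN conjunct2, THEN conjunct2, THEN conjunct2, THEN conjunct1, rule_format]
lemmas star_mul = ax[THEN conjunct2, THEN conjunct2, THEN conjunct2, THEN conjunct2, THEN conjunct2, THEN conjunct2, THEN conjunct2, THEN conjunct2, THEN conjunct2, THEN conjunct2, THEN conjunct2, THEN conjunct2, THEN conjunct2, THEN conjunct2, THEN conjunct2, THEN conjunct2, THEN conjunct2, THEN conjunct2, THEN conjunct2, THEN conjunct1, rule_format]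
lemmas nm_pos = ax[THEN conjunct2, THEN conjunct2, THEN conjunct2, THEN conjunct2, THEN conjunct2, THEN conjunct2, THEN conjunct2, THEN conjunct2, THEN conjunct2, THEN conjunct2, THEN conjunct2, THEN conjunct2, THEN conjunct2, THEN conjunct2, THEN conjunct2, THEN conjunct2, THEN conjunct2, THEN conjunct2, THEN conjunct2, THEN conjunct2, THEN conjunct1, rule_format]
lemmas nm_add = ax[THEN conjunct2, THEN conjunct2, THEN conjunct2, THEN conjunct2, THEN conjunct2, THEN conjunct2, THEN conjunct2, THEN conjunct2, THEN conjunct2, THEN conjunct2, THEN conjunct2, THEN conjunct2, THEN conjunct2, THEN conjunct2, THEN conjunct2, THEN conjunct2, THEN conjunct2, THEN conjunct2, THEN conjunct2, THEN conjunct2, THEN conjunct2, THEN conjunct1, rule_format]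
lemmas nm_sm = ax[THEN conjunct2, THEN conjunct2, THEN conjunct2, THEN conjunct2, THEN conjunct2, THEN conjunct2, THEN conjunct2, THEN conjunct2, THEN conjunct2, THEN conjunct2, THEN conjunct2, THEN conjunct2, THEN conjunct2, THEN conjunct2, THEN conjunct2, THEN conjunct2, THEN conjunct2, THEN conjunct2, THEN conjunct2, THEN conjunct2, THEN conjunct2, THEN conjunct2, THEN conjunct1, rule_format]
lemmas nm_mul = ax[THEN conjunct2, THEN conjunct2, THEN conjunct2, THEN conjunct2, THEN conjunct2, THEN conjunct2, THEN conjunct2, THEN conjunct2, THEN conjunct2, THEN conjunct2, THEN conjunct2, THEN conjunct2, THEN conjunct2, THEN conjunct2, THEN conjunct2, THEN conjunct2, THEN conjunct2, THEN conjunct2, THEN conjunct2, THEN conjunct2, THEN conjunct2, THEN conjunct2, THEN conjunct2, THEN conjunct1, rule_format]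
lemmas cstar_id = ax[THEN conjunct2, THEN conjunct2, THEN conjunct2, THEN conjunct2, THEN conjunct2, THEN conjunct2, THEN conjunct2, THEN conjunct2, THEN conjunct2, THEN conjunct2, THEN conjunct2, THEN conjunct2, THEN conjunct2, THEN conjunct2, THEN conjunct2, THEN conjunct2, THEN conjunct2, THEN conjunct2, THEN conjunct2, THEN conjunct2, THEN conjunct2, THEN conjunct2, THEN conjunct2, THEN conjunct2, THEN conjunct1, rule_format]
lemmas complete = ax[THEN conjunct2, THEN conjunct2, THEN conjunct2, THEN conjunct2, THEN conjunct2, THEN conjunct2, THEN conjunct2, THEN conjunct2, THEN conjunct2, THEN conjunct2, THEN conjunct2, THEN conjunct2, THEN conjunct2, THEN conjunct2, THEN conjunct2, THEN conjunct2, THEN conjunct2, THEN conjunct2, THEN conjunct2, THEN conjunct2, THEN conjunct2, THEN conjunct2, THEN conjunct2, THEN conjunct2, THEN conjunct2, rule_format]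

lemmas add_cl [simp] = add_mul_cl[THEN conjunct1]
lemmas mul_cl [simp] = add_mul_cl[THEN conjunct2]
lemma sm_mul: "\<lbrakk>x \<in> Cr; y \<in> Cr\<rbrakk> \<Longrightarrow> (c \<odot> x) \<otimes> y = c \<odot> (x \<otimes> y)"
  and mul_sm: "\<lbrakk>x \<in> Cr; y \<in> Cr\<rbrakk> \<Longrightarrow> x \<otimes> (c \<odot> y) = c \<odot> (x \<otimes> y)"
  using sm_mul_mul_sm by metis+
lemmas nm_ge_0 [simp] = nm_pos[THEN conjunct1]
lemmas nm_eq_0 = nm_pos[THEN conjunct2]

lemma add_zero [simp]: "x \<in> Cr \<Longrightarrow> x \<oplus> \<zero> = x"
  using add_comm[of x \<zero>] by simp

lemma add_lcomm: "\<lbrakk>x \<in> Cr; y \<in> Cr; z \<in> Cr\<rbrakk> \<Longrightarrow> x \<oplus> (y \<oplus> z) = y \<oplus> (x \<oplus> z)"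
  by (metis add_assoc add_comm)

lemma add_left_cancel [simp]: "\<lbrakk>x \<in> Cr; y \<in> Cr; z \<in> Cr\<rbrakk> \<Longrightarrow> x \<oplus> y = x \<oplus> z \<longleftrightarrow> y = z"
proof
  assume c: "x \<in> Cr" "y \<in> Cr" "z \<in> Cr" and eq: "x \<oplus> y = x \<oplus> z"
  have e: "(-1) \<odot> x \<oplus> (x \<oplus> w) = w" if "w \<in> Cr" for w
    using c that add_assoc[of "(-1) \<odot> x" x w] add_neg[of x] add_comm[of x "(-1) \<odot> x"] by simp
  show "y = z" using e[OF c(2)] e[OF c(3)] eq by metis
qed auto

lemma sm_0 [simp]: "x \<in> Cr \<Longrightarrow> 0 \<odot> x = \<zero>"
  using add_sm[of x 1 0] add_left_cancel[of x "0 \<odot> x" \<zero>] by simp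

lemma sm_zero [simp]: "c \<odot> \<zero> = \<zero>"
  using sm_0[of \<zero>] sm_mult[of \<zero> c 0] by simp

lemma mul_zero [simp]: "x \<in> Cr \<Longrightarrow> x \<otimes> \<zero> = \<zero>"
  using mul_sm[of x \<zero> 0] by simp

lemma zero_mul [simp]: "x \<in> Cr \<Longrightarrow> \<zero> \<otimes> x = \<zero>"
  using sm_mul[of \<zero> x 0] by simp

lemma star_zero [simp]: "\<zero>\<^sup>\<star> = \<zero>"
  using star_sm[of \<zero> 0] by simp

lemma nm_zero [simp]: "nm \<zero> = 0"
  by (simp add: nm_eq_0)

lemma diff_cl [simp]: "\<lbrakk>x \<in> Cr; y \<in> Cr\<rbrakk> \<Longrightarrow> x \<ominus> y \<in> Cr"
  by (simp add: cs_diff_def)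

lemma diff_eq_iff: "\<lbrakk>x \<in> Cr; y \<in> Cr; z \<in> Cr\<rbrakk> \<Longrightarrow> x \<ominus> y = z \<longleftrightarrow> x = z \<oplus> y"
proof -
  assume c: "x \<in> Cr" "y \<in> Cr" "z \<in> Cr"
  have "(x \<ominus> y) \<oplus> y = x"
    using c add_assoc[of x "(-1) \<odot> y" y] add_comm[of "(-1) \<odot> y" y] add_neg[of y] by (simp add: cs_diff_def)
  moreover have "(z \<oplus> y) \<ominus> y = z"
    using c add_assoc[of z y "(-1) \<odot> y"] add_neg[of y] by (simp add: cs_diff_def)
  ultimately show ?thesis by metis
qed

lemma eq_diff_iff: "\<lbrakk>x \<in> Cr; y \<in> Cr; z \<in> Cr\<rbrakk> \<Longrightarrow> z = x \<ominus> y \<longleftrightarrow> z \<oplus> y = x"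
  using diff_eq_iff by metis

lemma diff_self [simp]: "x \<in> Cr \<Longrightarrow> x \<ominus> x = \<zero>"
  by (simp add: diff_eq_iff)

lemma diff_zero [simp]: "x \<in> Cr \<Longrightarrow> x \<ominus> \<zero> = x"
  by (simp add: diff_eq_iff)

lemma diff_eq_zero: "\<lbrakk>x \<in> Cr; y \<in> Cr\<rbrakk> \<Longrightarrow> x \<ominus> y = \<zero> \<longleftrightarrow> x = y"
  by (simp add: diff_eq_iff)

lemma add_diff: "\<lbrakk>x \<in> Cr; y \<in> Cr; z \<in> Cr\<rbrakk> \<Longrightarrow> x \<oplus> (y \<ominus> z) = (x \<oplus> y) \<ominus> z"
  and diff_add: "\<lbrakk>x \<in> Cr; y \<in> Cr; z \<in> Cr\<rbrakk> \<Longrightarrow> (x \<ominus> y) \<oplus> z = (x \<oplus> z) \<ominus> y"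
  and diff_diff: "\<lbrakk>x \<in> Cr; y \<in> Cr; z \<in> Cr\<rbrakk> \<Longrightarrow> (x \<ominus> y) \<ominus> z = x \<ominus> (y \<oplus> z)"
  by (simp_all add: cs_diff_def sm_add add_assoc add_comm add_lcomm)

lemma diff_diff2: "\<lbrakk>x \<in> Cr; y \<in> Cr; z \<in> Cr\<rbrakk> \<Longrightarrow> x \<ominus> (y \<ominus> z) = (x \<oplus> z) \<ominus> y"
  by (simp add: diff_eq_iff add_diff diff_add)
    (simp add: eq_diff_iff add_assoc add_comm add_lcomm)

lemma diff_mul: "\<lbrakk>x \<in> Cr; y \<in> Cr; z \<in> Cr\<rbrakk> \<Longrightarrow> (x \<ominus> y) \<otimes> z = (x \<otimes> z) \<ominus> (y \<otimes> z)"
  and mul_diff: "\<lbrakk>x \<in> Cr; y \<in> Cr; z \<in> Cr\<rbrakk> \<Longrightarrow> z \<otimes> (x \<ominus> y) = (z \<otimes> x) \<ominus> (z \<otimes> y)"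
  and star_diff: "\<lbrakk>x \<in> Cr; y \<in> Cr\<rbrakk> \<Longrightarrow> (x \<ominus> y)\<^sup>\<star> = x\<^sup>\<star> \<ominus> y\<^sup>\<star>"
  and sm_diff: "\<lbrakk>x \<in> Cr; y \<in> Cr\<rbrakk> \<Longrightarrow> c \<odot> (x \<ominus> y) = c \<odot> x \<ominus> c \<odot> y"
  by (simp_all add: cs_diff_def add_mul mul_add sm_mul mul_sm star_add star_sm sm_add flip: sm_mult)

text \<open>A rewriting set for noncommutative identities: \<open>diff_eq_iff\<close> and
  \<open>eq_diff_iff\<close> move subtracted terms across an equation, so that only sums have to be
  normalized.\<close>

lemmas alg = add_assoc add_comm add_lcomm mul_assoc add_mul mul_add sm_mul mul_sm sm_add
  sm_mult[symmetric] star_add star_sm star_mul add_diff diff_add diff_diff diff_diff2 diff_eq_iff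
  eq_diff_iff diff_mul mul_diff star_diff sm_diff

lemma nm_star [simp]: "x \<in> Cr \<Longrightarrow> nm (x\<^sup>\<star>) = nm x"
proof -
  have le: "nm x \<le> nm (x\<^sup>\<star>)" if "x \<in> Cr" for x
  proof (cases "nm x = 0")
    case False
    then have "nm x * nm x \<le> nm (x\<^sup>\<star>) * nm x"
      using cstar_id[OF that] nm_mul[of "x\<^sup>\<star>" x] that by (simp add: power2_eq_square)
    then show ?thesis using False nm_ge_0[OF that] by simp
  qed (use that in simp)
  assume "x \<in> Cr"
  then show ?thesis using le[of x] le[of "x\<^sup>\<star>"] by simp
qed

lemma cstar_id': "x \<in> Cr \<Longrightarrow> nm (x \<otimes> x\<^sup>\<star>) = (nm x)\<^sup>2"
  using cstar_id[of "x\<^sup>\<star>"] by simp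

lemma sq_zero: "x \<in> Cr \<Longrightarrow> x\<^sup>\<star> \<otimes> x = \<zero> \<Longrightarrow> x = \<zero>"
  using cstar_id[of x] nm_eq_0[of x] by simp

lemma nm_diff: "\<lbrakk>x \<in> Cr; y \<in> Cr\<rbrakk> \<Longrightarrow> nm (x \<ominus> y) \<le> nm x + nm y"
  using nm_add[of x "(-1) \<odot> y"] by (simp add: cs_diff_def nm_sm)

lemma nm_minus_comm: "\<lbrakk>x \<in> Cr; y \<in> Cr\<rbrakk> \<Longrightarrow> nm (x \<ominus> y) = nm (y \<ominus> x)"
proof -
  assume "x \<in> Cr" "y \<in> Cr"
  then have "x \<ominus> y = (-1) \<odot> (y \<ominus> x)"
    by (simp add: cs_diff_def sm_add add_comm flip: sm_mult)
  then show ?thesis using \<open>x \<in> Cr\<close> \<open>y \<in> Cr\<close> by (simp add: nm_sm)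
qed

lemma nm_triangle: "\<lbrakk>x \<in> Cr; y \<in> Cr; z \<in> Cr\<rbrakk> \<Longrightarrow> nm (x \<ominus> z) \<le> nm (x \<ominus> y) + nm (y \<ominus> z)"
proof -
  assume c: "x \<in> Cr" "y \<in> Cr" "z \<in> Cr"
  then have "(x \<ominus> y) \<oplus> (y \<ominus> z) = x \<ominus> z" by (simp add: alg)
  then show ?thesis using nm_add[of "x \<ominus> y" "y \<ominus> z"] c by simp
qed

lemma nm_le_diff: "\<lbrakk>x \<in> Cr; y \<in> Cr\<rbrakk> \<Longrightarrow> nm x \<le> nm (x \<ominus> y) + nm y"
  using nm_triangle[of x y \<zero>] by simp

lemma nm_mul_le: "\<lbrakk>x \<in> Cr; y \<in> Cr; nm x \<le> a; nm y \<le> b\<rbrakk> \<Longrightarrow> nm (x \<otimes> y) \<le> a * b"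
  using nm_mul[of x y] mult_mono[of "nm x" a "nm y" b] nm_ge_0[of x] nm_ge_0[of y] by linarith

lemma nm_small_eq_0: "\<lbrakk>x \<in> Cr; \<And>e. e > 0 \<Longrightarrow> nm x \<le> e\<rbrakk> \<Longrightarrow> x = \<zero>"
  using nm_eq_0[of x] nm_ge_0[of x] by (metis field_le_epsilon add_0 order_antisym)

subsection \<open>Bounded additive maps and closures\<close>

text \<open>Compatibility with differences, rather than linearity, is demanded so that the
  conjugate-linear involution is covered.\<close>

definition blin :: "('a \<Rightarrow> 'a) \<Rightarrow> bool" where
  "blin T \<longleftrightarrow> (\<forall>x\<in>Cr. T x \<in> Cr) \<and> (\<forall>x\<in>Cr. \<forall>y\<in>Cr. T (x \<ominus> y) = T x \<ominus> T y) \<and> (\<exists>M. \<forall>x\<in>Cr. nm (T x) \<le> M * nm x)"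

lemma blinI: "(\<And>x. x \<in> Cr \<Longrightarrow> T x \<in> Cr) \<Longrightarrow> (\<And>x y. \<lbrakk>x \<in> Cr; y \<in> Cr\<rbrakk> \<Longrightarrow> T (x \<ominus> y) = T x \<ominus> T y)
   \<Longrightarrow> (\<And>x. x \<in> Cr \<Longrightarrow> nm (T x) \<le> M * nm x) \<Longrightarrow> blin T"
  unfolding blin_def by blast

lemma blin_cl: "blin T \<Longrightarrow> x \<in> Cr \<Longrightarrow> T x \<in> Cr"
  unfolding blin_def by blast

lemma blin_diff: "blin T \<Longrightarrow> x \<in> Cr \<Longrightarrow> y \<in> Cr \<Longrightarrow> T (x \<ominus> y) = T x \<ominus> T y"
  unfolding blin_def by blast

lemma blin_bound: "blin T \<Longrightarrow> \<exists>M>0. \<forall>x\<in>Cr. nm (T x) \<le> M * nm x"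
proof -
  assume "blin T"
  then obtain M where M: "\<forall>x\<in>Cr. nm (T x) \<le> M * nm x" unfolding blin_def by blast
  have "nm (T x) \<le> max M 1 * nm x" if "x \<in> Cr" for x
    using M that mult_right_mono[of M "max M 1" "nm x"] nm_ge_0[OF that] by fastforce
  then show ?thesis by (intro exI[of _ "max M 1"]) auto
qed

lemma blin_id: "blin (\<lambda>x. x)"
  by (rule blinI[of _ 1]) auto

lemma blin_mulr: "blin T \<Longrightarrow> a \<in> Cr \<Longrightarrow> blin (\<lambda>x. T x \<otimes> a)"
proof -
  assume T: "blin T" and a: "a \<in> Cr"
  obtain M where M: "M > 0" "\<forall>x\<in>Cr. nm (T x) \<le> M * nm x" using blin_bound[OF T] by blast
  show ?thesis
  proof (rule blinI[of _ "M * nm a"])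
    fix x assume x: "x \<in> Cr"
    show "nm (T x \<otimes> a) \<le> M * nm a * nm x"
      using nm_mul_le[of "T x" a "M * nm x" "nm a"] M x a blin_cl[OF T x] by (simp add: mult_ac)
  qed (simp_all add: T a blin_cl blin_diff diff_mul)
qed

lemma blin_mull: "blin T \<Longrightarrow> a \<in> Cr \<Longrightarrow> blin (\<lambda>x. a \<otimes> T x)"
proof -
  assume T: "blin T" and a: "a \<in> Cr"
  obtain M where M: "M > 0" "\<forall>x\<in>Cr. nm (T x) \<le> M * nm x" using blin_bound[OF T] by blast
  show ?thesis
  proof (rule blinI[of _ "M * nm a"])
    fix x assume x: "x \<in> Cr"
    show "nm (a \<otimes> T x) \<le> M * nm a * nm x"
      using nm_mul_le[of a "T x" "nm a" "M * nm x"] M x a blin_cl[OF T x] by (simp add: mult_ac)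
  qed (simp_all add: T a blin_cl blin_diff mul_diff)
qed

lemma blin_star: "blin T \<Longrightarrow> blin (\<lambda>x. (T x)\<^sup>\<star>)"
  unfolding blin_def by (simp add: star_diff)

lemma blin_sm: "blin T \<Longrightarrow> blin (\<lambda>x. c \<odot> T x)"
proof -
  assume T: "blin T"
  obtain M where M: "M > 0" "\<forall>x\<in>Cr. nm (T x) \<le> M * nm x" using blin_bound[OF T] by blast
  show ?thesis
  proof (rule blinI[of _ "cmod c * M"])
    fix x assume x: "x \<in> Cr"
    show "nm (c \<odot> T x) \<le> cmod c * M * nm x"
      using M x blin_cl[OF T x] by (simp add: nm_sm mult_left_mono mult.assoc)
  qed (simp_all add: T blin_cl blin_diff sm_diff)
qed

lemma blin_sub: "blin T \<Longrightarrow> blin S \<Longrightarrow> blin (\<lambda>x. T x \<ominus> S x)"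
proof -
  assume T: "blin T" and S: "blin S"
  obtain M where M: "M > 0" "\<forall>x\<in>Cr. nm (T x) \<le> M * nm x" using blin_bound[OF T] by blast
  obtain M' where M': "M' > 0" "\<forall>x\<in>Cr. nm (S x) \<le> M' * nm x" using blin_bound[OF S] by blast
  show ?thesis
  proof (rule blinI[of _ "M + M'"])
    fix x assume x: "x \<in> Cr"
    show "nm (T x \<ominus> S x) \<le> (M + M') * nm x"
      using nm_diff[of "T x" "S x"] M M' x blin_cl[OF T x] blin_cl[OF S x]
      by (fastforce simp: distrib_right)
    show "T x \<ominus> S x \<in> Cr" using blin_cl T S x by simp
  next
    fix x y assume "x \<in> Cr" "y \<in> Cr"
    then show "T (x \<ominus> y) \<ominus> S (x \<ominus> y) = (T x \<ominus> S x) \<ominus> (T y \<ominus> S y)"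
      using blin_cl[OF T] blin_cl[OF S] by (simp add: blin_diff T S alg)
  qed
qed

lemmas blin_intros = blin_id blin_mulr blin_mull blin_star blin_sm blin_sub

lemma in_closureI: "x \<in> Cr \<Longrightarrow> (\<And>e. e > 0 \<Longrightarrow> \<exists>s\<in>S. nm (x \<ominus> s) < e) \<Longrightarrow> x \<in> cs_closure A S"
  unfolding cs_closure_def cs_dist_def by blast

lemma in_closureD: "x \<in> cs_closure A S \<Longrightarrow> e > 0 \<Longrightarrow> \<exists>s\<in>S. nm (x \<ominus> s) < e"
  unfolding cs_closure_def cs_dist_def by blast

lemma closure_cl: "x \<in> cs_closure A S \<Longrightarrow> x \<in> Cr"
  unfolding cs_closure_def by blast

lemma closure_sub: "S \<subseteq> Cr \<Longrightarrow> S \<subseteq> cs_closure A S"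
  by (auto intro!: in_closureI bexI[of _ _ S])

lemma closure_mono: "S \<subseteq> T \<Longrightarrow> cs_closure A S \<subseteq> cs_closure A T"
  unfolding cs_closure_def by blast

lemma closure_closure: "S \<subseteq> Cr \<Longrightarrow> cs_closure A (cs_closure A S) = cs_closure A S"
proof
  assume S: "S \<subseteq> Cr"
  show "cs_closure A (cs_closure A S) \<subseteq> cs_closure A S"
  proof
    fix x assume x: "x \<in> cs_closure A (cs_closure A S)"
    show "x \<in> cs_closure A S"
    proof (rule in_closureI)
      show "x \<in> Cr" using x closure_cl by blast
      fix e :: real assume "e > 0"
      then obtain y where y: "y \<in> cs_closure A S" "nm (x \<ominus> y) < e/2"
        using in_closureD[OF x, of "e/2"] by auto
      then obtain s where s: "s \<in> S" "nm (y \<ominus> s) < e/2"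
        using in_closureD[OF y(1), of "e/2"] \<open>e > 0\<close> by auto
      have "nm (x \<ominus> s) < e"
        using nm_triangle[of x y s] y s S \<open>x \<in> Cr\<close> closure_cl[OF y(1)] by fastforce
      then show "\<exists>s\<in>S. nm (x \<ominus> s) < e" using s by blast
    qed
  qed
qed (use closure_sub[of "cs_closure A S"] closure_cl in blast)

lemma closure_blin:
  assumes T: "blin T" and S: "S \<subseteq> Cr" and "\<And>s. s \<in> S \<Longrightarrow> T s \<in> P" and x: "x \<in> cs_closure A S"
  shows "T x \<in> cs_closure A P"
proof (rule in_closureI)
  show "T x \<in> Cr" using T x closure_cl blin_cl by blast
  fix e :: real assume "e > 0"
  obtain M where M: "M > 0" "\<forall>x\<in>Cr. nm (T x) \<le> M * nm x" using blin_bound[OF T] by blast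
  obtain s where s: "s \<in> S" "nm (x \<ominus> s) < e / M" using in_closureD[OF x, of "e/M"] M \<open>e > 0\<close> by auto
  have "nm (T x \<ominus> T s) \<le> M * nm (x \<ominus> s)"
    using M s S closure_cl[OF x] by (auto simp flip: blin_diff[OF T])
  also have "\<dots> < e" using s M by (simp add: less_divide_eq mult.commute)
  finally show "\<exists>s\<in>P. nm (T x \<ominus> s) < e" using assms s by blast
qed

lemma closure_zero: "cs_closure A {\<zero>} = {\<zero>}"
  using closure_cl[of _ "{\<zero>}"] closure_sub[of "{\<zero>}"] in_closureD[of _ "{\<zero>}"]
  by (force intro: nm_small_eq_0 less_imp_le)

lemma closure_eqI: "S \<subseteq> Cr \<Longrightarrow> (\<And>x. x \<in> cs_closure A S \<Longrightarrow> x \<in> S) \<Longrightarrow> cs_closure A S = S"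
  using closure_sub by blast

lemma closed_approx:
  "\<lbrakk>cs_closure A S = S; x \<in> Cr; \<And>e. e > 0 \<Longrightarrow> \<exists>s\<in>S. nm (x \<ominus> s) \<le> e\<rbrakk> \<Longrightarrow> x \<in> S"
proof -
  assume *: "cs_closure A S = S" "x \<in> Cr" "\<And>e. e > 0 \<Longrightarrow> \<exists>s\<in>S. nm (x \<ominus> s) \<le> e"
  have "x \<in> cs_closure A S"
  proof (rule in_closureI)
    fix e :: real assume "e > 0"
    then obtain s where "s \<in> S" "nm (x \<ominus> s) \<le> e/2" using *(3)[of "e/2"] by auto
    then show "\<exists>s\<in>S. nm (x \<ominus> s) < e" using \<open>e > 0\<close> by (intro bexI[of _ s]) auto
  qed fact
  with * show ?thesis by simp
qed

text \<open>Commutants and many ideals below are intersections of such preimages, with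
  \<open>P\<close> a closed ideal or just zero; this is how they are seen to be closed.\<close>

lemma closed_blin_pre:
  assumes T: "blin T" and S: "S \<subseteq> Cr" "cs_closure A S = S" and P: "cs_closure A P = P"
  shows "cs_closure A {k\<in>S. T k \<in> P} = {k\<in>S. T k \<in> P}"
proof (rule closure_eqI)
  fix x assume x: "x \<in> cs_closure A {k\<in>S. T k \<in> P}"
  then have "x \<in> S" using closure_mono[of "{k\<in>S. T k \<in> P}" S] S by blast
  moreover have "T x \<in> cs_closure A P"
    by (rule closure_blin[OF T _ _ x]) (use S in auto)
  ultimately show "x \<in> {k\<in>S. T k \<in> P}" using P by simp
qed (use S in auto)

lemma closed_Inter:
  assumes "\<And>i. i \<in> J \<Longrightarrow> cs_closure A (S i) = S i" "J \<noteq> {}"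
  shows "cs_closure A (\<Inter>i\<in>J. S i) = (\<Inter>i\<in>J. S i)"
proof -
  have sub: "S i \<subseteq> Cr" if "i \<in> J" for i using assms(1)[OF that] closure_cl by blast
  show ?thesis
  proof (rule closure_eqI)
    fix x assume x: "x \<in> cs_closure A (\<Inter>i\<in>J. S i)"
    have "x \<in> S i" if "i \<in> J" for i
      using x closure_mono[of "\<Inter>i\<in>J. S i" "S i"] assms(1)[OF that] that by blast
    then show "x \<in> (\<Inter>i\<in>J. S i)" by blast
  qed (use sub assms(2) in blast)
qed

lemma closed_Int: "cs_closure A S = S \<Longrightarrow> cs_closure A T = T \<Longrightarrow> cs_closure A (S \<inter> T) = S \<inter> T"
  using closed_Inter[of "{True, False}" "\<lambda>b. if b then S else T"] by (simp add: Int_commute)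

lemma closed_carrier: "cs_closure A Cr = Cr"
  using closure_cl closure_sub by blast

fun pw :: "'a \<Rightarrow> 'a \<Rightarrow> nat \<Rightarrow> 'a" where
  "pw y s 0 = y"
| "pw y s (Suc n) = pw y s n \<otimes> s"

lemma pw_cl [simp]: "y \<in> Cr \<Longrightarrow> s \<in> Cr \<Longrightarrow> pw y s n \<in> Cr"
  by (induction n) auto

lemma nm_pw: "y \<in> Cr \<Longrightarrow> s \<in> Cr \<Longrightarrow> nm (pw y s n) \<le> nm y * nm s ^ n"
proof (induction n)
  case (Suc n)
  then show ?case using nm_mul_le[of "pw y s n" s "nm y * nm s ^ n" "nm s"] by (simp add: mult_ac)
qed simp

text \<open>The Neumann series shows \<open>y\<close> is in the right ideal as soon as \<open>y (1 - s)\<close> is.\<close>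
lemma neumann:
  assumes J: "cs_closure A J = J" "\<zero> \<in> J" "\<And>x y. x \<in> J \<Longrightarrow> y \<in> J \<Longrightarrow> x \<oplus> y \<in> J"
    and Js: "\<And>x. x \<in> J \<Longrightarrow> x \<otimes> s \<in> J" and s: "s \<in> Cr" "nm s < 1"
    and y: "y \<in> Cr" "y \<ominus> y \<otimes> s \<in> J"
  shows "y \<in> J"
proof -
  have Jc: "x \<in> J \<Longrightarrow> x \<in> Cr" for x using J(1) closure_cl by blast
  have step: "pw y s n \<ominus> pw y s (Suc n) \<in> J" for n
  proof (induction n)
    case (Suc n)
    have "(pw y s n \<ominus> pw y s (Suc n)) \<otimes> s \<in> J" by (rule Js[OF Suc])
    then show ?case using y s by (simp add: diff_mul)
  qed (use y in simp)
  have part: "y \<ominus> pw y s n \<in> J" for n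
  proof (induction n)
    case (Suc n)
    have "(y \<ominus> pw y s n) \<oplus> (pw y s n \<ominus> pw y s (Suc n)) \<in> J" by (rule J(3)[OF Suc step])
    moreover have "(y \<ominus> pw y s n) \<oplus> (pw y s n \<ominus> pw y s (Suc n)) = y \<ominus> pw y s (Suc n)"
      using y s by (simp add: alg)
    ultimately show ?case by simp
  qed (use y J in simp)
  show ?thesis
  proof (rule closed_approx[OF J(1) y(1)])
    fix e :: real assume "e > 0"
    have "(\<lambda>n. nm y * nm s ^ n) \<longlonglongrightarrow> nm y * 0"
      by (intro tendsto_intros LIMSEQ_power_zero) (use s in auto)
    then have "\<forall>\<^sub>F n in sequentially. nm y * nm s ^ n < e"
      using \<open>e > 0\<close> by (intro order_tendstoD(2)[of _ "nm y * 0"]) auto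
    then obtain n where "nm y * nm s ^ n < e" by (auto simp: eventually_sequentially)
    then have "nm (pw y s n) \<le> e" using nm_pw[OF y(1) s(1), of n] by linarith
    moreover have "y \<ominus> (y \<ominus> pw y s n) = pw y s n" using y s by (simp add: alg)
    ultimately show "\<exists>x\<in>J. nm (y \<ominus> x) \<le> e" using part[of n] by (intro bexI[of _ "y \<ominus> pw y s n"]) auto
  qed
qed

lemma completeD:
  assumes "\<And>n::nat. s n \<in> Cr" "\<And>e. e > 0 \<Longrightarrow> \<exists>N. \<forall>m\<ge>N. \<forall>n\<ge>N. nm (s m \<ominus> s n) < e"
  obtains y where "y \<in> Cr" "\<And>e. e > 0 \<Longrightarrow> \<exists>N. \<forall>n\<ge>N. nm (s n \<ominus> y) < e"
  using complete assms unfolding cs_complete_def cs_dist_def by blast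

end

section \<open>Continuous functional calculus\<close>

lemma poly_approx:
  fixes f :: "real \<Rightarrow> real"
  assumes "continuous_on UNIV f" "e > 0"
  shows "\<exists>p::complex poly. \<forall>x. \<bar>x\<bar> \<le> 1 \<longrightarrow> cmod (poly p (of_real x) - of_real (f (r * x))) \<le> e"
proof -
  have "continuous_on {-1..1} (\<lambda>x. f (r * x))"
    by (rule continuous_on_compose2[OF assms(1)]) (auto intro!: continuous_intros)
  then obtain g where g: "real_polynomial_function g" "\<And>x. x \<in> {-1..1} \<Longrightarrow> \<bar>f (r * x) - g x\<bar> < e"
    using Stone_Weierstrass_real_polynomial_function[of "{-1..1}" "\<lambda>x. f (r * x)" e] \<open>e > 0\<close> by auto
  obtain a n where a: "g = (\<lambda>x. \<Sum>i\<le>n. a i * x ^ i)"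
    using g(1) real_polynomial_function_iff_sum by blast
  define p where "p = (\<Sum>i\<le>n. monom (complex_of_real (a i)) i)"
  have p: "poly p (of_real x) = of_real (g x)" for x
    unfolding p_def a by (simp add: poly_sum poly_monom)
  have "cmod (poly p (of_real x) - of_real (f (r * x))) \<le> e" if "\<bar>x\<bar> \<le> 1" for x
  proof -
    have "cmod (poly p (of_real x) - of_real (f (r * x))) = \<bar>g x - f (r * x)\<bar>"
      unfolding p by (simp flip: of_real_diff)
    then show ?thesis using g(2)[of x] that by (simp add: abs_le_iff abs_less_iff)
  qed
  then show ?thesis by blast
qed

locale ucst = cst +
  fixes one :: 'a ("\<one>")
  assumes one_cl [simp]: "\<one> \<in> Cr"
    and one_mul [simp]: "x \<in> Cr \<Longrightarrow> \<one> \<otimes> x = x"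
    and mul_one [simp]: "x \<in> Cr \<Longrightarrow> x \<otimes> \<one> = x"
begin

lemma nm_le_0: "x \<in> Cr \<Longrightarrow> nm x \<le> 0 \<Longrightarrow> x = \<zero>"
  using nm_ge_0[of x] nm_eq_0[of x] by linarith

lemma star_one [simp]: "\<one>\<^sup>\<star> = \<one>"
  using star_mul[of "\<one>\<^sup>\<star>" \<one>] by simp

lemma nm_one_le: "nm \<one> \<le> 1"
  using cstar_id[of \<one>] by (cases "nm \<one> = 0") (simp_all add: power2_eq_square)

section \<open>Evaluation of polynomials at an element\<close>

definition ev :: "'a \<Rightarrow> complex poly \<Rightarrow> 'a" where
  "ev h p = fold_coeffs (\<lambda>a r. a \<odot> \<one> \<oplus> h \<otimes> r) p \<zero>"

lemma ev_0 [simp]: "ev h 0 = \<zero>"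
  by (simp add: ev_def)

lemma ev_pCons [simp]: "h \<in> Cr \<Longrightarrow> ev h (pCons a p) = a \<odot> \<one> \<oplus> h \<otimes> ev h p"
  unfolding ev_def by (cases "p = 0 \<and> a = 0") auto

lemma ev_cl [simp]: "h \<in> Cr \<Longrightarrow> ev h p \<in> Cr"
  by (induction p) auto

lemma ev_add: "h \<in> Cr \<Longrightarrow> ev h (p + q) = ev h p \<oplus> ev h q"
  by (induction p q rule: poly_induct2) (auto simp: alg add_sm)

lemma ev_smult: "h \<in> Cr \<Longrightarrow> ev h (smult c p) = c \<odot> ev h p"
  by (induction p) (auto simp: alg)

lemma ev_mult: "h \<in> Cr \<Longrightarrow> ev h (p * q) = ev h p \<otimes> ev h q"
proof (induction p)
  case (pCons a p)
  then show ?case by (simp add: ev_add ev_smult add_mul sm_mul mul_assoc)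
qed simp

lemma ev_diff: "h \<in> Cr \<Longrightarrow> ev h (p - q) = ev h p \<ominus> ev h q"
  using ev_add[of h "p - q" q] by (simp add: eq_diff_iff)

text \<open>Two different elements are allowed because, besides commutation, the proof that
  \<open>w\<^sup>\<star> \<otimes> w\<close> is positive needs \<open>z\<close> to intertwine
  \<open>z\<^sup>\<star> \<otimes> z\<close> with
  \<open>z \<otimes> z\<^sup>\<star>\<close>.\<close>

lemma ev_intertwine:
  "\<lbrakk>h \<in> Cr; h' \<in> Cr; z \<in> Cr; z \<otimes> h = h' \<otimes> z\<rbrakk> \<Longrightarrow> z \<otimes> ev h p = ev h' p \<otimes> z"
proof (induction p)
  case (pCons a p)
  have "z \<otimes> (h \<otimes> ev h p) = h' \<otimes> (z \<otimes> ev h p)"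
    using pCons.prems by (simp flip: mul_assoc)
  also have "\<dots> = h' \<otimes> ev h' p \<otimes> z"
    using pCons by (simp add: mul_assoc)
  finally show ?case using pCons.prems by (simp add: mul_add add_mul mul_sm sm_mul)
qed simp

definition sa :: "'a \<Rightarrow> bool" where "sa h \<longleftrightarrow> h \<in> Cr \<and> h\<^sup>\<star> = h"

lemma sa_cl [simp]: "sa h \<Longrightarrow> h \<in> Cr" and sa_star [simp]: "sa h \<Longrightarrow> h\<^sup>\<star> = h"
  by (simp_all add: sa_def)

lemma saI: "h \<in> Cr \<Longrightarrow> h\<^sup>\<star> = h \<Longrightarrow> sa h"
  unfolding sa_def by blast

lemma sa_sm: "sa h \<Longrightarrow> sa (complex_of_real r \<odot> h)"
  by (rule saI) (simp_all add: star_sm)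

lemma sa_square: "x \<in> Cr \<Longrightarrow> sa (x\<^sup>\<star> \<otimes> x)"
  by (rule saI) (simp_all add: star_mul)

lemma ev_star: "sa h \<Longrightarrow> ev h (map_poly cnj p) = (ev h p)\<^sup>\<star>"
proof (induction p)
  case (pCons a p)
  then show ?case
    using ev_intertwine[of h h h p] by (simp add: cnjp_pCons star_add star_sm star_mul)
qed simp

lemma ev_poly_cnorm: "sa h \<Longrightarrow> nm h \<le> 1/2 \<Longrightarrow> poly_cnorm (\<lambda>p. nm (ev h p))"
proof (unfold_locales)
  assume h: "sa h" "nm h \<le> 1/2"
  fix p q c
  show "nm (ev h (p + q)) \<le> nm (ev h p) + nm (ev h q)" using h by (simp add: ev_add nm_add)
  show "nm (ev h (p * q)) \<le> nm (ev h p) * nm (ev h q)" using h by (simp add: ev_mult nm_mul)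
  show "nm (ev h (smult c p)) = cmod c * nm (ev h p)" using h by (simp add: ev_smult nm_sm)
  show "nm (ev h (map_poly cnj p * p)) = (nm (ev h p))\<^sup>2"
    using h by (simp add: ev_mult ev_star cstar_id)
  show "nm (ev h 1) \<le> 1" using h nm_one_le by (simp add: one_pCons)
  show "nm (ev h [:0,1:]) \<le> 1/2" using h by simp
qed

text \<open>Dividing by \<open>R\<close> brings \<open>h\<close> to norm at most 1/2, as the
  polynomial estimate requires, and \<open>f\<close> then enters through its values on
  \<open>[-R, R]\<close>. Keeping \<open>R\<close> apart from \<open>h\<close> lets several
  elements, such as \<open>h\<close> and its image under a homomorphism, be treated at one common
  scale.\<close>

definition adm :: "real \<Rightarrow> 'a \<Rightarrow> bool" where
  "adm R h \<longleftrightarrow> sa h \<and> 2 * nm h \<le> R \<and> 0 < R"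

definition sc :: "real \<Rightarrow> 'a \<Rightarrow> 'a" where
  "sc R h = complex_of_real (1/R) \<odot> h"

lemma adm_sa: "adm R h \<Longrightarrow> sa h" and adm_pos: "adm R h \<Longrightarrow> R > 0"
  by (simp_all add: adm_def)

lemma sc_cl [simp]: "h \<in> Cr \<Longrightarrow> sc R h \<in> Cr"
  by (simp add: sc_def)

lemma ev_sc_norm:
  assumes "adm R h" "\<And>x::real. \<bar>x\<bar> \<le> 1 \<Longrightarrow> cmod (poly p (of_real x)) \<le> S"
  shows "nm (ev (sc R h) p) \<le> S"
proof -
  have "nm (sc R h) \<le> 1/2" using assms(1) by (simp add: adm_def sc_def nm_sm field_simps norm_divide)
  then interpret poly_cnorm "\<lambda>p. nm (ev (sc R h) p)"
    using assms(1) by (intro ev_poly_cnorm) (simp_all only: adm_def sc_def sa_sm)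
  show ?thesis using N_le_sup[OF assms(2)] .
qed

section \<open>Functional calculus as a limit of polynomials\<close>

definition near :: "real \<Rightarrow> (real \<Rightarrow> real) \<Rightarrow> complex poly \<Rightarrow> real \<Rightarrow> bool" where
  "near R f p e \<longleftrightarrow> (\<forall>x. \<bar>x\<bar> \<le> 1 \<longrightarrow> cmod (poly p (of_real x) - of_real (f (R * x))) \<le> e)"

text \<open>The value is pinned down by all approximating polynomials at once instead of one chosen
  sequence, so later proofs may pick whichever approximant suits them.\<close>

definition is_fc :: "real \<Rightarrow> 'a \<Rightarrow> (real \<Rightarrow> real) \<Rightarrow> 'a \<Rightarrow> bool" where
  "is_fc R h f y \<longleftrightarrow> y \<in> Cr \<and> (\<forall>p e. near R f p e \<longrightarrow> nm (ev (sc R h) p \<ominus> y) \<le> e)"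

definition fcR :: "real \<Rightarrow> 'a \<Rightarrow> (real \<Rightarrow> real) \<Rightarrow> 'a" where
  "fcR R h f = (SOME y. is_fc R h f y)"

text \<open>The summand 1 keeps the scale positive for \<open>h = 0\<close>.\<close>

abbreviation fc :: "'a \<Rightarrow> (real \<Rightarrow> real) \<Rightarrow> 'a" where
  "fc h \<equiv> fcR (2 * nm h + 1) h"

lemma adm_default: "sa h \<Longrightarrow> adm (2 * nm h + 1) h"
  by (simp add: adm_def add_nonneg_pos)

lemma near_diff_norm:
  assumes "adm R h" "near R f p d" "near R f q e"
  shows "nm (ev (sc R h) p \<ominus> ev (sc R h) q) \<le> d + e"
proof -
  have "nm (ev (sc R h) (p - q)) \<le> d + e"
  proof (rule ev_sc_norm[OF assms(1)])
    fix x :: real assume "\<bar>x\<bar> \<le> 1"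
    then have "cmod (poly p (of_real x) - of_real (f (R * x))) \<le> d" "cmod (poly q (of_real x) - of_real (f (R * x))) \<le> e"
      using assms unfolding near_def by auto
    then show "cmod (poly (p - q) (of_real x)) \<le> d + e"
      using norm_triangle_ineq4[of "poly p (of_real x) - of_real (f (R * x))" "poly q (of_real x) - of_real (f (R * x))"]
      by simp
  qed
  then show ?thesis using adm_sa[OF assms(1)] by (simp add: ev_diff)
qed

lemma ex_fc:
  assumes h: "adm R h" and f: "continuous_on UNIV f"
  shows "\<exists>y. is_fc R h f y"
proof -
  have "\<exists>p. near R f p (1 / real (Suc n))" for n
    unfolding near_def by (rule poly_approx[OF f]) simp
  then obtain P where P: "\<And>n. near R f (P n) (1 / real (Suc n))" by metis
  have hc [simp]: "h \<in> Cr" using adm_sa[OF h] by simp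
  obtain y where y: "y \<in> Cr" "\<And>e. e > 0 \<Longrightarrow> \<exists>N. \<forall>n\<ge>N. nm (ev (sc R h) (P n) \<ominus> y) < e"
  proof (rule completeD[of "\<lambda>n. ev (sc R h) (P n)"])
    fix e :: real assume "e > 0"
    then obtain N where N: "1 / real (Suc N) < e/2" using nat_approx_posE[of "e/2"] by auto
    have "nm (ev (sc R h) (P m) \<ominus> ev (sc R h) (P n)) < e" if "m \<ge> N" "n \<ge> N" for m n
    proof -
      have "1 / real (Suc k) \<le> 1 / real (Suc N)" if "k \<ge> N" for k
        using that by (simp add: frac_le)
      from this[OF that(1)] this[OF that(2)] show ?thesis
        using near_diff_norm[OF h P P, of m n] N by linarith
    qed
    then show "\<exists>N. \<forall>m\<ge>N. \<forall>n\<ge>N. nm (ev (sc R h) (P m) \<ominus> ev (sc R h) (P n)) < e" by blast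
  qed auto
  have "nm (ev (sc R h) p \<ominus> y) \<le> d" if d: "near R f p d" for p d
  proof (rule field_le_epsilon)
    fix e :: real assume "e > 0"
    obtain N where N: "\<forall>n\<ge>N. nm (ev (sc R h) (P n) \<ominus> y) < e/2" using y(2)[of "e/2"] \<open>e > 0\<close> by auto
    obtain n0 where n0: "1 / real (Suc n0) < e/2" using nat_approx_posE[of "e/2"] \<open>e > 0\<close> by auto
    define n where "n = max N n0"
    have "1 / real (Suc n) \<le> 1 / real (Suc n0)" by (simp add: n_def frac_le)
    then have "nm (ev (sc R h) p \<ominus> ev (sc R h) (P n)) \<le> d + e/2"
      using near_diff_norm[OF h d P, of n] n0 by linarith
    moreover have "nm (ev (sc R h) (P n) \<ominus> y) < e/2" using N by (simp add: n_def)
    ultimately show "nm (ev (sc R h) p \<ominus> y) \<le> d + e"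
      using nm_triangle[of "ev (sc R h) p" "ev (sc R h) (P n)" y] y(1) by simp
  qed
  then show ?thesis using y(1) unfolding is_fc_def by blast
qed

lemma is_fc_fcR: "adm R h \<Longrightarrow> continuous_on UNIV f \<Longrightarrow> is_fc R h f (fcR R h f)"
  unfolding fcR_def by (rule someI_ex) (rule ex_fc)

lemma fcR_cl [simp]: "adm R h \<Longrightarrow> continuous_on UNIV f \<Longrightarrow> fcR R h f \<in> Cr"
  using is_fc_fcR unfolding is_fc_def by blast

lemma near_fcR: "adm R h \<Longrightarrow> continuous_on UNIV f \<Longrightarrow> near R f p e \<Longrightarrow> nm (ev (sc R h) p \<ominus> fcR R h f) \<le> e"
  using is_fc_fcR unfolding is_fc_def by blast

lemma ex_near: "continuous_on UNIV f \<Longrightarrow> e > 0 \<Longrightarrow> \<exists>p. near R f p e"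
  unfolding near_def by (rule poly_approx)

text \<open>Uniqueness in usable form: one good polynomial for each tolerance identifies the value.
  The sum, product and adjoint rules are all derived from it.\<close>

lemma fcR_eqI:
  assumes h: "adm R h" and f: "continuous_on UNIV f" and y: "y \<in> Cr"
    and *: "\<And>e. e > 0 \<Longrightarrow> \<exists>p. near R f p e \<and> nm (ev (sc R h) p \<ominus> y) \<le> e"
  shows "fcR R h f = y"
proof -
  have "nm (fcR R h f \<ominus> y) \<le> e" if "e > 0" for e
  proof -
    have "e/2 > 0" using that by simp
    then obtain p where p: "near R f p (e/2)" "nm (ev (sc R h) p \<ominus> y) \<le> e/2" using * by blast
    then have "nm (ev (sc R h) p \<ominus> fcR R h f) \<le> e/2" using near_fcR[OF h f] by blast
    with p(2) show ?thesis
      using nm_triangle[of "fcR R h f" "ev (sc R h) p" y] nm_minus_comm[of "fcR R h f" "ev (sc R h) p"] y h f adm_sa[OF h] by simp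
  qed
  then have "fcR R h f \<ominus> y = \<zero>" using nm_small_eq_0[of "fcR R h f \<ominus> y"] y h f by simp
  then show ?thesis using y h f by (simp add: diff_eq_zero)
qed

lemma fcR_poly:
  assumes "adm R h" "continuous_on UNIV f" "\<And>x. poly p (of_real x) = of_real (f (R * x))"
  shows "fcR R h f = ev (sc R h) p"
  using assms adm_sa[of R h] by (intro fcR_eqI) (auto simp: near_def intro!: exI[of _ p])

lemma fcR_const: "adm R h \<Longrightarrow> fcR R h (\<lambda>_. c) = complex_of_real c \<odot> \<one>"
  using fcR_poly[of R h "\<lambda>_. c" "[:of_real c:]"] adm_sa[of R h] by simp

lemma fcR_id: "adm R h \<Longrightarrow> fcR R h (\<lambda>x. x) = h"
  using fcR_poly[of R h "\<lambda>x. x" "[:0, of_real R:]"] adm_sa[of R h] adm_pos[of R h]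
  by (simp add: sc_def mul_sm flip: sm_mult)

text \<open>The supremum runs over the whole sampling interval, which is at least twice as long as
  the norm of \<open>h\<close> calls for; \<open>fcR_norm\<close> is the sharp version.\<close>

lemma fcR_norm_weak:
  assumes h: "adm R h" and f: "continuous_on UNIV f" and B: "\<And>x. \<bar>x\<bar> \<le> R \<Longrightarrow> \<bar>f x\<bar> \<le> B"
  shows "nm (fcR R h f) \<le> B"
proof (rule field_le_epsilon)
  fix e :: real assume "e > 0"
  then obtain p where p: "near R f p (e/2)" using ex_near[OF f, of "e/2"] by auto
  have "nm (ev (sc R h) p) \<le> B + e/2"
  proof (rule ev_sc_norm[OF h])
    fix x :: real assume x: "\<bar>x\<bar> \<le> 1"
    then have "\<bar>f (R * x)\<bar> \<le> B"
      using B[of "R * x"] adm_pos[OF h] by (simp add: abs_mult mult_left_le)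
    moreover have "cmod (poly p (of_real x) - of_real (f (R * x))) \<le> e/2" using p x by (simp add: near_def)
    ultimately show "cmod (poly p (of_real x)) \<le> B + e/2"
      using norm_triangle_sub[of "poly p (of_real x)" "of_real (f (R * x))"] by simp
  qed
  moreover have "nm (fcR R h f) \<le> nm (fcR R h f \<ominus> ev (sc R h) p) + nm (ev (sc R h) p)"
    using adm_sa[OF h] h f by (simp add: nm_le_diff)
  ultimately show "nm (fcR R h f) \<le> B + e"
    using near_fcR[OF h f p] nm_minus_comm[of "fcR R h f" "ev (sc R h) p"] adm_sa[OF h] h f by simp
qed

lemma fcR_bounded:
  fixes f :: "real \<Rightarrow> real"
  assumes f: "continuous_on UNIV f"
  shows "\<exists>B>0. \<forall>x. \<bar>x\<bar> \<le> R \<longrightarrow> \<bar>f x\<bar> \<le> B"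
proof -
  have "bounded (f ` {-R..R})"
    by (intro compact_imp_bounded compact_continuous_image continuous_on_subset[OF f]) auto
  then obtain B where "B > 0" "\<forall>y\<in>f ` {-R..R}. norm y \<le> B" unfolding bounded_pos by blast
  then show ?thesis by (auto simp: abs_le_iff intro!: exI[of _ B])
qed

lemma fcR_add:
  assumes h: "adm R h" and f: "continuous_on UNIV f" and g: "continuous_on UNIV g"
  shows "fcR R h (\<lambda>x. f x + g x) = fcR R h f \<oplus> fcR R h g"
proof (rule fcR_eqI[OF h])
  show "continuous_on UNIV (\<lambda>x. f x + g x)" using f g by (intro continuous_intros)
  show "fcR R h f \<oplus> fcR R h g \<in> Cr" using h f g by simp
  fix e :: real assume "e > 0"
  then have "e/2 > 0" by simp
  then obtain p q where p: "near R f p (e/2)" and q: "near R g q (e/2)"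
    using ex_near[OF f] ex_near[OF g] by metis
  have "near R (\<lambda>x. f x + g x) (p + q) e"
    unfolding near_def
  proof (intro allI impI)
    fix x :: real assume "\<bar>x\<bar> \<le> 1"
    then show "cmod (poly (p + q) (of_real x) - of_real (f (R * x) + g (R * x))) \<le> e"
      using p q norm_triangle_ineq[of "poly p (of_real x) - of_real (f (R * x))" "poly q (of_real x) - of_real (g (R * x))"]
      unfolding near_def by (fastforce simp: algebra_simps)
  qed
  moreover have "ev (sc R h) (p + q) \<ominus> (fcR R h f \<oplus> fcR R h g)
      = (ev (sc R h) p \<ominus> fcR R h f) \<oplus> (ev (sc R h) q \<ominus> fcR R h g)"
    using adm_sa[OF h] h f g by (simp add: ev_add alg)
  moreover have "nm ((ev (sc R h) p \<ominus> fcR R h f) \<oplus> (ev (sc R h) q \<ominus> fcR R h g)) \<le> e"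
    using nm_add[of "ev (sc R h) p \<ominus> fcR R h f" "ev (sc R h) q \<ominus> fcR R h g"]
      near_fcR[OF h f p] near_fcR[OF h g q] adm_sa[OF h] h f g by simp
  ultimately show "\<exists>p. near R (\<lambda>x. f x + g x) p e \<and> nm (ev (sc R h) p \<ominus> (fcR R h f \<oplus> fcR R h g)) \<le> e"
    by auto
qed

lemma fcR_mult:
  assumes h: "adm R h" and f: "continuous_on UNIV f" and g: "continuous_on UNIV g"
  shows "fcR R h (\<lambda>x. f x * g x) = fcR R h f \<otimes> fcR R h g"
proof (rule fcR_eqI[OF h])
  show "continuous_on UNIV (\<lambda>x. f x * g x)" using f g by (intro continuous_intros)
  show "fcR R h f \<otimes> fcR R h g \<in> Cr" using h f g by simp
  fix e :: real assume "e > 0"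
  obtain B where B: "B > 0" "\<And>x. \<bar>x\<bar> \<le> R \<Longrightarrow> \<bar>f x\<bar> \<le> B" using fcR_bounded[OF f, of R] by auto
  obtain B' where B': "B' > 0" "\<And>x. \<bar>x\<bar> \<le> R \<Longrightarrow> \<bar>g x\<bar> \<le> B'" using fcR_bounded[OF g, of R] by auto
  \<comment> \<open>With both approximants within \<open>d \<le> 1\<close>, the product is off by at
    most \<open>d * (B' + 1) + B * d\<close>, which this choice keeps below
    \<open>e\<close>.\<close>
  define d where "d = min 1 (e / (B + B' + 1))"
  have d: "d > 0" "d \<le> 1" using \<open>e > 0\<close> B(1) B'(1) by (auto simp: d_def)
  have "d * (B + B' + 1) \<le> e / (B + B' + 1) * (B + B' + 1)"
    using B(1) B'(1) by (intro mult_right_mono) (auto simp: d_def)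
  then have d3: "d * (B + B' + 1) \<le> e" using B(1) B'(1) by simp
  obtain p q where p: "near R f p d" and q: "near R g q d"
    using ex_near[OF f] ex_near[OF g] d by metis
  have bd: "d * (B' + 1) + B * d \<le> e" using d3 d(1) by (simp add: algebra_simps)
  have Rx: "\<bar>R * x\<bar> \<le> R" if "\<bar>x\<bar> \<le> 1" for x
    using adm_pos[OF h] that by (simp add: abs_mult mult_left_le)
  have qb: "cmod (poly q (of_real x)) \<le> B' + 1" if x: "\<bar>x\<bar> \<le> 1" for x :: real
    using q x norm_triangle_sub[of "poly q (of_real x)" "of_real (g (R * x))"] d(2) B'(2)[OF Rx[OF x]]
    unfolding near_def by fastforce
  have "near R (\<lambda>x. f x * g x) (p * q) e"
    unfolding near_def
  proof (intro allI impI)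
    fix x :: real assume x: "\<bar>x\<bar> \<le> 1"
    define a b where "a = poly p (of_real x)" and "b = poly q (of_real x)"
    define s t :: complex where "s = of_real (f (R * x))" and "t = of_real (g (R * x))"
    have "a * b - s * t = (a - s) * b + s * (b - t)" by (simp add: algebra_simps)
    then have "cmod (a * b - s * t) \<le> cmod (a - s) * cmod b + cmod s * cmod (b - t)"
      by (metis norm_mult norm_triangle_ineq)
    also have "\<dots> \<le> d * (B' + 1) + B * d"
      using p q x qb[OF x] B(2)[OF Rx[OF x]] B(1) d(1) unfolding near_def a_def b_def s_def t_def
      by (intro add_mono mult_mono) auto
    finally show "cmod (poly (p * q) (of_real x) - of_real (f (R * x) * g (R * x))) \<le> e"
      using bd by (simp add: a_def b_def s_def t_def)
  qed
  moreover have "nm (ev (sc R h) (p * q) \<ominus> fcR R h f \<otimes> fcR R h g) \<le> e"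
  proof -
    have "ev (sc R h) (p * q) \<ominus> fcR R h f \<otimes> fcR R h g
      = (ev (sc R h) p \<ominus> fcR R h f) \<otimes> ev (sc R h) q \<oplus> fcR R h f \<otimes> (ev (sc R h) q \<ominus> fcR R h g)"
      using adm_sa[OF h] h f g by (simp add: ev_mult alg)
    moreover have "nm ((ev (sc R h) p \<ominus> fcR R h f) \<otimes> ev (sc R h) q) \<le> d * (B' + 1)"
      using near_fcR[OF h f p] ev_sc_norm[OF h qb] adm_sa[OF h] h f by (intro nm_mul_le) auto
    moreover have "nm (fcR R h f \<otimes> (ev (sc R h) q \<ominus> fcR R h g)) \<le> B * d"
      using near_fcR[OF h g q] fcR_norm_weak[OF h f B(2)] adm_sa[OF h] h f g by (intro nm_mul_le) auto
    ultimately show ?thesis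
      using bd adm_sa[OF h] h f g
        nm_add[of "(ev (sc R h) p \<ominus> fcR R h f) \<otimes> ev (sc R h) q" "fcR R h f \<otimes> (ev (sc R h) q \<ominus> fcR R h g)"]
      by simp
  qed
  ultimately show "\<exists>p. near R (\<lambda>x. f x * g x) p e \<and> nm (ev (sc R h) p \<ominus> fcR R h f \<otimes> fcR R h g) \<le> e"
    by blast
qed

lemma fcR_diff:
  assumes h: "adm R h" and f: "continuous_on UNIV f" and g: "continuous_on UNIV g"
  shows "fcR R h (\<lambda>x. f x - g x) = fcR R h f \<ominus> fcR R h g"
proof -
  have c: "continuous_on UNIV (\<lambda>x. f x - g x)" using f g by (intro continuous_intros)
  have "fcR R h f = fcR R h (\<lambda>x. f x - g x) \<oplus> fcR R h g"
    using fcR_add[OF h c g] by simp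
  then show ?thesis using h f g c by (simp add: eq_diff_iff)
qed

lemma fcR_star: "adm R h \<Longrightarrow> continuous_on UNIV f \<Longrightarrow> (fcR R h f)\<^sup>\<star> = fcR R h f"
proof -
  assume h: "adm R h" and f: "continuous_on UNIV f"
  have sas: "sa (sc R h)" using adm_sa[OF h] sa_sm unfolding sc_def by blast
  have "fcR R h f = (fcR R h f)\<^sup>\<star>"
  proof (rule fcR_eqI[OF h f])
    fix e :: real assume "e > 0"
    then obtain p where p: "near R f p e" using ex_near[OF f] by blast
    have "near R f (map_poly cnj p) e"
      unfolding near_def
    proof (intro allI impI)
      fix x :: real assume "\<bar>x\<bar> \<le> 1"
      then have "cmod (cnj (poly p (of_real x) - of_real (f (R * x)))) \<le> e"
        using p unfolding near_def complex_mod_cnj by blast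
      then show "cmod (poly (map_poly cnj p) (of_real x) - of_real (f (R * x))) \<le> e" by simp
    qed
    moreover have "ev (sc R h) (map_poly cnj p) \<ominus> (fcR R h f)\<^sup>\<star> = (ev (sc R h) p \<ominus> fcR R h f)\<^sup>\<star>"
      using h f adm_sa[OF h] by (simp add: ev_star[OF sas] star_diff)
    ultimately show "\<exists>p. near R f p e \<and> nm (ev (sc R h) p \<ominus> (fcR R h f)\<^sup>\<star>) \<le> e"
      using near_fcR[OF h f p] h f adm_sa[OF h] by (auto intro!: exI[of _ "map_poly cnj p"])
  qed (use h f in simp)
  then show ?thesis by simp
qed

lemma fcR_sa: "adm R h \<Longrightarrow> continuous_on UNIV f \<Longrightarrow> sa (fcR R h f)"
  by (rule saI) (simp_all add: fcR_star)

lemma fcR_intertwine: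
  assumes h: "adm R h" "adm R h'" and f: "continuous_on UNIV f" and z: "z \<in> Cr" "z \<otimes> h = h' \<otimes> z"
  shows "z \<otimes> fcR R h f = fcR R h' f \<otimes> z"
proof -
  have cl: "h \<in> Cr" "h' \<in> Cr" using h adm_sa by auto
  have *: "nm (z \<otimes> fcR R h f \<ominus> fcR R h' f \<otimes> z) \<le> e" if "e > 0" for e
  proof -
    define d where "d = e / (2 * nm z + 1)"
    have d: "d > 0" "2 * nm z * d \<le> e"
      using that nm_ge_0[OF z(1)] by (auto simp: d_def divide_simps)
    obtain p where p: "near R f p d" using ex_near[OF f] d by blast
    have "z \<otimes> ev (sc R h) p = ev (sc R h') p \<otimes> z"
      using z cl by (intro ev_intertwine) (auto simp: sc_def sm_mul mul_sm)
    then have "z \<otimes> fcR R h f \<ominus> fcR R h' f \<otimes> z = (ev (sc R h') p \<ominus> fcR R h' f) \<otimes> z \<ominus> z \<otimes> (ev (sc R h) p \<ominus> fcR R h f)"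
      using z cl h f by (simp add: alg)
    moreover have "nm ((ev (sc R h') p \<ominus> fcR R h' f) \<otimes> z) \<le> d * nm z"
      using near_fcR[OF h(2) f p] z cl h f by (intro nm_mul_le) auto
    moreover have "nm (z \<otimes> (ev (sc R h) p \<ominus> fcR R h f)) \<le> nm z * d"
      using near_fcR[OF h(1) f p] z cl h f by (intro nm_mul_le) auto
    ultimately show ?thesis
      using d z cl h f nm_diff[of "(ev (sc R h') p \<ominus> fcR R h' f) \<otimes> z" "z \<otimes> (ev (sc R h) p \<ominus> fcR R h f)"]
      by (simp add: mult_ac)
  qed
  have "z \<otimes> fcR R h f \<ominus> fcR R h' f \<otimes> z = \<zero>"
    using nm_small_eq_0[OF _ *] z h f by simp
  then show ?thesis using z h f by (simp add: diff_eq_zero)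
qed

lemma fcR_pow: "adm R h \<Longrightarrow> nm (fcR R h (\<lambda>x. x ^ n)) \<le> nm h ^ n"
proof (induction n)
  case 0
  then show ?case using fcR_const[of R h 1] nm_one_le by simp
next
  case (Suc n)
  have "fcR R h (\<lambda>x. x * x ^ n) = fcR R h (\<lambda>x. x) \<otimes> fcR R h (\<lambda>x. x ^ n)"
    by (rule fcR_mult[OF Suc.prems]) (intro continuous_intros)+
  then show ?case
    using Suc adm_sa[of R h] by (simp add: fcR_id continuous_on_power continuous_on_id nm_mul_le)
qed

text \<open>Writing \<open>f x = x ^ (2 n) * g x\<close> shows that only the values of \<open>f\<close> on \<open>[-\<parallel>h\<parallel>, \<parallel>h\<parallel>]\<close> matter.\<close>
lemma fcR_vanish:
  assumes h: "adm R h" and f: "continuous_on UNIV f" and M: "nm h < M"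
    and van: "\<And>x. \<bar>x\<bar> \<le> M \<Longrightarrow> f x = 0"
  shows "fcR R h f = \<zero>"
proof -
  have hc: "h \<in> Cr" using adm_sa[OF h] by simp
  have M0: "M > 0" using M nm_ge_0[OF hc] by linarith
  obtain B where B: "B > 0" "\<And>x. \<bar>x\<bar> \<le> R \<Longrightarrow> \<bar>f x\<bar> \<le> B" using fcR_bounded[OF f, of R] by auto
  have bound: "nm (fcR R h f) \<le> (nm h / M) ^ (2 * n) * B" for n
  proof -
    define g where "g x = f x / max \<bar>x\<bar> M ^ (2 * n)" for x
    have gc: "continuous_on UNIV g" unfolding g_def using M0 by (intro continuous_intros f) (auto simp: max_def)
    have "f = (\<lambda>x. x ^ (2 * n) * g x)"
    proof
      fix x show "f x = x ^ (2 * n) * g x"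
      proof (cases "\<bar>x\<bar> \<le> M")
        case False
        then have "max \<bar>x\<bar> M ^ (2 * n) = x ^ (2 * n)" "x \<noteq> 0" using M0 by (auto simp: max_def power_mult)
        then show ?thesis by (simp add: g_def)
      qed (simp add: van g_def)
    qed
    then have "fcR R h f = fcR R h (\<lambda>x. x ^ (2 * n)) \<otimes> fcR R h g"
      using fcR_mult[OF h _ gc, of "\<lambda>x. x ^ (2 * n)"] by (simp add: continuous_on_power continuous_on_id)
    moreover have "nm (fcR R h g) \<le> B / M ^ (2 * n)"
    proof (rule fcR_norm_weak[OF h gc])
      fix x assume "\<bar>x\<bar> \<le> R"
      moreover have "M ^ (2 * n) \<le> max \<bar>x\<bar> M ^ (2 * n)" using M0 by (intro power_mono) auto
      ultimately show "\<bar>g x\<bar> \<le> B / M ^ (2 * n)" unfolding g_def using B M0 by (auto simp: abs_divide intro!: frac_le)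
    qed
    ultimately have "nm (fcR R h f) \<le> nm h ^ (2 * n) * (B / M ^ (2 * n))"
      using fcR_pow[OF h, of "2 * n"] h gc
      by (simp only:) (intro nm_mul_le fcR_cl; simp add: continuous_on_power continuous_on_id)
    then show ?thesis by (simp add: power_divide)
  qed
  have "(\<lambda>n. (nm h / M) ^ (2 * n) * B) \<longlonglongrightarrow> 0 * B"
  proof (intro tendsto_intros)
    have "(\<lambda>n. ((nm h / M)\<^sup>2) ^ n) \<longlonglongrightarrow> 0"
      using M M0 nm_ge_0[OF hc] by (intro LIMSEQ_power_zero) (simp add: power_less_one_iff)
    then show "(\<lambda>n. (nm h / M) ^ (2 * n)) \<longlonglongrightarrow> 0" by (simp add: power_mult)
  qed
  then have "nm (fcR R h f) \<le> 0" using bound by (intro LIMSEQ_le_const) auto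
  then show ?thesis by (intro nm_le_0 fcR_cl h f)
qed

text \<open>By continuity \<open>f\<close> is bounded by \<open>B + e\<close> on a slightly longer
  interval \<open>[-M, M]\<close>. Truncating \<open>f\<close> at that height changes nothing there,
  so \<open>fcR_vanish\<close> removes the difference and the weak bound applies to the
  truncation.\<close>

lemma fcR_norm:
  assumes h: "adm R h" and f: "continuous_on UNIV f" and B: "\<And>x. \<bar>x\<bar> \<le> nm h \<Longrightarrow> \<bar>f x\<bar> \<le> B"
  shows "nm (fcR R h f) \<le> B"
proof (rule field_le_epsilon)
  fix e :: real assume e: "e > 0"
  have B0: "B \<ge> 0" using B[of 0] adm_sa[OF h] by simp
  obtain d1 where d1: "d1 > 0" "\<And>x. \<bar>x - nm h\<bar> < d1 \<Longrightarrow> \<bar>f x - f (nm h)\<bar> < e"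
    using f e unfolding continuous_on_iff dist_real_def by (metis UNIV_I)
  obtain d2 where d2: "d2 > 0" "\<And>x. \<bar>x - (- nm h)\<bar> < d2 \<Longrightarrow> \<bar>f x - f (- nm h)\<bar> < e"
    using f e unfolding continuous_on_iff dist_real_def by (metis UNIV_I)
  define M where "M = nm h + min d1 d2 / 2"
  have M: "nm h < M" using d1 d2 by (simp add: M_def)
  have fM: "\<bar>f x\<bar> \<le> B + e" if "\<bar>x\<bar> \<le> M" for x
  proof -
    consider "\<bar>x\<bar> \<le> nm h" | "x > nm h" | "x < - nm h" by linarith
    then show ?thesis
    proof cases
      case 1 then show ?thesis using B[of x] e by simp
    next
      case 2
      then have "\<bar>x - nm h\<bar> < d1" using that d1 d2 unfolding M_def by (auto simp: min_def split: if_splits)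
      then show ?thesis using d1(2)[of x] B[of "nm h"] adm_sa[OF h] by fastforce
    next
      case 3
      then have "\<bar>x - (- nm h)\<bar> < d2" using that d1 d2 unfolding M_def by (auto simp: min_def split: if_splits)
      then show ?thesis using d2(2)[of x] B[of "- nm h"] adm_sa[OF h] by fastforce
    qed
  qed
  define f1 where "f1 x = max (- (B + e)) (min (B + e) (f x))" for x
  have f1c: "continuous_on UNIV f1" unfolding f1_def by (intro continuous_intros f)
  have dc: "continuous_on UNIV (\<lambda>x. f x - f1 x)" by (intro continuous_intros f f1c)
  have "fcR R h (\<lambda>x. f x - f1 x) = \<zero>"
    using fM by (intro fcR_vanish[OF h dc M]) (fastforce simp: f1_def max_def min_def abs_le_iff)
  then have "fcR R h f = fcR R h f1" using fcR_diff[OF h f f1c] h f f1c by (simp add: diff_eq_zero)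
  moreover have "nm (fcR R h f1) \<le> B + e"
    using B0 e by (intro fcR_norm_weak[OF h f1c]) (auto simp: f1_def max_def min_def abs_le_iff)
  ultimately show "nm (fcR R h f) \<le> B + e" by simp
qed

lemma fcR_cong:
  assumes h: "adm R h" and f: "continuous_on UNIV f" and g: "continuous_on UNIV g"
    and eq: "\<And>x. \<bar>x\<bar> \<le> nm h \<Longrightarrow> f x = g x"
  shows "fcR R h f = fcR R h g"
proof -
  have "nm (fcR R h (\<lambda>x. f x - g x)) \<le> 0"
    by (rule fcR_norm[OF h]) (auto intro!: continuous_intros f g simp: eq)
  then have "fcR R h f \<ominus> fcR R h g = \<zero>"
    unfolding fcR_diff[OF h f g] using h f g by (intro nm_le_0) auto
  then show ?thesis using h f g by (simp add: diff_eq_zero)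
qed

text \<open>Stated for a closed subspace stable under left multiplication by \<open>h\<close>, so
  that closed subalgebras and closed ideals are both covered. As \<open>f 0 = 0\<close>, a good
  approximant has a small constant term, and what remains is a multiple of \<open>h\<close>.\<close>

lemma fcR_mem:
  assumes h: "adm R h" and f: "continuous_on UNIV f" and f0: "f 0 = 0"
    and S: "cs_closure A S = S" "\<zero> \<in> S" "\<And>x y. x \<in> S \<Longrightarrow> y \<in> S \<Longrightarrow> x \<oplus> y \<in> S" "\<And>c x. x \<in> S \<Longrightarrow> c \<odot> x \<in> S"
      "\<And>x. x \<in> S \<Longrightarrow> h \<otimes> x \<in> S" and hS: "h \<in> S"
  shows "fcR R h f \<in> S"
proof (rule closed_approx[OF S(1)])
  show "fcR R h f \<in> Cr" using h f by simp
  have hc: "h \<in> Cr" using adm_sa[OF h] by simp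
  have Sc: "x \<in> S \<Longrightarrow> x \<in> Cr" for x using S(1) closure_cl by blast
  have hq: "h \<otimes> ev (sc R h) q \<in> S" for q
  proof (induction q)
    case (pCons a q)
    have "h \<otimes> ev (sc R h) (pCons a q) = a \<odot> h \<oplus> complex_of_real (1/R) \<odot> (h \<otimes> (h \<otimes> ev (sc R h) q))"
      using hc by (simp add: sc_def mul_add mul_sm sm_mul)
    then show ?case using pCons S hS by simp
  qed (use hc S in simp)
  fix e :: real assume "e > 0"
  then obtain p where p: "near R f p (e/2)" using ex_near[OF f, of "e/2"] by auto
  obtain a q where aq: "p = pCons a q" by (cases p)
  have "cmod a \<le> e/2" using p f0 unfolding near_def aq by (auto dest!: spec[of _ 0])
  then have an: "nm (a \<odot> \<one>) \<le> e/2"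
    using nm_one_le mult_mono[of "cmod a" "e/2" "nm \<one>" 1] \<open>e > 0\<close> by (simp add: nm_sm)
  define s where "s = sc R h \<otimes> ev (sc R h) q"
  have "s = complex_of_real (1/R) \<odot> (h \<otimes> ev (sc R h) q)"
    unfolding s_def by (subst (1) sc_def) (use hc in \<open>simp add: sm_mul\<close>)
  then have sS: "s \<in> S" using hq S by simp
  have "fcR R h f \<ominus> s = (fcR R h f \<ominus> ev (sc R h) p) \<oplus> a \<odot> \<one>"
    using h f hc unfolding aq s_def by (simp add: alg)
  then have "nm (fcR R h f \<ominus> s) \<le> nm (fcR R h f \<ominus> ev (sc R h) p) + nm (a \<odot> \<one>)"
    using h f hc by (simp add: nm_add)
  also have "\<dots> \<le> e" using near_fcR[OF h f p] an nm_minus_comm[of "fcR R h f" "ev (sc R h) p"] h f hc by simp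
  finally show "\<exists>s\<in>S. nm (fcR R h f \<ominus> s) \<le> e" using sS by blast
qed

end

section \<open>Unitization and automatic isometry\<close>

context cst
begin

definition lact :: "'a \<Rightarrow> complex \<Rightarrow> 'a \<Rightarrow> 'a" where
  "lact a s b = a \<otimes> b \<oplus> s \<odot> b"

text \<open>Operator norm of left multiplication by the formal sum of \<open>a\<close> and
  \<open>s\<close> times a unit. Letting it act on the algebra itself avoids any reference to a
  unit.\<close>

definition opn :: "'a \<Rightarrow> complex \<Rightarrow> real" where
  "opn a s = (SUP b\<in>{b\<in>Cr. nm b \<le> 1}. nm (lact a s b))"

lemma lact_cl [simp]: "\<lbrakk>a \<in> Cr; b \<in> Cr\<rbrakk> \<Longrightarrow> lact a s b \<in> Cr"
  by (simp add: lact_def)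

lemma nm_lact: "\<lbrakk>a \<in> Cr; b \<in> Cr\<rbrakk> \<Longrightarrow> nm (lact a s b) \<le> (nm a + cmod s) * nm b"
  unfolding lact_def using nm_add[of "a \<otimes> b" "s \<odot> b"] nm_mul[of a b]
  by (simp add: nm_sm distrib_right)

lemma opn_bdd: "a \<in> Cr \<Longrightarrow> bdd_above ((\<lambda>b. nm (lact a s b)) ` {b\<in>Cr. nm b \<le> 1})"
proof (rule bdd_aboveI2)
  fix b assume "a \<in> Cr" "b \<in> {b\<in>Cr. nm b \<le> 1}"
  then show "nm (lact a s b) \<le> nm a + cmod s"
    using nm_lact[of a b s] mult_left_mono[of "nm b" 1 "nm a + cmod s"] by simp
qed

lemma opn_le: "(\<And>b. \<lbrakk>b \<in> Cr; nm b \<le> 1\<rbrakk> \<Longrightarrow> nm (lact a s b) \<le> B) \<Longrightarrow> opn a s \<le> B"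
  unfolding opn_def by (rule cSUP_least) (auto intro!: exI[of _ \<zero>])

lemma opn_ge1: "\<lbrakk>a \<in> Cr; b \<in> Cr; nm b \<le> 1\<rbrakk> \<Longrightarrow> nm (lact a s b) \<le> opn a s"
  unfolding opn_def by (rule cSUP_upper[OF _ opn_bdd]) auto

lemma opn_nonneg: "a \<in> Cr \<Longrightarrow> opn a s \<ge> 0"
  using opn_ge1[of a \<zero> s] by (simp add: lact_def)

lemma opn_ge: "\<lbrakk>a \<in> Cr; b \<in> Cr\<rbrakk> \<Longrightarrow> nm (lact a s b) \<le> opn a s * nm b"
proof (cases "b = \<zero>")
  case False
  assume c: "a \<in> Cr" "b \<in> Cr"
  then have nb: "nm b > 0" using False nm_eq_0[of b] nm_ge_0[of b] by linarith
  define b' where "b' = complex_of_real (1 / nm b) \<odot> b"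
  have b': "b' \<in> Cr" "nm b' \<le> 1" using c nb by (simp_all add: b'_def nm_sm norm_divide)
  have "lact a s b' = complex_of_real (1 / nm b) \<odot> lact a s b"
    using c by (simp add: b'_def lact_def alg mult.commute)
  then have "nm (lact a s b) / nm b \<le> opn a s"
    using opn_ge1[OF c(1) b', of s] c nb by (simp add: nm_sm norm_divide)
  then show ?thesis using nb by (simp add: divide_le_eq)
qed (simp add: lact_def)

lemma opn_upper: "a \<in> Cr \<Longrightarrow> opn a s \<le> nm a + cmod s"
  using nm_lact[of a _ s] mult_left_mono[of _ 1 "nm a + cmod s"] by (intro opn_le) fastforce

lemma opn_zero: "a \<in> Cr \<Longrightarrow> opn a 0 = nm a"
proof (rule antisym)
  assume a: "a \<in> Cr"
  then show "opn a 0 \<le> nm a" using opn_upper[of a 0] by simp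
  have "nm a * nm a \<le> opn a 0 * nm a"
    using opn_ge[of a "a\<^sup>\<star>" 0] cstar_id'[of a] a by (simp add: lact_def power2_eq_square)
  then show "nm a \<le> opn a 0" using opn_nonneg[OF a, of 0] a nm_ge_0[OF a]
    by (cases "nm a = 0") auto
qed

text \<open>Bounds the first coordinate by the norm of the pair, so Cauchy sequences of pairs are
  Cauchy in each coordinate.\<close>

lemma nm_le_opn: "a \<in> Cr \<Longrightarrow> nm a \<le> opn a s + cmod s"
proof -
  assume a: "a \<in> Cr"
  have "opn a 0 \<le> opn a s + cmod s"
  proof (rule opn_le)
    fix b assume b: "b \<in> Cr" "nm b \<le> 1"
    have "lact a 0 b = lact a s b \<ominus> s \<odot> b" using a b by (simp add: lact_def alg)
    then have "nm (lact a 0 b) \<le> nm (lact a s b) + cmod s * nm b"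
      using nm_diff[of "lact a s b" "s \<odot> b"] a b by (simp add: nm_sm)
    also have "\<dots> \<le> opn a s + cmod s * 1"
      using opn_ge1[OF a b, of s] b by (intro add_mono mult_left_mono) auto
    finally show "nm (lact a 0 b) \<le> opn a s + cmod s" by simp
  qed
  then show ?thesis using opn_zero[OF a] by simp
qed

lemma opn_add: "\<lbrakk>a \<in> Cr; b \<in> Cr\<rbrakk> \<Longrightarrow> opn (a \<oplus> b) (s + t) \<le> opn a s + opn b t"
proof (rule opn_le)
  fix x assume c: "a \<in> Cr" "b \<in> Cr" "x \<in> Cr" "nm x \<le> 1"
  have "lact (a \<oplus> b) (s + t) x = lact a s x \<oplus> lact b t x"
    using c by (simp add: lact_def alg add_sm)
  then show "nm (lact (a \<oplus> b) (s + t) x) \<le> opn a s + opn b t"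
    using nm_add[of "lact a s x" "lact b t x"] opn_ge1[of a x s] opn_ge1[of b x t] c by simp
qed

lemma opn_sm: "a \<in> Cr \<Longrightarrow> opn (c \<odot> a) (c * s) = cmod c * opn a s"
proof -
  have le: "opn (c \<odot> a) (c * s) \<le> cmod c * opn a s" if "a \<in> Cr" for c a s
  proof (rule opn_le)
    fix x assume x: "x \<in> Cr" "nm x \<le> 1"
    have "lact (c \<odot> a) (c * s) x = c \<odot> lact a s x"
      using that x by (simp add: lact_def alg)
    then show "nm (lact (c \<odot> a) (c * s) x) \<le> cmod c * opn a s"
      using opn_ge1[OF that x, of s] that x by (simp add: nm_sm mult_left_mono)
  qed
  assume a: "a \<in> Cr"
  show ?thesis
  proof (cases "c = 0")
    case True
    then show ?thesis using le[OF a, of 0 s] opn_nonneg[of "0 \<odot> a" 0] a by simp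
  next
    case False
    have "opn (inverse c \<odot> (c \<odot> a)) (inverse c * (c * s)) \<le> cmod (inverse c) * opn (c \<odot> a) (c * s)"
      using a by (intro le) simp
    then have "cmod c * opn a s \<le> opn (c \<odot> a) (c * s)"
      using False a by (simp add: norm_inverse norm_divide divide_simps mult.commute flip: sm_mult)
    then show ?thesis using le[OF a, of c s] by simp
  qed
qed

lemma lact_lact: "\<lbrakk>a \<in> Cr; b \<in> Cr; x \<in> Cr\<rbrakk> \<Longrightarrow> lact a s (lact b t x) = lact (a \<otimes> b \<oplus> s \<odot> b \<oplus> t \<odot> a) (s * t) x"
  by (simp add: lact_def alg mult.commute)

lemma opn_mult: "\<lbrakk>a \<in> Cr; b \<in> Cr\<rbrakk> \<Longrightarrow> opn (a \<otimes> b \<oplus> s \<odot> b \<oplus> t \<odot> a) (s * t) \<le> opn a s * opn b t"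
proof (rule opn_le)
  fix x assume c: "a \<in> Cr" "b \<in> Cr" "x \<in> Cr" "nm x \<le> 1"
  have "nm (lact a s (lact b t x)) \<le> opn a s * nm (lact b t x)"
    using opn_ge c by simp
  also have "\<dots> \<le> opn a s * opn b t"
    using opn_ge1 opn_nonneg c by (intro mult_left_mono) auto
  finally show "nm (lact (a \<otimes> b \<oplus> s \<odot> b \<oplus> t \<odot> a) (s * t) x) \<le> opn a s * opn b t"
    using c by (simp add: lact_lact)
qed

text \<open>Computing the square of \<open>lact a s b\<close> for \<open>b\<close> in the unit ball
  gives one inequality. Combined with submultiplicativity it first forces invariance of
  \<open>opn\<close> under the involution, and this then supplies the reverse inequality.\<close>

lemma opn_cstar: "a \<in> Cr \<Longrightarrow> opn (a\<^sup>\<star> \<otimes> a \<oplus> cnj s \<odot> a \<oplus> s \<odot> a\<^sup>\<star>) (cnj s * s) = (opn a s)\<^sup>2"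
proof -
  have ge: "(opn a s)\<^sup>2 \<le> opn (a\<^sup>\<star> \<otimes> a \<oplus> cnj s \<odot> a \<oplus> s \<odot> a\<^sup>\<star>) (cnj s * s)" if a: "a \<in> Cr" for a s
  proof -
    let ?Q = "opn (a\<^sup>\<star> \<otimes> a \<oplus> cnj s \<odot> a \<oplus> s \<odot> a\<^sup>\<star>) (cnj s * s)"
    have Q0: "?Q \<ge> 0" using a by (intro opn_nonneg) simp
    have "opn a s \<le> sqrt ?Q"
    proof (rule opn_le)
      fix b assume b: "b \<in> Cr" "nm b \<le> 1"
      have "(lact a s b)\<^sup>\<star> \<otimes> lact a s b = b\<^sup>\<star> \<otimes> lact (a\<^sup>\<star> \<otimes> a \<oplus> cnj s \<odot> a \<oplus> s \<odot> a\<^sup>\<star>) (cnj s * s) b"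
        using a b by (simp add: lact_def alg mult.commute)
      moreover have "nm (b\<^sup>\<star> \<otimes> lact (a\<^sup>\<star> \<otimes> a \<oplus> cnj s \<odot> a \<oplus> s \<odot> a\<^sup>\<star>) (cnj s * s) b) \<le> 1 * ?Q"
        using a b by (intro nm_mul_le opn_ge1) auto
      ultimately have "(nm (lact a s b))\<^sup>2 \<le> ?Q"
        using cstar_id[of "lact a s b"] a b by simp
      then show "nm (lact a s b) \<le> sqrt ?Q" by (rule real_le_rsqrt)
    qed
    then show ?thesis using Q0 opn_nonneg[OF a, of s] by (metis power_mono real_sqrt_pow2)
  qed
  have mu: "opn (a\<^sup>\<star> \<otimes> a \<oplus> cnj s \<odot> a \<oplus> s \<odot> a\<^sup>\<star>) (cnj s * s) \<le> opn (a\<^sup>\<star>) (cnj s) * opn a s" if "a \<in> Cr" for a s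
    using opn_mult[of "a\<^sup>\<star>" a "cnj s" s] that by simp
  have st: "opn a s \<le> opn (a\<^sup>\<star>) (cnj s)" if a: "a \<in> Cr" for a s
  proof (cases "opn a s = 0")
    case True
    then show ?thesis using opn_nonneg[of "a\<^sup>\<star>" "cnj s"] a by simp
  next
    case False
    then have "opn a s > 0" using opn_nonneg[OF a, of s] by simp
    moreover have "opn a s * opn a s \<le> opn (a\<^sup>\<star>) (cnj s) * opn a s"
      using ge[OF a, of s] mu[OF a, of s] by (simp add: power2_eq_square)
    ultimately show ?thesis by simp
  qed
  assume a: "a \<in> Cr"
  have "opn (a\<^sup>\<star>) (cnj s) = opn a s" using st[OF a, of s] st[of "a\<^sup>\<star>" "cnj s"] a by simp
  then show ?thesis using ge[OF a, of s] mu[OF a, of s] by (simp add: power2_eq_square)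
qed

lemma opn_nondeg: "a \<in> Cr \<Longrightarrow> opn a 0 = 0 \<longleftrightarrow> a = \<zero>"
  by (simp add: opn_zero nm_eq_0)

end

text \<open>If the algebra already has a unit, the new unit minus the old one acts as zero, and
  \<open>opn\<close> alone would be only a seminorm; the maximum with the modulus of the scalar
  repairs this. A unit is therefore adjoined in every case, and homomorphisms extend by fixing the
  scalar coordinate.\<close>

definition unitz :: "'a cstar \<Rightarrow> ('a \<times> complex) cstar" where
  "unitz A = \<lparr>cs_carrier = cs_carrier A \<times> UNIV, cs_zero = (cs_zero A, 0),
    cs_add = (\<lambda>(a, s) (b, t). (cs_add A a b, s + t)),
    cs_smult = (\<lambda>c (a, s). (cs_smult A c a, c * s)),
    cs_mult = (\<lambda>(a, s) (b, t). (cs_add A (cs_add A (cs_mult A a b) (cs_smult A s b)) (cs_smult A t a), s * t)),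
    cs_star = (\<lambda>(a, s). (cs_star A a, cnj s)),
    cs_norm = (\<lambda>(a, s). max (cst.opn A a s) (cmod s))\<rparr>"

context cst
begin

lemma unitz_sel:
  "cs_carrier (unitz A) = Cr \<times> UNIV" "cs_zero (unitz A) = (\<zero>, 0)"
  "cs_add (unitz A) (a, s) (b, t) = (a \<oplus> b, s + t)"
  "cs_smult (unitz A) c (a, s) = (c \<odot> a, c * s)"
  "cs_mult (unitz A) (a, s) (b, t) = (a \<otimes> b \<oplus> s \<odot> b \<oplus> t \<odot> a, s * t)"
  "cs_star (unitz A) (a, s) = (a\<^sup>\<star>, cnj s)"
  "cs_norm (unitz A) (a, s) = max (opn a s) (cmod s)"
  "cs_diff (unitz A) (a, s) (b, t) = (a \<ominus> b, s - t)"
  by (simp_all add: unitz_def cs_diff_def)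

lemma unitz_complete: "cs_complete (unitz A)"
  unfolding cs_complete_def cs_dist_def
proof (intro allI impI)
  fix z :: "nat \<Rightarrow> 'a \<times> complex"
  assume zc: "\<forall>n. z n \<in> cs_carrier (unitz A)"
    and cau: "\<forall>e>0. \<exists>N. \<forall>m\<ge>N. \<forall>n\<ge>N. cs_norm (unitz A) (cs_diff (unitz A) (z m) (z n)) < e"
  define a s where "a n = fst (z n)" and "s n = snd (z n)" for n
  have z: "z n = (a n, s n)" and ac: "a n \<in> Cr" for n
    using zc by (auto simp: a_def s_def unitz_sel mem_Times_iff)
  have cau': "\<exists>N. \<forall>m\<ge>N. \<forall>n\<ge>N. opn (a m \<ominus> a n) (s m - s n) < e \<and> cmod (s m - s n) < e" if "e > 0" for e
    using cau that by (simp add: z unitz_sel)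
  have "Cauchy s"
  proof (rule metric_CauchyI)
    fix e :: real assume "e > 0"
    then show "\<exists>M. \<forall>m\<ge>M. \<forall>n\<ge>M. dist (s m) (s n) < e"
      using cau'[of e] unfolding dist_norm by blast
  qed
  then obtain t where t: "s \<longlonglongrightarrow> t" using Cauchy_convergent convergent_def by blast
  obtain b where b: "b \<in> Cr" "\<And>e. e > 0 \<Longrightarrow> \<exists>N. \<forall>n\<ge>N. nm (a n \<ominus> b) < e"
  proof (rule completeD[of a])
    fix e :: real assume "e > 0"
    then obtain N where N: "\<forall>m\<ge>N. \<forall>n\<ge>N. opn (a m \<ominus> a n) (s m - s n) < e/2 \<and> cmod (s m - s n) < e/2"
      using cau'[of "e/2"] by auto
    have "nm (a m \<ominus> a n) < e" if "m \<ge> N" "n \<ge> N" for m n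
      using N that nm_le_opn[of "a m \<ominus> a n" "s m - s n"] ac by fastforce
    then show "\<exists>N. \<forall>m\<ge>N. \<forall>n\<ge>N. nm (a m \<ominus> a n) < e" by blast
  qed (use ac in auto)
  have "\<exists>N. \<forall>n\<ge>N. cs_norm (unitz A) (cs_diff (unitz A) (z n) (b, t)) < e" if e: "e > 0" for e
  proof -
    obtain N1 where N1: "\<forall>n\<ge>N1. nm (a n \<ominus> b) < e/2" using b(2)[of "e/2"] e by auto
    obtain N2 where N2: "\<forall>n\<ge>N2. cmod (s n - t) < e/2" using LIMSEQ_D[OF t, of "e/2"] e by auto
    have "cs_norm (unitz A) (cs_diff (unitz A) (z n) (b, t)) < e" if "n \<ge> max N1 N2" for n
      using N1[rule_format, of n] N2[rule_format, of n] that opn_upper[of "a n \<ominus> b" "s n - t"] ac b(1) e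
      by (simp add: z unitz_sel)
    then show ?thesis by blast
  qed
  then show "\<exists>y\<in>cs_carrier (unitz A). \<forall>e>0. \<exists>N. \<forall>n\<ge>N. cs_norm (unitz A) (cs_diff (unitz A) (z n) y) < e"
    using b(1) by (intro bexI[of _ "(b, t)"]) (auto simp: unitz_sel)
qed

lemma unitz_cstar: "cstar_alg (unitz A)"
proof -
  let ?N = "\<lambda>a s. max (opn a s) (cmod s)"
  have n0: "?N a s = 0 \<longleftrightarrow> a = \<zero> \<and> s = 0" "?N a s \<ge> 0" if "a \<in> Cr" for a s
    using opn_nondeg[OF that] opn_nonneg[OF that, of s] by (cases "s = 0"; auto simp: max_def)+
  have nadd: "?N (a \<oplus> b) (s + t) \<le> ?N a s + ?N b t" if "a \<in> Cr" "b \<in> Cr" for a b s t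
    using opn_add[OF that, of s t] norm_triangle_ineq[of s t] by linarith
  have nsm: "?N (c \<odot> a) (c * s) = cmod c * ?N a s" if "a \<in> Cr" for a c s
    using opn_sm[OF that] by (simp add: norm_mult max_mult_distrib_left)
  have nmult: "?N (a \<otimes> b \<oplus> s \<odot> b \<oplus> t \<odot> a) (s * t) \<le> ?N a s * ?N b t" if "a \<in> Cr" "b \<in> Cr" for a b s t
  proof -
    have "opn a s * opn b t \<le> ?N a s * ?N b t" "cmod s * cmod t \<le> ?N a s * ?N b t"
      using opn_nonneg that by (intro mult_mono; simp add: le_max_iff_disj)+
    then show ?thesis using opn_mult[OF that, of s t] by (simp add: norm_mult)
  qed
  have nst: "?N (a\<^sup>\<star> \<otimes> a \<oplus> cnj s \<odot> a \<oplus> s \<odot> a\<^sup>\<star>) (cnj s * s) = (?N a s)\<^sup>2" if "a \<in> Cr" for a s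
  proof -
    have "max (o' * o') (t * t) = (max o' t)\<^sup>2" if "o' \<ge> 0" "t \<ge> 0" for o' t :: real
      using that by (cases "o' \<le> t") (auto simp: max_def power2_eq_square mult_mono intro: antisym)
    then show ?thesis
      using opn_cstar[OF that, of s] opn_nonneg[OF that, of s] by (simp add: norm_mult power2_eq_square)
  qed
  show ?thesis
    unfolding cstar_alg_def Let_def
  proof (intro conjI ballI allI unitz_complete, goal_cases)
    case 1
    then show ?case by (simp add: unitz_sel )
  next
    case (2 x y)
    then show ?case by (cases x; cases y; simp add: unitz_sel )
  next
    case (3 x y)
    then show ?case by (cases x; cases y; simp add: unitz_sel )
  next
    case (4 c x)
    then show ?case by (cases x; simp add: unitz_sel )
  next
    case (5 x)
    then show ?case by (cases x; simp add: unitz_sel )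
  next
    case (6 x y w)
    then show ?case by (cases x; cases y; cases w; simp add: unitz_sel alg)
  next
    case (7 x y)
    then show ?case by (cases x; cases y; simp add: unitz_sel add_comm)
  next
    case (8 x)
    then show ?case by (cases x; simp add: unitz_sel )
  next
    case (9 x)
    then show ?case by (cases x; simp add: unitz_sel add_neg)
  next
    case (10 c x y)
    then show ?case by (cases x; cases y; simp add: unitz_sel sm_add ring_distribs)
  next
    case (11 c d x)
    then show ?case by (cases x; simp add: unitz_sel add_sm ring_distribs)
  next
    case (12 c d x)
    then show ?case by (cases x; simp add: unitz_sel sm_mult mult.assoc)
  next
    case (13 x)
    then show ?case by (cases x; simp add: unitz_sel )
  next
    case (14 x y w)
    then show ?case by (cases x; cases y; cases w; simp add: unitz_sel alg mult_ac)
  next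
    case (15 x y w)
    then show ?case by (cases x; cases y; cases w; simp add: unitz_sel alg add_sm ring_distribs)
  next
    case (16 x y w)
    then show ?case by (cases x; cases y; cases w; simp add: unitz_sel alg add_sm ring_distribs)
  next
    case (17 c x y)
    then show ?case by (cases x; cases y; simp add: unitz_sel alg mult_ac)
  next
    case (18 c x y)
    then show ?case by (cases x; cases y; simp add: unitz_sel alg mult_ac)
  next
    case (19 x)
    then show ?case by (cases x; simp add: unitz_sel )
  next
    case (20 x y)
    then show ?case by (cases x; cases y; simp add: unitz_sel star_add)
  next
    case (21 c x)
    then show ?case by (cases x; simp add: unitz_sel star_sm)
  next
    case (22 x y)
    then show ?case by (cases x; cases y; simp add: unitz_sel alg mult.commute)
  next
    case (23 x)
    then show ?case by (cases x, simp only: unitz_sel mem_Times_iff fst_conv snd_conv n0(2))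
  next
    case (24 x)
    then show ?case by (cases x, simp only: unitz_sel mem_Times_iff fst_conv snd_conv n0(1) prod.inject)
  next
    case (25 x y)
    then show ?case by (cases x, cases y, simp only: unitz_sel mem_Times_iff fst_conv snd_conv nadd)
  next
    case (26 c x)
    then show ?case by (cases x, simp only: unitz_sel mem_Times_iff fst_conv snd_conv nsm)
  next
    case (27 x y)
    then show ?case by (cases x, cases y, simp only: unitz_sel mem_Times_iff fst_conv snd_conv nmult)
  next
    case (28 x)
    then show ?case by (cases x, simp only: unitz_sel mem_Times_iff fst_conv snd_conv nst)
  qed
qed

lemma unitz_ucst: "ucst (unitz A) (\<zero>, 1)"
  by unfold_locales (auto simp: unitz_cstar unitz_sel)

lemma unitz_norm: "a \<in> Cr \<Longrightarrow> cs_norm (unitz A) (a, 0) = nm a"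
  using opn_zero[of a] by (simp add: unitz_sel)

end

section \<open>Automatic contractivity and isometry\<close>

context ucst
begin

text \<open>The element \<open>u\<close>, formed as \<open>a\<close> plus \<open>\<i>\<close> times
  \<open>b\<close>, satisfies \<open>u\<^sup>\<star> \<otimes> u = \<one>\<close>, so its norm is at
  most 1, and \<open>a\<close> is its real part.\<close>

lemma commuting_unit_circle:
  assumes "sa a" "sa b" "a \<otimes> b = b \<otimes> a" "a \<otimes> a \<oplus> b \<otimes> b = \<one>"
  shows "nm a \<le> 1"
proof -
  have c [simp]: "a \<in> Cr" "b \<in> Cr" "a\<^sup>\<star> = a" "b\<^sup>\<star> = b" using assms by auto
  define u where "u = a \<oplus> \<i> \<odot> b"
  have uc: "u \<in> Cr" by (simp add: u_def)
  have us: "u\<^sup>\<star> = a \<ominus> \<i> \<odot> b" by (simp add: u_def star_add star_sm cs_diff_def flip: sm_mult)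
  have w: "(\<i> \<odot> b) \<otimes> (\<i> \<odot> b) = (-1) \<odot> (b \<otimes> b)" "a \<otimes> (\<i> \<odot> b) = (\<i> \<odot> b) \<otimes> a"
    using assms(3) by (simp_all add: sm_mul mul_sm flip: sm_mult)
  have "(a \<ominus> w) \<otimes> (a \<oplus> w) = a \<otimes> a \<ominus> w \<otimes> w" if "w \<in> Cr" "a \<otimes> w = w \<otimes> a" for w
    using that by (simp add: alg)
  from this[OF _ w(2)] have "u\<^sup>\<star> \<otimes> u = a \<otimes> a \<oplus> b \<otimes> b"
    unfolding us unfolding u_def w(1) by (simp add: cs_diff_def flip: sm_mult)
  then have "(nm u)\<^sup>2 \<le> 1" using assms(4) cstar_id[OF uc] nm_one_le by simp
  then have u1: "nm u \<le> 1" using nm_ge_0[OF uc] by (simp add: abs_square_le_1)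
  have "2 \<odot> a = u \<oplus> u\<^sup>\<star>"
    unfolding us unfolding u_def using add_sm[of a 1 1] by (simp add: alg)
  then have "2 * nm a \<le> nm u + nm (u\<^sup>\<star>)" using nm_add[of u "u\<^sup>\<star>"] uc nm_sm[of a 2] by simp
  then show ?thesis using u1 uc by simp
qed

end

locale uhom =
  S: ucst A oneA + T: ucst B oneB
  for A :: "'a cstar" and oneA and B :: "'b cstar" and oneB +
  fixes \<Phi> :: "'a \<Rightarrow> 'b"
  assumes hom: "star_hom A B \<Phi>" and unital: "\<Phi> oneA = oneB"
begin

lemma hom_cl [simp]: "x \<in> cs_carrier A \<Longrightarrow> \<Phi> x \<in> cs_carrier B"
  using hom unfolding star_hom_def by blast

lemma hom_simps:
  "\<lbrakk>x \<in> cs_carrier A; y \<in> cs_carrier A\<rbrakk> \<Longrightarrow> \<Phi> (cs_add A x y) = cs_add B (\<Phi> x) (\<Phi> y)"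
  "\<lbrakk>x \<in> cs_carrier A; y \<in> cs_carrier A\<rbrakk> \<Longrightarrow> \<Phi> (cs_mult A x y) = cs_mult B (\<Phi> x) (\<Phi> y)"
  "x \<in> cs_carrier A \<Longrightarrow> \<Phi> (cs_smult A c x) = cs_smult B c (\<Phi> x)"
  "x \<in> cs_carrier A \<Longrightarrow> \<Phi> (cs_star A x) = cs_star B (\<Phi> x)"
  using hom unfolding star_hom_def by blast+

lemma hom_diff: "\<lbrakk>x \<in> cs_carrier A; y \<in> cs_carrier A\<rbrakk> \<Longrightarrow> \<Phi> (cs_diff A x y) = cs_diff B (\<Phi> x) (\<Phi> y)"
  by (simp add: cs_diff_def hom_simps)

lemma hom_zero: "\<Phi> (cs_zero A) = cs_zero B"
  using hom_simps(3)[of "cs_zero A" 0] by simp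

lemma hom_ev: "h \<in> cs_carrier A \<Longrightarrow> \<Phi> (S.ev h p) = T.ev (\<Phi> h) p"
  by (induction p) (auto simp: hom_simps hom_zero unital)

lemma hom_sa: "S.sa h \<Longrightarrow> T.sa (\<Phi> h)"
  using S.sa_cl[of h] S.sa_star[of h] by (intro T.saI) (auto simp flip: hom_simps)

text \<open>After division by any \<open>M\<close> above the norm, \<open>k\<close> and
  \<open>c\<close>, the square root of \<open>1 - k\<^sup>2\<close>, form a commuting self-adjoint
  pair on the unit circle. That relation is algebraic, hence preserved by \<open>\<Phi>\<close>, and
  it bounds the norm of the image of \<open>k\<close>.\<close>

lemma hom_contr_sa:
  assumes h: "S.sa h"
  shows "cs_norm B (\<Phi> h) \<le> cs_norm A h"
proof (rule dense_ge)
  fix M assume M: "cs_norm A h < M"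
  have hc: "h \<in> cs_carrier A" using h by simp
  have M0: "M > 0" using M S.nm_ge_0[OF hc] by linarith
  define k where "k = cs_smult A (complex_of_real (1/M)) h"
  have ks: "S.sa k" unfolding k_def by (rule S.sa_sm[OF h])
  have kn: "cs_norm A k \<le> 1" unfolding k_def using hc M M0 by (simp add: S.nm_sm norm_divide)
  define f where "f t = sqrt (max 0 (1 - t * t))" for t :: real
  have fc: "continuous_on UNIV f" unfolding f_def by (intro continuous_intros)
  note ad = S.adm_default[OF ks]
  define c where "c = S.fc k f"
  have cs: "S.sa c" unfolding c_def by (rule S.fcR_sa[OF ad fc])
  have cc: "c \<in> cs_carrier A" "k \<in> cs_carrier A" using cs ks by auto
  have comm: "cs_mult A k c = cs_mult A c k"
    unfolding c_def by (rule S.fcR_intertwine[OF ad ad fc]) (use cc in auto)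
  have "S.fc k (\<lambda>x. x * x + f x * f x) = cs_add A (cs_mult A k k) (cs_mult A c c)"
    using S.fcR_add[OF ad, of "\<lambda>x. x * x" "\<lambda>x. f x * f x"] S.fcR_mult[OF ad, of "\<lambda>x. x" "\<lambda>x. x"] S.fcR_mult[OF ad fc fc] fc
    by (simp add: S.fcR_id[OF ad] c_def continuous_intros)
  moreover have "S.fc k (\<lambda>x. x * x + f x * f x) = S.fc k (\<lambda>_. 1)"
  proof (rule S.fcR_cong[OF ad])
    fix x assume "\<bar>x\<bar> \<le> cs_norm A k"
    then have "x * x \<le> 1" using kn abs_square_le_1[of x] by (simp add: power2_eq_square)
    then show "x * x + f x * f x = 1" by (simp add: f_def)
  qed (intro continuous_intros fc)+
  ultimately have "cs_add A (cs_mult A k k) (cs_mult A c c) = oneA"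
    using S.fcR_const[OF ad, of 1] by simp
  then have "cs_add B (cs_mult B (\<Phi> k) (\<Phi> k)) (cs_mult B (\<Phi> c) (\<Phi> c)) = oneB"
    using unital cc by (metis S.mul_cl hom_simps(1,2))
  moreover have "cs_mult B (\<Phi> k) (\<Phi> c) = cs_mult B (\<Phi> c) (\<Phi> k)"
    using comm cc by (metis hom_simps(2))
  ultimately have "cs_norm B (\<Phi> k) \<le> 1"
    using hom_sa[OF ks] hom_sa[OF cs] by (intro T.commuting_unit_circle[of "\<Phi> k" "\<Phi> c"])
  moreover have "cs_norm B (\<Phi> k) = cs_norm B (\<Phi> h) / M"
    unfolding k_def using hc M0 by (simp add: hom_simps T.nm_sm norm_divide)
  ultimately show "cs_norm B (\<Phi> h) \<le> M" using M0 by (simp add: divide_le_eq)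
qed

lemma hom_contr:
  assumes x: "x \<in> cs_carrier A"
  shows "cs_norm B (\<Phi> x) \<le> cs_norm A x"
proof -
  have "(cs_norm B (\<Phi> x))\<^sup>2 = cs_norm B (\<Phi> (cs_mult A (cs_star A x) x))"
    using x by (simp add: hom_simps T.cstar_id)
  also have "\<dots> \<le> (cs_norm A x)\<^sup>2"
    using hom_contr_sa[OF S.sa_square[OF x]] x by (simp add: S.cstar_id)
  finally show ?thesis by (rule power2_le_imp_le) (use x in simp)
qed

lemma hom_adm: "S.adm R h \<Longrightarrow> T.adm R (\<Phi> h)"
  using hom_sa[of h] hom_contr_sa[of h] unfolding S.adm_def T.adm_def by linarith

lemma hom_fcR:
  assumes h: "S.adm R h" and f: "continuous_on UNIV f"
  shows "T.fcR R (\<Phi> h) f = \<Phi> (S.fcR R h f)"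
proof (rule T.fcR_eqI[OF hom_adm[OF h] f])
  have hc: "h \<in> cs_carrier A" using S.adm_sa[OF h] by simp
  fix e :: real assume "e > 0"
  then obtain p where p: "S.near R f p e" using S.ex_near[OF f] by blast
  have "cs_norm B (\<Phi> (cs_diff A (S.ev (S.sc R h) p) (S.fcR R h f))) \<le> e"
    using hom_contr[of "cs_diff A (S.ev (S.sc R h) p) (S.fcR R h f)"] S.near_fcR[OF h f p] hc h f by simp
  then have "cs_norm B (cs_diff B (T.ev (T.sc R (\<Phi> h)) p) (\<Phi> (S.fcR R h f))) \<le> e"
    using hc h f by (simp add: hom_diff hom_ev S.sc_def T.sc_def hom_simps)
  then show "\<exists>p. T.near R f p e \<and> cs_norm B (cs_diff B (T.ev (T.sc R (\<Phi> h)) p) (\<Phi> (S.fcR R h f))) \<le> e"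
    using p unfolding S.near_def T.near_def by blast
qed (use h f in simp)

text \<open>Truncate \<open>h\<close> at height \<open>M\<close>, the norm of its image. The excess
  over the truncation is sent to the same function of the image, which is zero; injectivity makes
  the excess zero, so \<open>h\<close> equals its truncation and has norm at most
  \<open>M\<close>.\<close>

lemma hom_isometric_sa:
  assumes inj: "inj_on \<Phi> (cs_carrier A)" and h: "S.sa h"
  shows "cs_norm B (\<Phi> h) = cs_norm A h"
proof (rule antisym[OF hom_contr_sa[OF h]])
  define M where "M = cs_norm B (\<Phi> h)"
  have hc: "h \<in> cs_carrier A" using h by simp
  define cl where "cl t = max (- M) (min M t)" for t :: real
  have clc: "continuous_on UNIV cl" unfolding cl_def by (intro continuous_intros)
  have gc: "continuous_on UNIV (\<lambda>t. t - cl t)" by (intro continuous_intros clc)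
  note ad = S.adm_default[OF h]
  let ?R = "2 * cs_norm A h + 1"
  have M0: "M \<ge> 0" unfolding M_def using hc by simp
  have "T.fcR ?R (\<Phi> h) (\<lambda>t. t - cl t) = T.fcR ?R (\<Phi> h) (\<lambda>_. 0)"
    by (rule T.fcR_cong[OF hom_adm[OF ad] gc]) (auto simp: cl_def M_def abs_le_iff)
  also have "\<dots> = cs_zero B" using T.fcR_const[OF hom_adm[OF ad], of 0] by simp
  finally have "\<Phi> (S.fc h (\<lambda>t. t - cl t)) = \<Phi> (cs_zero A)"
    using hom_fcR[OF ad gc] hom_zero by simp
  then have "S.fc h (\<lambda>t. t - cl t) = cs_zero A"
    using inj ad gc by (simp add: inj_on_eq_iff)
  then have "cs_diff A h (S.fc h cl) = cs_zero A"
    using S.fcR_diff[OF ad _ clc, of "\<lambda>t. t"] by (simp add: S.fcR_id[OF ad] continuous_intros)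
  then have "h = S.fc h cl" using hc ad clc by (simp add: S.diff_eq_zero)
  moreover have "cs_norm A (S.fc h cl) \<le> M"
    using M0 by (intro S.fcR_norm[OF ad clc]) (auto simp: cl_def)
  ultimately show "cs_norm A h \<le> cs_norm B (\<Phi> h)" by (simp add: M_def)
qed

lemma hom_isometric:
  assumes inj: "inj_on \<Phi> (cs_carrier A)" and x: "x \<in> cs_carrier A"
  shows "cs_norm B (\<Phi> x) = cs_norm A x"
proof -
  have "(cs_norm B (\<Phi> x))\<^sup>2 = cs_norm B (\<Phi> (cs_mult A (cs_star A x) x))"
    using x by (simp add: hom_simps T.cstar_id)
  also have "\<dots> = (cs_norm A x)\<^sup>2"
    using hom_isometric_sa[OF inj S.sa_square[OF x]] x by (simp add: S.cstar_id)
  finally show ?thesis by (rule power2_eq_imp_eq) (use x in simp_all)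
qed

end

text \<open>Without units at hand, the map is extended to the unitizations by keeping the scalar
  coordinate. The extension is unital and, because of that coordinate, again injective.\<close>

lemma star_mono_isometric:
  assumes A: "cstar_alg A" and B: "cstar_alg B" and f: "star_mono A B f" and x: "x \<in> cs_carrier A"
  shows "cs_norm B (f x) = cs_norm A x"
proof -
  interpret A: cst A using A by unfold_locales
  interpret B: cst B using B by unfold_locales
  interpret A': ucst "unitz A" "(cs_zero A, 1)" by (rule A.unitz_ucst)
  interpret B': ucst "unitz B" "(cs_zero B, 1)" by (rule B.unitz_ucst)
  have fh: "star_hom A B f" and inj: "inj_on f (cs_carrier A)" using f unfolding star_mono_def by auto
  have cl: "y \<in> cs_carrier A \<Longrightarrow> f y \<in> cs_carrier B" for y using fh unfolding star_hom_def by blast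
  have f0: "f (cs_zero A) = cs_zero B"
  proof -
    have "f (cs_smult A 0 (cs_zero A)) = cs_smult B 0 (f (cs_zero A))"
      using fh unfolding star_hom_def by (metis A.zero_cl)
    then show ?thesis using cl[OF A.zero_cl] by simp
  qed
  define F where "F = (\<lambda>(a, s::complex). (f a, s))"
  have "star_hom (unitz A) (unitz B) F"
    using fh unfolding star_hom_def F_def by (auto simp: A.unitz_sel B.unitz_sel)
  then interpret uhom "unitz A" "(cs_zero A, 1)" "unitz B" "(cs_zero B, 1)" F
    by unfold_locales (simp_all add: F_def f0)
  have "inj_on F (cs_carrier (unitz A))"
    using inj by (auto simp: inj_on_def F_def A.unitz_sel)
  from hom_isometric[OF this, of "(x, 0)"] show ?thesis
    using x cl[OF x] by (simp add: F_def A.unitz_norm B.unitz_norm) (simp add: A.unitz_sel A.unitz_norm)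
qed

section \<open>Ideals, approximate units and positivity\<close>

context ucst
begin

lemmas fc_cl = fcR_cl[OF adm_default] and fc_add = fcR_add[OF adm_default]
  and fc_mult = fcR_mult[OF adm_default] and fc_diff = fcR_diff[OF adm_default]
  and fc_sa = fcR_sa[OF adm_default] and fc_norm = fcR_norm[OF adm_default]
  and fc_cong = fcR_cong[OF adm_default] and fc_id = fcR_id[OF adm_default]
  and fc_const = fcR_const[OF adm_default] and fc_commute = fcR_intertwine[OF adm_default adm_default]

lemma fc_one: "sa h \<Longrightarrow> fc h (\<lambda>_. 1) = \<one>"
  using fc_const[of h 1] by simp

lemma fc_zero_fun: "sa h \<Longrightarrow> fc h (\<lambda>_. 0) = \<zero>"
  using fc_const[of h 0] by simp

lemma subalg_cl: "cs_subalg A S \<Longrightarrow> x \<in> S \<Longrightarrow> x \<in> Cr"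
  unfolding cs_subalg_def by blast

lemma subalg_closed: "cs_subalg A S \<Longrightarrow> cs_closure A S = S"
  unfolding cs_subalg_def by blast

lemma subalg_ops:
  assumes "cs_subalg A S"
  shows "\<zero> \<in> S" "x \<in> S \<Longrightarrow> y \<in> S \<Longrightarrow> x \<oplus> y \<in> S" "x \<in> S \<Longrightarrow> y \<in> S \<Longrightarrow> x \<otimes> y \<in> S" "x \<in> S \<Longrightarrow> c \<odot> x \<in> S" "x \<in> S \<Longrightarrow> x\<^sup>\<star> \<in> S"
    "x \<in> S \<Longrightarrow> y \<in> S \<Longrightarrow> x \<ominus> y \<in> S"
  using assms unfolding cs_subalg_def cs_diff_def by blast+

lemma subalg_self_ideal: "cs_subalg A S \<Longrightarrow> closed_ideal_in A S S"
  unfolding cs_subalg_def closed_ideal_in_def by blast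

lemma ideal_sub: "closed_ideal_in A B K \<Longrightarrow> x \<in> K \<Longrightarrow> x \<in> B"
  unfolding closed_ideal_in_def by blast

lemma ideal_closed: "closed_ideal_in A B K \<Longrightarrow> cs_closure A K = K"
  unfolding closed_ideal_in_def by blast

lemma ideal_cl: "closed_ideal_in A B K \<Longrightarrow> x \<in> K \<Longrightarrow> x \<in> Cr"
  using ideal_closed closure_cl by blast

lemma ideal_ops:
  assumes "closed_ideal_in A B K"
  shows "\<zero> \<in> K" "x \<in> K \<Longrightarrow> y \<in> K \<Longrightarrow> x \<oplus> y \<in> K" "x \<in> K \<Longrightarrow> b \<in> B \<Longrightarrow> x \<otimes> b \<in> K" "x \<in> K \<Longrightarrow> b \<in> B \<Longrightarrow> b \<otimes> x \<in> K"
    "x \<in> K \<Longrightarrow> c \<odot> x \<in> K" "x \<in> K \<Longrightarrow> y \<in> K \<Longrightarrow> x \<ominus> y \<in> K"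
  using assms unfolding closed_ideal_in_def cs_diff_def by blast+

lemma fc_ideal:
  assumes K: "closed_ideal_in A B K" and h: "h \<in> K" "sa h" and f: "continuous_on UNIV f" "f 0 = 0"
  shows "fc h f \<in> K"
  using ideal_ops[OF K] ideal_closed[OF K] ideal_sub[OF K] h
  by (intro fcR_mem[OF adm_default f]) auto

lemma fc_subalg: "cs_subalg A S \<Longrightarrow> h \<in> S \<Longrightarrow> sa h \<Longrightarrow> continuous_on UNIV f \<Longrightarrow> f 0 = 0 \<Longrightarrow> fc h f \<in> S"
  by (rule fc_ideal[OF subalg_self_ideal])

text \<open>For abelian \<open>B\<close> these are, by Gelfand duality, the nonempty open subsets of
  the spectrum of \<open>B\<close>.\<close>

definition nid :: "'a set \<Rightarrow> 'a set \<Rightarrow> bool" where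
  "nid B K \<longleftrightarrow> closed_ideal_in A B K \<and> K \<noteq> {\<zero>}"

lemma nid_ideal: "nid B K \<Longrightarrow> closed_ideal_in A B K"
  by (simp add: nid_def)

lemma nid_ex: "nid B K \<Longrightarrow> \<exists>k\<in>K. k \<noteq> \<zero>"
  unfolding nid_def closed_ideal_in_def by blast

lemma nidI: "closed_ideal_in A B K \<Longrightarrow> k \<in> K \<Longrightarrow> k \<noteq> \<zero> \<Longrightarrow> nid B K"
  unfolding nid_def by blast

lemma ideal_Int:
  "\<lbrakk>closed_ideal_in A C J; cs_subalg A B; B \<subseteq> C\<rbrakk> \<Longrightarrow> closed_ideal_in A B (J \<inter> B)"
  unfolding closed_ideal_in_def cs_subalg_def by (auto simp: closed_Int)

text \<open>\<open>1 - w\<close> times \<open>y\<^sup>* y\<close> is uniformly small for \<open>w = u(y\<^sup>* y)\<close>, \<open>u t = |t| / max |t| (e\<^sup>2)\<close>.\<close>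
lemma approx_unit:
  assumes y: "y \<in> Cr" and e: "e > 0"
  obtains f where "continuous_on UNIV f" "f 0 = 0" "nm (y \<ominus> y \<otimes> fc (y\<^sup>\<star> \<otimes> y) f) \<le> e"
proof
  define f where "f t = \<bar>t\<bar> / max \<bar>t\<bar> (e\<^sup>2)" for t :: real
  have fc: "continuous_on UNIV f" unfolding f_def using e by (intro continuous_intros) (auto simp: max_def)
  have gc: "continuous_on UNIV (\<lambda>t. 1 - f t)" by (intro continuous_intros fc)
  have tgc: "continuous_on UNIV (\<lambda>t. t * (1 - f t))" by (intro continuous_intros fc)
  show "continuous_on UNIV f" "f 0 = 0" by (rule fc) (simp add: f_def)
  define m where "m = y\<^sup>\<star> \<otimes> y"
  have m: "sa m" unfolding m_def by (rule sa_square[OF y])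
  define w where "w = \<one> \<ominus> fc m f"
  have w: "w = fc m (\<lambda>t. 1 - f t)" unfolding w_def using fc_diff[OF m _ fc, of "\<lambda>_. 1"] fc_one[OF m] by simp
  have wsa: "sa w" unfolding w by (rule fc_sa[OF m gc])
  have mw: "m \<otimes> w = fc m (\<lambda>t. t * (1 - f t))"
    unfolding w using fc_mult[OF m _ gc, of "\<lambda>t. t"] fc_id[OF m] by (simp add: continuous_intros)
  have "w \<otimes> (m \<otimes> w) = fc m (\<lambda>t. (1 - f t) * (t * (1 - f t)))"
    unfolding mw unfolding w by (rule fc_mult[OF m gc tgc, symmetric])
  moreover have "nm (fc m (\<lambda>t. (1 - f t) * (t * (1 - f t)))) \<le> e\<^sup>2"
  proof (rule fc_norm[OF m])
    show "continuous_on UNIV (\<lambda>t. (1 - f t) * (t * (1 - f t)))" by (intro continuous_intros gc tgc)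
    fix t
    show "\<bar>(1 - f t) * (t * (1 - f t))\<bar> \<le> e\<^sup>2"
    proof (cases "\<bar>t\<bar> \<le> e\<^sup>2")
      case True
      have "0 \<le> f t" "f t \<le> 1" using e by (auto simp: f_def divide_le_eq)
      then have "\<bar>1 - f t\<bar> * (\<bar>t\<bar> * \<bar>1 - f t\<bar>) \<le> 1 * (e\<^sup>2 * 1)"
        using True by (intro mult_mono) auto
      then show ?thesis by (simp add: abs_mult)
    next
      case False
      then have "f t = 1" using e by (auto simp: f_def max_def)
      then show ?thesis by simp
    qed
  qed
  moreover have "(y \<otimes> w)\<^sup>\<star> \<otimes> (y \<otimes> w) = w \<otimes> (m \<otimes> w)"
    using y wsa by (simp add: star_mul m_def mul_assoc)
  ultimately have "(nm (y \<otimes> w))\<^sup>2 \<le> e\<^sup>2"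
    using cstar_id[of "y \<otimes> w"] y wsa by simp
  then have "nm (y \<otimes> w) \<le> e" by (rule power2_le_imp_le) (use e in simp)
  moreover have "y \<otimes> w = y \<ominus> y \<otimes> fc m f"
    unfolding w_def using y m fc by (simp add: mul_diff fc_cl)
  ultimately show "nm (y \<ominus> y \<otimes> fc (y\<^sup>\<star> \<otimes> y) f) \<le> e" by (simp add: m_def)
qed

text \<open>Closed ideals are defined without the involution. The approximation of \<open>k\<close>
  by \<open>k\<close> times a self-adjoint \<open>w\<close> in the ideal turns, under the adjoint,
  into an approximation of \<open>k\<^sup>\<star>\<close> by
  \<open>w \<otimes> k\<^sup>\<star>\<close>, which lies in the ideal.\<close>

lemma ideal_star:
  assumes B: "cs_subalg A B" and K: "closed_ideal_in A B K" and k: "k \<in> K"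
  shows "k\<^sup>\<star> \<in> K"
proof (rule closed_approx[OF ideal_closed[OF K]])
  have kc: "k \<in> Cr" "k \<in> B" using ideal_cl[OF K k] ideal_sub[OF K k] by auto
  show "k\<^sup>\<star> \<in> Cr" using kc by simp
  fix e :: real assume "e > 0"
  then obtain f where f: "continuous_on UNIV f" "f 0 = 0" "nm (k \<ominus> k \<otimes> fc (k\<^sup>\<star> \<otimes> k) f) \<le> e"
    using approx_unit[OF kc(1)] by blast
  have ks: "k\<^sup>\<star> \<in> B" using subalg_ops[OF B] kc by blast
  have m: "k\<^sup>\<star> \<otimes> k \<in> K" "sa (k\<^sup>\<star> \<otimes> k)" using ideal_ops[OF K] k ks sa_square kc by auto
  have w: "fc (k\<^sup>\<star> \<otimes> k) f \<in> K" by (rule fc_ideal[OF K m f(1,2)])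
  have "(k \<ominus> k \<otimes> fc (k\<^sup>\<star> \<otimes> k) f)\<^sup>\<star> = k\<^sup>\<star> \<ominus> fc (k\<^sup>\<star> \<otimes> k) f \<otimes> k\<^sup>\<star>"
    using kc m f fc_sa[OF m(2) f(1)] by (simp add: star_diff star_mul)
  then have "nm (k\<^sup>\<star> \<ominus> fc (k\<^sup>\<star> \<otimes> k) f \<otimes> k\<^sup>\<star>) \<le> e"
    using f(3) kc m f fc_cl by (metis diff_cl mul_cl nm_star sa_cl)
  moreover have "fc (k\<^sup>\<star> \<otimes> k) f \<otimes> k\<^sup>\<star> \<in> K" using ideal_ops[OF K] w ks by blast
  ultimately show "\<exists>s\<in>K. nm (k\<^sup>\<star> \<ominus> s) \<le> e" by blast
qed

lemma nid_sa_ex: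
  assumes B: "cs_subalg A B" and K: "nid B K"
  shows "\<exists>h\<in>K. sa h \<and> h \<noteq> \<zero>"
proof -
  obtain k where k: "k \<in> K" "k \<noteq> \<zero>" using nid_ex[OF K] by blast
  have kc: "k \<in> Cr" "k \<in> B" using ideal_cl[OF nid_ideal[OF K]] ideal_sub[OF nid_ideal[OF K]] k by auto
  have "k\<^sup>\<star> \<otimes> k \<in> K" by (rule ideal_ops(4)[OF nid_ideal[OF K] k(1)]) (rule subalg_ops(5)[OF B kc(2)])
  moreover have "k\<^sup>\<star> \<otimes> k \<noteq> \<zero>" using sq_zero[OF kc(1)] k by blast
  ultimately show ?thesis using sa_square[OF kc(1)] by blast
qed

subsection \<open>Local units\<close>

text \<open>Viewing \<open>h\<close> as a function: \<open>bu h\<close> is a cutoff equal to 1 where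
  the modulus of \<open>h\<close> is at least half its norm, \<open>bp h\<close> is a nonzero
  element supported there, and \<open>bg h\<close> is a local inverse with
  \<open>h \<otimes> bg h = bu h \<otimes> bu h\<close>. All three functions vanish at 0, so the
  elements stay in every closed ideal that contains \<open>h\<close>.\<close>

definition bu :: "'a \<Rightarrow> 'a" where "bu h = fc h (\<lambda>t. \<bar>t\<bar> / max \<bar>t\<bar> (nm h / 2))"
definition bp :: "'a \<Rightarrow> 'a" where "bp h = fc h (\<lambda>t. t - max (- (nm h / 2)) (min (nm h / 2) t))"
definition bg :: "'a \<Rightarrow> 'a" where "bg h = fc h (\<lambda>t. t / (max \<bar>t\<bar> (nm h / 2))\<^sup>2)"

context
  fixes h assumes h: "sa h" "h \<noteq> \<zero>"
begin

lemma bump_pos: "nm h > 0"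
  using h nm_eq_0[OF sa_cl[OF h(1)]] nm_ge_0[OF sa_cl[OF h(1)]] by (simp add: less_le)

lemma bump_cont:
  "continuous_on UNIV (\<lambda>t. \<bar>t\<bar> / max \<bar>t\<bar> (nm h / 2))"
  "continuous_on UNIV (\<lambda>t. t - max (- (nm h / 2)) (min (nm h / 2) t))"
  "continuous_on UNIV (\<lambda>t. t / (max \<bar>t\<bar> (nm h / 2))\<^sup>2)"
  using bump_pos by (intro continuous_intros; auto simp: max_def)+

lemma bu_sa: "sa (bu h)" and bp_sa: "sa (bp h)" and bg_sa: "sa (bg h)"
  unfolding bu_def bp_def bg_def using bump_cont h by (auto intro: fc_sa)

lemma bu_ideal: "closed_ideal_in A B K \<Longrightarrow> h \<in> K \<Longrightarrow> bu h \<in> K"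
  and bp_ideal: "closed_ideal_in A B K \<Longrightarrow> h \<in> K \<Longrightarrow> bp h \<in> K"
  and bg_ideal: "closed_ideal_in A B K \<Longrightarrow> h \<in> K \<Longrightarrow> bg h \<in> K"
  unfolding bu_def bp_def bg_def using bump_cont h bump_pos by (auto intro!: fc_ideal)

lemma bu_norm: "nm (bu h) \<le> 1"
  unfolding bu_def using bump_pos by (intro fc_norm[OF h(1) bump_cont(1)]) (auto simp: divide_le_eq)

lemma bg_norm: "nm (bg h) \<le> 2 / nm h"
  unfolding bg_def
proof (intro fc_norm[OF h(1) bump_cont(3)])
  fix x :: real
  let ?m = "max \<bar>x\<bar> (nm h / 2)"
  have m: "?m > 0" using bump_pos by simp
  have "\<bar>x / ?m\<^sup>2\<bar> = \<bar>x\<bar> / ?m * (1 / ?m)" by (simp add: power2_eq_square abs_mult)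
  also have "\<dots> \<le> 1 * (1 / (nm h / 2))"
    using m bump_pos by (intro mult_mono frac_le) (auto simp: divide_le_eq)
  finally show "\<bar>x / ?m\<^sup>2\<bar> \<le> 2 / nm h" by simp
qed

lemma bp_nz: "bp h \<noteq> \<zero>"
proof
  assume "bp h = \<zero>"
  define cl where "cl t = max (- (nm h / 2)) (min (nm h / 2) t)" for t
  have c: "continuous_on UNIV cl" unfolding cl_def by (intro continuous_intros)
  have "h \<ominus> fc h cl = bp h" unfolding bp_def
    using fc_diff[OF h(1) _ c, of "\<lambda>t. t"] fc_id[OF h(1)] by (simp add: cl_def continuous_intros)
  then have "h = fc h cl" using \<open>bp h = \<zero>\<close> h c by (simp add: diff_eq_zero fc_cl)
  moreover have "nm (fc h cl) \<le> nm h / 2"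
    using bump_pos by (intro fc_norm[OF h(1) c]) (auto simp: cl_def)
  ultimately show False using bump_pos by simp
qed

lemma bp_bu: "bp h \<otimes> bu h = bp h" and bu_bp: "bu h \<otimes> bp h = bp h"
proof -
  have eq: "(t - max (- (nm h / 2)) (min (nm h / 2) t)) * (\<bar>t\<bar> / max \<bar>t\<bar> (nm h / 2))
    = t - max (- (nm h / 2)) (min (nm h / 2) t)" for t
    using bump_pos by (cases "\<bar>t\<bar> \<le> nm h / 2") (auto simp: max_def min_def)
  show "bp h \<otimes> bu h = bp h" unfolding bp_def bu_def
    by (subst fc_mult[OF h(1) bump_cont(2,1), symmetric]) (simp only: eq)
  show "bu h \<otimes> bp h = bp h" unfolding bp_def bu_def
    by (subst fc_mult[OF h(1) bump_cont(1,2), symmetric]) (subst (2) mult.commute, simp only: eq)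
qed

lemma bu_sq: "bu h \<otimes> bu h = h \<otimes> bg h"
proof -
  have "h \<otimes> bg h = fc h (\<lambda>t. t * (t / (max \<bar>t\<bar> (nm h / 2))\<^sup>2))"
    unfolding bg_def using fc_mult[OF h(1) _ bump_cont(3), of "\<lambda>t. t"] fc_id[OF h(1)] by (simp add: continuous_intros)
  also have "\<dots> = bu h \<otimes> bu h"
    unfolding bu_def fc_mult[OF h(1) bump_cont(1) bump_cont(1), symmetric] by (simp add: power2_eq_square)
  finally show ?thesis by simp
qed

lemma bu_sq': "bu h \<otimes> bu h = bg h \<otimes> h"
  using fc_commute[OF h(1) h(1) bump_cont(3), of h] bu_sq h(1) by (simp add: bg_def)

end

lemma fix_ideal:
  assumes B: "cs_subalg A B" and K: "closed_ideal_in A B K" and uc: "u \<in> Cr"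
    and comm: "\<And>b. b \<in> B \<Longrightarrow> b \<otimes> u = u \<otimes> b"
  shows "closed_ideal_in A B {k\<in>K. k \<otimes> u = k}"
proof -
  have Kc: "k \<in> K \<Longrightarrow> k \<in> Cr" for k by (rule ideal_cl[OF K])
  have Bc: "b \<in> B \<Longrightarrow> b \<in> Cr" for b using B subalg_cl by blast
  have eq: "{k\<in>K. k \<otimes> u = k} = {k\<in>K. k \<otimes> u \<ominus> k \<in> {\<zero>}}"
    using Kc uc by (auto simp: diff_eq_zero)
  have bl: "blin (\<lambda>k. k \<otimes> u \<ominus> k)" by (intro blin_intros uc)
  have cl: "cs_closure A {k\<in>K. k \<otimes> u = k} = {k\<in>K. k \<otimes> u = k}"
    unfolding eq by (intro closed_blin_pre[OF bl]) (use Kc ideal_closed[OF K] closure_zero in auto)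
  have r: "(k \<otimes> b) \<otimes> u = k \<otimes> b" if "k \<in> K" "k \<otimes> u = k" "b \<in> B" for k b
    using that Kc[of k] Bc[of b] uc comm[of b] by (metis mul_assoc)
  show ?thesis
    unfolding closed_ideal_in_def
    using ideal_ops[OF K] ideal_sub[OF K] Kc Bc uc r cl
    by (auto simp: add_mul sm_mul mul_assoc)
qed

subsection \<open>Positivity\<close>

text \<open>A ball around a multiple of the unit, with radius equal to that multiple, replaces
  nonnegativity of the spectrum. Sums are then immediate from the triangle inequality.\<close>

definition pos :: "'a \<Rightarrow> bool" where
  "pos p \<longleftrightarrow> sa p \<and> (\<exists>c::real. c \<ge> 0 \<and> nm (complex_of_real c \<odot> \<one> \<ominus> p) \<le> c)"

lemma pos_sa: "pos p \<Longrightarrow> sa p"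
  by (simp add: pos_def)

text \<open>The factor \<open>a\<close> lets both signs be treated together. Where
  \<open>a * t > d\<close> the function \<open>l\<close> is at least \<open>c + d\<close>, so
  \<open>k = l * (G * k)\<close> with norms at most \<open>c\<close> and \<open>1 / (c + d)\<close>
  for the first two factors; this forces \<open>k\<close> to vanish at \<open>h\<close>. Finally
  \<open>d\<close> tends to 0.\<close>

lemma one_sided_spectrum:
  assumes h: "sa h" and c: "c \<ge> 0" "nm (complex_of_real c \<odot> \<one> \<oplus> complex_of_real a \<odot> h) \<le> c"
  shows "fc h (\<lambda>t. max (a * t) 0) = \<zero>"
proof -
  have fcn: "continuous_on UNIV (\<lambda>t. max (a * t) (0::real))" by (intro continuous_intros)
  have kz: "fc h (\<lambda>t. max (a * t - d) 0) = \<zero>" if d: "d > 0" for d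
  proof -
    define k where "k t = max (a * t - d) 0" for t
    define G where "G t = 1 / (c + max (a * t) d)" for t
    define l where "l t = c + a * t" for t
    have kc: "continuous_on UNIV k" unfolding k_def by (intro continuous_intros)
    have Gc: "continuous_on UNIV G" unfolding G_def using c d
      by (intro continuous_intros) (auto simp: max_def add_nonneg_eq_0_iff)
    have lc: "continuous_on UNIV l" unfolding l_def by (intro continuous_intros)
    have Gkc: "continuous_on UNIV (\<lambda>t. G t * k t)" by (intro continuous_intros Gc kc)
    have hc: "h \<in> Cr" using h by simp
    have l: "fc h l = complex_of_real c \<odot> \<one> \<oplus> complex_of_real a \<odot> h"
      unfolding l_def using fc_add[OF h, of "\<lambda>_. c" "\<lambda>t. a * t"] fc_mult[OF h, of "\<lambda>_. a" "\<lambda>t. t"] fc_id[OF h] hc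
      by (simp add: fc_const[OF h] continuous_intros sm_mul)
    have "k t = l t * (G t * k t)" for t
      using c d by (auto simp: k_def l_def G_def max_def)
    then have "fc h k = fc h (\<lambda>t. l t * (G t * k t))" by (intro arg_cong[where f = "fc h"] ext)
    also have "\<dots> = fc h l \<otimes> (fc h G \<otimes> fc h k)"
      by (simp add: fc_mult[OF h lc Gkc] fc_mult[OF h Gc kc])
    also have "nm \<dots> \<le> c * (1 / (c + d) * nm (fc h k))"
    proof (intro nm_mul_le)
      show "nm (fc h G) \<le> 1 / (c + d)"
      proof (rule fc_norm[OF h Gc])
        fix x show "\<bar>G x\<bar> \<le> 1 / (c + d)"
          using c d unfolding G_def by (auto simp: abs_divide intro!: frac_le)
      qed
    qed (use l c h lc Gc kc in \<open>auto simp: fc_cl\<close>)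
    finally have "nm (fc h k) \<le> c * (1 / (c + d) * nm (fc h k))" .
    then have "(c + d) * nm (fc h k) \<le> c * nm (fc h k)" using c d by (simp add: field_simps)
    then have "d * nm (fc h k) \<le> 0" by (simp add: algebra_simps)
    then have "nm (fc h k) \<le> 0" using d by (simp add: mult_le_0_iff)
    then have "fc h k = \<zero>" using h kc by (intro nm_le_0) (auto simp: fc_cl)
    then show ?thesis by (simp add: k_def[abs_def])
  qed
  have "nm (fc h (\<lambda>t. max (a * t) 0)) \<le> d" if d: "d > 0" for d
  proof -
    have kc: "continuous_on UNIV (\<lambda>t. max (a * t - d) 0)" by (intro continuous_intros)
    have "fc h (\<lambda>t. max (a * t) 0) = fc h (\<lambda>t. max (a * t) 0 - max (a * t - d) 0)"
      using fc_diff[OF h fcn kc] kz[OF d] h fcn by (simp add: fc_cl)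
    also have "nm \<dots> \<le> d" using d by (intro fc_norm[OF h]) (auto intro!: continuous_intros)
    finally show ?thesis .
  qed
  then show ?thesis using h fcn by (intro nm_small_eq_0) (auto simp: fc_cl)
qed

lemma pos_fc: "pos p \<Longrightarrow> fc p (\<lambda>t. max t 0) = p"
proof -
  assume p: "pos p"
  then obtain c where c: "sa p" "c \<ge> 0" "nm (complex_of_real c \<odot> \<one> \<ominus> p) \<le> c" unfolding pos_def by blast
  have pc: "p \<in> Cr" using c by simp
  have m: "fc p (\<lambda>t. max (- t) 0) = \<zero>"
    using one_sided_spectrum[of p c "-1"] c pc by (simp add: cs_diff_def)
  have "fc p (\<lambda>t. max t 0 - max (- t) 0) = fc p (\<lambda>t. max t 0) \<ominus> fc p (\<lambda>t. max (- t) 0)"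
    by (intro fc_diff[OF c(1)] continuous_intros)
  moreover have "(\<lambda>t::real. max t 0 - max (- t) 0) = (\<lambda>t. t)" by (auto simp: max_def fun_eq_iff)
  ultimately show ?thesis using m c(1) by (simp add: fc_id fc_cl continuous_intros)
qed

text \<open>The constant in \<open>pos\<close> may be any bound for the norm. A constant that is
  uniform along an approximating family is what \<open>pos_closed\<close> relies on.\<close>

lemma pos_norm: "pos p \<Longrightarrow> nm p \<le> c \<Longrightarrow> nm (complex_of_real c \<odot> \<one> \<ominus> p) \<le> c"
proof -
  assume p: "pos p" and n: "nm p \<le> c"
  have "complex_of_real c \<odot> \<one> \<ominus> p = fc p (\<lambda>t. c - max t 0)"
    using fc_diff[OF pos_sa[OF p], of "\<lambda>_. c" "\<lambda>t. max t 0"] pos_fc[OF p] fc_const[OF pos_sa[OF p]]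
    by (simp add: continuous_intros)
  also have "nm \<dots> \<le> c"
    using n nm_ge_0[OF sa_cl[OF pos_sa[OF p]]]
    by (intro fc_norm[OF pos_sa[OF p]]) (auto intro!: continuous_intros)
  finally show ?thesis .
qed

lemma posI_fc: "sa p \<Longrightarrow> fc p (\<lambda>t. max t 0) = p \<Longrightarrow> pos p"
proof -
  assume p: "sa p" "fc p (\<lambda>t. max t 0) = p"
  have "complex_of_real (nm p) \<odot> \<one> \<ominus> p = fc p (\<lambda>t. nm p - max t 0)"
    using fc_diff[OF p(1), of "\<lambda>_. nm p" "\<lambda>t. max t 0"] p(2) fc_const[OF p(1)]
    by (simp add: continuous_intros)
  also have "nm \<dots> \<le> nm p"
    using p nm_ge_0[of p] by (intro fc_norm[OF p(1)]) (auto intro!: continuous_intros)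
  finally show ?thesis using p(1) unfolding pos_def by (auto intro!: exI[of _ "nm p"])
qed

lemma pos_add: "pos p \<Longrightarrow> pos q \<Longrightarrow> pos (p \<oplus> q)"
proof -
  assume "pos p" "pos q"
  then obtain c d where cd: "sa p" "c \<ge> 0" "nm (complex_of_real c \<odot> \<one> \<ominus> p) \<le> c"
    "sa q" "d \<ge> 0" "nm (complex_of_real d \<odot> \<one> \<ominus> q) \<le> d" unfolding pos_def by blast
  have "complex_of_real (c + d) \<odot> \<one> \<ominus> (p \<oplus> q) = (complex_of_real c \<odot> \<one> \<ominus> p) \<oplus> (complex_of_real d \<odot> \<one> \<ominus> q)"
    using cd by (simp add: alg add_sm)
  then have "nm (complex_of_real (c + d) \<odot> \<one> \<ominus> (p \<oplus> q)) \<le> c + d"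
    using nm_add[of "complex_of_real c \<odot> \<one> \<ominus> p" "complex_of_real d \<odot> \<one> \<ominus> q"] cd by simp
  moreover have "sa (p \<oplus> q)" using cd by (intro saI) (auto simp: star_add)
  ultimately show ?thesis using cd unfolding pos_def by (intro conjI exI[of _ "c + d"]) auto
qed

lemma pos_sm: "pos p \<Longrightarrow> a \<ge> 0 \<Longrightarrow> pos (complex_of_real a \<odot> p)"
proof -
  assume p: "pos p" and a: "a \<ge> 0"
  then obtain c where c: "sa p" "c \<ge> 0" "nm (complex_of_real c \<odot> \<one> \<ominus> p) \<le> c" unfolding pos_def by blast
  have "complex_of_real (a * c) \<odot> \<one> \<ominus> complex_of_real a \<odot> p = complex_of_real a \<odot> (complex_of_real c \<odot> \<one> \<ominus> p)"
    using c by (simp add: sm_diff sm_mult)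
  then have "nm (complex_of_real (a * c) \<odot> \<one> \<ominus> complex_of_real a \<odot> p) \<le> a * c"
    using c a by (simp add: nm_sm mult_left_mono)
  then show ?thesis using sa_sm[OF c(1)] a c unfolding pos_def by (intro conjI exI[of _ "a * c"]) auto
qed

lemma pos_sq: "sa r \<Longrightarrow> pos (r \<otimes> r)"
proof -
  assume r: "sa r"
  have "complex_of_real ((nm r)\<^sup>2) \<odot> \<one> \<ominus> r \<otimes> r = fc r (\<lambda>t. (nm r)\<^sup>2 - t * t)"
    using fc_diff[OF r, of "\<lambda>_. (nm r)\<^sup>2" "\<lambda>t. t * t"] fc_mult[OF r, of "\<lambda>t. t" "\<lambda>t. t"] fc_id[OF r] fc_const[OF r]
    by (simp add: continuous_intros)
  also have "nm \<dots> \<le> (nm r)\<^sup>2"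
  proof (intro fc_norm[OF r] continuous_intros)
    fix x assume "\<bar>x\<bar> \<le> nm r"
    then have "\<bar>x\<bar>\<^sup>2 \<le> (nm r)\<^sup>2" by (intro power_mono) auto
    then show "\<bar>(nm r)\<^sup>2 - x * x\<bar> \<le> (nm r)\<^sup>2" by (simp add: power2_eq_square abs_le_iff)
  qed
  finally show ?thesis using sa_square[of r] r unfolding pos_def by (auto intro!: exI[of _ "(nm r)\<^sup>2"])
qed

lemma pos_root:
  assumes p: "pos p" and S: "cs_subalg A S" "p \<in> S"
  shows "\<exists>r\<in>S. sa r \<and> p = r \<otimes> r"
proof -
  define f where "f t = sqrt (max t 0)" for t :: real
  have f: "continuous_on UNIV f" unfolding f_def by (intro continuous_intros)
  have "fc p f \<otimes> fc p f = fc p (\<lambda>t. f t * f t)" by (rule fc_mult[OF pos_sa[OF p] f f, symmetric])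
  also have "(\<lambda>t. f t * f t) = (\<lambda>t. max t 0)" by (auto simp: f_def)
  finally have "p = fc p f \<otimes> fc p f" using pos_fc[OF p] by simp
  moreover have "fc p f \<in> S" by (rule fc_subalg[OF S pos_sa[OF p] f]) (simp add: f_def)
  ultimately show ?thesis using fc_sa[OF pos_sa[OF p] f] by blast
qed

lemma pos_closed:
  assumes p: "sa p" and *: "\<And>e. e > 0 \<Longrightarrow> \<exists>q. pos q \<and> nm (p \<ominus> q) \<le> e"
  shows "pos p"
proof -
  have pc: "p \<in> Cr" using p by simp
  define c where "c = nm p + 1"
  have "nm (complex_of_real c \<odot> \<one> \<ominus> p) \<le> c"
  proof (rule field_le_epsilon)
    fix e :: real assume "e > 0"
    then obtain q where q: "pos q" "nm (p \<ominus> q) \<le> min e 1" using *[of "min e 1"] by auto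
    have qc: "q \<in> Cr" using pos_sa[OF q(1)] by simp
    have "nm q \<le> c" using nm_le_diff[OF qc pc] nm_minus_comm[OF qc pc] q(2) by (simp add: c_def)
    then have "nm (complex_of_real c \<odot> \<one> \<ominus> q) \<le> c" by (rule pos_norm[OF q(1)])
    then show "nm (complex_of_real c \<odot> \<one> \<ominus> p) \<le> c + e"
      using nm_triangle[of "complex_of_real c \<odot> \<one>" q p] nm_minus_comm[OF qc pc] q(2) qc pc by simp
  qed
  then show ?thesis using p pc unfolding pos_def c_def by (intro conjI exI[of _ "nm p + 1"]) auto
qed

text \<open>Kelley--Vaught: with \<open>n\<close> the negative part of \<open>w\<^sup>* w\<close> and \<open>z = w \<surd>n\<close>, one has
  \<open>z\<^sup>* z = - n\<^sup>2\<close> while \<open>z z\<^sup>* = 2 (Re z)\<^sup>2 + 2 (Im z)\<^sup>2 + n\<^sup>2\<close>, and these intertwine.\<close>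
theorem pos_star_mult:
  assumes w: "w \<in> Cr"
  shows "pos (w\<^sup>\<star> \<otimes> w)"
proof -
  define p where "p = w\<^sup>\<star> \<otimes> w"
  have p: "sa p" unfolding p_def by (rule sa_square[OF w])
  define nf where "nf t = max (- t) 0" for t :: real
  define sf where "sf t = sqrt (nf t)" for t
  have nfc: "continuous_on UNIV nf" and sfc: "continuous_on UNIV sf"
    unfolding sf_def nf_def by (intro continuous_intros)+
  define n where "n = fc p nf"
  define s where "s = fc p sf"
  have n: "sa n" and s: "sa s" unfolding n_def s_def using fc_sa[OF p] nfc sfc by auto
  define z where "z = w \<otimes> s"
  have zc: "z \<in> Cr" and cl: "n \<in> Cr" "s \<in> Cr" "p \<in> Cr" unfolding z_def using w n s p by auto
  define h where "h = z\<^sup>\<star> \<otimes> z"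
  define h' where "h' = z \<otimes> z\<^sup>\<star>"
  have h: "sa h" "sa h'" unfolding h_def h'_def using sa_square[OF zc] sa_square[of "z\<^sup>\<star>"] zc by auto
  have hcl: "h \<in> Cr" "h' \<in> Cr" using h by auto
  have "p \<otimes> s = fc p (\<lambda>t. t * sf t)"
    unfolding s_def using fc_mult[OF p _ sfc, of "\<lambda>t. t"] fc_id[OF p] by (simp add: continuous_intros)
  then have sps: "s \<otimes> (p \<otimes> s) = fc p (\<lambda>t. sf t * (t * sf t))"
    unfolding s_def using fc_mult[OF p sfc, of "\<lambda>t. t * sf t"] by (simp add: continuous_intros sfc)
  have "fc p (\<lambda>t. 0 - nf t * nf t) = \<zero> \<ominus> n \<otimes> n"
    unfolding n_def using fc_diff[OF p, of "\<lambda>_. 0" "\<lambda>t. nf t * nf t"] fc_mult[OF p nfc nfc] fc_zero_fun[OF p]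
    by (simp add: continuous_intros nfc)
  moreover have "(\<lambda>t. sf t * (t * sf t)) = (\<lambda>t. 0 - nf t * nf t)"
  proof
    fix t
    have "sf t * sf t = nf t" by (simp add: sf_def nf_def)
    then have "sf t * (t * sf t) = t * nf t" by (simp add: mult.left_commute)
    also have "\<dots> = 0 - nf t * nf t" by (cases "t \<le> 0") (auto simp: nf_def)
    finally show "sf t * (t * sf t) = 0 - nf t * nf t" .
  qed
  moreover have "h = s \<otimes> (p \<otimes> s)" unfolding h_def z_def p_def using w s cl by (simp add: star_mul mul_assoc)
  ultimately have hn: "h = \<zero> \<ominus> n \<otimes> n" using sps by simp
  then have hn': "h \<oplus> n \<otimes> n = \<zero>" using cl hcl by (simp add: diff_eq_iff eq_diff_iff)
  define a b where "a = z \<oplus> z\<^sup>\<star>" and "b = \<i> \<odot> (z \<ominus> z\<^sup>\<star>)"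
  have ab: "sa a" "sa b"
    unfolding a_def b_def using zc
    by (auto intro!: saI simp: star_add star_sm star_diff sm_diff add_comm)
       (simp add: cs_diff_def sm_add add_comm flip: sm_mult)
  have sq: "\<i> \<odot> x \<otimes> (\<i> \<odot> x) = (-1) \<odot> (x \<otimes> x)" if "x \<in> Cr" for x
    using that by (simp add: sm_mul mul_sm flip: sm_mult)
  have zz: "(z \<oplus> z\<^sup>\<star>) \<otimes> (z \<oplus> z\<^sup>\<star>) \<ominus> (z \<ominus> z\<^sup>\<star>) \<otimes> (z \<ominus> z\<^sup>\<star>) = (h' \<oplus> h) \<oplus> (h' \<oplus> h)"
    unfolding h_def h'_def using zc by (simp add: alg)
  have "a \<otimes> a \<oplus> b \<otimes> b = (h' \<oplus> h) \<oplus> (h' \<oplus> h)"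
    unfolding zz[symmetric] unfolding a_def b_def using sq[of "z \<ominus> z\<^sup>\<star>"] zc by (simp add: cs_diff_def)
  moreover have half: "complex_of_real (1/2) \<odot> (x \<oplus> x) = x" if "x \<in> Cr" for x
  proof -
    have "complex_of_real (1/2) \<odot> (x \<oplus> x) = (complex_of_real (1/2) + complex_of_real (1/2)) \<odot> x"
      by (simp only: sm_add[OF that that] add_sm[OF that])
    also have "\<dots> = x" using that by simp
    finally show ?thesis .
  qed
  ultimately have "h' \<oplus> h = complex_of_real (1/2) \<odot> (a \<otimes> a \<oplus> b \<otimes> b)"
    using half[of "h' \<oplus> h"] hcl by simp
  moreover have "h' = (h' \<oplus> h) \<oplus> n \<otimes> n"
    using hn' hcl cl by (simp add: add_assoc)
  ultimately have "h' = complex_of_real (1/2) \<odot> (a \<otimes> a \<oplus> b \<otimes> b) \<oplus> n \<otimes> n" by simp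
  moreover have "pos (complex_of_real (1/2) \<odot> (a \<otimes> a \<oplus> b \<otimes> b) \<oplus> n \<otimes> n)"
    by (intro pos_add pos_sm pos_sq ab n) simp
  ultimately have ph': "pos h'" by simp
  obtain c where c: "c \<ge> 0" "nm (complex_of_real c \<odot> \<one> \<ominus> n \<otimes> n) \<le> c"
    using pos_sq[OF n] unfolding pos_def by blast
  have "complex_of_real c \<odot> \<one> \<ominus> n \<otimes> n = complex_of_real c \<odot> \<one> \<oplus> complex_of_real 1 \<odot> h"
    unfolding hn using cl by (simp add: alg)
  then have h0: "fc h (\<lambda>t. max t 0) = \<zero>"
    using one_sided_spectrum[OF h(1) c(1), of 1] c by simp
  \<comment> \<open>Equal norms give \<open>h\<close> and \<open>h'\<close> the same default scale,
    so that the intertwining can be stated between their functional calculi.\<close>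
  have nmh: "nm h = nm h'" unfolding h_def h'_def using cstar_id[OF zc] cstar_id'[OF zc] by simp
  have "z \<otimes> fc h (\<lambda>t. max t 0) = fcR (2 * nm h + 1) h' (\<lambda>t. max t 0) \<otimes> z"
  proof (rule fcR_intertwine[OF adm_default[OF h(1)]])
    show "adm (2 * nm h + 1) h'" using adm_default[OF h(2)] by (simp add: nmh)
    show "z \<otimes> h = h' \<otimes> z" unfolding h_def h'_def using zc by (simp add: mul_assoc)
  qed (intro continuous_intros zc)+
  then have "h' \<otimes> z = \<zero>" using h0 pos_fc[OF ph'] zc by (simp add: nmh)
  then have "h' \<otimes> h' = \<zero>" unfolding h'_def using zc by (simp flip: mul_assoc)
  then have "h' = \<zero>" using sq_zero[OF hcl(2)] h(2) by simp
  then have "nm h = 0" using nmh by simp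
  then have "n \<otimes> n = \<zero>" using hn' hcl cl by (simp add: nm_eq_0)
  then have n0: "n = \<zero>" using sq_zero[OF cl(1)] n by simp
  have "fc p (\<lambda>t. max t 0 - nf t) = fc p (\<lambda>t. max t 0) \<ominus> n"
    unfolding n_def by (intro fc_diff[OF p] continuous_intros nfc)
  moreover have "(\<lambda>t::real. max t 0 - nf t) = (\<lambda>t. t)" by (auto simp: nf_def max_def fun_eq_iff)
  ultimately have "fc p (\<lambda>t. max t 0) = p" using n0 p by (simp add: fc_id fc_cl continuous_intros)
  then show ?thesis using posI_fc[OF p] by (simp add: p_def)
qed

end

section \<open>Local behaviour on ideals of an abelian subalgebra\<close>

context ucst
begin

text \<open>Ideals with property \<open>P\<close> are found below every nonzero closed ideal. For
  abelian \<open>B\<close> and properties inherited by smaller ideals, the corresponding open sets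
  have dense union in the spectrum.\<close>

definition locally :: "'a set \<Rightarrow> ('a set \<Rightarrow> bool) \<Rightarrow> bool" where
  "locally B P \<longleftrightarrow> (\<forall>K. nid B K \<longrightarrow> (\<exists>K'. nid B K' \<and> K' \<subseteq> K \<and> P K'))"

lemma locallyE: "locally B P \<Longrightarrow> nid B K \<Longrightarrow> (\<And>K'. nid B K' \<Longrightarrow> K' \<subseteq> K \<Longrightarrow> P K' \<Longrightarrow> thesis) \<Longrightarrow> thesis"
  unfolding locally_def by blast

text \<open>Refine twice; only the first property has to survive the second refinement.\<close>

lemma locally_conj:
  "\<lbrakk>locally B P; locally B Q; \<And>K K'. P K \<Longrightarrow> K' \<subseteq> K \<Longrightarrow> P K'\<rbrakk> \<Longrightarrow> locally B (\<lambda>K. P K \<and> Q K)"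
  unfolding locally_def by (meson order_trans)

lemma locally_mono: "\<lbrakk>locally B P; \<And>K. nid B K \<Longrightarrow> P K \<Longrightarrow> Q K\<rbrakk> \<Longrightarrow> locally B Q"
  unfolding locally_def by meson

lemma abelianD: "cs_abelian A B \<Longrightarrow> x \<in> B \<Longrightarrow> y \<in> B \<Longrightarrow> x \<otimes> y = y \<otimes> x"
  unfolding cs_abelian_def by blast

text \<open>Shrinking an ideal until one of its own elements acts as a unit is the standard move
  below, and a substitute for evaluating near a point.\<close>

lemma bump_ideal:
  assumes B: "cs_subalg A B" "cs_abelian A B" and K: "closed_ideal_in A B K" and h: "h \<in> K" "sa h" "h \<noteq> \<zero>"
  shows "nid B {k\<in>K. k \<otimes> bu h = k}"
proof -
  note hh = h(2,3)
  have "bu h \<in> B" using bu_ideal[OF hh K h(1)] ideal_sub[OF K] by blast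
  then have "closed_ideal_in A B {k\<in>K. k \<otimes> bu h = k}"
    using abelianD[OF B(2)] subalg_cl[OF B(1)] by (intro fix_ideal[OF B(1) K]) auto
  then show ?thesis using bp_ideal[OF hh K h(1)] bp_bu[OF hh] bp_nz[OF hh] by (intro nidI[of _ _ "bp h"]) auto
qed

text \<open>On the ideal where \<open>bu m\<close> acts as a unit,
  \<open>m = b\<^sup>\<star> \<otimes> b\<close> has the local inverse \<open>bg m\<close> of norm
  at most 2 divided by the norm of \<open>m\<close>. A bounded local inverse prevents
  \<open>b\<close> from being small on any nonzero ideal below.\<close>

lemma locally_small_zero:
  assumes B: "cs_subalg A B" "cs_abelian A B" and b: "b \<in> B"
    and loc: "\<And>e. e > 0 \<Longrightarrow> locally B (\<lambda>K. \<forall>k\<in>K. nm (b \<otimes> k) \<le> e * nm k)"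
  shows "b = \<zero>"
proof (rule ccontr)
  assume b0: "b \<noteq> \<zero>"
  note Bc = subalg_cl[OF B(1)]
  define m where "m = b\<^sup>\<star> \<otimes> b"
  have bs: "b\<^sup>\<star> \<in> B" by (rule subalg_ops(5)[OF B(1) b])
  have mB: "m \<in> B" unfolding m_def by (rule subalg_ops(3)[OF B(1) bs b])
  have m: "sa m" "m \<noteq> \<zero>" using sa_square[OF Bc[OF b]] sq_zero[OF Bc[OF b]] b0 by (auto simp: m_def)
  note bB = subalg_self_ideal[OF B(1)]
  have K: "nid B {k\<in>B. k \<otimes> bu m = k}" by (rule bump_ideal[OF B bB mB m])
  \<comment> \<open>Chosen so that \<open>nm b * e * (2 / nm m)\<close> is at most 1/2, which makes
    the resulting inequality for \<open>nm k\<close> contradictory.\<close>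
  define e where "e = nm m / (4 * (nm b + 1))"
  have mp: "nm m > 0" by (rule bump_pos[OF m])
  have bp: "nm b \<ge> 0" using Bc[OF b] by simp
  have "e > 0" using mp bp by (simp add: e_def)
  from locallyE[OF loc[OF this] K] obtain K' where K': "nid B K'" "K' \<subseteq> {k\<in>B. k \<otimes> bu m = k}"
    "\<forall>k\<in>K'. nm (b \<otimes> k) \<le> e * nm k" by blast
  obtain k where k: "k \<in> K'" "k \<noteq> \<zero>" using nid_ex[OF K'(1)] by blast
  have kB: "k \<in> B" "k \<otimes> bu m = k" using k K' by auto
  have kc: "k \<in> Cr" by (rule Bc[OF kB(1)])
  have uc: "bu m \<in> Cr" "bg m \<in> Cr" using bu_sa[OF m] bg_sa[OF m] by auto
  have "k = k \<otimes> (bu m \<otimes> bu m)" using kB kc uc by (simp flip: mul_assoc)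
  also have "\<dots> = (k \<otimes> m) \<otimes> bg m" using bu_sq[OF m] kc uc m by (simp add: mul_assoc)
  also have "k \<otimes> m = b\<^sup>\<star> \<otimes> (b \<otimes> k)"
    using abelianD[OF B(2) kB(1) mB] Bc[OF b] Bc[OF bs] kc by (simp add: m_def mul_assoc)
  finally have "nm k \<le> nm b * (e * nm k) * (2 / nm m)"
    using bg_norm[OF m] K'(3) k(1) Bc[OF b] Bc[OF bs] kc uc
    by (metis nm_mul_le mul_cl nm_star order_refl)
  also have "\<dots> = (2 * nm b / (4 * (nm b + 1))) * nm k"
    using mp by (simp add: e_def)
  also have "\<dots> \<le> (1/2) * nm k"
    using bp kc by (intro mult_right_mono) (auto simp: divide_le_eq)
  finally have "nm k \<le> 0" by simp
  then show False using nm_le_0[OF kc] k by blast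
qed

text \<open>For \<open>f 0 \<noteq> 0\<close> the element \<open>fc a f\<close> may lie outside
  \<open>E\<close>. It differs from an element of \<open>E\<close> by a multiple of the unit, and
  hence still multiplies \<open>E\<close> into itself.\<close>

lemma fc_mult_subalg:
  assumes E: "cs_subalg A E" and a: "a \<in> E" "sa a" and f: "continuous_on UNIV f" and b: "b \<in> E"
  shows "fc a f \<otimes> b \<in> E" "b \<otimes> fc a f \<in> E"
proof -
  have c: "continuous_on UNIV (\<lambda>t. f t - f 0)" by (intro continuous_intros f)
  have g: "fc a (\<lambda>t. f t - f 0) \<in> E" by (rule fc_subalg[OF E a c]) simp
  have "fc a (\<lambda>t. f t - f 0) = fc a f \<ominus> complex_of_real (f 0) \<odot> \<one>"
    using fc_diff[OF a(2) f, of "\<lambda>_. f 0"] fc_const[OF a(2), of "f 0"] by simp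
  then have fe: "fc a f = fc a (\<lambda>t. f t - f 0) \<oplus> complex_of_real (f 0) \<odot> \<one>"
    using a f by (simp add: diff_add eq_diff_iff fc_cl)
  note cl = subalg_cl[OF E g] subalg_cl[OF E b]
  have "fc a f \<otimes> b = fc a (\<lambda>t. f t - f 0) \<otimes> b \<oplus> complex_of_real (f 0) \<odot> b"
    "b \<otimes> fc a f = b \<otimes> fc a (\<lambda>t. f t - f 0) \<oplus> complex_of_real (f 0) \<odot> b"
    unfolding fe using cl by (simp_all add: add_mul mul_add sm_mul mul_sm)
  then show "fc a f \<otimes> b \<in> E" "b \<otimes> fc a f \<in> E" using subalg_ops[OF E] g b by auto
qed

text \<open>A plateau of height 1 up to distance \<open>(n - 1) * e\<close> from \<open>c\<close>,
  falling to 0 at distance \<open>n * e\<close>. The tent with \<open>n + 1\<close> is therefore 1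
  wherever the tent with \<open>n\<close> is nonzero; the nested tents with
  \<open>n = 1, 2, 3\<close> are used.\<close>

definition tent :: "real \<Rightarrow> real \<Rightarrow> real \<Rightarrow> real \<Rightarrow> real" where
  "tent n c e t = max 0 (min 1 (n - \<bar>t - c\<bar> / e))"

lemma tent_cont [continuous_intros]: "continuous_on UNIV (tent n c e)"
  unfolding tent_def by (auto intro!: continuous_intros simp: divide_inverse)

text \<open>Finitely many tents cover the interval relevant for \<open>a\<close>, and their sum is
  bounded below there, hence invertible in the functional calculus. If each tent annihilated
  \<open>k\<close>, so would the sum, and \<open>k\<close> would be zero.\<close>

lemma exists_tent:
  assumes a: "sa a" and k: "k \<in> Cr" "k \<noteq> \<zero>" and e: "e > 0"
  shows "\<exists>c. fc a (tent 1 c e) \<otimes> k \<noteq> \<zero>"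
proof (rule ccontr)
  assume "\<nexists>c. fc a (tent 1 c e) \<otimes> k \<noteq> \<zero>"
  then have z: "fc a (tent 1 c e) \<otimes> k = \<zero>" for c by blast
  define M where "M = nm a"
  have M0: "M \<ge> 0" using a by (simp add: M_def)
  obtain T where T: "finite T" "{-M..M} \<subseteq> (\<Union>c\<in>T. ball c e)"
  proof (rule compactE_image[of "{-M..M}" "{-M..M}" "\<lambda>c. ball c e"])
    show "{-M..M} \<subseteq> (\<Union>c\<in>{-M..M}. ball c e)" using e by auto
  qed auto
  define f where "f t = (\<Sum>c\<in>T. tent 1 c e t)" for t
  have fcn: "continuous_on UNIV f" unfolding f_def by (intro continuous_intros)
  have fz: "fc a (\<lambda>t. \<Sum>c\<in>T'. tent 1 c e t) \<otimes> k = \<zero>" if "finite T'" for T'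
    using that
  proof (induction T' rule: finite_induct)
    case empty
    then show ?case using fc_zero_fun[OF a] k by simp
  next
    case (insert c T')
    have "continuous_on UNIV (\<lambda>t. \<Sum>c\<in>T'. tent 1 c e t)" by (intro continuous_intros)
    then have "fc a (\<lambda>t. tent 1 c e t + (\<Sum>c\<in>T'. tent 1 c e t)) = fc a (tent 1 c e) \<oplus> fc a (\<lambda>t. \<Sum>c\<in>T'. tent 1 c e t)"
      using fc_add[OF a tent_cont] by blast
    then show ?case using insert z k a by (simp add: add_mul fc_cl continuous_intros)
  qed
  obtain x where x: "x \<in> {-M..M}" "\<And>y. y \<in> {-M..M} \<Longrightarrow> f x \<le> f y"
  proof -
    have "continuous_on {-M..M} f" by (rule continuous_on_subset[OF fcn]) simp
    then have "\<exists>x\<in>{-M..M}. \<forall>y\<in>{-M..M}. f x \<le> f y"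
      by (intro continuous_attains_inf) (use M0 in auto)
    then show ?thesis using that by blast
  qed
  have t0: "tent 1 c e t \<ge> 0" for c t by (simp add: tent_def)
  obtain c where c: "c \<in> T" "x \<in> ball c e" using T x(1) by blast
  have "tent 1 c e x > 0" using c(2) e by (simp add: tent_def dist_real_def divide_less_eq abs_minus_commute)
  then have fx: "f x > 0" unfolding f_def using c(1) T(1) t0 by (intro sum_pos2[of T c]) auto
  define g where "g t = 1 / max (f t) (f x)" for t
  have gcn: "continuous_on UNIV g" unfolding g_def using fx by (intro continuous_intros fcn) (auto simp: max_def)
  have "\<one> = fc a (\<lambda>_. 1)" using fc_one[OF a] by simp
  also have "\<dots> = fc a (\<lambda>t. g t * f t)"
  proof (rule fc_cong[OF a])
    fix t assume "\<bar>t\<bar> \<le> nm a"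
    then have "f x \<le> f t" using x(2)[of t] by (simp add: M_def abs_le_iff)
    then show "1 = g t * f t" using fx by (simp add: g_def)
  qed (intro continuous_intros gcn fcn)+
  also have "\<dots> = fc a g \<otimes> fc a f" by (rule fc_mult[OF a gcn fcn])
  finally have "k = fc a g \<otimes> (fc a f \<otimes> k)" using k a gcn fcn by (simp add: fc_cl flip: mul_assoc)
  also have "fc a f \<otimes> k = \<zero>" using fz[OF T(1)] by (simp add: f_def[abs_def])
  finally show False using k a gcn by (simp add: fc_cl)
qed

lemma tent_mult: "tent 2 c e t * tent 1 c e t = tent 1 c e t" "tent 3 c e t * tent 2 c e t = tent 2 c e t" if "e > 0"
  using that by (auto simp: tent_def max_def min_def divide_simps split: if_splits)

text \<open>Some tent of \<open>a\<close> has a nonzero product with \<open>bp h\<close> for a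
  suitable \<open>h\<close> in the given ideal. The elements of \<open>E\<close> on which both the
  next larger tent and \<open>bu h\<close> act as units form a nonzero ideal of \<open>E\<close>, so
  by essentiality it meets \<open>B\<close>; and \<open>bu h\<close> pulls the intersection back
  into the given ideal.\<close>

lemma local_value:
  assumes B: "cs_subalg A B" "cs_abelian A B" and E: "cs_subalg A E" "cs_abelian A E" and BE: "B \<subseteq> E" "iip A E B"
    and a: "a \<in> E" "sa a" and e: "e > 0"
  shows "locally B (\<lambda>K. \<exists>c. \<forall>k\<in>K. k \<otimes> fc a (tent 2 c e) = k)"
  unfolding locally_def
proof (intro allI impI)
  fix K assume K: "nid B K"
  note Ki = nid_ideal[OF K]
  obtain h where h: "h \<in> K" "sa h" "h \<noteq> \<zero>" using nid_sa_ex[OF B(1) K] by blast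
  note hh = h(2,3)
  let ?u = "bu h" and ?p = "bp h"
  have up: "?u \<in> K" "?p \<in> K" using bu_ideal[OF hh Ki h(1)] bp_ideal[OF hh Ki h(1)] by auto
  then have upE: "?u \<in> E" "?p \<in> E" using ideal_sub[OF Ki] BE by auto
  note Ec = subalg_cl[OF E(1)]
  have upc: "?u \<in> Cr" "?p \<in> Cr" using upE Ec by auto
  obtain c where c: "fc a (tent 1 c e) \<otimes> ?p \<noteq> \<zero>"
    using exists_tent[OF a(2) upc(2) bp_nz[OF hh] e] by blast
  let ?s = "fc a (tent 2 c e)" and ?t = "fc a (tent 1 c e)"
  have stc: "?s \<in> Cr" "?t \<in> Cr" using fc_cl[OF a(2) tent_cont] by auto
  have comm: "b \<otimes> ?s = ?s \<otimes> b" if "b \<in> E" for b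
    using that a Ec abelianD[OF E(2)] by (intro fc_commute[OF a(2) a(2) tent_cont]) auto
  define J where "J = {x\<in>{x\<in>E. x \<otimes> ?u = x}. x \<otimes> ?s = x}"
  have J: "closed_ideal_in A E J"
    unfolding J_def using abelianD[OF E(2)] upE upc stc comm
    by (intro fix_ideal[OF E(1)] subalg_self_ideal[OF E(1)]) auto
  have "?t \<otimes> ?p \<in> J"
    unfolding J_def
  proof (intro CollectI conjI)
    show "?t \<otimes> ?p \<in> E" by (rule fc_mult_subalg(1)[OF E(1) a tent_cont upE(2)])
    show "?t \<otimes> ?p \<otimes> ?u = ?t \<otimes> ?p" using bp_bu[OF hh] stc upc by (simp add: mul_assoc)
    have "?s \<otimes> ?t = fc a (\<lambda>t. tent 2 c e t * tent 1 c e t)"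
      by (rule fc_mult[OF a(2) tent_cont tent_cont, symmetric])
    then have st: "?s \<otimes> ?t = ?t" using tent_mult(1)[OF e] by (simp add: eta_contract_eq)
    show "?t \<otimes> ?p \<otimes> ?s = ?t \<otimes> ?p"
      using comm[OF fc_mult_subalg(1)[OF E(1) a tent_cont upE(2)]] st stc upc by (simp flip: mul_assoc)
  qed
  then have "J \<noteq> {\<zero>}" using c by blast
  then have "J \<inter> B \<noteq> {\<zero>}" using BE(2) J unfolding iip_def by blast
  moreover have "closed_ideal_in A B (J \<inter> B)" by (rule ideal_Int[OF J B(1) BE(1)])
  ultimately have "nid B (J \<inter> B)" by (simp add: nid_def)
  moreover have "J \<inter> B \<subseteq> K"
  proof
    fix x assume "x \<in> J \<inter> B"
    then have "x \<in> B" "x \<otimes> ?u = x" by (auto simp: J_def)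
    then show "x \<in> K" using ideal_ops(4)[OF Ki up(1)] by metis
  qed
  moreover have "\<forall>k\<in>J \<inter> B. k \<otimes> ?s = k" by (auto simp: J_def)
  ultimately show "\<exists>K'. nid B K' \<and> K' \<subseteq> K \<and> (\<exists>c. \<forall>k\<in>K'. k \<otimes> fc a (tent 2 c e) = k)" by blast
qed

lemma tent_shift_norm:
  assumes a: "sa a" and e: "e > 0" and n: "n \<ge> 0"
  shows "fc a (\<lambda>t. (t - c) * tent n c e t) = (a \<ominus> complex_of_real c \<odot> \<one>) \<otimes> fc a (tent n c e)"
    and "nm (fc a (\<lambda>t. (t - c) * tent n c e t)) \<le> n * e"
proof -
  have "fc a (\<lambda>t. (t - c) * tent n c e t) = fc a (\<lambda>t. t - c) \<otimes> fc a (tent n c e)"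
    by (intro fc_mult[OF a] continuous_intros)
  also have "fc a (\<lambda>t. t - c) = a \<ominus> complex_of_real c \<odot> \<one>"
    using fc_diff[OF a, of "\<lambda>t. t" "\<lambda>_. c"] fc_id[OF a] fc_const[OF a] by (simp add: continuous_intros)
  finally show "fc a (\<lambda>t. (t - c) * tent n c e t) = (a \<ominus> complex_of_real c \<odot> \<one>) \<otimes> fc a (tent n c e)" .
  show "nm (fc a (\<lambda>t. (t - c) * tent n c e t)) \<le> n * e"
  proof (intro fc_norm[OF a] continuous_intros)
    fix t
    show "\<bar>(t - c) * tent n c e t\<bar> \<le> n * e"
    proof (cases "\<bar>t - c\<bar> \<le> n * e")
      case True
      have "0 \<le> tent n c e t" "tent n c e t \<le> 1" by (auto simp: tent_def)
      then have "\<bar>t - c\<bar> * \<bar>tent n c e t\<bar> \<le> (n * e) * 1" using True by (intro mult_mono) auto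
      then show ?thesis by (simp add: abs_mult)
    next
      case False
      then have "n - \<bar>t - c\<bar> / e \<le> 0" using e by (simp add: le_divide_eq)
      then have "tent n c e t = 0" by (simp add: tent_def)
      then show ?thesis using n e by simp
    qed
  qed
qed

lemma local_approx_sa:
  assumes B: "cs_subalg A B" "cs_abelian A B" and E: "cs_subalg A E" "cs_abelian A E" and BE: "B \<subseteq> E" "iip A E B"
    and a: "a \<in> E" "sa a" and e: "e > 0"
  shows "locally B (\<lambda>K. \<exists>c. \<forall>k\<in>K. nm ((a \<ominus> complex_of_real c \<odot> \<one>) \<otimes> k) \<le> e * nm k)"
proof (rule locally_mono[OF local_value[OF B E BE a, of "e/2"]])
  show "e/2 > 0" using e by simp
  fix K assume K: "nid B K" and "\<exists>c. \<forall>k\<in>K. k \<otimes> fc a (tent 2 c (e/2)) = k"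
  then obtain c where c: "\<forall>k\<in>K. k \<otimes> fc a (tent 2 c (e/2)) = k" by blast
  let ?s = "fc a (tent 2 c (e/2))"
  have ac: "a \<in> Cr" "?s \<in> Cr" using a fc_cl[OF a(2) tent_cont] by auto
  have "nm ((a \<ominus> complex_of_real c \<odot> \<one>) \<otimes> k) \<le> e * nm k" if k: "k \<in> K" for k
  proof -
    have kB: "k \<in> E" "k \<in> Cr" using k ideal_sub[OF nid_ideal[OF K]] ideal_cl[OF nid_ideal[OF K]] BE by auto
    have "k \<otimes> ?s = ?s \<otimes> k"
      using kB a abelianD[OF E(2)] by (intro fc_commute[OF a(2) a(2) tent_cont]) auto
    then have "(a \<ominus> complex_of_real c \<odot> \<one>) \<otimes> k = ((a \<ominus> complex_of_real c \<odot> \<one>) \<otimes> ?s) \<otimes> k"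
      using c k ac kB by (simp add: mul_assoc)
    also have "nm \<dots> \<le> (2 * (e/2)) * nm k"
      by (rule nm_mul_le) (use tent_shift_norm[OF a(2), of "e/2" 2 c] e ac kB in auto)
    finally show ?thesis by simp
  qed
  then show "\<exists>c. \<forall>k\<in>K. nm ((a \<ominus> complex_of_real c \<odot> \<one>) \<otimes> k) \<le> e * nm k" by blast
qed

lemma re_im:
  assumes a: "a \<in> Cr"
  defines "x \<equiv> (1/2) \<odot> (a \<oplus> a\<^sup>\<star>)" and "y \<equiv> (- \<i> / 2) \<odot> (a \<ominus> a\<^sup>\<star>)"
  shows "sa x" "sa y" "a = x \<oplus> \<i> \<odot> y"
proof -
  show "sa x" unfolding x_def using a by (intro saI) (simp_all add: star_sm star_add add_comm)
  show "sa y" unfolding y_def using a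
    by (intro saI) (simp_all add: cs_diff_def star_sm star_add sm_add add_comm flip: sm_mult)
  have "x \<oplus> \<i> \<odot> y = ((1/2) \<odot> a \<oplus> (1/2) \<odot> a\<^sup>\<star>) \<oplus> ((1/2) \<odot> a \<ominus> (1/2) \<odot> a\<^sup>\<star>)"
    unfolding x_def y_def using a by (simp add: sm_add sm_diff flip: sm_mult)
  also have "\<dots> = (1/2) \<odot> a \<oplus> (1/2) \<odot> a"
    using a by (simp add: alg)
  also have "\<dots> = (1/2 + 1/2) \<odot> a" using a by (simp only: add_sm)
  finally show "a = x \<oplus> \<i> \<odot> y" using a by simp
qed

lemma re_im_subalg:
  assumes "cs_subalg A E" "a \<in> E"
  shows "(1/2) \<odot> (a \<oplus> a\<^sup>\<star>) \<in> E" "(- \<i> / 2) \<odot> (a \<ominus> a\<^sup>\<star>) \<in> E"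
  using assms subalg_ops[OF assms(1)] by auto

lemma local_approx:
  assumes B: "cs_subalg A B" "cs_abelian A B" and E: "cs_subalg A E" "cs_abelian A E" and BE: "B \<subseteq> E" "iip A E B"
    and a: "a \<in> E" and e: "e > 0"
  shows "locally B (\<lambda>K. \<exists>c. \<forall>k\<in>K. nm ((a \<ominus> c \<odot> \<one>) \<otimes> k) \<le> e * nm k)"
proof -
  have ac: "a \<in> Cr" by (rule subalg_cl[OF E(1) a])
  define x where "x = (1/2) \<odot> (a \<oplus> a\<^sup>\<star>)"
  define y where "y = (- \<i> / 2) \<odot> (a \<ominus> a\<^sup>\<star>)"
  note ri = re_im[OF ac, folded x_def y_def] and riE = re_im_subalg[OF E(1) a, folded x_def y_def]
  have xy: "x \<in> Cr" "y \<in> Cr" using ri by auto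
  have "e/2 > 0" using e by simp
  note lx = local_approx_sa[OF B E BE riE(1) ri(1) this] and ly = local_approx_sa[OF B E BE riE(2) ri(2) this]
  show ?thesis
  proof (rule locally_mono[OF locally_conj[OF lx ly]])
    fix K
    assume K: "nid B K" and "(\<exists>c. \<forall>k\<in>K. nm ((x \<ominus> complex_of_real c \<odot> \<one>) \<otimes> k) \<le> e/2 * nm k) \<and>
      (\<exists>c. \<forall>k\<in>K. nm ((y \<ominus> complex_of_real c \<odot> \<one>) \<otimes> k) \<le> e/2 * nm k)"
    then obtain c d where c: "\<forall>k\<in>K. nm ((x \<ominus> complex_of_real c \<odot> \<one>) \<otimes> k) \<le> e/2 * nm k"
      and d: "\<forall>k\<in>K. nm ((y \<ominus> complex_of_real d \<odot> \<one>) \<otimes> k) \<le> e/2 * nm k" by blast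
    have "nm ((a \<ominus> (complex_of_real c + \<i> * complex_of_real d) \<odot> \<one>) \<otimes> k) \<le> e * nm k" if k: "k \<in> K" for k
    proof -
      have kc: "k \<in> Cr" by (rule ideal_cl[OF nid_ideal[OF K] k])
      have "(a \<ominus> (complex_of_real c + \<i> * complex_of_real d) \<odot> \<one>) \<otimes> k
        = (x \<ominus> complex_of_real c \<odot> \<one>) \<otimes> k \<oplus> \<i> \<odot> ((y \<ominus> complex_of_real d \<odot> \<one>) \<otimes> k)"
        unfolding ri(3) using xy kc by (simp add: alg add_sm)
      also have "nm \<dots> \<le> nm ((x \<ominus> complex_of_real c \<odot> \<one>) \<otimes> k) + nm ((y \<ominus> complex_of_real d \<odot> \<one>) \<otimes> k)"
        using xy kc nm_add[of "(x \<ominus> complex_of_real c \<odot> \<one>) \<otimes> k" "\<i> \<odot> ((y \<ominus> complex_of_real d \<odot> \<one>) \<otimes> k)"]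
        by (simp add: nm_sm)
      also have "\<dots> \<le> e * nm k" using c d k by fastforce
      finally show ?thesis .
    qed
    then show "\<exists>c. \<forall>k\<in>K. nm ((a \<ominus> c \<odot> \<one>) \<otimes> k) \<le> e * nm k" by blast
  qed blast
qed

subsection \<open>Normalizers\<close>

lemma normalizersD:
  assumes "v \<in> normalizers A B"
  shows "v \<in> Cr" "d \<in> B \<Longrightarrow> v \<otimes> d \<otimes> v\<^sup>\<star> \<in> B" "d \<in> B \<Longrightarrow> v\<^sup>\<star> \<otimes> d \<otimes> v \<in> B"
  using assms unfolding normalizers_def by blast+

lemma normalizers_star: "v \<in> normalizers A B \<Longrightarrow> v\<^sup>\<star> \<in> normalizers A B"
  unfolding normalizers_def by simp

text \<open>\<open>B\<close> need not contain a unit, so \<open>v\<^sup>\<star> \<otimes> v\<close>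
  is not itself of the form covered by the definition of a normalizer. For
  \<open>y = d \<otimes> v\<^sup>\<star>\<close> the element
  \<open>y\<^sup>\<star> \<otimes> y\<close> is in \<open>B\<close>, and a function \<open>w\<close>
  of it satisfies \<open>y \<otimes> w\<close> close to \<open>y\<close>; then
  \<open>d \<otimes> (v\<^sup>\<star> \<otimes> w \<otimes> v)\<close> is in \<open>B\<close> and
  close to the target.\<close>

lemma normalizer_square_mem:
  assumes B: "cs_subalg A B" and v: "v \<in> normalizers A B" and d: "d \<in> B"
  shows "d \<otimes> (v\<^sup>\<star> \<otimes> v) \<in> B"
proof (rule closed_approx[OF subalg_closed[OF B]])
  note Bc = subalg_cl[OF B] and Bo = subalg_ops[OF B]
  have vc: "v \<in> Cr" and dc: "d \<in> Cr" using normalizersD(1)[OF v] Bc[OF d] by auto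
  show "d \<otimes> (v\<^sup>\<star> \<otimes> v) \<in> Cr" using vc dc by simp
  fix e :: real assume e: "e > 0"
  define y where "y = d \<otimes> v\<^sup>\<star>"
  have yc: "y \<in> Cr" using vc dc by (simp add: y_def)
  have "y\<^sup>\<star> \<otimes> y = v \<otimes> (d\<^sup>\<star> \<otimes> d) \<otimes> v\<^sup>\<star>" unfolding y_def using vc dc by (simp add: star_mul mul_assoc)
  then have yB: "y\<^sup>\<star> \<otimes> y \<in> B" using normalizersD(2)[OF v Bo(3)[OF Bo(5)[OF d] d]] by simp
  have "e / (nm v + 1) > 0" using e vc by (simp add: add_nonneg_pos)
  then obtain f where f: "continuous_on UNIV f" "f 0 = 0" "nm (y \<ominus> y \<otimes> fc (y\<^sup>\<star> \<otimes> y) f) \<le> e / (nm v + 1)"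
    by (rule approx_unit[OF yc])
  define w where "w = fc (y\<^sup>\<star> \<otimes> y) f"
  have w: "w \<in> B" unfolding w_def by (rule fc_subalg[OF B yB sa_square[OF yc] f(1,2)])
  have wc: "w \<in> Cr" by (rule Bc[OF w])
  have "d \<otimes> (v\<^sup>\<star> \<otimes> v) \<ominus> d \<otimes> (v\<^sup>\<star> \<otimes> w \<otimes> v) = (y \<ominus> y \<otimes> w) \<otimes> v"
    unfolding y_def using vc dc wc by (simp add: diff_mul mul_assoc)
  also have "nm \<dots> \<le> e / (nm v + 1) * nm v"
    using f(3) yc vc wc by (intro nm_mul_le) (auto simp: w_def)
  also have "\<dots> \<le> e" using e vc by (simp add: divide_le_eq add_nonneg_pos)
  finally show "\<exists>s\<in>B. nm (d \<otimes> (v\<^sup>\<star> \<otimes> v) \<ominus> s) \<le> e"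
    using Bo(3)[OF d normalizersD(3)[OF v w]] by blast
qed

text \<open>The commutator of \<open>v\<^sup>\<star> \<otimes> v\<close> and \<open>d\<close> lies
  in \<open>B\<close> by the previous lemma. Every element of \<open>B\<close> annihilates it, in
  particular its own adjoint does, so it is zero.\<close>

lemma normalizer_square:
  assumes B: "cs_subalg A B" "cs_abelian A B" and v: "v \<in> normalizers A B" and d: "d \<in> B"
  shows "(v\<^sup>\<star> \<otimes> v) \<otimes> d \<in> B" "(v\<^sup>\<star> \<otimes> v) \<otimes> d = d \<otimes> (v\<^sup>\<star> \<otimes> v)"
proof -
  note Bc = subalg_cl[OF B(1)] and Bo = subalg_ops[OF B(1)]
  define t where "t = v\<^sup>\<star> \<otimes> v"
  have t: "sa t" unfolding t_def by (rule sa_square[OF normalizersD(1)[OF v]])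
  then have tc: "t \<in> Cr" by simp
  have dt: "b \<otimes> t \<in> B" if "b \<in> B" for b unfolding t_def by (rule normalizer_square_mem[OF B(1) v that])
  have td: "t \<otimes> b \<in> B" if "b \<in> B" for b
    using Bo(5)[OF dt[OF Bo(5)[OF that]]] t Bc[OF that] by (simp add: star_mul)
  show "(v\<^sup>\<star> \<otimes> v) \<otimes> d \<in> B" using td[OF d] by (simp add: t_def)
  define y where "y = t \<otimes> d \<ominus> d \<otimes> t"
  have y: "y \<in> B" unfolding y_def by (rule Bo(6)[OF td[OF d] dt[OF d]])
  have "b \<otimes> y = \<zero>" if b: "b \<in> B" for b
  proof -
    have "b \<otimes> t \<otimes> d = d \<otimes> (b \<otimes> t)" by (rule abelianD[OF B(2) dt[OF b] d])
    moreover have "d \<otimes> b = b \<otimes> d" by (rule abelianD[OF B(2) d b])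
    ultimately have "b \<otimes> (t \<otimes> d) = b \<otimes> (d \<otimes> t)"
      using Bc[OF b] Bc[OF d] tc by (metis mul_assoc)
    then show ?thesis unfolding y_def using Bc[OF b] Bc[OF d] tc by (simp add: mul_diff)
  qed
  then have "y = \<zero>" using sq_zero[OF Bc[OF y]] Bo(5)[OF y] by blast
  then show "(v\<^sup>\<star> \<otimes> v) \<otimes> d = d \<otimes> (v\<^sup>\<star> \<otimes> v)" unfolding y_def t_def[symmetric]
    using tc Bc[OF d] by (simp add: diff_eq_zero)
qed

lemma iip_refl: "iip A B B"
  unfolding iip_def closed_ideal_in_def by (metis inf.absorb1)

text \<open>If \<open>v\<close> moves no point of the open set \<open>K\<close>, in the sense that it preserves disjointness there,
  then it commutes with \<open>B\<close> on \<open>K\<close>; here \<open>w\<close> measures the failure and vanishes locally.\<close>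
lemma local_commute_sa:
  assumes B: "cs_subalg A B" "cs_abelian A B" and v: "v \<in> normalizers A B" and K: "closed_ideal_in A B K"
    and disj: "\<And>f g. \<lbrakk>f \<in> B; g \<in> K; f \<otimes> g = \<zero>\<rbrakk> \<Longrightarrow> f \<otimes> v \<otimes> g = \<zero>"
    and f: "f \<in> B" "sa f" and k: "k \<in> K"
  shows "f \<otimes> v \<otimes> k = v \<otimes> f \<otimes> k"
proof -
  note Bc = subalg_cl[OF B(1)] and Bo = subalg_ops[OF B(1)] and Ko = ideal_ops[OF K] and Kc = ideal_cl[OF K]
  have vc [simp]: "v \<in> Cr" by (rule normalizersD(1)[OF v])
  have kc [simp]: "k \<in> Cr" and kB: "k \<in> B" using Kc[OF k] ideal_sub[OF K k] by auto
  have fc [simp]: "f \<in> Cr" using f by simp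
  define w where "w = f \<otimes> v \<otimes> k \<ominus> v \<otimes> f \<otimes> k"
  have wc [simp]: "w \<in> Cr" by (simp add: w_def)
  \<comment> \<open>Here \<open>v\<close> occurs only in the forms
    \<open>v\<^sup>\<star> \<otimes> b \<otimes> v\<close> and
    \<open>v\<^sup>\<star> \<otimes> v\<close>, surrounded by elements of \<open>B\<close>. So the
    square of the failure lies in \<open>B\<close> even if \<open>w\<close> does not, and it can be
    tested locally.\<close>
  have "w\<^sup>\<star> \<otimes> w = (k\<^sup>\<star> \<otimes> (v\<^sup>\<star> \<otimes> (f \<otimes> f) \<otimes> v) \<otimes> k \<ominus> k\<^sup>\<star> \<otimes> f \<otimes> (v\<^sup>\<star> \<otimes> f \<otimes> v) \<otimes> k)
     \<ominus> (k\<^sup>\<star> \<otimes> (v\<^sup>\<star> \<otimes> f \<otimes> v) \<otimes> (f \<otimes> k) \<ominus> k\<^sup>\<star> \<otimes> f \<otimes> ((v\<^sup>\<star> \<otimes> v) \<otimes> (f \<otimes> k)))"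
    unfolding w_def using f(2) by (simp add: star_diff star_mul diff_mul mul_diff mul_assoc)
  also have "\<dots> \<in> B"
  proof -
    note ks = Bo(5)[OF kB] and fk = Bo(3)[OF f(1) kB] and q1 = normalizersD(3)[OF v Bo(3)[OF f(1) f(1)]]
      and q2 = normalizersD(3)[OF v f(1)] and q3 = normalizer_square(1)[OF B v Bo(3)[OF f(1) kB]]
    note ksf = Bo(3)[OF ks f(1)]
    show ?thesis
      by (rule Bo(6)[OF Bo(6)[OF Bo(3)[OF Bo(3)[OF ks q1] kB] Bo(3)[OF Bo(3)[OF ksf q2] kB]]
            Bo(6)[OF Bo(3)[OF Bo(3)[OF ks q2] fk] Bo(3)[OF ksf q3]]])
  qed
  finally have wB: "w\<^sup>\<star> \<otimes> w \<in> B" .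
  have "w\<^sup>\<star> \<otimes> w = \<zero>"
  proof (rule locally_small_zero[OF B wB])
    fix e :: real assume e: "e > 0"
    \<comment> \<open>The 5 is the sum of 3 and 2, the half-widths in units of \<open>e'\<close> of
      the two tents used to cut off \<open>f - c\<close>.\<close>
    define e' where "e' = e / (nm w * (5 * nm v * nm k) + 1)"
    have "nm w * (5 * nm v * nm k) \<ge> 0" by simp
    then have e': "e' > 0" "nm w * (5 * nm v * nm k) * e' \<le> e"
      using e unfolding e'_def by (auto simp: divide_simps add_nonneg_pos distrib_right mult.commute)
    show "locally B (\<lambda>K. \<forall>x\<in>K. nm (w\<^sup>\<star> \<otimes> w \<otimes> x) \<le> e * nm x)"
    proof (rule locally_mono[OF local_value[OF B B order_refl iip_refl f e'(1)]])
      fix K1 assume K1: "nid B K1" and "\<exists>c. \<forall>k\<in>K1. k \<otimes> fc f (tent 2 c e') = k"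
      then obtain c where c: "\<forall>k\<in>K1. k \<otimes> fc f (tent 2 c e') = k" by blast
      let ?s = "fc f (tent 2 c e')" and ?r = "fc f (tent 3 c e')" and ?c = "complex_of_real c \<odot> \<one>"
      have src [simp]: "?s \<in> Cr" "?r \<in> Cr" using fc_cl[OF f(2) tent_cont] by auto
      have scomm: "b \<otimes> ?s = ?s \<otimes> b" if "b \<in> B" for b
        using that f Bc abelianD[OF B(2)] by (intro fc_commute[OF f(2) f(2) tent_cont]) auto
      \<comment> \<open>The part of \<open>f - c\<close> away from \<open>c\<close>. It vanishes
        where the tent with parameter 2 lives, so it annihilates the ideal, and \<open>disj\<close>
        will show that it still does so after \<open>v\<close> is inserted.\<close>
      define f2 where "f2 = fc f (\<lambda>t. (t - c) * (1 - tent 3 c e' t))"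
      have f2cont: "continuous_on UNIV (\<lambda>t. (t - c) * (1 - tent 3 c e' t))" by (intro continuous_intros)
      have f2: "sa f2" unfolding f2_def by (rule fc_sa[OF f(2) f2cont])
      then have f2c [simp]: "f2 \<in> Cr" by simp
      have split: "f \<ominus> ?c = (f \<ominus> ?c) \<otimes> ?r \<oplus> f2"
      proof -
        have "fc f (\<lambda>t. (t - c) * tent 3 c e' t + (t - c) * (1 - tent 3 c e' t)) = (f \<ominus> ?c) \<otimes> ?r \<oplus> f2"
          unfolding f2_def tent_shift_norm(1)[OF f(2) e'(1), of 3 c, symmetric, simplified]
          by (intro fc_add[OF f(2)] continuous_intros)
        moreover have "(\<lambda>t. (t - c) * tent 3 c e' t + (t - c) * (1 - tent 3 c e' t)) = (\<lambda>t. t - c)"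
          by (auto simp: algebra_simps)
        moreover have "fc f (\<lambda>t. t - c) = f \<ominus> ?c"
          using fc_diff[OF f(2), of "\<lambda>t. t" "\<lambda>_. c"] fc_id[OF f(2)] fc_const[OF f(2)] by (simp add: continuous_intros)
        ultimately show ?thesis by simp
      qed
      have f2s: "f2 \<otimes> ?s = \<zero>"
      proof -
        have "f2 \<otimes> ?s = fc f (\<lambda>t. (t - c) * (1 - tent 3 c e' t) * tent 2 c e' t)"
          unfolding f2_def by (rule fc_mult[OF f(2) f2cont tent_cont, symmetric])
        moreover have "(\<lambda>t. (t - c) * (1 - tent 3 c e' t) * tent 2 c e' t) = (\<lambda>_. 0)"
        proof
          fix t
          have "(1 - tent 3 c e' t) * tent 2 c e' t = 0" using tent_mult(2)[OF e'(1), of c t] by (simp add: left_diff_distrib)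
          then show "(t - c) * (1 - tent 3 c e' t) * tent 2 c e' t = 0" by (simp only: mult.assoc mult_zero_right)
        qed
        ultimately show ?thesis using fc_zero_fun[OF f(2)] by simp
      qed
      have "nm (w\<^sup>\<star> \<otimes> w \<otimes> x) \<le> e * nm x" if x: "x \<in> K1" for x
      proof -
        have xB: "x \<in> B" by (rule ideal_sub[OF nid_ideal[OF K1] x])
        have xc [simp]: "x \<in> Cr" by (rule Bc[OF xB])
        have xs: "?s \<otimes> x = x" using c x scomm[OF xB] by auto
        have kx: "k \<otimes> x \<in> K" by (rule Ko(3)[OF k xB])
        have kxB: "k \<otimes> x \<in> B" by (rule Bo(3)[OF kB xB])
        have kxs: "k \<otimes> x = ?s \<otimes> (k \<otimes> x)"
        proof -
          have "k \<otimes> (?s \<otimes> x) = ?s \<otimes> (k \<otimes> x)" using scomm[OF kB] by (simp flip: mul_assoc)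
          then show ?thesis using xs by simp
        qed
        have f2kx: "f2 \<otimes> (k \<otimes> x) = \<zero>"
          by (subst kxs) (simp add: f2s flip: mul_assoc)
        define y where "y = f2 \<otimes> v \<otimes> (k \<otimes> x)"
        have yc [simp]: "y \<in> Cr" by (simp add: y_def)
        \<comment> \<open>\<open>f2\<close> need not be in \<open>B\<close>, since its function may
          be nonzero at 0. So \<open>disj\<close> is applied to \<open>b \<otimes> f2\<close>
          instead, and \<open>b\<close> is afterwards taken to be
          \<open>y \<otimes> y\<^sup>\<star>\<close>.\<close>
        have by0: "b \<otimes> y = \<zero>" if b: "b \<in> B" for b
        proof -
          have "b \<otimes> f2 \<in> B" unfolding f2_def by (rule fc_mult_subalg(2)[OF B(1) f f2cont b])
          moreover have "(b \<otimes> f2) \<otimes> (k \<otimes> x) = \<zero>" using f2kx Bc[OF b] by (simp add: mul_assoc)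
          ultimately have "(b \<otimes> f2) \<otimes> v \<otimes> (k \<otimes> x) = \<zero>" using disj kx by blast
          then show ?thesis unfolding y_def using Bc[OF b] by (simp add: mul_assoc)
        qed
        have "y \<otimes> y\<^sup>\<star> = f2 \<otimes> ((v \<otimes> ((k \<otimes> x) \<otimes> (k \<otimes> x)\<^sup>\<star>) \<otimes> v\<^sup>\<star>) \<otimes> f2)"
          unfolding y_def using f2 by (simp add: star_mul mul_assoc)
        also have "\<dots> \<in> B" unfolding f2_def
          by (intro fc_mult_subalg[OF B(1) f f2cont] normalizersD(2)[OF v] Bo(3)[OF kxB Bo(5)[OF kxB]])
        finally have "(y \<otimes> y\<^sup>\<star>) \<otimes> y = \<zero>" by (rule by0)
        then have "(y \<otimes> y\<^sup>\<star>) \<otimes> (y \<otimes> y\<^sup>\<star>) = \<zero>" by (simp flip: mul_assoc)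
        then have "y \<otimes> y\<^sup>\<star> = \<zero>" using sq_zero[of "y \<otimes> y\<^sup>\<star>"] by (simp add: star_mul)
        then have y0: "y = \<zero>" using cstar_id'[of y] nm_eq_0[of y] by simp
        have t1: "nm (((f \<ominus> ?c) \<otimes> ?r) \<otimes> (v \<otimes> (k \<otimes> x))) \<le> (3 * e') * (nm v * (nm k * nm x))"
          using tent_shift_norm[OF f(2) e'(1), of 3 c] nm_mul_le[of k x "nm k" "nm x"]
          by (intro nm_mul_le[of "(f \<ominus> ?c) \<otimes> ?r"] nm_mul_le[of v]) auto
        have t2: "nm ((v \<otimes> k) \<otimes> (((f \<ominus> ?c) \<otimes> ?s) \<otimes> x)) \<le> (nm v * nm k) * ((2 * e') * nm x)"
          using tent_shift_norm[OF f(2) e'(1), of 2 c] nm_mul_le[of v k "nm v" "nm k"]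
          by (intro nm_mul_le[of "v \<otimes> k"] nm_mul_le[of "(f \<ominus> ?c) \<otimes> ?s"]) auto
        have "f \<otimes> k = k \<otimes> f" by (rule abelianD[OF B(2) f(1) kB])
        then have "w \<otimes> x = (f \<ominus> ?c) \<otimes> (v \<otimes> (k \<otimes> x)) \<ominus> (v \<otimes> k) \<otimes> ((f \<ominus> ?c) \<otimes> x)"
          unfolding w_def by (simp add: alg)
        also have "(f \<ominus> ?c) \<otimes> (v \<otimes> (k \<otimes> x)) = ((f \<ominus> ?c) \<otimes> ?r) \<otimes> (v \<otimes> (k \<otimes> x))"
          by (subst split) (use y0 in \<open>simp add: add_mul y_def mul_assoc\<close>)
        also have "(f \<ominus> ?c) \<otimes> x = ((f \<ominus> ?c) \<otimes> ?s) \<otimes> x"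
          using xs by (simp add: mul_assoc)
        finally have "nm (w \<otimes> x) \<le> nm (((f \<ominus> ?c) \<otimes> ?r) \<otimes> (v \<otimes> (k \<otimes> x))) + nm ((v \<otimes> k) \<otimes> (((f \<ominus> ?c) \<otimes> ?s) \<otimes> x))"
          using nm_diff[of "((f \<ominus> ?c) \<otimes> ?r) \<otimes> (v \<otimes> (k \<otimes> x))" "(v \<otimes> k) \<otimes> (((f \<ominus> ?c) \<otimes> ?s) \<otimes> x)"] by simp
        also have "\<dots> \<le> (3 * e') * (nm v * (nm k * nm x)) + (nm v * nm k) * ((2 * e') * nm x)"
          by (rule add_mono[OF t1 t2])
        also have "\<dots> = (5 * nm v * nm k) * e' * nm x" by (simp add: algebra_simps)
        finally have "nm (w \<otimes> x) \<le> (5 * nm v * nm k) * e' * nm x" .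
        then have "nm (w\<^sup>\<star> \<otimes> (w \<otimes> x)) \<le> nm w * ((5 * nm v * nm k) * e' * nm x)"
          by (intro nm_mul_le[of "w\<^sup>\<star>"]) auto
        also have "\<dots> = (nm w * (5 * nm v * nm k) * e') * nm x" by (simp add: mult_ac)
        also have "\<dots> \<le> e * nm x" using e'(2) by (intro mult_right_mono) auto
        finally show ?thesis by (simp add: mul_assoc)
      qed
      then show "\<forall>x\<in>K1. nm (w\<^sup>\<star> \<otimes> w \<otimes> x) \<le> e * nm x" by blast
    qed
  qed
  then have "w = \<zero>" by (rule sq_zero[OF wc])
  then show ?thesis by (simp add: w_def diff_eq_zero)
qed

text \<open>If disjointness is preserved, \<open>local_commute_sa\<close> applied to real and
  imaginary parts gives the second alternative. Otherwise \<open>f \<otimes> g = \<zero>\<close> but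
  \<open>f \<otimes> v \<otimes> g \<noteq> \<zero>\<close>, so \<open>v\<close> moves part of the
  support of \<open>g\<close> into that of \<open>f\<close>. The ideal \<open>K'\<close> collects
  the members of \<open>Z\<close> that \<open>v\<close> moves away from all of \<open>Z\<close>; the
  square of \<open>f \<otimes> v \<otimes> g\<close> is a nonzero member.\<close>

lemma normalizer_dichotomy:
  assumes B: "cs_subalg A B" "cs_abelian A B" and v: "v \<in> normalizers A B" and K: "nid B K"
  obtains K' where "nid B K'" "K' \<subseteq> K" "\<And>k k'. k \<in> K' \<Longrightarrow> k' \<in> K' \<Longrightarrow> k \<otimes> v \<otimes> k' = \<zero>"
  | "\<And>b k. b \<in> B \<Longrightarrow> k \<in> K \<Longrightarrow> b \<otimes> (v \<otimes> k) = (v \<otimes> k) \<otimes> b"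
proof (cases "\<forall>f\<in>B. \<forall>g\<in>K. f \<otimes> g = \<zero> \<longrightarrow> f \<otimes> v \<otimes> g = \<zero>")
  case True
  note Ki = nid_ideal[OF K]
  note Bc = subalg_cl[OF B(1)] and Kc = ideal_cl[OF Ki]
  have vc: "v \<in> Cr" by (rule normalizersD(1)[OF v])
  have *: "f \<otimes> v \<otimes> k = v \<otimes> f \<otimes> k" if "f \<in> B" "sa f" "k \<in> K" for f k
    using True that by (intro local_commute_sa[OF B v Ki]) auto
  have "b \<otimes> (v \<otimes> k) = (v \<otimes> k) \<otimes> b" if b: "b \<in> B" and k: "k \<in> K" for b k
  proof -
    have bc: "b \<in> Cr" "k \<in> Cr" using Bc[OF b] Kc[OF k] by auto
    define x y where "x = (1/2) \<odot> (b \<oplus> b\<^sup>\<star>)" and "y = (- \<i> / 2) \<odot> (b \<ominus> b\<^sup>\<star>)"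
    note ri = re_im[OF bc(1), folded x_def y_def] and riB = re_im_subalg[OF B(1) b, folded x_def y_def]
    have xy: "x \<in> Cr" "y \<in> Cr" using ri by auto
    have "b \<otimes> v \<otimes> k = v \<otimes> b \<otimes> k"
      unfolding ri(3) using *[OF riB(1) ri(1) k] *[OF riB(2) ri(2) k] xy vc bc
      by (simp add: add_mul mul_add sm_mul mul_sm)
    moreover have "b \<otimes> k = k \<otimes> b" by (rule abelianD[OF B(2) b ideal_sub[OF Ki k]])
    ultimately show ?thesis using vc bc by (simp add: mul_assoc)
  qed
  then show ?thesis by (rule that(2))
next
  case False
  then obtain f g where fg: "f \<in> B" "g \<in> K" "f \<otimes> g = \<zero>" "f \<otimes> v \<otimes> g \<noteq> \<zero>" by blast
  note Ki = nid_ideal[OF K]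
  note Bc = subalg_cl[OF B(1)] and Kc = ideal_cl[OF Ki] and Bo = subalg_ops[OF B(1)] and Ko = ideal_ops[OF Ki]
  have vc [simp]: "v \<in> Cr" by (rule normalizersD(1)[OF v])
  have gB: "g \<in> B" by (rule ideal_sub[OF Ki fg(2)])
  have [simp]: "f \<in> Cr" "g \<in> Cr" using Bc fg gB by auto
  define q where "q = v\<^sup>\<star> \<otimes> (f\<^sup>\<star> \<otimes> f) \<otimes> v"
  have qB: "q \<in> B" unfolding q_def by (intro normalizersD(3)[OF v] Bo(3) Bo(5) fg)
  have [simp]: "q \<in> Cr" by (rule Bc[OF qB])
  define e where "e = (f \<otimes> v \<otimes> g)\<^sup>\<star> \<otimes> (f \<otimes> v \<otimes> g)"
  have e: "e = (g\<^sup>\<star> \<otimes> q) \<otimes> g" unfolding e_def q_def by (simp add: star_mul mul_assoc)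
  have gq: "g\<^sup>\<star> \<otimes> q \<in> B" by (intro Bo(3) Bo(5) gB qB)
  have eK: "e \<in> K" unfolding e by (rule Ko(4)[OF fg(2) gq])
  have e0: "e \<noteq> \<zero>" unfolding e_def using sq_zero[of "f \<otimes> v \<otimes> g"] fg(4) by auto
  have ec [simp]: "e \<in> Cr" by (rule Kc[OF eK])
  have gf: "g \<otimes> f = \<zero>" using abelianD[OF B(2) fg(1) gB] fg(3) by simp
  define Z where "Z = {k\<in>K. k \<otimes> f = \<zero>}"
  have Zc: "z \<in> Z \<Longrightarrow> z \<in> Cr" for z unfolding Z_def using Kc by blast
  have Z0: "\<zero> \<in> Z" unfolding Z_def using Ko(1) by simp
  define K' where "K' = Z \<inter> (\<Inter>z\<in>Z. {k\<in>K. (z \<otimes> v) \<otimes> k \<in> {\<zero>}})"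
  have Zcl: "cs_closure A Z = Z"
  proof -
    have "Z = {k\<in>K. k \<otimes> f \<in> {\<zero>}}" by (simp add: Z_def)
    then show ?thesis
      using closed_blin_pre[OF blin_mulr[OF blin_id], of f K "{\<zero>}"] Kc ideal_closed[OF Ki] closure_zero by auto
  qed
  have "cs_closure A (\<Inter>z\<in>Z. {k\<in>K. (z \<otimes> v) \<otimes> k \<in> {\<zero>}}) = (\<Inter>z\<in>Z. {k\<in>K. (z \<otimes> v) \<otimes> k \<in> {\<zero>}})"
    using Kc ideal_closed[OF Ki] closure_zero Zc Z0
    by (intro closed_Inter closed_blin_pre blin_intros) auto
  then have K'cl: "cs_closure A K' = K'" unfolding K'_def by (intro closed_Int Zcl)
  have mem: "x \<in> K' \<longleftrightarrow> x \<in> K \<and> x \<otimes> f = \<zero> \<and> (\<forall>z\<in>Z. (z \<otimes> v) \<otimes> x = \<zero>)" for x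
    unfolding K'_def Z_def using Z0 by (auto simp: Z_def)
  have ideal: "closed_ideal_in A B K'"
    unfolding closed_ideal_in_def
  proof (intro conjI ballI allI K'cl)
    show "K' \<subseteq> B" using mem ideal_sub[OF Ki] by blast
    show "\<zero> \<in> K'" using mem Ko(1) Zc by auto
    show "x \<oplus> y \<in> K'" if "x \<in> K'" "y \<in> K'" for x y
      using that Zc Kc Ko(2) by (auto simp: mem add_mul mul_add)
    show "c \<odot> x \<in> K'" if "x \<in> K'" for c x
      using that Zc Kc Ko(5) by (auto simp: mem sm_mul mul_sm)
    have r: "x \<otimes> b \<in> K'" if x: "x \<in> K'" and b: "b \<in> B" for x b
    proof -
      have xc: "x \<in> Cr" "b \<in> Cr" using x mem Kc Bc[OF b] by auto
      have "x \<otimes> b \<otimes> f = (x \<otimes> f) \<otimes> b" using abelianD[OF B(2) b fg(1)] xc by (simp add: mul_assoc)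
      moreover have "z \<otimes> v \<otimes> (x \<otimes> b) = (z \<otimes> v \<otimes> x) \<otimes> b" if "z \<in> Z" for z
        using Zc[OF that] xc by (simp add: mul_assoc)
      ultimately show ?thesis using x b xc Ko(3) by (auto simp: mem)
    qed
    show "x \<otimes> b \<in> K'" if "x \<in> K'" "b \<in> B" for x b using r that by blast
    show "b \<otimes> x \<in> K'" if "x \<in> K'" "b \<in> B" for x b
      using r[OF that] abelianD[OF B(2), of x b] that mem ideal_sub[OF Ki] by metis
  qed
  have "e \<in> K'"
    unfolding mem
  proof (intro conjI ballI eK)
    show "e \<otimes> f = \<zero>" unfolding e using gf Bc[OF gq] by (simp add: mul_assoc)
    fix z assume z: "z \<in> Z"
    have zB: "z \<in> B" and zf: "z \<otimes> f = \<zero>" using z ideal_sub[OF Ki] unfolding Z_def by auto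
    have zc [simp]: "z \<in> Cr" by (rule Bc[OF zB])
    \<comment> \<open>\<open>v \<otimes> v\<^sup>\<star>\<close> commutes with \<open>B\<close>,
      which lets \<open>z\<close> travel to \<open>f\<^sup>\<star> \<otimes> f\<close> and
      annihilate it.\<close>
    have vv: "(v \<otimes> v\<^sup>\<star>) \<otimes> z = z \<otimes> (v \<otimes> v\<^sup>\<star>)"
      using normalizer_square(2)[OF B normalizers_star[OF v] zB] by simp
    have "z \<otimes> (f\<^sup>\<star> \<otimes> f) = (z \<otimes> f) \<otimes> f\<^sup>\<star>"
      using abelianD[OF B(2) fg(1) Bo(5)[OF fg(1)]] by (simp add: mul_assoc)
    then have zff: "z \<otimes> (f\<^sup>\<star> \<otimes> f) = \<zero>" using zf by simp
    have "g\<^sup>\<star> \<otimes> q = q \<otimes> g\<^sup>\<star>" by (rule abelianD[OF B(2) Bo(5)[OF gB] qB])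
    then have "(z \<otimes> v) \<otimes> e = (z \<otimes> (v \<otimes> v\<^sup>\<star>)) \<otimes> ((f\<^sup>\<star> \<otimes> f) \<otimes> (v \<otimes> (g\<^sup>\<star> \<otimes> g)))"
      unfolding e by (simp add: q_def mul_assoc)
    also have "\<dots> = (v \<otimes> v\<^sup>\<star>) \<otimes> ((z \<otimes> (f\<^sup>\<star> \<otimes> f)) \<otimes> (v \<otimes> (g\<^sup>\<star> \<otimes> g)))"
      unfolding vv[symmetric] by (simp add: mul_assoc)
    finally show "(z \<otimes> v) \<otimes> e = \<zero>" using zff by simp
  qed
  then have "nid B K'" by (rule nidI[OF ideal _ e0])
  moreover have "K' \<subseteq> K" using mem by blast
  moreover have "k \<otimes> v \<otimes> k' = \<zero>" if "k \<in> K'" "k' \<in> K'" for k k'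
    using that unfolding mem by (auto simp: Z_def)
  ultimately show ?thesis by (rule that(1))
qed

end

section \<open>Elements that are locally scalar\<close>

text \<open>The denominator \<open>b + 1\<close> spares a case distinction at \<open>b = 0\<close>
  when tolerances are rescaled.\<close>

lemma scale_eps:
  fixes e b :: real
  assumes "e > 0" "b \<ge> 0"
  shows "e / (b + 1) > 0" "b * (e / (b + 1)) \<le> e"
  using assms by (auto simp: field_simps)

context ucst
begin

lemma rel_subalg:
  assumes S: "cs_subalg A S" and B: "cs_subalg A B"
  shows "cs_subalg A (S \<inter> relcomm A B)"
proof -
  note Sc = subalg_cl[OF S] and Bc = subalg_cl[OF B] and So = subalg_ops[OF S]
  have eq: "S \<inter> relcomm A B = (\<Inter>b\<in>B. {x\<in>S. x \<otimes> b \<ominus> b \<otimes> x \<in> {\<zero>}})"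
  proof (rule set_eqI)
    fix x
    have "x \<in> S \<inter> relcomm A B \<longleftrightarrow> x \<in> S \<and> (\<forall>b\<in>B. x \<otimes> b = b \<otimes> x)" using Sc by (auto simp: relcomm_def)
    also have "\<dots> \<longleftrightarrow> x \<in> S \<and> (\<forall>b\<in>B. x \<otimes> b \<ominus> b \<otimes> x \<in> {\<zero>})" using Sc Bc by (auto simp: diff_eq_zero)
    also have "\<dots> \<longleftrightarrow> x \<in> (\<Inter>b\<in>B. {x\<in>S. x \<otimes> b \<ominus> b \<otimes> x \<in> {\<zero>}})" using subalg_ops(1)[OF B] by blast
    finally show "x \<in> S \<inter> relcomm A B \<longleftrightarrow> x \<in> (\<Inter>b\<in>B. {x\<in>S. x \<otimes> b \<ominus> b \<otimes> x \<in> {\<zero>}})" .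
  qed
  have "cs_closure A (S \<inter> relcomm A B) = S \<inter> relcomm A B"
    unfolding eq using Sc Bc subalg_ops(1)[OF B] subalg_closed[OF S] closure_zero
    by (intro closed_Inter closed_blin_pre blin_intros) auto
  moreover have "x\<^sup>\<star> \<otimes> b = b \<otimes> x\<^sup>\<star>" if "x \<in> S" "\<forall>b\<in>B. x \<otimes> b = b \<otimes> x" "b \<in> B" for x b
  proof -
    have "x \<otimes> b\<^sup>\<star> = b\<^sup>\<star> \<otimes> x" using that subalg_ops(5)[OF B] by blast
    then have "(x \<otimes> b\<^sup>\<star>)\<^sup>\<star> = (b\<^sup>\<star> \<otimes> x)\<^sup>\<star>" by simp
    then show ?thesis using Sc[OF that(1)] Bc[OF that(3)] by (simp add: star_mul)
  qed
  moreover have "x \<otimes> y \<otimes> b = b \<otimes> (x \<otimes> y)"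
    if "x \<in> S" "y \<in> S" "\<forall>b\<in>B. x \<otimes> b = b \<otimes> x" "\<forall>b\<in>B. y \<otimes> b = b \<otimes> y" "b \<in> B" for x y b
    using that Sc[OF that(1)] Sc[OF that(2)] Bc[OF that(5)] by (metis mul_assoc)
  ultimately show ?thesis
    unfolding cs_subalg_def using So Sc Bc
    by (auto simp: relcomm_def add_mul mul_add sm_mul mul_sm)
qed

text \<open>The scalar may depend on the ideal and on the tolerance, so no limiting function has to
  be constructed. Compression from both sides allows the scalar 0 for a normalizer that moves
  points.\<close>

definition apx :: "'a \<Rightarrow> real \<Rightarrow> 'a set \<Rightarrow> bool" where
  "apx x e K \<longleftrightarrow> (\<exists>c. \<forall>k\<in>K. \<forall>k'\<in>K. nm (k \<otimes> x \<otimes> k' \<ominus> c \<odot> (k \<otimes> k')) \<le> e * nm k * nm k')"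

definition loc :: "'a set \<Rightarrow> 'a \<Rightarrow> bool" where
  "loc B x \<longleftrightarrow> x \<in> Cr \<and> (\<forall>e>0. locally B (apx x e))"

lemma apx_antimono: "apx x e K \<Longrightarrow> K' \<subseteq> K \<Longrightarrow> apx x e K'"
  unfolding apx_def by blast

lemma apx_perturb:
  assumes K: "K \<subseteq> Cr" and y: "apx y e K" and xy: "x \<in> Cr" "y \<in> Cr" "nm (x \<ominus> y) \<le> d"
  shows "apx x (d + e) K"
proof -
  obtain c where c: "\<And>k k'. k \<in> K \<Longrightarrow> k' \<in> K \<Longrightarrow> nm (k \<otimes> y \<otimes> k' \<ominus> c \<odot> (k \<otimes> k')) \<le> e * nm k * nm k'"
    using y unfolding apx_def by blast
  have "nm (k \<otimes> x \<otimes> k' \<ominus> c \<odot> (k \<otimes> k')) \<le> (d + e) * nm k * nm k'" if k: "k \<in> K" "k' \<in> K" for k k'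
  proof -
    have kc: "k \<in> Cr" "k' \<in> Cr" using k K by auto
    have "k \<otimes> x \<otimes> k' \<ominus> c \<odot> (k \<otimes> k') = (k \<otimes> (x \<ominus> y) \<otimes> k') \<oplus> (k \<otimes> y \<otimes> k' \<ominus> c \<odot> (k \<otimes> k'))"
      using kc xy by (simp add: alg)
    moreover have "nm (k \<otimes> (x \<ominus> y) \<otimes> k') \<le> (nm k * d) * nm k'"
      using kc xy by (intro nm_mul_le) auto
    ultimately show ?thesis
      using c[OF k] kc xy nm_add[of "k \<otimes> (x \<ominus> y) \<otimes> k'" "k \<otimes> y \<otimes> k' \<ominus> c \<odot> (k \<otimes> k')"]
      by (simp add: algebra_simps)
  qed
  then show ?thesis unfolding apx_def by blast
qed

lemma nid_sub: "nid B K \<Longrightarrow> K \<subseteq> Cr"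
  using ideal_cl nid_ideal by blast

lemma loc_limit:
  assumes x: "x \<in> cs_closure A S" and S: "\<And>y. y \<in> S \<Longrightarrow> loc B y"
  shows "loc B x"
  unfolding loc_def
proof (intro conjI allI impI)
  show xc: "x \<in> Cr" using x closure_cl by blast
  fix e :: real assume e: "e > 0"
  then obtain y where y: "y \<in> S" "nm (x \<ominus> y) < e/2" using in_closureD[OF x, of "e/2"] by auto
  have "locally B (apx y (e/2))" "y \<in> Cr" using S[OF y(1)] e unfolding loc_def by auto
  then show "locally B (apx x e)"
    using apx_perturb[OF nid_sub, of B _ y "e/2" x "e/2"] xc y(2) by (auto elim!: locally_mono)
qed

lemma loc_zero: "loc B \<zero>"
  unfolding loc_def
proof (intro conjI allI impI)
  fix e :: real assume "e > 0"
  then have "apx \<zero> e K" if "nid B K" for K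
    unfolding apx_def using nid_sub[OF that] by (intro exI[of _ 0]) (auto simp: subset_iff)
  then show "locally B (apx \<zero> e)" unfolding locally_def by blast
qed simp

lemma loc_add: "loc B x \<Longrightarrow> loc B y \<Longrightarrow> loc B (x \<oplus> y)"
  unfolding loc_def
proof (intro conjI allI impI)
  assume x: "x \<in> Cr \<and> (\<forall>e>0. locally B (apx x e))" and y: "y \<in> Cr \<and> (\<forall>e>0. locally B (apx y e))"
  then show "x \<oplus> y \<in> Cr" by simp
  fix e :: real assume e: "e > 0"
  have "locally B (\<lambda>K. apx x (e/2) K \<and> apx y (e/2) K)"
    using x y e by (intro locally_conj) (auto intro: apx_antimono)
  then show "locally B (apx (x \<oplus> y) e)"
  proof (rule locally_mono)
    fix K assume K: "nid B K" and "apx x (e/2) K \<and> apx y (e/2) K"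
    then obtain c d where c: "\<And>k k'. k \<in> K \<Longrightarrow> k' \<in> K \<Longrightarrow> nm (k \<otimes> x \<otimes> k' \<ominus> c \<odot> (k \<otimes> k')) \<le> e/2 * nm k * nm k'"
      and d: "\<And>k k'. k \<in> K \<Longrightarrow> k' \<in> K \<Longrightarrow> nm (k \<otimes> y \<otimes> k' \<ominus> d \<odot> (k \<otimes> k')) \<le> e/2 * nm k * nm k'"
      unfolding apx_def by blast
    have "nm (k \<otimes> (x \<oplus> y) \<otimes> k' \<ominus> (c + d) \<odot> (k \<otimes> k')) \<le> e * nm k * nm k'" if k: "k \<in> K" "k' \<in> K" for k k'
    proof -
      have kc: "k \<in> Cr" "k' \<in> Cr" using k nid_sub[OF K] by auto
      have "k \<otimes> (x \<oplus> y) \<otimes> k' \<ominus> (c + d) \<odot> (k \<otimes> k')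
        = (k \<otimes> x \<otimes> k' \<ominus> c \<odot> (k \<otimes> k')) \<oplus> (k \<otimes> y \<otimes> k' \<ominus> d \<odot> (k \<otimes> k'))"
        using kc x y by (simp add: alg add_sm)
      then show ?thesis
        using c[OF k] d[OF k] kc x y
          nm_add[of "k \<otimes> x \<otimes> k' \<ominus> c \<odot> (k \<otimes> k')" "k \<otimes> y \<otimes> k' \<ominus> d \<odot> (k \<otimes> k')"] by simp
    qed
    then show "apx (x \<oplus> y) e K" unfolding apx_def by blast
  qed
qed

lemma loc_sm: "loc B x \<Longrightarrow> loc B (a \<odot> x)"
  unfolding loc_def
proof (intro conjI allI impI)
  assume x: "x \<in> Cr \<and> (\<forall>e>0. locally B (apx x e))"
  then show "a \<odot> x \<in> Cr" by simp
  fix e :: real assume e: "e > 0"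
  have e': "e / (cmod a + 1) > 0" using e by (rule scale_eps) simp
  have "locally B (apx x (e / (cmod a + 1)))" using x e' by blast
  then show "locally B (apx (a \<odot> x) e)"
  proof (rule locally_mono)
    fix K assume K: "nid B K" and "apx x (e / (cmod a + 1)) K"
    then obtain c where c: "\<And>k k'. k \<in> K \<Longrightarrow> k' \<in> K \<Longrightarrow> nm (k \<otimes> x \<otimes> k' \<ominus> c \<odot> (k \<otimes> k')) \<le> e / (cmod a + 1) * nm k * nm k'"
      unfolding apx_def by blast
    have "nm (k \<otimes> (a \<odot> x) \<otimes> k' \<ominus> (a * c) \<odot> (k \<otimes> k')) \<le> e * nm k * nm k'" if k: "k \<in> K" "k' \<in> K" for k k'
    proof -
      have kc: "k \<in> Cr" "k' \<in> Cr" using k nid_sub[OF K] by auto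
      have "k \<otimes> (a \<odot> x) \<otimes> k' \<ominus> (a * c) \<odot> (k \<otimes> k') = a \<odot> (k \<otimes> x \<otimes> k' \<ominus> c \<odot> (k \<otimes> k'))"
        using kc x by (simp add: sm_mul mul_sm sm_diff sm_mult)
      then have "nm (k \<otimes> (a \<odot> x) \<otimes> k' \<ominus> (a * c) \<odot> (k \<otimes> k')) \<le> cmod a * (e / (cmod a + 1) * nm k * nm k')"
        using mult_left_mono[OF c[OF k], of "cmod a"] kc x by (simp add: nm_sm)
      also have "\<dots> = (cmod a * (e / (cmod a + 1))) * (nm k * nm k')" by simp
      also have "\<dots> \<le> e * (nm k * nm k')"
        using scale_eps(2)[OF e, of "cmod a"] kc by (intro mult_right_mono) auto
      finally show ?thesis by (simp add: mult.assoc)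
    qed
    then show "apx (a \<odot> x) e K" unfolding apx_def by blast
  qed
qed

text \<open>In the first alternative of the dichotomy the scalar is 0. In the second,
  \<open>v\<close> times a local unit \<open>bu h\<close> lies in the relative commutant, where
  \<open>local_approx\<close> supplies a scalar; on the ideal where \<open>bu h\<close> acts as a
  unit this product and \<open>v\<close> have the same compressions.\<close>

lemma loc_normalizer:
  assumes B: "cs_subalg A B" "cs_abelian A B" and S: "cs_subalg A S" "B \<subseteq> S"
    and E: "cs_abelian A (S \<inter> relcomm A B)" "iip A (S \<inter> relcomm A B) B"
    and v: "v \<in> normalizers A B" "v \<in> S"
  shows "loc B v"
  unfolding loc_def
proof (intro conjI allI impI)
  show vc: "v \<in> Cr" by (rule normalizersD(1)[OF v(1)])
  note Bc = subalg_cl[OF B(1)]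
  fix e :: real assume e: "e > 0"
  show "locally B (apx v e)"
    unfolding locally_def
  proof (intro allI impI)
    fix K assume K: "nid B K"
    note Ki = nid_ideal[OF K]
    from B v(1) K show "\<exists>K'. nid B K' \<and> K' \<subseteq> K \<and> apx v e K'"
    proof (cases rule: normalizer_dichotomy)
      case (1 K')
      have "nm (k \<otimes> v \<otimes> k' \<ominus> 0 \<odot> (k \<otimes> k')) \<le> e * nm k * nm k'" if k: "k \<in> K'" "k' \<in> K'" for k k'
        using 1(3)[OF k] k nid_sub[OF 1(1)] e by (auto simp: subset_iff)
      then show ?thesis using 1(1,2) unfolding apx_def by blast
    next
      case 2
      obtain h where h: "h \<in> K" "sa h" "h \<noteq> \<zero>" using nid_sa_ex[OF B(1) K] by blast
      note hh = h(2,3)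
      let ?u = "bu h"
      have uK: "?u \<in> K" by (rule bu_ideal[OF hh Ki h(1)])
      then have uB: "?u \<in> B" by (rule ideal_sub[OF Ki])
      have uc: "?u \<in> Cr" by (rule Bc[OF uB])
      have BE: "B \<subseteq> S \<inter> relcomm A B" using S(2) B Bc unfolding relcomm_def cs_abelian_def by auto
      have "v \<otimes> ?u \<in> S \<inter> relcomm A B"
        using subalg_ops(3)[OF S(1) v(2)] uB S(2) vc uc 2[OF _ uK] unfolding relcomm_def by auto
      from local_approx[OF B rel_subalg[OF S(1) B(1)] E(1) BE E(2) this e]
      have l: "locally B (\<lambda>K. \<exists>c. \<forall>k\<in>K. nm ((v \<otimes> ?u \<ominus> c \<odot> \<one>) \<otimes> k) \<le> e * nm k)" .
      have K2: "nid B {k\<in>K. k \<otimes> ?u = k}" by (rule bump_ideal[OF B Ki h])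
      obtain K' where K': "nid B K'" "K' \<subseteq> {k\<in>K. k \<otimes> ?u = k}" "\<exists>c. \<forall>k\<in>K'. nm ((v \<otimes> ?u \<ominus> c \<odot> \<one>) \<otimes> k) \<le> e * nm k"
        by (rule locallyE[OF l K2])
      then obtain c where c: "\<And>k. k \<in> K' \<Longrightarrow> nm ((v \<otimes> ?u \<ominus> c \<odot> \<one>) \<otimes> k) \<le> e * nm k" by blast
      have "nm (k \<otimes> v \<otimes> k' \<ominus> c \<odot> (k \<otimes> k')) \<le> e * nm k * nm k'" if k: "k \<in> K'" "k' \<in> K'" for k k'
      proof -
        have kc: "k \<in> Cr" "k' \<in> Cr" using k nid_sub[OF K'(1)] by auto
        have "k' \<in> B" by (rule ideal_sub[OF nid_ideal[OF K'(1)] k(2)])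
        then have "?u \<otimes> k' = k'" using K'(2) k abelianD[OF B(2) uB] by auto
        then have "k \<otimes> v \<otimes> k' \<ominus> c \<odot> (k \<otimes> k') = k \<otimes> ((v \<otimes> ?u \<ominus> c \<odot> \<one>) \<otimes> k')"
          using kc vc uc by (simp add: alg)
        also have "nm \<dots> \<le> nm k * (e * nm k')" by (rule nm_mul_le) (use c[OF k(2)] kc vc uc in auto)
        finally show ?thesis by (simp add: mult_ac)
      qed
      then have "apx v e K'" unfolding apx_def by blast
      then show ?thesis using K' by blast
    qed
  qed
qed

lemma loc_regular:
  assumes B: "cs_subalg A B" "cs_abelian A B" and S: "cs_subalg A S" "B \<subseteq> S"
    and E: "cs_abelian A (S \<inter> relcomm A B)" "iip A (S \<inter> relcomm A B) B"
    and reg: "cs_closure A (cs_span A (S \<inter> normalizers A B)) = S" and x: "x \<in> S"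
  shows "loc B x"
proof (rule loc_limit[of x "cs_span A (S \<inter> normalizers A B)"])
  show "x \<in> cs_closure A (cs_span A (S \<inter> normalizers A B))" using reg x by simp
  fix y assume "y \<in> cs_span A (S \<inter> normalizers A B)"
  then show "loc B y"
    by (induction rule: cs_span.induct) (auto intro: loc_zero loc_add loc_sm loc_normalizer[OF B S E])
qed

text \<open>Restricting to \<open>B\<close> and returning through a local unit turns an ideal of \<open>D\<close> on which
  something holds into one of the same kind, since \<open>B\<close> is essential in \<open>D\<close>.\<close>
lemma extend_ideal:
  assumes B: "cs_subalg A B" and D: "cs_subalg A D" "cs_abelian A D" and BD: "B \<subseteq> D" "iip A D B"
    and K: "nid D K" and loc: "locally B P"
  obtains K' h where "nid B K'" "P K'" "h \<in> K'" "sa h" "h \<noteq> \<zero>" "K' \<subseteq> K" "nid D {k\<in>D. k \<otimes> bu h = k}" "{k\<in>D. k \<otimes> bu h = k} \<subseteq> K"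
    "bu h \<in> K'"
proof -
  note Ki = nid_ideal[OF K]
  have "nid B (K \<inter> B)"
    using ideal_Int[OF Ki B BD(1)] BD(2) K Ki unfolding iip_def nid_def by blast
  then obtain K' where K': "nid B K'" "K' \<subseteq> K \<inter> B" "P K'" using locallyE[OF loc] by blast
  obtain h where h: "h \<in> K'" "sa h" "h \<noteq> \<zero>" using nid_sa_ex[OF B K'(1)] by blast
  have u: "bu h \<in> K'" by (rule bu_ideal[OF h(2,3) nid_ideal[OF K'(1)] h(1)])
  have "h \<in> D" using h K' BD by blast
  then have "nid D {k\<in>D. k \<otimes> bu h = k}"
    by (intro bump_ideal[OF D subalg_self_ideal[OF D(1)] _ h(2,3)])
  moreover have "{k\<in>D. k \<otimes> bu h = k} \<subseteq> K"
  proof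
    fix k assume "k \<in> {k\<in>D. k \<otimes> bu h = k}"
    moreover have "bu h \<in> K" using u K' by blast
    ultimately show "k \<in> K" using ideal_ops(4)[OF Ki] by (metis (mono_tags, lifting) mem_Collect_eq)
  qed
  ultimately show ?thesis using that K' h u by blast
qed

text \<open>Since \<open>k = k \<otimes> bu h\<close> and \<open>k' = bu h \<otimes> k'\<close>,
  every compression factors through the one by \<open>bu h\<close>, so a single estimate
  suffices.\<close>

lemma sandwich:
  assumes D: "cs_subalg A D" "cs_abelian A D" and h: "sa h" "h \<noteq> \<zero>" "bu h \<in> D"
    and k: "k \<in> D" "k \<otimes> bu h = k" "k' \<in> D" "k' \<otimes> bu h = k'"
    and z: "z \<in> Cr" "nm (bu h \<otimes> z \<otimes> bu h) \<le> e"
  shows "nm (k \<otimes> z \<otimes> k') \<le> e * nm k * nm k'"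
proof -
  note Dc = subalg_cl[OF D(1)]
  have kc: "k \<in> Cr" "k' \<in> Cr" "bu h \<in> Cr" using k h Dc by auto
  have "bu h \<otimes> k' = k'" using abelianD[OF D(2) h(3) k(3)] k by simp
  then have "k \<otimes> z \<otimes> k' = (k \<otimes> bu h) \<otimes> z \<otimes> (bu h \<otimes> k')" using k by simp
  also have "\<dots> = k \<otimes> (bu h \<otimes> z \<otimes> bu h) \<otimes> k'" using kc z by (simp add: mul_assoc)
  also have "nm \<dots> \<le> (nm k * e) * nm k'" using kc z by (intro nm_mul_le) auto
  finally show ?thesis by (simp add: mult_ac)
qed

text \<open>An ideal of \<open>B\<close> need not be an ideal of \<open>D\<close>. The estimate is
  used only at the element \<open>bu h\<close> of \<open>B\<close> and spread by
  \<open>sandwich\<close> to the ideal of \<open>D\<close> on which this element acts as a unit,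
  with the same scalar.\<close>

lemma loc_extend:
  assumes B: "cs_subalg A B" and D: "cs_subalg A D" "cs_abelian A D" and BD: "B \<subseteq> D" "iip A D B"
    and x: "loc B x"
  shows "loc D x"
  unfolding loc_def
proof (intro conjI allI impI)
  show xc: "x \<in> Cr" using x by (simp add: loc_def)
  fix e :: real assume e: "e > 0"
  then have l: "locally B (apx x e)" using x by (simp add: loc_def)
  show "locally D (apx x e)"
    unfolding locally_def
  proof (intro allI impI)
    fix K assume K: "nid D K"
    from extend_ideal[OF B D BD K l] obtain K' h where K': "nid B K'" "apx x e K'" "h \<in> K'" "sa h" "h \<noteq> \<zero>" "K' \<subseteq> K"
      "nid D {k\<in>D. k \<otimes> bu h = k}" "{k\<in>D. k \<otimes> bu h = k} \<subseteq> K" "bu h \<in> K'" .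
    let ?u = "bu h"
    obtain c where c: "nm (?u \<otimes> x \<otimes> ?u \<ominus> c \<odot> (?u \<otimes> ?u)) \<le> e * nm ?u * nm ?u"
      using K'(2,9) unfolding apx_def by blast
    have uc: "?u \<in> Cr" and uD: "?u \<in> D" using K'(9) ideal_sub[OF nid_ideal[OF K'(1)]] BD subalg_cl[OF B] by auto
    have "e * nm ?u * nm ?u \<le> e * 1 * 1"
      using bu_norm[OF K'(4,5)] e uc by (intro mult_mono) auto
    moreover have "?u \<otimes> x \<otimes> ?u \<ominus> c \<odot> (?u \<otimes> ?u) = ?u \<otimes> (x \<ominus> c \<odot> \<one>) \<otimes> ?u" using uc xc by (simp add: alg)
    ultimately have ue: "nm (?u \<otimes> (x \<ominus> c \<odot> \<one>) \<otimes> ?u) \<le> e" using c by simp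
    have "nm (k \<otimes> x \<otimes> k' \<ominus> c \<odot> (k \<otimes> k')) \<le> e * nm k * nm k'"
      if k: "k \<in> {k\<in>D. k \<otimes> bu h = k}" "k' \<in> {k\<in>D. k \<otimes> bu h = k}" for k k'
    proof -
      have kc: "k \<in> Cr" "k' \<in> Cr" using k subalg_cl[OF D(1)] by auto
      have "k \<otimes> x \<otimes> k' \<ominus> c \<odot> (k \<otimes> k') = k \<otimes> (x \<ominus> c \<odot> \<one>) \<otimes> k'" using kc xc by (simp add: alg)
      then show ?thesis using sandwich[OF D K'(4,5) uD _ _ _ _ _ ue] k xc by simp
    qed
    then have "apx x e {k\<in>D. k \<otimes> bu h = k}" unfolding apx_def by blast
    then show "\<exists>K'. nid D K' \<and> K' \<subseteq> K \<and> apx x e K'" using K' by blast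
  qed
qed

text \<open>Locally scalar with scalar 0. The relation that \<open>x \<ominus> d\<close> is locally
  zero, for \<open>d\<close> in the subalgebra, expresses that \<open>d\<close> is the expectation
  of \<open>x\<close>.\<close>

definition lz :: "'a set \<Rightarrow> 'a \<Rightarrow> bool" where
  "lz B z \<longleftrightarrow> z \<in> Cr \<and> (\<forall>e>0. locally B (\<lambda>K. \<forall>k\<in>K. \<forall>k'\<in>K. nm (k \<otimes> z \<otimes> k') \<le> e * nm k * nm k'))"

lemma lz_extend:
  assumes B: "cs_subalg A B" and D: "cs_subalg A D" "cs_abelian A D" and BD: "B \<subseteq> D" "iip A D B"
    and x: "lz B x"
  shows "lz D x"
  unfolding lz_def
proof (intro conjI allI impI)
  show xc: "x \<in> Cr" using x by (simp add: lz_def)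
  fix e :: real assume e: "e > 0"
  then have l: "locally B (\<lambda>K. \<forall>k\<in>K. \<forall>k'\<in>K. nm (k \<otimes> x \<otimes> k') \<le> e * nm k * nm k')" using x by (simp add: lz_def)
  show "locally D (\<lambda>K. \<forall>k\<in>K. \<forall>k'\<in>K. nm (k \<otimes> x \<otimes> k') \<le> e * nm k * nm k')"
    unfolding locally_def
  proof (intro allI impI)
    fix K assume K: "nid D K"
    from extend_ideal[OF B D BD K l] obtain K' h where K': "nid B K'" "\<forall>k\<in>K'. \<forall>k'\<in>K'. nm (k \<otimes> x \<otimes> k') \<le> e * nm k * nm k'"
      "h \<in> K'" "sa h" "h \<noteq> \<zero>" "K' \<subseteq> K"
      "nid D {k\<in>D. k \<otimes> bu h = k}" "{k\<in>D. k \<otimes> bu h = k} \<subseteq> K" "bu h \<in> K'" .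
    let ?u = "bu h"
    have uc: "?u \<in> Cr" and uD: "?u \<in> D" using K'(9) ideal_sub[OF nid_ideal[OF K'(1)]] BD subalg_cl[OF B] by auto
    have "e * nm ?u * nm ?u \<le> e * 1 * 1"
      using bu_norm[OF K'(4,5)] e uc by (intro mult_mono) auto
    moreover have "nm (?u \<otimes> x \<otimes> ?u) \<le> e * nm ?u * nm ?u" using K'(2,9) by blast
    ultimately have "nm (?u \<otimes> x \<otimes> ?u) \<le> e" by simp
    then have "\<forall>k\<in>{k\<in>D. k \<otimes> bu h = k}. \<forall>k'\<in>{k\<in>D. k \<otimes> bu h = k}. nm (k \<otimes> x \<otimes> k') \<le> e * nm k * nm k'"
      using sandwich[OF D K'(4,5) uD _ _ _ _ xc] by blast
    then show "\<exists>K'. nid D K' \<and> K' \<subseteq> K \<and> (\<forall>k\<in>K'. \<forall>k'\<in>K'. nm (k \<otimes> x \<otimes> k') \<le> e * nm k * nm k')" using K' by blast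
  qed
qed

lemma lz_limit:
  assumes x: "x \<in> Cr" and S: "\<And>e. e > 0 \<Longrightarrow> \<exists>y. lz B y \<and> nm (x \<ominus> y) \<le> e"
  shows "lz B x"
  unfolding lz_def
proof (intro conjI allI impI x)
  fix e :: real assume e: "e > 0"
  then obtain y where y: "lz B y" "nm (x \<ominus> y) \<le> e/2" using S[of "e/2"] by auto
  then have yc: "y \<in> Cr" by (simp add: lz_def)
  have "locally B (\<lambda>K. \<forall>k\<in>K. \<forall>k'\<in>K. nm (k \<otimes> y \<otimes> k') \<le> e/2 * nm k * nm k')"
    using y(1) e unfolding lz_def by (meson half_gt_zero)
  then show "locally B (\<lambda>K. \<forall>k\<in>K. \<forall>k'\<in>K. nm (k \<otimes> x \<otimes> k') \<le> e * nm k * nm k')"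
  proof (rule locally_mono, intro ballI)
    fix K k k' assume K: "nid B K" and *: "\<forall>k\<in>K. \<forall>k'\<in>K. nm (k \<otimes> y \<otimes> k') \<le> e/2 * nm k * nm k'" and k: "k \<in> K" "k' \<in> K"
    have kc: "k \<in> Cr" "k' \<in> Cr" using k nid_sub[OF K] by auto
    have "k \<otimes> x \<otimes> k' = k \<otimes> (x \<ominus> y) \<otimes> k' \<oplus> k \<otimes> y \<otimes> k'" using kc x yc by (simp add: alg)
    moreover have "nm (k \<otimes> (x \<ominus> y) \<otimes> k') \<le> (nm k * (e/2)) * nm k'"
      using kc x yc y(2) by (intro nm_mul_le) auto
    ultimately show "nm (k \<otimes> x \<otimes> k') \<le> e * nm k * nm k'"
      using bspec[OF bspec[OF * k(1)] k(2)] kc x yc nm_add[of "k \<otimes> (x \<ominus> y) \<otimes> k'" "k \<otimes> y \<otimes> k'"]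
      by (simp add: algebra_simps)
  qed
qed

lemma lz_zero: "lz B \<zero>"
  unfolding lz_def
proof (intro conjI allI impI)
  fix e :: real assume "e > 0"
  then show "locally B (\<lambda>K. \<forall>k\<in>K. \<forall>k'\<in>K. nm (k \<otimes> \<zero> \<otimes> k') \<le> e * nm k * nm k')"
    unfolding locally_def using nid_sub by (fastforce simp: subset_iff)
qed simp

lemma lz_add: "lz B x \<Longrightarrow> lz B y \<Longrightarrow> lz B (x \<oplus> y)"
  unfolding lz_def
proof (intro conjI allI impI)
  let ?P = "\<lambda>x e K. \<forall>k\<in>K. \<forall>k'\<in>K. nm (k \<otimes> x \<otimes> k') \<le> e * nm k * nm k'"
  assume x: "x \<in> Cr \<and> (\<forall>e>0. locally B (?P x e))" and y: "y \<in> Cr \<and> (\<forall>e>0. locally B (?P y e))"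
  then show "x \<oplus> y \<in> Cr" by simp
  fix e :: real assume e: "e > 0"
  have "locally B (?P x (e/2))" "locally B (?P y (e/2))"
    using x y e by (meson half_gt_zero)+
  then have "locally B (\<lambda>K. ?P x (e/2) K \<and> ?P y (e/2) K)"
    by (rule locally_conj) blast
  then show "locally B (?P (x \<oplus> y) e)"
  proof (rule locally_mono, intro ballI)
    fix K k k' assume K: "nid B K" and *: "?P x (e/2) K \<and> ?P y (e/2) K" and k: "k \<in> K" "k' \<in> K"
    have kc: "k \<in> Cr" "k' \<in> Cr" using k nid_sub[OF K] by auto
    have "k \<otimes> (x \<oplus> y) \<otimes> k' = k \<otimes> x \<otimes> k' \<oplus> k \<otimes> y \<otimes> k'" using kc x y by (simp add: add_mul mul_add)
    moreover have "nm (k \<otimes> x \<otimes> k') \<le> e/2 * nm k * nm k'" "nm (k \<otimes> y \<otimes> k') \<le> e/2 * nm k * nm k'"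
      using * k by blast+
    ultimately show "nm (k \<otimes> (x \<oplus> y) \<otimes> k') \<le> e * nm k * nm k'"
      using kc x y nm_add[of "k \<otimes> x \<otimes> k'" "k \<otimes> y \<otimes> k'"] by simp
  qed
qed

lemma lz_mult:
  assumes D: "cs_subalg A D" "cs_abelian A D" and x: "lz D x" and d: "d \<in> D" "d' \<in> D"
  shows "lz D (d \<otimes> x \<otimes> d')"
  unfolding lz_def
proof (intro conjI allI impI)
  note Dc = subalg_cl[OF D(1)]
  have xc [simp]: "x \<in> Cr" using x by (simp add: lz_def)
  have [simp]: "d \<in> Cr" "d' \<in> Cr" using d Dc by auto
  show "d \<otimes> x \<otimes> d' \<in> Cr" by simp
  fix e :: real assume e: "e > 0"
  define e' where "e' = e / (nm d * nm d' + 1)"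
  have e': "e' > 0" "nm d * nm d' * e' \<le> e"
    using scale_eps[OF e, of "nm d * nm d'"] by (auto simp: e'_def)
  then have "locally D (\<lambda>K. \<forall>k\<in>K. \<forall>k'\<in>K. nm (k \<otimes> x \<otimes> k') \<le> e' * nm k * nm k')"
    using x by (simp add: lz_def)
  then show "locally D (\<lambda>K. \<forall>k\<in>K. \<forall>k'\<in>K. nm (k \<otimes> (d \<otimes> x \<otimes> d') \<otimes> k') \<le> e * nm k * nm k')"
  proof (rule locally_mono, intro ballI)
    fix K k k' assume K: "nid D K" and *: "\<forall>k\<in>K. \<forall>k'\<in>K. nm (k \<otimes> x \<otimes> k') \<le> e' * nm k * nm k'" and k: "k \<in> K" "k' \<in> K"
    have kc: "k \<in> Cr" "k' \<in> Cr" using k nid_sub[OF K] by auto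
    have kd: "k \<otimes> d \<in> K" "d' \<otimes> k' \<in> K" using ideal_ops[OF nid_ideal[OF K]] k d by auto
    have "nm (k \<otimes> (d \<otimes> x \<otimes> d') \<otimes> k') = nm ((k \<otimes> d) \<otimes> x \<otimes> (d' \<otimes> k'))" using kc by (simp add: mul_assoc)
    also have "\<dots> \<le> e' * nm (k \<otimes> d) * nm (d' \<otimes> k')" using * kd by blast
    also have "\<dots> \<le> e' * (nm k * nm d) * (nm d' * nm k')"
      using e' kc nm_mul[of k d] nm_mul[of d' k'] by (intro mult_mono) auto
    also have "\<dots> = (nm d * nm d' * e') * (nm k * nm k')" by simp
    also have "\<dots> \<le> e * (nm k * nm k')" using e' kc by (intro mult_right_mono) auto
    finally show "nm (k \<otimes> (d \<otimes> x \<otimes> d') \<otimes> k') \<le> e * nm k * nm k'" by (simp add: mult.assoc)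
  qed
qed

lemma lz_sm: "lz B x \<Longrightarrow> lz B (a \<odot> x)"
  unfolding lz_def
proof (intro conjI allI impI)
  assume x: "x \<in> Cr \<and> (\<forall>e>0. locally B (\<lambda>K. \<forall>k\<in>K. \<forall>k'\<in>K. nm (k \<otimes> x \<otimes> k') \<le> e * nm k * nm k'))"
  then show "a \<odot> x \<in> Cr" by simp
  fix e :: real assume e: "e > 0"
  define e' where "e' = e / (cmod a + 1)"
  have e': "e' > 0" "cmod a * e' \<le> e"
    using scale_eps[OF e, of "cmod a"] by (auto simp: e'_def)
  have "locally B (\<lambda>K. \<forall>k\<in>K. \<forall>k'\<in>K. nm (k \<otimes> x \<otimes> k') \<le> e' * nm k * nm k')" using x e' by blast
  then show "locally B (\<lambda>K. \<forall>k\<in>K. \<forall>k'\<in>K. nm (k \<otimes> (a \<odot> x) \<otimes> k') \<le> e * nm k * nm k')"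
  proof (rule locally_mono, intro ballI)
    fix K k k' assume K: "nid B K" and *: "\<forall>k\<in>K. \<forall>k'\<in>K. nm (k \<otimes> x \<otimes> k') \<le> e' * nm k * nm k'" and k: "k \<in> K" "k' \<in> K"
    have kc: "k \<in> Cr" "k' \<in> Cr" using k nid_sub[OF K] by auto
    have "nm (k \<otimes> (a \<odot> x) \<otimes> k') = cmod a * nm (k \<otimes> x \<otimes> k')" using kc x by (simp add: mul_sm sm_mul nm_sm)
    also have "\<dots> \<le> cmod a * (e' * nm k * nm k')" using * k by (intro mult_left_mono) auto
    also have "\<dots> = (cmod a * e') * (nm k * nm k')" by simp
    also have "\<dots> \<le> e * (nm k * nm k')" using e' kc by (intro mult_right_mono) auto
    finally show "nm (k \<otimes> (a \<odot> x) \<otimes> k') \<le> e * nm k * nm k'" by (simp add: mult.assoc)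
  qed
qed

lemma lz_diff: "lz B x \<Longrightarrow> lz B y \<Longrightarrow> lz B (x \<ominus> y)"
  unfolding cs_diff_def by (intro lz_add lz_sm)

text \<open>A local unit placed on the left moves across \<open>z\<close> and is absorbed by
  \<open>k\<close>, which turns the two-sided estimate into a one-sided one.\<close>

lemma lz_commuting:
  assumes D: "cs_subalg A D" "cs_abelian A D" and z: "lz D z" "\<And>d. d \<in> D \<Longrightarrow> z \<otimes> d = d \<otimes> z" and e: "e > 0"
  shows "locally D (\<lambda>K. \<forall>k\<in>K. nm (z \<otimes> k) \<le> e * nm k)"
  unfolding locally_def
proof (intro allI impI)
  note Dc = subalg_cl[OF D(1)]
  have zc: "z \<in> Cr" using z by (simp add: lz_def)
  fix K assume "nid D K"
  then obtain K' where K': "nid D K'" "K' \<subseteq> K" "\<forall>k\<in>K'. \<forall>k'\<in>K'. nm (k \<otimes> z \<otimes> k') \<le> e * nm k * nm k'"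
    using z(1) e unfolding lz_def locally_def by meson
  note Ki = nid_ideal[OF K'(1)]
  obtain h where h: "h \<in> K'" "sa h" "h \<noteq> \<zero>" using nid_sa_ex[OF D(1) K'(1)] by blast
  have uK: "bu h \<in> K'" by (rule bu_ideal[OF h(2,3) Ki h(1)])
  have uD: "bu h \<in> D" by (rule ideal_sub[OF Ki uK])
  have uc: "bu h \<in> Cr" by (rule Dc[OF uD])
  have "nm (z \<otimes> k) \<le> e * nm k" if k: "k \<in> K'" "k \<otimes> bu h = k" for k
  proof -
    have kD: "k \<in> D" by (rule ideal_sub[OF Ki k(1)])
    have kc: "k \<in> Cr" by (rule Dc[OF kD])
    have "z \<otimes> k = z \<otimes> (bu h \<otimes> k)" using abelianD[OF D(2) kD uD] k by simp
    also have "\<dots> = bu h \<otimes> z \<otimes> k" using z(2)[OF uD] zc uc kc by (simp flip: mul_assoc)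
    finally have "nm (z \<otimes> k) \<le> e * nm (bu h) * nm k" using K'(3) uK k by simp
    also have "\<dots> \<le> e * 1 * nm k" using bu_norm[OF h(2,3)] e kc by (intro mult_right_mono mult_left_mono) auto
    finally show ?thesis by simp
  qed
  then show "\<exists>K'. nid D K' \<and> K' \<subseteq> K \<and> (\<forall>k\<in>K'. nm (z \<otimes> k) \<le> e * nm k)"
    using bump_ideal[OF D Ki h] K'(2) by (intro exI[of _ "{k\<in>K'. k \<otimes> bu h = k}"]) auto
qed

text \<open>The difference of two candidates is locally zero and lies in the abelian algebra
  \<open>D\<close>, so it is locally small in the one-sided sense and vanishes.\<close>

lemma lz_unique:
  assumes D: "cs_subalg A D" "cs_abelian A D" and d: "d \<in> D" "d' \<in> D" and z: "lz D (x \<ominus> d)" "lz D (x \<ominus> d')" "x \<in> Cr"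
  shows "d = d'"
proof -
  note Dc = subalg_cl[OF D(1)]
  have dc: "d \<in> Cr" "d' \<in> Cr" using d Dc by auto
  have "(x \<ominus> d') \<ominus> (x \<ominus> d) = d \<ominus> d'" using dc z(3) by (simp add: alg)
  then have l: "lz D (d \<ominus> d')" using lz_diff[OF z(2,1)] by simp
  have dD: "d \<ominus> d' \<in> D" by (rule subalg_ops(6)[OF D(1) d])
  have "d \<ominus> d' = \<zero>"
    by (rule locally_small_zero[OF D dD]) (rule lz_commuting[OF D l abelianD[OF D(2) dD]])
  then show ?thesis using dc by (simp add: diff_eq_zero)
qed

text \<open>A contractive bimodule map fixing \<open>B\<close> carries the estimate for
  \<open>k \<otimes> x \<otimes> k'\<close> to the same estimate for
  \<open>k \<otimes> F x \<otimes> k'\<close>, with the same scalar. Subtracting cancels the scalar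
  and adds the two tolerances.\<close>

lemma lz_condexp:
  assumes B: "cs_subalg A B" and S: "cs_subalg A S" "B \<subseteq> S" and x: "x \<in> S" "loc B x"
    and F: "\<And>x. x \<in> S \<Longrightarrow> F x \<in> B" "\<And>d. d \<in> B \<Longrightarrow> F d = d" "\<And>x y. x \<in> S \<Longrightarrow> y \<in> S \<Longrightarrow> F (x \<oplus> y) = F x \<oplus> F y"
      "\<And>c x. x \<in> S \<Longrightarrow> F (c \<odot> x) = c \<odot> F x" "\<And>x d d'. x \<in> S \<Longrightarrow> d \<in> B \<Longrightarrow> d' \<in> B \<Longrightarrow> F (d \<otimes> x \<otimes> d') = d \<otimes> F x \<otimes> d'"
      "\<And>x. x \<in> S \<Longrightarrow> nm (F x) \<le> nm x"
  shows "lz B (x \<ominus> F x)"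
  unfolding lz_def
proof (intro conjI allI impI)
  note Bc = subalg_cl[OF B] and Sc = subalg_cl[OF S(1)] and Bo = subalg_ops[OF B] and So = subalg_ops[OF S(1)]
  have xc: "x \<in> Cr" and Fc: "F x \<in> Cr" using x F(1) Sc Bc by auto
  then show "x \<ominus> F x \<in> Cr" by simp
  fix e :: real assume e: "e > 0"
  then have "locally B (apx x (e/2))" using x(2) by (simp add: loc_def)
  then show "locally B (\<lambda>K. \<forall>k\<in>K. \<forall>k'\<in>K. nm (k \<otimes> (x \<ominus> F x) \<otimes> k') \<le> e * nm k * nm k')"
  proof (rule locally_mono)
    fix K assume K: "nid B K" and "apx x (e/2) K"
    then obtain c where c: "\<And>k k'. k \<in> K \<Longrightarrow> k' \<in> K \<Longrightarrow> nm (k \<otimes> x \<otimes> k' \<ominus> c \<odot> (k \<otimes> k')) \<le> e/2 * nm k * nm k'"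
      unfolding apx_def by blast
    show "\<forall>k\<in>K. \<forall>k'\<in>K. nm (k \<otimes> (x \<ominus> F x) \<otimes> k') \<le> e * nm k * nm k'"
    proof (intro ballI)
      fix k k' assume k: "k \<in> K" "k' \<in> K"
      have kB: "k \<in> B" "k' \<in> B" using k ideal_sub[OF nid_ideal[OF K]] by auto
      have kc: "k \<in> Cr" "k' \<in> Cr" using kB Bc by auto
      have kS: "k \<otimes> x \<otimes> k' \<in> S" "k \<otimes> k' \<in> S" using So(3)[OF So(3)[OF subsetD[OF S(2) kB(1)] x(1)] subsetD[OF S(2) kB(2)]]
        So(3)[OF subsetD[OF S(2) kB(1)] subsetD[OF S(2) kB(2)]] by auto
      have "F (k \<otimes> x \<otimes> k' \<ominus> c \<odot> (k \<otimes> k')) = F (k \<otimes> x \<otimes> k') \<oplus> (-1) \<odot> (c \<odot> F (k \<otimes> k'))"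
        unfolding cs_diff_def using F(3,4) kS So by simp
      also have "\<dots> = k \<otimes> F x \<otimes> k' \<ominus> c \<odot> (k \<otimes> k')"
        using F(5)[OF x(1) kB] F(2)[OF Bo(3)[OF kB]] by (simp add: cs_diff_def)
      finally have "nm (k \<otimes> F x \<otimes> k' \<ominus> c \<odot> (k \<otimes> k')) \<le> e/2 * nm k * nm k'"
        using F(6)[of "k \<otimes> x \<otimes> k' \<ominus> c \<odot> (k \<otimes> k')"] kS So c[OF k] by simp
      moreover have "k \<otimes> (x \<ominus> F x) \<otimes> k' = (k \<otimes> x \<otimes> k' \<ominus> c \<odot> (k \<otimes> k')) \<ominus> (k \<otimes> F x \<otimes> k' \<ominus> c \<odot> (k \<otimes> k'))"
        using kc xc Fc by (simp add: alg)
      ultimately show "nm (k \<otimes> (x \<ominus> F x) \<otimes> k') \<le> e * nm k * nm k'"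
        using c[OF k] kc xc Fc nm_diff[of "k \<otimes> x \<otimes> k' \<ominus> c \<odot> (k \<otimes> k')" "k \<otimes> F x \<otimes> k' \<ominus> c \<odot> (k \<otimes> k')"] by simp
    qed
  qed
qed

subsection \<open>Ideals in closures of unions\<close>

text \<open>A positive \<open>h\<close> in \<open>J\<close> is approximated by a self-adjoint
  \<open>a\<close> in some \<open>S i\<close>. With
  \<open>s = (a \<ominus> h) \<otimes> bg a\<close> of norm below 1, the element
  \<open>bp a \<ominus> bp a \<otimes> s\<close> equals
  \<open>bp a \<otimes> (h \<otimes> bg a)\<close> and is in \<open>J\<close>; the Neumann series
  then puts \<open>bp a\<close> itself into \<open>J\<close>.\<close>

lemma ideal_meets:
  assumes C: "cs_subalg A C" "C \<subseteq> cs_closure A (\<Union>i\<in>I. S i)" and S: "\<And>i. i \<in> I \<Longrightarrow> cs_subalg A (S i)" "\<And>i. i \<in> I \<Longrightarrow> S i \<subseteq> C"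
    and J: "closed_ideal_in A C J" "J \<noteq> {\<zero>}"
  shows "\<exists>i\<in>I. J \<inter> S i \<noteq> {\<zero>}"
proof -
  note Cc = subalg_cl[OF C(1)] and Co = subalg_ops[OF C(1)] and Jo = ideal_ops[OF J(1)] and Jc = ideal_cl[OF J(1)]
  obtain x where x: "x \<in> J" "x \<noteq> \<zero>" using J Jo(1) by blast
  have xC: "x \<in> C" by (rule ideal_sub[OF J(1) x(1)])
  define h where "h = x\<^sup>\<star> \<otimes> x"
  have hJ: "h \<in> J" unfolding h_def by (rule Jo(4)[OF x(1) Co(5)[OF xC]])
  have hs: "sa h" "h \<noteq> \<zero>" unfolding h_def using sa_square[OF Cc[OF xC]] sq_zero[OF Cc[OF xC]] x by auto
  have hC: "h \<in> C" and hc [simp]: "h \<in> Cr" using hJ ideal_sub[OF J(1)] Jc by auto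
  have hp: "nm h > 0" by (rule bump_pos[OF hs])
  \<comment> \<open>An error of one eighth keeps \<open>nm a\<close> at least
    \<open>7/8 * nm h\<close>, and then the norm of \<open>s\<close> is at most 2/7.\<close>
  have "nm h / 8 > 0" using hp by simp
  then obtain i a0 where a0: "i \<in> I" "a0 \<in> S i" "nm (h \<ominus> a0) < nm h / 8"
    using in_closureD[of h "\<Union>i\<in>I. S i" "nm h / 8"] C(2) hC by blast
  have a0c [simp]: "a0 \<in> Cr" by (rule subalg_cl[OF S(1)[OF a0(1)] a0(2)])
  define a where "a = (1/2) \<odot> (a0 \<oplus> a0\<^sup>\<star>)"
  have aS: "a \<in> S i" unfolding a_def by (rule re_im_subalg[OF S(1)[OF a0(1)] a0(2)])
  have as: "sa a" unfolding a_def by (rule re_im(1)[OF a0c])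
  then have ac [simp]: "a \<in> Cr" by simp
  have "(1/2) \<odot> ((h \<ominus> a0) \<oplus> (h \<ominus> a0)\<^sup>\<star>) = ((1/2) \<odot> h \<oplus> (1/2) \<odot> h) \<ominus> a"
    unfolding a_def using hs by (simp add: alg)
  also have "(1/2) \<odot> h \<oplus> (1/2) \<odot> h = (1/2 + 1/2) \<odot> h" by (simp only: add_sm[OF hc])
  finally have "h \<ominus> a = (1/2) \<odot> ((h \<ominus> a0) \<oplus> (h \<ominus> a0)\<^sup>\<star>)" by simp
  then have ha: "nm (h \<ominus> a) \<le> nm h / 8"
    using a0(3) nm_add[of "h \<ominus> a0" "(h \<ominus> a0)\<^sup>\<star>"] by (simp add: nm_sm)
  then have na: "nm a \<ge> 7/8 * nm h" using nm_le_diff[OF hc ac] by simp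
  then have a0': "a \<noteq> \<zero>" using hp by auto
  note aa = as a0'
  note Si = subalg_self_ideal[OF S(1)[OF a0(1)]]
  have mem: "bp a \<in> S i" "bg a \<in> S i" using bp_ideal[OF aa Si aS] bg_ideal[OF aa Si aS] by auto
  then have memC: "bp a \<in> C" "bg a \<in> C" "a \<in> C" using S(2)[OF a0(1)] aS by auto
  then have cl [simp]: "bp a \<in> Cr" "bg a \<in> Cr" using Cc by auto
  have uc [simp]: "bu a \<in> Cr" using bu_sa[OF aa] by simp
  define s where "s = (a \<ominus> h) \<otimes> bg a"
  have sC: "s \<in> C" unfolding s_def by (intro Co memC hC)
  have "nm s \<le> nm h / 8 * (2 / nm a)"
    unfolding s_def using ha nm_minus_comm[of h a] bg_norm[OF aa] by (intro nm_mul_le) auto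
  also have "\<dots> < 1" using na hp by (simp add: divide_less_eq)
  finally have s1: "nm s < 1" .
  have "bp a = bp a \<otimes> (bu a \<otimes> bu a)" using bp_bu[OF aa] by (simp flip: mul_assoc)
  also have "\<dots> = bp a \<otimes> (a \<otimes> bg a)" by (simp only: bu_sq[OF aa])
  finally have eq: "bp a = bp a \<otimes> (a \<otimes> bg a)" .
  have "bp a \<otimes> (a \<otimes> bg a) \<ominus> bp a \<otimes> s = bp a \<otimes> (h \<otimes> bg a)" unfolding s_def by (simp add: alg)
  then have "bp a \<ominus> bp a \<otimes> s = bp a \<otimes> (h \<otimes> bg a)" using eq by simp
  also have "\<dots> \<in> J" by (rule Jo(4)[OF Jo(3)[OF hJ memC(2)] memC(1)])
  finally have pJ: "bp a \<ominus> bp a \<otimes> s \<in> J" .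
  have "bp a \<in> J"
    by (rule neumann[OF ideal_closed[OF J(1)] Jo(1,2) Jo(3)[OF _ sC] Cc[OF sC] s1 cl(1) pJ])
  then show ?thesis using mem bp_nz[OF aa] a0(1) by blast
qed

end

section \<open>Regular inclusions with locally scalar elements\<close>

context ucst
begin

lemma iipD:
  assumes "iip A X Y" "closed_ideal_in A X J" "J \<noteq> {\<zero>}" "\<zero> \<in> Y"
  shows "\<exists>x\<in>J \<inter> Y. x \<noteq> \<zero>"
proof -
  have "J \<inter> Y \<noteq> {\<zero>}" using assms(1-3) unfolding iip_def by metis
  moreover have "\<zero> \<in> J \<inter> Y" using ideal_ops(1)[OF assms(2)] assms(4) by simp
  ultimately show ?thesis by blast
qed

lemma iipI:
  assumes "\<And>J. closed_ideal_in A X J \<Longrightarrow> J \<noteq> {\<zero>} \<Longrightarrow> \<exists>x\<in>J \<inter> Y. x \<noteq> \<zero>"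
  shows "iip A X Y"
  unfolding iip_def
proof (intro allI impI notI)
  fix J assume J: "closed_ideal_in A X J \<and> J \<noteq> {\<zero>}" and "J \<inter> Y = {\<zero>}"
  then show False using assms[of J] by simp
qed

lemma span_subset:
  assumes "cs_subalg A C" "T \<subseteq> C" "x \<in> cs_span A T"
  shows "x \<in> C"
  using assms(3)
  by (induction rule: cs_span.induct) (use assms(2) subalg_ops[OF assms(1)] in auto)

lemma span_mono: "T \<subseteq> T' \<Longrightarrow> cs_span A T \<subseteq> cs_span A T'"
proof
  fix x assume "T \<subseteq> T'" "x \<in> cs_span A T"
  from this(2,1) show "x \<in> cs_span A T'"
    by (induction rule: cs_span.induct) (auto intro: cs_span.intros)
qed

lemma closure_subalg:
  assumes T: "T \<subseteq> Cr" "\<zero> \<in> T" "\<And>x y. x \<in> T \<Longrightarrow> y \<in> T \<Longrightarrow> x \<oplus> y \<in> T" "\<And>x y. x \<in> T \<Longrightarrow> y \<in> T \<Longrightarrow> x \<otimes> y \<in> T"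
    "\<And>c x. x \<in> T \<Longrightarrow> c \<odot> x \<in> T" "\<And>x. x \<in> T \<Longrightarrow> x\<^sup>\<star> \<in> T"
  shows "cs_subalg A (cs_closure A T)"
proof -
  let ?C = "cs_closure A T"
  have TC: "T \<subseteq> ?C" by (rule closure_sub[OF T(1)])
  have CC: "cs_closure A ?C = ?C" by (rule closure_closure[OF T(1)])
  have Cc: "x \<in> ?C \<Longrightarrow> x \<in> Cr" for x by (rule closure_cl)
  have Csub: "?C \<subseteq> Cr" using Cc by blast
  have 1: "x \<otimes> y \<in> ?C" if x: "x \<in> ?C" and y: "y \<in> ?C" for x y
  proof -
    have *: "z \<otimes> y \<in> ?C" if "z \<in> T" for z
      by (rule closure_blin[OF blin_mull[OF blin_id] T(1) _ y]) (use that T in auto)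
    have "x \<otimes> y \<in> cs_closure A ?C"
      by (rule closure_blin[OF blin_mulr[OF blin_id Cc[OF y]] T(1) * x])
    then show ?thesis by (simp add: CC)
  qed
  have 2: "c \<odot> x \<in> ?C" if "x \<in> ?C" for c x
    by (rule closure_blin[OF blin_sm[OF blin_id] T(1) _ that]) (rule T)
  have 3: "x\<^sup>\<star> \<in> ?C" if "x \<in> ?C" for x
    by (rule closure_blin[OF blin_star[OF blin_id] T(1) _ that]) (rule T)
  have 4: "x \<oplus> y \<in> ?C" if x: "x \<in> ?C" and y: "y \<in> ?C" for x y
  proof (rule in_closureI)
    show "x \<oplus> y \<in> Cr" using x y Cc by simp
    fix e :: real assume "e > 0"
    then obtain s t where st: "s \<in> T" "nm (x \<ominus> s) < e/2" "t \<in> T" "nm (y \<ominus> t) < e/2"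
      using in_closureD[OF x, of "e/2"] in_closureD[OF y, of "e/2"] by auto
    have cl: "s \<in> Cr" "t \<in> Cr" "x \<in> Cr" "y \<in> Cr" using st T(1) x y Cc by auto
    have "(x \<oplus> y) \<ominus> (s \<oplus> t) = (x \<ominus> s) \<oplus> (y \<ominus> t)" using cl by (simp add: alg)
    then have "nm ((x \<oplus> y) \<ominus> (s \<oplus> t)) < e" using nm_add[of "x \<ominus> s" "y \<ominus> t"] cl st by simp
    then show "\<exists>s\<in>T. nm (x \<oplus> y \<ominus> s) < e" using T(3) st by blast
  qed
  show ?thesis unfolding cs_subalg_def
    by (intro conjI ballI allI CC Csub 1 2 3 4 subsetD[OF TC T(2)])
qed

text \<open>A conditional expectation between subalgebras of the ambient algebra. Positivity is
  tracked separately through \<open>pos\<close>, because \<open>cs_positive\<close> would refer to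
  factorizations in the ambient carrier.\<close>

definition rce :: "'a set \<Rightarrow> 'a set \<Rightarrow> ('a \<Rightarrow> 'a) \<Rightarrow> bool" where
  "rce S B F \<longleftrightarrow> (\<forall>x\<in>S. F x \<in> B) \<and> (\<forall>d\<in>B. F d = d) \<and> (\<forall>x\<in>S. \<forall>y\<in>S. F (x \<oplus> y) = F x \<oplus> F y) \<and>
     (\<forall>c. \<forall>x\<in>S. F (c \<odot> x) = c \<odot> F x) \<and> (\<forall>x\<in>S. \<forall>d\<in>B. \<forall>d'\<in>B. F (d \<otimes> x \<otimes> d') = d \<otimes> F x \<otimes> d') \<and>
     (\<forall>x\<in>S. nm (F x) \<le> nm x)"

lemma rceD:
  assumes "rce S B F"
  shows "x \<in> S \<Longrightarrow> F x \<in> B" "d \<in> B \<Longrightarrow> F d = d" "x \<in> S \<Longrightarrow> y \<in> S \<Longrightarrow> F (x \<oplus> y) = F x \<oplus> F y"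
    "x \<in> S \<Longrightarrow> F (c \<odot> x) = c \<odot> F x" "x \<in> S \<Longrightarrow> d \<in> B \<Longrightarrow> d' \<in> B \<Longrightarrow> F (d \<otimes> x \<otimes> d') = d \<otimes> F x \<otimes> d'"
    "x \<in> S \<Longrightarrow> nm (F x) \<le> nm x"
  using assms unfolding rce_def by blast+

lemma rce_diff: "rce S B F \<Longrightarrow> cs_subalg A S \<Longrightarrow> x \<in> S \<Longrightarrow> y \<in> S \<Longrightarrow> F (x \<ominus> y) = F x \<ominus> F y"
  using rceD(3)[of S B F x "(-1) \<odot> y"] rceD(4)[of S B F y "-1"] subalg_ops(4)[of S y "-1"]
  by (simp add: cs_diff_def)

end

locale pci = ucst A one for A :: "'a cstar" and one ("\<one>") +
  fixes C D
  assumes C: "cs_subalg A C" and D: "cs_subalg A D" and DC: "D \<subseteq> C" and Dab: "cs_abelian A D"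
    and reg: "cs_closure A (cs_span A (C \<inter> normalizers A D)) = C"
    and iipCD: "iip A C D"
    and locC: "x \<in> C \<Longrightarrow> loc D x"
begin

lemmas Cc = subalg_cl[OF C] and Co = subalg_ops[OF C] and Dc = subalg_cl[OF D] and Do = subalg_ops[OF D]

text \<open>The analogue of the left kernel of a pseudo-expectation. One-sided smallness makes it a
  left ideal at once; stability under right multiplication is the real point and comes from
  normalizers.\<close>

definition negl :: "'a set" where
  "negl = {x\<in>C. \<forall>e>0. locally D (\<lambda>K. \<forall>k\<in>K. nm (x \<otimes> k) \<le> e * nm k)}"

lemma negl_add: "x \<in> negl \<Longrightarrow> y \<in> negl \<Longrightarrow> x \<oplus> y \<in> negl"
  unfolding negl_def
proof (intro CollectI conjI allI impI)
  let ?P = "\<lambda>x e K. \<forall>k\<in>K. nm (x \<otimes> k) \<le> e * nm k"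
  assume x: "x \<in> {x\<in>C. \<forall>e>0. locally D (?P x e)}" and y: "y \<in> {x\<in>C. \<forall>e>0. locally D (?P x e)}"
  then show "x \<oplus> y \<in> C" using Co by blast
  have xy: "x \<in> Cr" "y \<in> Cr" using x y Cc by auto
  fix e :: real assume e: "e > 0"
  have "locally D (?P x (e/2))" "locally D (?P y (e/2))"
    using x y e by (simp_all only: mem_Collect_eq half_gt_zero)
  then have "locally D (\<lambda>K. ?P x (e/2) K \<and> ?P y (e/2) K)"
    by (rule locally_conj) blast
  then show "locally D (?P (x \<oplus> y) e)"
  proof (rule locally_mono, intro ballI)
    fix K k assume K: "nid D K" and *: "?P x (e/2) K \<and> ?P y (e/2) K" and k: "k \<in> K"
    have kc: "k \<in> Cr" using k nid_sub[OF K] by auto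
    have "nm (x \<otimes> k) \<le> e/2 * nm k" "nm (y \<otimes> k) \<le> e/2 * nm k" using * k by blast+
    then show "nm ((x \<oplus> y) \<otimes> k) \<le> e * nm k"
      using kc xy nm_add[of "x \<otimes> k" "y \<otimes> k"] by (simp add: add_mul)
  qed
qed

lemma negl_zero: "\<zero> \<in> negl"
  unfolding negl_def
proof (intro CollectI conjI allI impI)
  fix e :: real assume "e > 0"
  then show "locally D (\<lambda>K. \<forall>k\<in>K. nm (\<zero> \<otimes> k) \<le> e * nm k)"
    unfolding locally_def using nid_sub by (fastforce simp: subset_iff)
qed (rule Co)

lemma negl_mull: "x \<in> negl \<Longrightarrow> a \<in> C \<Longrightarrow> a \<otimes> x \<in> negl"
  unfolding negl_def
proof (intro CollectI conjI allI impI)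
  assume x: "x \<in> {x\<in>C. \<forall>e>0. locally D (\<lambda>K. \<forall>k\<in>K. nm (x \<otimes> k) \<le> e * nm k)}" and a: "a \<in> C"
  then show "a \<otimes> x \<in> C" using Co by blast
  have xa: "x \<in> Cr" "a \<in> Cr" using x a Cc by auto
  fix e :: real assume e: "e > 0"
  define e' where "e' = e / (nm a + 1)"
  have e': "e' > 0" "nm a * e' \<le> e"
    using scale_eps[OF e, of "nm a"] xa by (auto simp: e'_def)
  have "locally D (\<lambda>K. \<forall>k\<in>K. nm (x \<otimes> k) \<le> e' * nm k)" using x e' by blast
  then show "locally D (\<lambda>K. \<forall>k\<in>K. nm (a \<otimes> x \<otimes> k) \<le> e * nm k)"
  proof (rule locally_mono, intro ballI)
    fix K k assume K: "nid D K" and *: "\<forall>k\<in>K. nm (x \<otimes> k) \<le> e' * nm k" and k: "k \<in> K"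
    have kc: "k \<in> Cr" using k nid_sub[OF K] by auto
    have "nm (a \<otimes> (x \<otimes> k)) \<le> nm a * (e' * nm k)" by (rule nm_mul_le) (use * k xa kc in auto)
    also have "\<dots> \<le> e * nm k" using e' kc mult_right_mono[OF e'(2), of "nm k"] by (simp add: mult.assoc)
    finally show "nm (a \<otimes> x \<otimes> k) \<le> e * nm k" using kc xa by (simp add: mul_assoc)
  qed
qed

lemma negl_sm: "x \<in> negl \<Longrightarrow> c \<odot> x \<in> negl"
  unfolding negl_def
proof (intro CollectI conjI allI impI)
  assume x: "x \<in> {x\<in>C. \<forall>e>0. locally D (\<lambda>K. \<forall>k\<in>K. nm (x \<otimes> k) \<le> e * nm k)}"
  then show "c \<odot> x \<in> C" using Co by blast
  have xc: "x \<in> Cr" using x Cc by auto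
  fix e :: real assume e: "e > 0"
  define e' where "e' = e / (cmod c + 1)"
  have e': "e' > 0" "cmod c * e' \<le> e"
    using scale_eps[OF e, of "cmod c"] by (auto simp: e'_def)
  have "locally D (\<lambda>K. \<forall>k\<in>K. nm (x \<otimes> k) \<le> e' * nm k)" using x e' by blast
  then show "locally D (\<lambda>K. \<forall>k\<in>K. nm (c \<odot> x \<otimes> k) \<le> e * nm k)"
  proof (rule locally_mono, intro ballI)
    fix K k assume K: "nid D K" and *: "\<forall>k\<in>K. nm (x \<otimes> k) \<le> e' * nm k" and k: "k \<in> K"
    have kc: "k \<in> Cr" using k nid_sub[OF K] by auto
    have "cmod c * nm (x \<otimes> k) \<le> cmod c * (e' * nm k)" using * k by (intro mult_left_mono) auto
    also have "\<dots> \<le> e * nm k" using e' kc mult_right_mono[OF e'(2), of "nm k"] by (simp add: mult.assoc)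
    finally show "nm (c \<odot> x \<otimes> k) \<le> e * nm k" using kc xc by (simp add: sm_mul nm_sm)
  qed
qed

lemma negl_closed: "cs_closure A negl = negl"
proof (rule closure_eqI)
  show "negl \<subseteq> Cr" unfolding negl_def using Cc by blast
  fix x assume x: "x \<in> cs_closure A negl"
  have "x \<in> C" using x closure_mono[of negl C] subalg_closed[OF C] unfolding negl_def by blast
  then have xc: "x \<in> Cr" by (rule Cc)
  have "locally D (\<lambda>K. \<forall>k\<in>K. nm (x \<otimes> k) \<le> e * nm k)" if e: "e > 0" for e
  proof -
    obtain y where y: "y \<in> negl" "nm (x \<ominus> y) < e/2" using in_closureD[OF x, of "e/2"] e by auto
    have yc: "y \<in> Cr" using y Cc unfolding negl_def by blast
    have "locally D (\<lambda>K. \<forall>k\<in>K. nm (y \<otimes> k) \<le> e/2 * nm k)" using y(1) half_gt_zero[OF e] unfolding negl_def by blast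
    then show ?thesis
    proof (rule locally_mono, intro ballI)
      fix K k assume K: "nid D K" and *: "\<forall>k\<in>K. nm (y \<otimes> k) \<le> e/2 * nm k" and k: "k \<in> K"
      have kc: "k \<in> Cr" using k nid_sub[OF K] by auto
      have "x \<otimes> k = (x \<ominus> y) \<otimes> k \<oplus> y \<otimes> k" using xc yc kc by (simp add: alg)
      moreover have "nm ((x \<ominus> y) \<otimes> k) \<le> e/2 * nm k" using xc yc kc y(2) by (intro nm_mul_le) auto
      moreover have "nm (y \<otimes> k) \<le> e/2 * nm k" using * k by blast
      ultimately show "nm (x \<otimes> k) \<le> e * nm k"
        using xc yc kc nm_add[of "(x \<ominus> y) \<otimes> k" "y \<otimes> k"] by simp
    qed
  qed
  then show "x \<in> negl" unfolding negl_def using \<open>x \<in> C\<close> by blast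
qed

text \<open>A normalizer \<open>v\<close> carries the open set \<open>K\<close> to one on which \<open>x\<close> is small somewhere; pull that back.\<close>
lemma negl_normalizer:
  assumes x: "x \<in> negl" and v: "v \<in> normalizers A D" "v \<in> C"
  shows "x \<otimes> v \<in> negl"
  unfolding negl_def
proof (intro CollectI conjI allI impI)
  have xC: "x \<in> C" using x by (simp add: negl_def)
  show "x \<otimes> v \<in> C" by (rule Co(3)[OF xC v(2)])
  have [simp]: "x \<in> Cr" "v \<in> Cr" using xC v(2) Cc by auto
  fix e :: real assume e: "e > 0"
  define b where "b = nm x * (nm v)\<^sup>2"
  have b: "b \<ge> 0" by (simp add: b_def)
  define e' where "e' = e\<^sup>2 / (b + 1)"
  have e': "e' > 0" "e' * b \<le> e\<^sup>2"
    using scale_eps[of "e\<^sup>2" b] e b by (auto simp: e'_def mult.commute)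
  show "locally D (\<lambda>K. \<forall>k\<in>K. nm (x \<otimes> v \<otimes> k) \<le> e * nm k)"
    unfolding locally_def
  proof (intro allI impI)
    fix K assume K: "nid D K"
    note Ki = nid_ideal[OF K]
    note Ko = ideal_ops[OF Ki] and Kc = ideal_cl[OF Ki] and KD = ideal_sub[OF Ki]
    show "\<exists>K'. nid D K' \<and> K' \<subseteq> K \<and> (\<forall>k\<in>K'. nm (x \<otimes> v \<otimes> k) \<le> e * nm k)"
    proof (cases "\<forall>k\<in>K. v \<otimes> k = \<zero>")
      case True
      then have "\<forall>k\<in>K. nm (x \<otimes> v \<otimes> k) \<le> e * nm k" using Kc e by (auto simp: mul_assoc)
      then show ?thesis using K by blast
    next
      case False
      then obtain k0 where k0: "k0 \<in> K" "v \<otimes> k0 \<noteq> \<zero>" by blast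
      have k0c [simp]: "k0 \<in> Cr" and k0D: "k0 \<in> D" using k0 Kc KD by auto
      define h where "h = v \<otimes> (k0 \<otimes> k0\<^sup>\<star>) \<otimes> v\<^sup>\<star>"
      have hD: "h \<in> D" unfolding h_def by (intro normalizersD(2)[OF v(1)] Do k0D)
      have "h = (v \<otimes> k0) \<otimes> (v \<otimes> k0)\<^sup>\<star>" unfolding h_def by (simp add: star_mul mul_assoc)
      then have h: "sa h" "h \<noteq> \<zero>"
        using sa_square[of "(v \<otimes> k0)\<^sup>\<star>"] cstar_id'[of "v \<otimes> k0"] nm_eq_0[of "v \<otimes> k0"] k0(2) by auto
      have G: "nid D {k\<in>D. k \<otimes> bu h = k}" by (rule bump_ideal[OF D Dab subalg_self_ideal[OF D] hD h])
      have "locally D (\<lambda>K. \<forall>k\<in>K. nm (x \<otimes> k) \<le> e' * nm k)" using x e' unfolding negl_def by blast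
      then obtain K1 where K1: "nid D K1" "K1 \<subseteq> {k\<in>D. k \<otimes> bu h = k}" "\<forall>k\<in>K1. nm (x \<otimes> k) \<le> e' * nm k"
        by (rule locallyE[OF _ G])
      note K1i = nid_ideal[OF K1(1)]
      \<comment> \<open>The members of \<open>K\<close> that \<open>v\<close> carries into
        \<open>K1\<close>. The quantifier over \<open>d\<close> makes this condition stable under
        multiplication by \<open>D\<close>.\<close>
      define K' where "K' = (\<Inter>d\<in>D. {k\<in>K. v \<otimes> (k \<otimes> d) \<otimes> v\<^sup>\<star> \<in> K1})"
      have D0: "\<zero> \<in> D" by (rule Do(1))
      have K'K: "K' \<subseteq> K" unfolding K'_def using D0 by blast
      have K'mem: "k \<in> K' \<longleftrightarrow> k \<in> K \<and> (\<forall>d\<in>D. v \<otimes> (k \<otimes> d) \<otimes> v\<^sup>\<star> \<in> K1)" for k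
        unfolding K'_def using D0 by blast
      have K'cl: "cs_closure A K' = K'"
        unfolding K'_def using D0 Dc Kc ideal_closed[OF Ki] ideal_closed[OF K1i]
        by (intro closed_Inter closed_blin_pre blin_intros) auto
      have K'r: "k \<otimes> b \<in> K'" if "k \<in> K'" "b \<in> D" for k b
        unfolding K'mem
      proof (intro conjI ballI)
        show "k \<otimes> b \<in> K" using that Ko(3) K'K by blast
        fix d assume d: "d \<in> D"
        have "v \<otimes> (k \<otimes> (b \<otimes> d)) \<otimes> v\<^sup>\<star> \<in> K1" using that Do(3)[OF that(2) d] unfolding K'mem by blast
        then show "v \<otimes> (k \<otimes> b \<otimes> d) \<otimes> v\<^sup>\<star> \<in> K1" using that Dc d K'K Kc by (simp add: mul_assoc subset_iff)
      qed
      have K'i: "closed_ideal_in A D K'"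
        unfolding closed_ideal_in_def
      proof (intro conjI ballI allI K'cl)
        show "K' \<subseteq> D" using K'K KD by blast
        show "\<zero> \<in> K'" unfolding K'mem using Ko(1) ideal_ops(1)[OF K1i] Dc by auto
        show "k \<oplus> l \<in> K'" if "k \<in> K'" "l \<in> K'" for k l
          using that Ko(2) ideal_ops(2)[OF K1i] Dc Kc unfolding K'mem by (auto simp: add_mul mul_add)
        show "c \<odot> k \<in> K'" if "k \<in> K'" for c k
          using that Ko(5) ideal_ops(5)[OF K1i] Dc Kc unfolding K'mem by (auto simp: sm_mul mul_sm)
        show "k \<otimes> b \<in> K'" if "k \<in> K'" "b \<in> D" for k b by (rule K'r[OF that])
        show "b \<otimes> k \<in> K'" if "k \<in> K'" "b \<in> D" for k b
          using K'r[OF that] abelianD[OF Dab, of k b] that K'K KD by (metis subsetD)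
      qed
      obtain f where f: "f \<in> K1" "f \<noteq> \<zero>" using nid_ex[OF K1(1)] by blast
      have fD: "f \<in> D" "f \<otimes> bu h = f" using f K1(2) by auto
      have fc [simp]: "f \<in> Cr" and uc: "bu h \<in> Cr" "bg h \<in> Cr" using Dc[OF fD(1)] bu_sa[OF h] bg_sa[OF h] by auto
      have "f = f \<otimes> (bu h \<otimes> bu h)" using fD uc by (simp flip: mul_assoc)
      also have "\<dots> = (f \<otimes> h) \<otimes> bg h" using bu_sq[OF h] uc h by (simp add: mul_assoc)
      finally have "f \<otimes> h \<noteq> \<zero>" using f(2) uc by auto
      then have fvk: "f \<otimes> v \<otimes> k0 \<noteq> \<zero>" unfolding h_def using fc by (auto simp flip: mul_assoc)
      define k where "k = v\<^sup>\<star> \<otimes> (f\<^sup>\<star> \<otimes> f) \<otimes> v \<otimes> k0"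
      have ff: "f\<^sup>\<star> \<otimes> f \<in> K1" by (rule ideal_ops(4)[OF K1i f(1) Do(5)[OF fD(1)]])
      have ffD: "f\<^sup>\<star> \<otimes> f \<in> D" by (rule ideal_sub[OF K1i ff])
      have kK: "k \<in> K" unfolding k_def by (rule Ko(4)[OF k0(1) normalizersD(3)[OF v(1) ffD]])
      have "k0\<^sup>\<star> \<otimes> k = (f \<otimes> v \<otimes> k0)\<^sup>\<star> \<otimes> (f \<otimes> v \<otimes> k0)" unfolding k_def by (simp add: star_mul mul_assoc)
      then have kn: "k \<noteq> \<zero>" using fvk sq_zero[of "f \<otimes> v \<otimes> k0"] by auto
      have "k \<in> K'"
        unfolding K'mem
      proof (intro conjI ballI kK)
        fix d assume d: "d \<in> D"
        have dc [simp]: "d \<in> Cr" by (rule Dc[OF d])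
        have "v \<otimes> (k \<otimes> d) \<otimes> v\<^sup>\<star> = ((v \<otimes> v\<^sup>\<star>) \<otimes> (f\<^sup>\<star> \<otimes> f)) \<otimes> (v \<otimes> (k0 \<otimes> d) \<otimes> v\<^sup>\<star>)"
          unfolding k_def by (simp add: mul_assoc)
        also have "(v \<otimes> v\<^sup>\<star>) \<otimes> (f\<^sup>\<star> \<otimes> f) = (f\<^sup>\<star> \<otimes> f) \<otimes> (v \<otimes> v\<^sup>\<star>)"
          using normalizer_square(2)[OF D Dab normalizers_star[OF v(1)] ffD] by simp
        also have "\<dots> \<otimes> (v \<otimes> (k0 \<otimes> d) \<otimes> v\<^sup>\<star>) = (f\<^sup>\<star> \<otimes> f) \<otimes> (v \<otimes> ((v\<^sup>\<star> \<otimes> v) \<otimes> (k0 \<otimes> d)) \<otimes> v\<^sup>\<star>)"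
          by (simp add: mul_assoc)
        also have "\<dots> \<in> K1"
          by (intro ideal_ops(3)[OF K1i ff] normalizersD(2)[OF v(1)] normalizer_square(1)[OF D Dab v(1)] Do k0D d)
        finally show "v \<otimes> (k \<otimes> d) \<otimes> v\<^sup>\<star> \<in> K1" .
      qed
      then have "nid D K'" by (rule nidI[OF K'i _ kn])
      moreover have "nm (x \<otimes> v \<otimes> l) \<le> e * nm l" if l: "l \<in> K'" for l
      proof -
        have lK: "l \<in> K" and lD: "l \<in> D" using l K'K KD by auto
        have lc [simp]: "l \<in> Cr" by (rule Dc[OF lD])
        \<comment> \<open>This lies in \<open>K1\<close>, where \<open>x\<close> is small, and
          \<open>x \<otimes> q \<otimes> x\<^sup>\<star>\<close> has the squared norm of
          \<open>x \<otimes> v \<otimes> l\<close>. Taking the square root explains the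
          \<open>e\<^sup>2\<close> in the tolerance \<open>e'\<close>.\<close>
        define q where "q = v \<otimes> (l \<otimes> l\<^sup>\<star>) \<otimes> v\<^sup>\<star>"
        have q: "q \<in> K1" using l Do(5)[OF lD] unfolding K'mem q_def by blast
        have [simp]: "q \<in> Cr" by (simp add: q_def)
        have q2: "nm q \<le> (nm v * (nm l * nm l)) * nm v"
          unfolding q_def by (intro nm_mul_le) auto
        have "(nm (x \<otimes> v \<otimes> l))\<^sup>2 = nm ((x \<otimes> q) \<otimes> x\<^sup>\<star>)"
          unfolding q_def by (subst cstar_id'[symmetric]) (simp_all add: star_mul mul_assoc)
        also have "\<dots> \<le> (e' * ((nm v * (nm l * nm l)) * nm v)) * nm x"
        proof (rule nm_mul_le)
          have "nm (x \<otimes> q) \<le> e' * nm q" using K1(3) q by blast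
          also have "\<dots> \<le> e' * ((nm v * (nm l * nm l)) * nm v)" using q2 e' by (intro mult_left_mono) auto
          finally show "nm (x \<otimes> q) \<le> e' * ((nm v * (nm l * nm l)) * nm v)" .
        qed auto
        also have "\<dots> = (e' * b) * (nm l)\<^sup>2" by (simp add: b_def power2_eq_square)
        also have "\<dots> \<le> e\<^sup>2 * (nm l)\<^sup>2" using e' by (intro mult_right_mono) auto
        finally have "(nm (x \<otimes> v \<otimes> l))\<^sup>2 \<le> (e * nm l)\<^sup>2" by (simp add: power_mult_distrib)
        then show ?thesis by (rule power2_le_imp_le) (use e in simp)
      qed
      ultimately show ?thesis using K'K by blast
    qed
  qed
qed

lemma negl_cl: "x \<in> negl \<Longrightarrow> x \<in> C"
  by (simp add: negl_def)

text \<open>Normalizers have dense span in \<open>C\<close> by regularity, and \<open>negl\<close>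
  is a closed subspace, so the case of a normalizer suffices.\<close>

lemma negl_mulr:
  assumes x: "x \<in> negl" and b: "b \<in> C"
  shows "x \<otimes> b \<in> negl"
proof -
  have xc: "x \<in> Cr" using negl_cl[OF x] Cc by blast
  have sub: "cs_span A (C \<inter> normalizers A D) \<subseteq> Cr"
    using span_subset[OF C, of "C \<inter> normalizers A D"] Cc by blast
  have "x \<otimes> y \<in> negl" if "y \<in> cs_span A (C \<inter> normalizers A D)" for y
    using that
  proof (induction rule: cs_span.induct)
    case span_zero
    then show ?case using negl_zero xc by simp
  next
    case (span_base s)
    then show ?case using negl_normalizer[OF x] by blast
  next
    case (span_add y z)
    then show ?case using negl_add[OF span_add(3,4)] sub xc by (simp add: mul_add subset_iff)
  next
    case (span_smult y c)
    then show ?case using negl_sm sub xc by (simp add: mul_sm subset_iff)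
  qed
  then have "x \<otimes> b \<in> cs_closure A negl"
    using b reg by (intro closure_blin[OF blin_mull[OF blin_id xc] sub]) auto
  then show ?thesis by (simp add: negl_closed)
qed

theorem negl_eq_0: "x \<in> negl \<Longrightarrow> x = \<zero>"
proof -
  have "closed_ideal_in A C negl"
    unfolding closed_ideal_in_def
    by (intro conjI ballI allI subsetI negl_closed negl_zero)
      (assumption | rule negl_cl negl_add negl_sm | (rule negl_mull, assumption, assumption)
        | (rule negl_mulr, assumption, assumption))+
  moreover have "d = \<zero>" if "d \<in> negl \<inter> D" for d
    by (rule locally_small_zero[OF D Dab, of d]) (use that in \<open>auto simp: negl_def\<close>)
  ultimately have "negl = {\<zero>}" using iipD[OF iipCD _ _ Do(1), of negl] by blast
  then show "x \<in> negl \<Longrightarrow> x = \<zero>" by blast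
qed

lemma lz_commuting_zero: "x \<in> C \<Longrightarrow> lz D x \<Longrightarrow> (\<And>d. d \<in> D \<Longrightarrow> x \<otimes> d = d \<otimes> x) \<Longrightarrow> x = \<zero>"
  by (rule negl_eq_0) (auto simp: negl_def intro: lz_commuting[OF D Dab])

section \<open>The relative commutant of the limit subalgebra\<close>

abbreviation "Dcom \<equiv> C \<inter> relcomm A D"

lemma Dcom_comm: "x \<in> Dcom \<Longrightarrow> d \<in> D \<Longrightarrow> x \<otimes> d = d \<otimes> x"
  by (simp add: relcomm_def)

lemma Dcom_cl: "x \<in> Dcom \<Longrightarrow> x \<in> Cr"
  by (simp add: relcomm_def)

lemma D_Dcom: "D \<subseteq> Dcom"
  using DC Dc abelianD[OF Dab] unfolding relcomm_def by blast

text \<open>For \<open>x\<close> commuting with \<open>D\<close>, the left factor in the compression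
  can be taken to be a local unit, moved across \<open>x\<close> and absorbed. The scalar from
  \<open>apx\<close> then approximates \<open>x\<close> from one side.\<close>

lemma Dcom_scalar:
  assumes x: "x \<in> Dcom" and e: "e > 0"
  shows "locally D (\<lambda>K. \<exists>c. \<forall>k\<in>K. nm ((x \<ominus> c \<odot> \<one>) \<otimes> k) \<le> e * nm k)"
  unfolding locally_def
proof (intro allI impI)
  have xc [simp]: "x \<in> Cr" by (rule Dcom_cl[OF x])
  fix K assume K: "nid D K"
  have "locally D (apx x e)" using locC x e unfolding loc_def by blast
  then obtain K' where K': "nid D K'" "K' \<subseteq> K" "apx x e K'" by (rule locallyE[OF _ K])
  note Ki = nid_ideal[OF K'(1)]
  obtain h where h: "h \<in> K'" "sa h" "h \<noteq> \<zero>" using nid_sa_ex[OF D K'(1)] by blast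
  have uK: "bu h \<in> K'" by (rule bu_ideal[OF h(2,3) Ki h(1)])
  have uD: "bu h \<in> D" by (rule ideal_sub[OF Ki uK])
  have uc [simp]: "bu h \<in> Cr" by (rule Dc[OF uD])
  obtain c where c: "\<And>k k'. k \<in> K' \<Longrightarrow> k' \<in> K' \<Longrightarrow> nm (k \<otimes> x \<otimes> k' \<ominus> c \<odot> (k \<otimes> k')) \<le> e * nm k * nm k'"
    using K'(3) unfolding apx_def by blast
  have "nm ((x \<ominus> c \<odot> \<one>) \<otimes> k) \<le> e * nm k" if k: "k \<in> K'" "k \<otimes> bu h = k" for k
  proof -
    have kD: "k \<in> D" by (rule ideal_sub[OF Ki k(1)])
    have kc [simp]: "k \<in> Cr" by (rule Dc[OF kD])
    have uk: "bu h \<otimes> k = k" using abelianD[OF Dab kD uD] k by simp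
    have "bu h \<otimes> x \<otimes> k = x \<otimes> (bu h \<otimes> k)" using Dcom_comm[OF x uD] by (simp flip: mul_assoc)
    then have "(x \<ominus> c \<odot> \<one>) \<otimes> k = bu h \<otimes> x \<otimes> k \<ominus> c \<odot> (bu h \<otimes> k)" using uk by (simp add: diff_mul sm_mul)
    then have "nm ((x \<ominus> c \<odot> \<one>) \<otimes> k) \<le> e * nm (bu h) * nm k" using c[OF uK k(1)] by simp
    also have "\<dots> \<le> e * 1 * nm k" using bu_norm[OF h(2,3)] e by (intro mult_right_mono mult_left_mono) auto
    finally show ?thesis by simp
  qed
  then show "\<exists>K'. nid D K' \<and> K' \<subseteq> K \<and> (\<exists>c. \<forall>k\<in>K'. nm ((x \<ominus> c \<odot> \<one>) \<otimes> k) \<le> e * nm k)"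
    using bump_ideal[OF D Dab Ki h] K'(2) by (intro exI[of _ "{k\<in>K'. k \<otimes> bu h = k}"]) auto
qed

lemma Dcom_subalg: "cs_subalg A Dcom"
  by (rule rel_subalg[OF C D])

text \<open>Locally \<open>x\<close> and \<open>y\<close> are within \<open>e'\<close> of scalars
  \<open>c\<close> and \<open>d\<close>, and their commutator equals that of \<open>x\<close> minus
  \<open>c\<close> and \<open>y\<close> minus \<open>d\<close>. It is thus of size at most twice the
  square of \<open>e'\<close>, so it is negligible.\<close>

theorem Dcom_abelian: "cs_abelian A Dcom"
  unfolding cs_abelian_def
proof (intro ballI)
  fix x y assume x: "x \<in> Dcom" and y: "y \<in> Dcom"
  have [simp]: "x \<in> Cr" "y \<in> Cr" using x y Dcom_cl by auto
  define z where "z = x \<otimes> y \<ominus> y \<otimes> x"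
  have "z \<in> negl"
    unfolding negl_def
  proof (intro CollectI conjI allI impI)
    have "x \<in> C" "y \<in> C" using x y by auto
    then show "z \<in> C" unfolding z_def by (intro Co(6) Co(3))
    fix e :: real assume e: "e > 0"
    define e' where "e' = min 1 (e/2)"
    have e': "e' > 0" "e' \<le> 1" "e' \<le> e/2" using e by (auto simp: e'_def)
    have "e' * e' \<le> 1 * (e/2)" using e' by (intro mult_mono) auto
    then have ee: "e' * e' + e' * e' \<le> e" by simp
    have "locally D (\<lambda>K. (\<exists>c. \<forall>k\<in>K. nm ((x \<ominus> c \<odot> \<one>) \<otimes> k) \<le> e' * nm k) \<and> (\<exists>c. \<forall>k\<in>K. nm ((y \<ominus> c \<odot> \<one>) \<otimes> k) \<le> e' * nm k))"
      by (rule locally_conj[OF Dcom_scalar[OF x e'(1)] Dcom_scalar[OF y e'(1)]]) blast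
    then show "locally D (\<lambda>K. \<forall>k\<in>K. nm (z \<otimes> k) \<le> e * nm k)"
      unfolding locally_def
    proof (elim all_forward imp_forward exE)
      fix K K'
      assume "nid D K' \<and> K' \<subseteq> K \<and> (\<exists>c. \<forall>k\<in>K'. nm ((x \<ominus> c \<odot> \<one>) \<otimes> k) \<le> e' * nm k) \<and> (\<exists>c. \<forall>k\<in>K'. nm ((y \<ominus> c \<odot> \<one>) \<otimes> k) \<le> e' * nm k)"
      then obtain c d where K': "nid D K'" "K' \<subseteq> K" and c: "\<And>k. k \<in> K' \<Longrightarrow> nm ((x \<ominus> c \<odot> \<one>) \<otimes> k) \<le> e' * nm k"
        and d: "\<And>k. k \<in> K' \<Longrightarrow> nm ((y \<ominus> d \<odot> \<one>) \<otimes> k) \<le> e' * nm k" by metis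
      note Ki = nid_ideal[OF K'(1)]
      obtain h where h: "h \<in> K'" "sa h" "h \<noteq> \<zero>" using nid_sa_ex[OF D K'(1)] by blast
      let ?u = "bu h"
      have uK: "?u \<in> K'" by (rule bu_ideal[OF h(2,3) Ki h(1)])
      have uD: "?u \<in> D" by (rule ideal_sub[OF Ki uK])
      have uc [simp]: "?u \<in> Cr" by (rule Dc[OF uD])
      have "e' * nm ?u \<le> e' * 1" using bu_norm[OF h(2,3)] e' by (intro mult_left_mono) auto
      then have u1: "nm ((x \<ominus> c \<odot> \<one>) \<otimes> ?u) \<le> e'" "nm ((y \<ominus> d \<odot> \<one>) \<otimes> ?u) \<le> e'"
        using c[OF uK] d[OF uK] by auto
      have "nm (z \<otimes> k) \<le> e * nm k" if k: "k \<in> K'" "k \<otimes> ?u = k" for k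
      proof -
        have kD: "k \<in> D" by (rule ideal_sub[OF Ki k(1)])
        have kc [simp]: "k \<in> Cr" by (rule Dc[OF kD])
        have uk: "?u \<otimes> k = k" using abelianD[OF Dab kD uD] k by simp
        have ux: "?u \<otimes> (x \<otimes> k) = x \<otimes> k" "?u \<otimes> (y \<otimes> k) = y \<otimes> k"
          using Dcom_comm[OF x uD] Dcom_comm[OF y uD] uk by (simp_all add: mul_assoc flip: mul_assoc)
            (metis uk mul_assoc uc kc \<open>x \<in> Cr\<close> \<open>y \<in> Cr\<close>)+
        \<comment> \<open>The local unit \<open>?u\<close> is inserted between the factors because
          the left factor is known to be small only against elements of the ideal.\<close>
        have "z \<otimes> k = ((x \<ominus> c \<odot> \<one>) \<otimes> ?u) \<otimes> ((y \<ominus> d \<odot> \<one>) \<otimes> k) \<ominus> ((y \<ominus> d \<odot> \<one>) \<otimes> ?u) \<otimes> ((x \<ominus> c \<odot> \<one>) \<otimes> k)"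
          unfolding z_def by (simp add: alg uk ux mult.commute)
        moreover have "nm (((x \<ominus> c \<odot> \<one>) \<otimes> ?u) \<otimes> ((y \<ominus> d \<odot> \<one>) \<otimes> k)) \<le> e' * (e' * nm k)"
          by (rule nm_mul_le) (use u1 d[OF k(1)] in auto)
        moreover have "nm (((y \<ominus> d \<odot> \<one>) \<otimes> ?u) \<otimes> ((x \<ominus> c \<odot> \<one>) \<otimes> k)) \<le> e' * (e' * nm k)"
          by (rule nm_mul_le) (use u1 c[OF k(1)] in auto)
        ultimately have "nm (z \<otimes> k) \<le> e' * (e' * nm k) + e' * (e' * nm k)"
          using nm_diff[of "((x \<ominus> c \<odot> \<one>) \<otimes> ?u) \<otimes> ((y \<ominus> d \<odot> \<one>) \<otimes> k)" "((y \<ominus> d \<odot> \<one>) \<otimes> ?u) \<otimes> ((x \<ominus> c \<odot> \<one>) \<otimes> k)"]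
          by simp
        also have "\<dots> = (e' * e' + e' * e') * nm k" by (simp add: algebra_simps)
        also have "\<dots> \<le> e * nm k" using ee by (intro mult_right_mono) auto
        finally show ?thesis .
      qed
      then show "\<exists>K'. nid D K' \<and> K' \<subseteq> K \<and> (\<forall>k\<in>K'. nm (z \<otimes> k) \<le> e * nm k)"
        using bump_ideal[OF D Dab Ki h] K'(2) by (intro exI[of _ "{k\<in>K'. k \<otimes> ?u = k}"]) auto
    qed
  qed
  then have "z = \<zero>" by (rule negl_eq_0)
  then show "x \<otimes> y = y \<otimes> x" by (simp add: z_def diff_eq_zero)
qed

text \<open>On a small open set a non-negligible \<open>h\<close> is close to a nonzero constant, hence invertible there.\<close>
theorem Dcom_iip: "iip A Dcom D"
proof (rule iipI)
  fix J assume J: "closed_ideal_in A Dcom J" "J \<noteq> {\<zero>}"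
  note Jo = ideal_ops[OF J(1)] and Jc = ideal_cl[OF J(1)] and Jsub = ideal_sub[OF J(1)] and Eo = subalg_ops[OF Dcom_subalg]
  obtain x where x: "x \<in> J" "x \<noteq> \<zero>" using J Jo(1) by blast
  have xc: "x \<in> Cr" by (rule Jc[OF x(1)])
  define h where "h = x\<^sup>\<star> \<otimes> x"
  have hJ: "h \<in> J" unfolding h_def by (rule Jo(4)[OF x(1) Eo(5)[OF Jsub[OF x(1)]]])
  have hn: "h \<noteq> \<zero>" unfolding h_def using sq_zero[OF xc] x by auto
  have hE: "h \<in> Dcom" and hc [simp]: "h \<in> Cr" using Jsub[OF hJ] Jc[OF hJ] by auto
  have "h \<notin> negl" using negl_eq_0 hn by blast
  then obtain e where e: "e > 0" "\<not> locally D (\<lambda>K. \<forall>k\<in>K. nm (h \<otimes> k) \<le> e * nm k)"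
    unfolding negl_def using hE by blast
  then obtain K0 where K0: "nid D K0" "\<And>K'. nid D K' \<Longrightarrow> K' \<subseteq> K0 \<Longrightarrow> \<not> (\<forall>k\<in>K'. nm (h \<otimes> k) \<le> e * nm k)"
    unfolding locally_def by blast
  have "e/4 > 0" using e by simp
  from locallyE[OF Dcom_scalar[OF hE this] K0(1)] obtain K where K: "nid D K" "K \<subseteq> K0"
    "\<exists>c. \<forall>k\<in>K. nm ((h \<ominus> c \<odot> \<one>) \<otimes> k) \<le> e/4 * nm k" by blast
  then obtain c where c: "\<And>k. k \<in> K \<Longrightarrow> nm ((h \<ominus> c \<odot> \<one>) \<otimes> k) \<le> e/4 * nm k" by blast
  note Ki = nid_ideal[OF K(1)]
  \<comment> \<open>A smaller scalar would give the bound \<open>e/4 + 3/4 * e = e\<close> for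
    \<open>h\<close> on \<open>K\<close>, against the choice of \<open>K0\<close>.\<close>
  have cb: "cmod c > 3/4 * e"
  proof (rule ccontr)
    assume "\<not> cmod c > 3/4 * e"
    then have c': "cmod c \<le> 3/4 * e" by simp
    have "nm (h \<otimes> k) \<le> e * nm k" if k: "k \<in> K" for k
    proof -
      have kc [simp]: "k \<in> Cr" using k nid_sub[OF K(1)] by auto
      have "h \<otimes> k = (h \<ominus> c \<odot> \<one>) \<otimes> k \<oplus> c \<odot> k" by (simp add: alg)
      then have "nm (h \<otimes> k) \<le> e/4 * nm k + cmod c * nm k"
        using nm_add[of "(h \<ominus> c \<odot> \<one>) \<otimes> k" "c \<odot> k"] c[OF k] by (simp add: nm_sm)
      also have "\<dots> \<le> e/4 * nm k + 3/4 * e * nm k"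
        using mult_right_mono[OF c', of "nm k"] by simp
      finally show ?thesis by simp
    qed
    then show False using K0(2)[OF K(1,2)] by blast
  qed
  then have c0: "c \<noteq> 0" using e by auto
  obtain k0 where k0: "k0 \<in> K" "sa k0" "k0 \<noteq> \<zero>" using nid_sa_ex[OF D K(1)] by blast
  let ?u = "bu k0" and ?p = "bp k0"
  have up: "?u \<in> K" "?p \<in> K" using bu_ideal[OF k0(2,3) Ki k0(1)] bp_ideal[OF k0(2,3) Ki k0(1)] by auto
  have upD: "?u \<in> D" "?p \<in> D" using up ideal_sub[OF Ki] by auto
  have upc [simp]: "?u \<in> Cr" "?p \<in> Cr" using upD Dc by auto
  have upE: "?u \<in> Dcom" "?p \<in> Dcom" using upD D_Dcom by auto
  \<comment> \<open>Up to the factor \<open>-1/c\<close> this is the small element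
    \<open>(h \<ominus> c \<odot> \<one>) \<otimes> ?u\<close>. As
    \<open>?p \<ominus> ?p \<otimes> s\<close> is a multiple of
    \<open>?p \<otimes> (h \<otimes> ?u)\<close>, it lies in \<open>J\<close>, and the Neumann
    series applies.\<close>
  define s where "s = ?u \<ominus> (1/c) \<odot> (h \<otimes> ?u)"
  have sE: "s \<in> Dcom" unfolding s_def by (intro Eo upE hE)
  have sc [simp]: "s \<in> Cr" by (rule Dcom_cl[OF sE])
  have "s = (- (1/c)) \<odot> ((h \<ominus> c \<odot> \<one>) \<otimes> ?u)"
    unfolding s_def using c0 by (simp add: cs_diff_def add_mul sm_mul sm_add add_comm flip: sm_mult)
  then have "nm s = nm ((h \<ominus> c \<odot> \<one>) \<otimes> ?u) / cmod c" by (simp add: nm_sm norm_divide)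
  also have "\<dots> \<le> (e/4) / cmod c"
  proof (rule divide_right_mono)
    have "e/4 * nm ?u \<le> e/4 * 1" using bu_norm[OF k0(2,3)] e by (intro mult_left_mono) auto
    then show "nm ((h \<ominus> c \<odot> \<one>) \<otimes> ?u) \<le> e/4" using c[OF up(1)] by simp
  qed simp
  also have "\<dots> < 1" using cb e(1) c0 by (simp add: divide_less_eq)
  finally have s1: "nm s < 1" .
  have "?p \<ominus> ?p \<otimes> s = (1/c) \<odot> (?p \<otimes> (h \<otimes> ?u))"
    unfolding s_def using bp_bu[OF k0(2,3)] by (simp add: alg)
  also have "\<dots> \<in> J" by (intro Jo(5) Jo(4)[OF _ upE(2)] Jo(3)[OF hJ upE(1)])
  finally have pJ: "?p \<ominus> ?p \<otimes> s \<in> J" .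
  have "?p \<in> J"
    by (rule neumann[OF ideal_closed[OF J(1)] Jo(1,2) Jo(3)[OF _ sE] sc s1 upc(2) pJ])
  then show "\<exists>x\<in>J \<inter> D. x \<noteq> \<zero>" using upD(2) bp_nz[OF k0(2,3)] by blast
qed

theorem C_iip: "iip A C Dcom"
proof (rule iipI)
  fix J assume "closed_ideal_in A C J" "J \<noteq> {\<zero>}"
  then show "\<exists>x\<in>J \<inter> Dcom. x \<noteq> \<zero>" using iipD[OF iipCD _ _ Do(1)] D_Dcom by blast
qed

text \<open>\<open>lz_condexp\<close> shows that \<open>x\<^sup>\<star> \<otimes> x\<close> is
  locally zero. Compressing it by \<open>k\<^sup>\<star>\<close> and \<open>k\<close> yields the
  square of \<open>x \<otimes> k\<close>, so \<open>x\<close> is negligible.\<close>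

lemma rce_faithful:
  assumes F: "rce C D F" and x: "x \<in> C" "F (x\<^sup>\<star> \<otimes> x) = \<zero>"
  shows "x = \<zero>"
proof (rule negl_eq_0)
  have xc [simp]: "x \<in> Cr" by (rule Cc[OF x(1)])
  have xx: "x\<^sup>\<star> \<otimes> x \<in> C" by (rule Co(3)[OF Co(5)[OF x(1)] x(1)])
  have "lz D (x\<^sup>\<star> \<otimes> x \<ominus> F (x\<^sup>\<star> \<otimes> x))"
    by (rule lz_condexp[OF D C DC xx locC[OF xx]]) (use rceD[OF F] in blast)+
  then have l: "lz D (x\<^sup>\<star> \<otimes> x)" using x(2) by simp
  show "x \<in> negl"
    unfolding negl_def
  proof (intro CollectI conjI allI impI x(1))
    fix e :: real assume e: "e > 0"
    then have "locally D (\<lambda>K. \<forall>k\<in>K. \<forall>k'\<in>K. nm (k \<otimes> (x\<^sup>\<star> \<otimes> x) \<otimes> k') \<le> e\<^sup>2 * nm k * nm k')"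
      using l unfolding lz_def by simp
    then show "locally D (\<lambda>K. \<forall>k\<in>K. nm (x \<otimes> k) \<le> e * nm k)"
    proof (rule locally_mono, intro ballI)
      fix K k assume K: "nid D K" and *: "\<forall>k\<in>K. \<forall>k'\<in>K. nm (k \<otimes> (x\<^sup>\<star> \<otimes> x) \<otimes> k') \<le> e\<^sup>2 * nm k * nm k'" and k: "k \<in> K"
      have kc [simp]: "k \<in> Cr" using k nid_sub[OF K] by auto
      have "k\<^sup>\<star> \<in> K" by (rule ideal_star[OF D nid_ideal[OF K] k])
      then have "nm (k\<^sup>\<star> \<otimes> (x\<^sup>\<star> \<otimes> x) \<otimes> k) \<le> e\<^sup>2 * nm (k\<^sup>\<star>) * nm k" using * k by blast
      moreover have "k\<^sup>\<star> \<otimes> (x\<^sup>\<star> \<otimes> x) \<otimes> k = (x \<otimes> k)\<^sup>\<star> \<otimes> (x \<otimes> k)" by (simp add: star_mul mul_assoc)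
      ultimately have "(nm (x \<otimes> k))\<^sup>2 \<le> (e * nm k)\<^sup>2"
        by (simp add: cstar_id power_mult_distrib power2_eq_square mult_ac)
      then show "nm (x \<otimes> k) \<le> e * nm k" by (rule power2_le_imp_le) (use e in simp)
    qed
  qed
qed

text \<open>For \<open>x\<close> in the relative commutant, \<open>x \<ominus> F x\<close> is
  locally zero and commutes with \<open>D\<close>, so it vanishes and
  \<open>x = F x\<close>.\<close>

lemma rce_masa:
  assumes F: "rce C D F" and x: "x \<in> Dcom"
  shows "x \<in> D"
proof -
  have xC: "x \<in> C" and xc: "x \<in> Cr" using x Dcom_cl by auto
  have FD: "F x \<in> D" by (rule rceD(1)[OF F xC])
  have l: "lz D (x \<ominus> F x)"
    by (rule lz_condexp[OF D C DC xC locC[OF xC]]) (use rceD[OF F] in blast)+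
  have "x \<ominus> F x \<in> Dcom" using x FD D_Dcom subalg_ops(6)[OF Dcom_subalg] by blast
  then have "x \<ominus> F x = \<zero>" using l by (intro lz_commuting_zero) (auto simp: relcomm_def)
  then have "x = F x" using xc Dc[OF FD] by (simp add: diff_eq_zero)
  then show ?thesis using FD by simp
qed

end

section \<open>Directed systems inside a unital algebra\<close>

text \<open>The system as seen inside one unital algebra: connecting maps have become inclusions,
  \<open>normS\<close> is regularity of the expansions and \<open>essB\<close> their
  essentiality.\<close>

locale dsys = ucst A one for A :: "'a cstar" and one ("\<one>") +
  fixes I :: "'i set" and le :: "'i \<Rightarrow> 'i \<Rightarrow> bool" and S B :: "'i \<Rightarrow> 'a set"
  assumes dir: "directed_set I le"
    and S: "i \<in> I \<Longrightarrow> cs_subalg A (S i)" and B: "i \<in> I \<Longrightarrow> cs_subalg A (B i)"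
    and BS: "i \<in> I \<Longrightarrow> B i \<subseteq> S i" and Bab: "i \<in> I \<Longrightarrow> cs_abelian A (B i)"
    and Eab: "i \<in> I \<Longrightarrow> cs_abelian A (S i \<inter> relcomm A (B i))"
    and iipS: "i \<in> I \<Longrightarrow> iip A (S i) (S i \<inter> relcomm A (B i))"
    and iipE: "i \<in> I \<Longrightarrow> iip A (S i \<inter> relcomm A (B i)) (B i)"
    and regS: "i \<in> I \<Longrightarrow> cs_closure A (cs_span A (S i \<inter> normalizers A (B i))) = S i"
    and monoS: "\<lbrakk>i \<in> I; j \<in> I; le i j\<rbrakk> \<Longrightarrow> S i \<subseteq> S j"
    and monoB: "\<lbrakk>i \<in> I; j \<in> I; le i j\<rbrakk> \<Longrightarrow> B i \<subseteq> B j"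
    and normS: "\<lbrakk>i \<in> I; j \<in> I; le i j\<rbrakk> \<Longrightarrow> S i \<inter> normalizers A (B i) \<subseteq> normalizers A (B j)"
    and essB: "\<lbrakk>i \<in> I; j \<in> I; le i j\<rbrakk> \<Longrightarrow> iip A (B j) (B i)"
begin

definition "C = cs_closure A (\<Union>i\<in>I. S i)"
definition "D = cs_closure A (\<Union>i\<in>I. B i)"

lemma ex_upper: "i \<in> I \<Longrightarrow> j \<in> I \<Longrightarrow> \<exists>k\<in>I. le i k \<and> le j k"
  using dir unfolding directed_set_def by blast

lemma ex_idx: "\<exists>i. i \<in> I"
  using dir unfolding directed_set_def by blast

lemma union_subalg:
  assumes T: "\<And>i. i \<in> I \<Longrightarrow> cs_subalg A (T i)" and mono: "\<And>i j. \<lbrakk>i \<in> I; j \<in> I; le i j\<rbrakk> \<Longrightarrow> T i \<subseteq> T j"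
  shows "cs_subalg A (cs_closure A (\<Union>i\<in>I. T i))"
proof (rule closure_subalg)
  have both: "\<exists>k\<in>I. x \<in> T k \<and> y \<in> T k" if "x \<in> (\<Union>i\<in>I. T i)" "y \<in> (\<Union>i\<in>I. T i)" for x y
  proof -
    from that obtain i j where ij: "i \<in> I" "x \<in> T i" "j \<in> I" "y \<in> T j" by blast
    then obtain k where "k \<in> I" "le i k" "le j k" using ex_upper by blast
    then show ?thesis using ij mono[of i k] mono[of j k] by blast
  qed
  show "(\<Union>i\<in>I. T i) \<subseteq> Cr" using subalg_cl[OF T] by blast
  show "\<zero> \<in> (\<Union>i\<in>I. T i)" using ex_idx subalg_ops(1)[OF T] by blast
  show "x \<oplus> y \<in> (\<Union>i\<in>I. T i)" if "x \<in> (\<Union>i\<in>I. T i)" "y \<in> (\<Union>i\<in>I. T i)" for x y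
    using both[OF that] subalg_ops(2)[OF T] by blast
  show "x \<otimes> y \<in> (\<Union>i\<in>I. T i)" if "x \<in> (\<Union>i\<in>I. T i)" "y \<in> (\<Union>i\<in>I. T i)" for x y
    using both[OF that] subalg_ops(3)[OF T] by blast
  show "c \<odot> x \<in> (\<Union>i\<in>I. T i)" if "x \<in> (\<Union>i\<in>I. T i)" for c x
    using that subalg_ops(4)[OF T] by blast
  show "x\<^sup>\<star> \<in> (\<Union>i\<in>I. T i)" if "x \<in> (\<Union>i\<in>I. T i)" for x
    using that subalg_ops(5)[OF T] by blast
qed

lemma C_subalg: "cs_subalg A C" and D_subalg: "cs_subalg A D"
  unfolding C_def D_def
  by (rule union_subalg[OF S monoS]; assumption) (rule union_subalg[OF B monoB]; assumption)

lemma Sc: "i \<in> I \<Longrightarrow> x \<in> S i \<Longrightarrow> x \<in> Cr" and Bc: "i \<in> I \<Longrightarrow> x \<in> B i \<Longrightarrow> x \<in> Cr"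
  by (rule subalg_cl[OF S], assumption+) (rule subalg_cl[OF B], assumption+)

lemma UnS: "(\<Union>i\<in>I. S i) \<subseteq> Cr" and UnB: "(\<Union>i\<in>I. B i) \<subseteq> Cr"
  using Sc Bc by blast+

lemma SC: "i \<in> I \<Longrightarrow> S i \<subseteq> C" and BD: "i \<in> I \<Longrightarrow> B i \<subseteq> D"
  unfolding C_def D_def using closure_sub[OF UnS] closure_sub[OF UnB] by blast+

lemma D_sub_C: "D \<subseteq> C"
  unfolding C_def D_def using BS by (intro closure_mono) blast

lemma D_abelian: "cs_abelian A D"
  unfolding cs_abelian_def
proof (intro ballI)
  fix x y assume x: "x \<in> D" and y: "y \<in> D"
  note Dcl = subalg_cl[OF D_subalg]
  have 1: "s \<otimes> t = t \<otimes> s" if s: "s \<in> (\<Union>i\<in>I. B i)" and t: "t \<in> (\<Union>i\<in>I. B i)" for s t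
  proof -
    from s t obtain i j where ij: "i \<in> I" "s \<in> B i" "j \<in> I" "t \<in> B j" by blast
    then obtain k where "k \<in> I" "le i k" "le j k" using ex_upper by blast
    then show ?thesis using ij monoB[of i k] monoB[of j k] abelianD[OF Bab[of k]] by blast
  qed
  have 2: "s \<otimes> y \<ominus> y \<otimes> s \<in> {\<zero>}" if s: "s \<in> (\<Union>i\<in>I. B i)" for s
  proof -
    have sc: "s \<in> Cr" using s UnB by blast
    have "s \<otimes> y \<ominus> y \<otimes> s \<in> cs_closure A {\<zero>}"
      by (rule closure_blin[of "\<lambda>y. s \<otimes> y \<ominus> y \<otimes> s", OF _ UnB _ y[unfolded D_def]])
         (use sc UnB 1[OF s] in \<open>auto intro!: blin_intros simp: diff_eq_zero\<close>)
    then show ?thesis by (simp add: closure_zero)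
  qed
  have "x \<otimes> y \<ominus> y \<otimes> x \<in> cs_closure A {\<zero>}"
    by (rule closure_blin[of "\<lambda>x. x \<otimes> y \<ominus> y \<otimes> x", OF _ UnB 2 x[unfolded D_def]])
       (intro blin_intros Dcl[OF y])
  then show "x \<otimes> y = y \<otimes> x" using Dcl[OF x] Dcl[OF y] by (simp add: closure_zero diff_eq_zero)
qed

text \<open>For \<open>d\<close> in some \<open>B j\<close>, regularity makes \<open>v\<close> a
  normalizer of \<open>B k\<close> at a common upper index \<open>k\<close>. Conjugation by
  \<open>v\<close> is continuous, so the property passes to the closure.\<close>

lemma normalizers_limit:
  assumes i: "i \<in> I" and v: "v \<in> S i \<inter> normalizers A (B i)"
  shows "v \<in> normalizers A D"
proof -
  have vc: "v \<in> Cr" using v normalizersD(1) by blast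
  have *: "v \<otimes> d \<otimes> v\<^sup>\<star> \<in> (\<Union>i\<in>I. B i) \<and> v\<^sup>\<star> \<otimes> d \<otimes> v \<in> (\<Union>i\<in>I. B i)" if "d \<in> (\<Union>i\<in>I. B i)" for d
  proof -
    from that obtain j where j: "j \<in> I" "d \<in> B j" by blast
    then obtain k where k: "k \<in> I" "le i k" "le j k" using ex_upper i by blast
    have "v \<in> normalizers A (B k)" using normS[OF i k(1,2)] v by blast
    moreover have "d \<in> B k" using monoB[OF j(1) k(1,3)] j by blast
    ultimately show ?thesis using normalizersD(2,3)[of v "B k" d] k(1) by blast
  qed
  have "v \<otimes> d \<otimes> v\<^sup>\<star> \<in> D" "v\<^sup>\<star> \<otimes> d \<otimes> v \<in> D" if d: "d \<in> D" for d
    unfolding D_def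
    by (rule closure_blin[of "\<lambda>d. v \<otimes> d \<otimes> v\<^sup>\<star>", OF _ UnB _ d[unfolded D_def]];
        use * vc in \<open>auto intro!: blin_intros\<close>)
       (rule closure_blin[of "\<lambda>d. v\<^sup>\<star> \<otimes> d \<otimes> v", OF _ UnB _ d[unfolded D_def]];
        use * vc in \<open>auto intro!: blin_intros\<close>)
  then show ?thesis unfolding normalizers_def using vc by blast
qed

lemma C_reg: "cs_closure A (cs_span A (C \<inter> normalizers A D)) = C"
proof
  let ?X = "cs_span A (C \<inter> normalizers A D)"
  have X: "?X \<subseteq> C" using span_subset[OF C_subalg, of "C \<inter> normalizers A D"] by blast
  have Xc: "?X \<subseteq> Cr" using X subalg_cl[OF C_subalg] by blast
  show "cs_closure A ?X \<subseteq> C" using closure_mono[OF X] subalg_closed[OF C_subalg] by simp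
  have "S i \<subseteq> cs_closure A ?X" if i: "i \<in> I" for i
  proof -
    have "S i \<inter> normalizers A (B i) \<subseteq> C \<inter> normalizers A D"
      using SC[OF i] normalizers_limit[OF i] by blast
    from closure_mono[OF span_mono[OF this]] show ?thesis using regS[OF i] by simp
  qed
  then have "(\<Union>i\<in>I. S i) \<subseteq> cs_closure A ?X" by blast
  from closure_mono[OF this] show "C \<subseteq> cs_closure A ?X" using closure_closure[OF Xc] by (simp add: C_def)
qed

section \<open>Ideal intersection properties and local scalars in the limit\<close>

lemma SB_iip: "i \<in> I \<Longrightarrow> closed_ideal_in A (S i) J \<Longrightarrow> J \<noteq> {\<zero>} \<Longrightarrow> \<exists>x\<in>J \<inter> B i. x \<noteq> \<zero>"
proof -
  assume i: "i \<in> I" and J: "closed_ideal_in A (S i) J" "J \<noteq> {\<zero>}"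
  let ?E = "S i \<inter> relcomm A (B i)"
  have E: "cs_subalg A ?E" by (rule rel_subalg[OF S[OF i] B[OF i]])
  obtain x where x: "x \<in> J \<inter> ?E" "x \<noteq> \<zero>" using iipD[OF iipS[OF i] J subalg_ops(1)[OF E]] by blast
  have "closed_ideal_in A ?E (J \<inter> ?E)" by (rule ideal_Int[OF J(1) E]) blast
  then show ?thesis using iipD[OF iipE[OF i] _ _ subalg_ops(1)[OF B[OF i]], of "J \<inter> ?E"] x by blast
qed

lemma CD_iip: "iip A C D"
proof (rule iipI)
  fix J assume J: "closed_ideal_in A C J" "J \<noteq> {\<zero>}"
  have "\<exists>i\<in>I. J \<inter> S i \<noteq> {\<zero>}"
    by (rule ideal_meets[OF C_subalg _ S SC J]) (auto simp: C_def)
  then obtain i where i: "i \<in> I" "J \<inter> S i \<noteq> {\<zero>}" by blast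
  have "closed_ideal_in A (S i) (J \<inter> S i)" by (rule ideal_Int[OF J(1) S[OF i(1)] SC[OF i(1)]])
  from SB_iip[OF i(1) this i(2)] show "\<exists>x\<in>J \<inter> D. x \<noteq> \<zero>" using BD[OF i(1)] by blast
qed

text \<open>The ideal first meets some \<open>B j\<close>. At a common upper index \<open>k\<close>
  of \<open>i\<close> and \<open>j\<close> it is still nonzero, and essentiality of
  \<open>B i\<close> in \<open>B k\<close> moves the intersection into \<open>B i\<close>.\<close>

lemma DB_iip: "i \<in> I \<Longrightarrow> iip A D (B i)"
proof (rule iipI)
  fix J assume i: "i \<in> I" and J: "closed_ideal_in A D J" "J \<noteq> {\<zero>}"
  have "\<exists>i\<in>I. J \<inter> B i \<noteq> {\<zero>}"
    by (rule ideal_meets[OF D_subalg _ B BD J]) (auto simp: D_def)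
  then obtain j where j: "j \<in> I" "J \<inter> B j \<noteq> {\<zero>}" by blast
  have Jj: "closed_ideal_in A (B j) (J \<inter> B j)" by (rule ideal_Int[OF J(1) B[OF j(1)] BD[OF j(1)]])
  then obtain x where x: "x \<in> J \<inter> B j" "x \<noteq> \<zero>" using j(2) ideal_ops(1)[OF Jj] by blast
  obtain k where k: "k \<in> I" "le i k" "le j k" using ex_upper i j by blast
  have "closed_ideal_in A (B k) (J \<inter> B k)" by (rule ideal_Int[OF J(1) B[OF k(1)] BD[OF k(1)]])
  moreover have "J \<inter> B k \<noteq> {\<zero>}" using x monoB[OF j(1) k(1,3)] by blast
  ultimately obtain y where "y \<in> (J \<inter> B k) \<inter> B i" "y \<noteq> \<zero>"
    using iipD[OF essB[OF i k(1,2)] _ _ subalg_ops(1)[OF B[OF i]]] by blast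
  then show "\<exists>x\<in>J \<inter> B i. x \<noteq> \<zero>" by blast
qed

lemma loc_B: "i \<in> I \<Longrightarrow> x \<in> S i \<Longrightarrow> loc (B i) x"
  by (rule loc_regular[OF B Bab S BS Eab iipE regS])

text \<open>Local scalars are found over \<open>B i\<close>, where regularity of the single
  inclusion is available, carried to \<open>D\<close> by essentiality of \<open>B i\<close> in
  \<open>D\<close>, and extended to \<open>C\<close> by density.\<close>

lemma loc_D:
  assumes "x \<in> C"
  shows "loc D x"
proof (rule loc_limit[of x "\<Union>i\<in>I. S i"])
  show "x \<in> cs_closure A (\<Union>i\<in>I. S i)" using assms by (simp add: C_def)
  fix y assume "y \<in> (\<Union>i\<in>I. S i)"
  then obtain i where i: "i \<in> I" "y \<in> S i" by blast
  show "loc D y"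
    by (rule loc_extend[OF B[OF i(1)] D_subalg D_abelian BD[OF i(1)] DB_iip[OF i(1)] loc_B[OF i]])
qed

sublocale pci A \<one> C D
  by unfold_locales (fact C_subalg D_subalg D_sub_C D_abelian C_reg CD_iip loc_D)+

section \<open>Conditional expectations along the system\<close>

lemma rce_lz: "\<lbrakk>i \<in> I; x \<in> S i; rce (S i) (B i) F\<rbrakk> \<Longrightarrow> lz D (x \<ominus> F x)"
proof -
  assume i: "i \<in> I" "x \<in> S i" and F: "rce (S i) (B i) F"
  have "lz (B i) (x \<ominus> F x)"
    by (rule lz_condexp[OF B[OF i(1)] S[OF i(1)] BS[OF i(1)] i(2) loc_B[OF i]]) (use rceD[OF F] in blast)+
  then show ?thesis
    by (rule lz_extend[OF B[OF i(1)] D_subalg D_abelian BD[OF i(1)] DB_iip[OF i(1)]])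
qed

text \<open>Both \<open>G x\<close> and \<open>F x\<close> are elements of \<open>D\<close>
  differing from \<open>x\<close> by something locally zero, and there is only one such
  element.\<close>

lemma rce_unique:
  assumes G: "rce C D G" and i: "i \<in> I" "x \<in> S i" and F: "rce (S i) (B i) F"
  shows "G x = F x"
proof -
  have xC: "x \<in> C" using SC i by blast
  have "lz D (x \<ominus> G x)"
    by (rule lz_condexp[OF D_subalg C_subalg D_sub_C xC loc_D[OF xC]]) (use rceD[OF G] in blast)+
  then show ?thesis
    using rce_lz[OF i F] rceD(1)[OF G xC] rceD(1)[OF F i(2)] BD[OF i(1)] Sc[OF i]
    by (intro lz_unique[OF D_subalg D_abelian, of _ _ x]) auto
qed

text \<open>The limit of the conditional expectations is characterized by \<open>x - E x\<close> being locally zero.\<close>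
lemma rce_limit:
  assumes F: "\<And>i. i \<in> I \<Longrightarrow> rce (S i) (B i) (F i)"
    and pF: "\<And>i y. i \<in> I \<Longrightarrow> y \<in> S i \<Longrightarrow> pos (F i (y\<^sup>\<star> \<otimes> y))"
  shows "\<exists>E. rce C D E \<and> (\<forall>y\<in>C. pos (E (y\<^sup>\<star> \<otimes> y)))"
proof -
  note Dcl = subalg_cl[OF D_subalg] and Ccl = subalg_cl[OF C_subalg]
  note Dops = subalg_ops[OF D_subalg] and Cops = subalg_ops[OF C_subalg]
  have FD: "F i x \<in> D" if "i \<in> I" "x \<in> S i" for i x
    using rceD(1)[OF F[OF that(1)] that(2)] BD[OF that(1)] by blast
  have uniq: "d = F i x" if "i \<in> I" "x \<in> S i" "d \<in> D" "lz D (x \<ominus> d)" for i x d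
    using that rce_lz[OF that(1,2) F[OF that(1)]] FD[OF that(1,2)] Sc[OF that(1,2)]
    by (intro lz_unique[OF D_subalg D_abelian, of _ _ x])
  \<comment> \<open>The expectations of different indices agree at a common upper index, because
    each value is characterized by \<open>uniq\<close>. So contractivity of one of them compares
    values taken at different indices.\<close>
  have contr: "nm (F i x \<ominus> F j y) \<le> nm (x \<ominus> y)" if "i \<in> I" "x \<in> S i" "j \<in> I" "y \<in> S j" for i j x y
  proof -
    note ij = that
    obtain k where k: "k \<in> I" "le i k" "le j k" using ex_upper[OF ij(1,3)] by blast
    have xy: "x \<in> S k" "y \<in> S k" using monoS[of i k] monoS[of j k] ij k by auto
    have "F i x = F k x" "F j y = F k y"
      using uniq[OF k(1) xy(1) FD[OF ij(1,2)] rce_lz[OF ij(1,2) F[OF ij(1)]]]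
        uniq[OF k(1) xy(2) FD[OF ij(3,4)] rce_lz[OF ij(3,4) F[OF ij(3)]]] by auto
    moreover have "F k (x \<ominus> y) = F k x \<ominus> F k y" by (rule rce_diff[OF F[OF k(1)] S[OF k(1)] xy])
    ultimately show ?thesis
      using rceD(6)[OF F[OF k(1)] subalg_ops(6)[OF S[OF k(1)] xy]] by simp
  qed
  \<comment> \<open>Besides the defining property, the approximation of \<open>x\<close> and
    \<open>d\<close> by elements of the \<open>S i\<close> and their expectations is recorded: norm
    bound and positivity of the limit are read off from it.\<close>
  have ex: "\<exists>d. d \<in> D \<and> lz D (x \<ominus> d) \<and> (\<forall>e>0. \<exists>i\<in>I. \<exists>y\<in>S i. nm (x \<ominus> y) \<le> e \<and> nm (d \<ominus> F i y) \<le> e)"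
    if x: "x \<in> C" for x
  proof -
    have xc [simp]: "x \<in> Cr" by (rule Ccl[OF x])
    have "\<exists>i y. i \<in> I \<and> y \<in> S i \<and> nm (x \<ominus> y) < 1 / real (Suc n)" for n
      using in_closureD[of x "\<Union>i\<in>I. S i" "1 / real (Suc n)"] x unfolding C_def by auto
    then obtain ix yx where iy: "\<And>n. ix n \<in> I" "\<And>n. yx n \<in> S (ix n)" "\<And>n. nm (x \<ominus> yx n) < 1 / real (Suc n)"
      by metis
    have yc [simp]: "yx n \<in> Cr" for n using Sc iy by blast
    have Fc [simp]: "F (ix n) (yx n) \<in> Cr" for n using Dcl FD iy by blast
    have small: "\<exists>N. \<forall>n\<ge>N. nm (x \<ominus> yx n) < e" if e: "e > 0" for e
    proof -
      obtain N where N: "1 / real (Suc N) < e" using nat_approx_posE[OF e] by blast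
      have "nm (x \<ominus> yx n) < e" if "n \<ge> N" for n
      proof -
        have "1 / real (Suc n) \<le> 1 / real (Suc N)" using that by (simp add: frac_le)
        then show ?thesis using iy(3)[of n] N by linarith
      qed
      then show ?thesis by blast
    qed
    obtain d where d: "d \<in> Cr" "\<And>e. e > 0 \<Longrightarrow> \<exists>N. \<forall>n\<ge>N. nm (F (ix n) (yx n) \<ominus> d) < e"
    proof (rule completeD[of "\<lambda>n. F (ix n) (yx n)"])
      fix e :: real assume "e > 0"
      then obtain N where N: "\<forall>n\<ge>N. nm (x \<ominus> yx n) < e/2" using small[of "e/2"] by auto
      have "nm (F (ix m) (yx m) \<ominus> F (ix n) (yx n)) < e" if "m \<ge> N" "n \<ge> N" for m n
      proof -
        have "nm (yx m \<ominus> yx n) \<le> nm (x \<ominus> yx m) + nm (x \<ominus> yx n)"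
          using nm_triangle[of "yx m" x "yx n"] nm_minus_comm[of "yx m" x] by simp
        then show ?thesis
          using contr[OF iy(1)[of m] iy(2)[of m] iy(1)[of n] iy(2)[of n]] N[rule_format, OF that(1)] N[rule_format, OF that(2)]
          by linarith
      qed
      then show "\<exists>N. \<forall>m\<ge>N. \<forall>n\<ge>N. nm (F (ix m) (yx m) \<ominus> F (ix n) (yx n)) < e" by blast
    qed auto
    have app: "\<exists>n. nm (x \<ominus> yx n) \<le> e \<and> nm (d \<ominus> F (ix n) (yx n)) \<le> e" if e: "e > 0" for e
    proof -
      obtain N1 where N1: "\<forall>n\<ge>N1. nm (x \<ominus> yx n) < e" using small[OF e] by blast
      obtain N2 where N2: "\<forall>n\<ge>N2. nm (F (ix n) (yx n) \<ominus> d) < e" using d(2)[OF e] by blast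
      show ?thesis
        using N1[rule_format, of "max N1 N2"] N2[rule_format, of "max N1 N2"] nm_minus_comm[OF d(1) Fc]
        by (intro exI[of _ "max N1 N2"]) (simp add: less_imp_le)
    qed
    have dD: "d \<in> D"
    proof (rule closed_approx[OF subalg_closed[OF D_subalg] d(1)])
      fix e :: real assume "e > 0"
      then obtain n where "nm (d \<ominus> F (ix n) (yx n)) \<le> e" using app by blast
      then show "\<exists>s\<in>D. nm (d \<ominus> s) \<le> e" using FD[OF iy(1,2)] by blast
    qed
    have "lz D (x \<ominus> d)"
    proof (rule lz_limit)
      show "x \<ominus> d \<in> Cr" using d(1) by simp
      fix e :: real assume "e > 0"
      then obtain n where n: "nm (x \<ominus> yx n) \<le> e/2" "nm (d \<ominus> F (ix n) (yx n)) \<le> e/2" using app[of "e/2"] by auto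
      have "(x \<ominus> d) \<ominus> (yx n \<ominus> F (ix n) (yx n)) = (x \<ominus> yx n) \<ominus> (d \<ominus> F (ix n) (yx n))"
        using d(1) by (simp add: alg)
      then have "nm ((x \<ominus> d) \<ominus> (yx n \<ominus> F (ix n) (yx n))) \<le> e"
        using nm_diff[of "x \<ominus> yx n" "d \<ominus> F (ix n) (yx n)"] n d(1) by simp
      then show "\<exists>y. lz D y \<and> nm (x \<ominus> d \<ominus> y) \<le> e" using rce_lz[OF iy(1,2) F[OF iy(1)]] by blast
    qed
    then show ?thesis using dD app iy by blast
  qed
  then obtain E where E: "\<And>x. x \<in> C \<Longrightarrow> E x \<in> D" "\<And>x. x \<in> C \<Longrightarrow> lz D (x \<ominus> E x)"
    "\<And>x e. x \<in> C \<Longrightarrow> e > 0 \<Longrightarrow> \<exists>i\<in>I. \<exists>y\<in>S i. nm (x \<ominus> y) \<le> e \<and> nm (E x \<ominus> F i y) \<le> e"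
    by metis
  have Ec: "x \<in> C \<Longrightarrow> E x \<in> Cr" for x using E(1) Dcl by blast
  have Euniq: "E x = d" if "x \<in> C" "d \<in> D" "lz D (x \<ominus> d)" for x d
    by (rule lz_unique[OF D_subalg D_abelian E(1)[OF that(1)] that(2) E(2)[OF that(1)] that(3) Ccl[OF that(1)]])
  have ES: "E x = F i x" if i: "i \<in> I" "x \<in> S i" for i x
    using i SC[OF i(1)] rce_lz[OF i F[OF i(1)]] FD[OF i] by (intro Euniq) auto
  have rce: "rce C D E"
    unfolding rce_def
  proof (intro conjI ballI allI)
    fix x assume x: "x \<in> C"
    have xc [simp]: "x \<in> Cr" "E x \<in> Cr" using Ccl[OF x] Ec[OF x] by auto
    show "E x \<in> D" by (rule E(1)[OF x])
    show "E (x \<oplus> y) = E x \<oplus> E y" if y: "y \<in> C" for y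
    proof (rule Euniq)
      have yc: "y \<in> Cr" "E y \<in> Cr" using Ccl[OF y] Ec[OF y] by auto
      have "(x \<oplus> y) \<ominus> (E x \<oplus> E y) = (x \<ominus> E x) \<oplus> (y \<ominus> E y)" using yc by (simp add: alg)
      then show "lz D (x \<oplus> y \<ominus> (E x \<oplus> E y))" using lz_add[OF E(2)[OF x] E(2)[OF y]] by simp
    qed (intro Cops Dops E(1) x y)+
    show "E (c \<odot> x) = c \<odot> E x" for c
    proof (rule Euniq)
      have "c \<odot> x \<ominus> c \<odot> E x = c \<odot> (x \<ominus> E x)" by (simp add: sm_diff)
      then show "lz D (c \<odot> x \<ominus> c \<odot> E x)" using lz_sm[OF E(2)[OF x]] by simp
    qed (intro Cops Dops E(1) x)+
    show "E (d \<otimes> x \<otimes> d') = d \<otimes> E x \<otimes> d'" if d: "d \<in> D" "d' \<in> D" for d d'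
    proof (rule Euniq)
      have "d \<otimes> x \<otimes> d' \<ominus> d \<otimes> E x \<otimes> d' = d \<otimes> (x \<ominus> E x) \<otimes> d'" using Dcl[OF d(1)] Dcl[OF d(2)] by (simp add: diff_mul mul_diff)
      then show "lz D (d \<otimes> x \<otimes> d' \<ominus> d \<otimes> E x \<otimes> d')" using lz_mult[OF D_subalg D_abelian E(2)[OF x] d] by simp
      have "d \<in> C" "d' \<in> C" using d D_sub_C by auto
      then show "d \<otimes> x \<otimes> d' \<in> C" by (intro Cops x)
      show "d \<otimes> E x \<otimes> d' \<in> D" by (intro Dops E(1) x d)
    qed
    show "nm (E x) \<le> nm x"
    proof (rule field_le_epsilon)
      fix e :: real assume "e > 0"
      then obtain i y where y: "i \<in> I" "y \<in> S i" "nm (x \<ominus> y) \<le> e/2" "nm (E x \<ominus> F i y) \<le> e/2"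
        using E(3)[OF x, of "e/2"] by auto
      have yc: "y \<in> Cr" "F i y \<in> Cr" using Sc y Dcl FD by auto
      have "nm (E x) \<le> nm (E x \<ominus> F i y) + nm (F i y)" using yc by (intro nm_le_diff) auto
      moreover have "nm (F i y) \<le> nm y" by (rule rceD(6)[OF F[OF y(1)] y(2)])
      moreover have "nm y \<le> nm (x \<ominus> y) + nm x" using nm_le_diff[of y x] nm_minus_comm[of x y] yc by simp
      ultimately show "nm (E x) \<le> nm x + e" using y by linarith
    qed
  next
    fix d assume d: "d \<in> D"
    have "d \<in> C" using d D_sub_C by blast
    then show "E d = d" using d Dcl[OF d] lz_zero by (intro Euniq) auto
  qed
  have "pos (E (y\<^sup>\<star> \<otimes> y))" if y: "y \<in> C" for y
  proof -
    have yc [simp]: "y \<in> Cr" by (rule Ccl[OF y])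
    define p where "p = E (y\<^sup>\<star> \<otimes> y)"
    have yy: "y\<^sup>\<star> \<otimes> y \<in> C" by (intro Cops y)
    have pc [simp]: "p \<in> Cr" unfolding p_def by (rule Ec[OF yy])
    have app: "\<exists>q. pos q \<and> nm (p \<ominus> q) \<le> e" if e: "e > 0" for e
    proof -
      \<comment> \<open>For \<open>d \<le> 1\<close> the squares of \<open>y\<close> and
        \<open>z\<close> differ by at most \<open>d * nm y + (nm y + 1) * d\<close>, which this
        choice keeps below \<open>e\<close>.\<close>
      define d where "d = min 1 (e / (2 * nm y + 1 + 1))"
      have "2 * nm y + 1 + 1 > 0" using nm_ge_0[OF yc] by linarith
      then have d: "d > 0" "d \<le> 1" "d \<le> e / (2 * nm y + 1 + 1)" using e by (auto simp: d_def)
      have de: "(2 * nm y + 1) * d \<le> e"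
      proof -
        have "(2 * nm y + 1) * d \<le> (2 * nm y + 1) * (e / (2 * nm y + 1 + 1))"
          using d by (intro mult_left_mono) auto
        also have "\<dots> \<le> e" using e by (intro scale_eps(2)) auto
        finally show ?thesis .
      qed
      obtain i z where z: "i \<in> I" "z \<in> S i" "nm (y \<ominus> z) \<le> d" using E(3)[OF y d(1)] by blast
      have zc [simp]: "z \<in> Cr" by (rule Sc[OF z(1,2)])
      have zz: "z\<^sup>\<star> \<otimes> z \<in> S i" by (intro subalg_ops[OF S[OF z(1)]] z(2))
      have zC: "z\<^sup>\<star> \<otimes> z \<in> C" using zz SC[OF z(1)] by blast
      have "p \<ominus> F i (z\<^sup>\<star> \<otimes> z) = E (y\<^sup>\<star> \<otimes> y \<ominus> z\<^sup>\<star> \<otimes> z)"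
        unfolding p_def ES[OF z(1) zz, symmetric] by (rule rce_diff[OF rce C_subalg yy zC, symmetric])
      then have "nm (p \<ominus> F i (z\<^sup>\<star> \<otimes> z)) \<le> nm (y\<^sup>\<star> \<otimes> y \<ominus> z\<^sup>\<star> \<otimes> z)"
        using rceD(6)[OF rce Cops(6)[OF yy zC]] by simp
      also have "y\<^sup>\<star> \<otimes> y \<ominus> z\<^sup>\<star> \<otimes> z = (y \<ominus> z)\<^sup>\<star> \<otimes> y \<oplus> z\<^sup>\<star> \<otimes> (y \<ominus> z)" by (simp add: alg)
      also have "nm \<dots> \<le> d * nm y + nm z * d"
        using z(3) nm_mul_le[of "(y \<ominus> z)\<^sup>\<star>" y d "nm y"] nm_mul_le[of "z\<^sup>\<star>" "y \<ominus> z" "nm z" d]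
          nm_add[of "(y \<ominus> z)\<^sup>\<star> \<otimes> y" "z\<^sup>\<star> \<otimes> (y \<ominus> z)"] by simp
      also have "\<dots> \<le> d * nm y + (nm y + 1) * d"
        using z(3) d nm_le_diff[of z y] nm_minus_comm[of y z] by (intro add_left_mono mult_right_mono) auto
      also have "\<dots> = (2 * nm y + 1) * d" by (simp add: algebra_simps)
      finally show ?thesis using de pF[OF z(1,2)] by (intro exI[of _ "F i (z\<^sup>\<star> \<otimes> z)"]) simp
    qed
    \<comment> \<open>\<open>pos_closed\<close> presupposes self-adjointness, so this is settled
      first: \<open>p\<close> is a limit of self-adjoint elements.\<close>
    have "nm (p \<ominus> p\<^sup>\<star>) \<le> e" if e: "e > 0" for e
    proof -
      obtain q where q: "pos q" "nm (p \<ominus> q) \<le> e/2" using app[of "e/2"] e by auto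
      have q': "q \<in> Cr" "q\<^sup>\<star> = q" using pos_sa[OF q(1)] by auto
      have "p \<ominus> p\<^sup>\<star> = (p \<ominus> q) \<ominus> (p \<ominus> q)\<^sup>\<star>" using q' by (simp add: alg)
      then show ?thesis using nm_diff[of "p \<ominus> q" "(p \<ominus> q)\<^sup>\<star>"] q q' by simp
    qed
    then have "p \<ominus> p\<^sup>\<star> = \<zero>" by (intro nm_small_eq_0) auto
    then have "sa p" by (intro saI) (simp_all add: diff_eq_zero)
    then have "pos p" using app by (rule pos_closed)
    then show ?thesis by (simp add: p_def)
  qed
  then show ?thesis using rce by blast
qed

end

section \<open>Transfer along injective homomorphisms\<close>

locale iso_mono = S: cst A + T: cst B for A :: "'a cstar" and B :: "'b cstar" +
  fixes f :: "'a \<Rightarrow> 'b"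
  assumes mono: "star_mono A B f"
begin

lemma f_cl [simp]: "x \<in> cs_carrier A \<Longrightarrow> f x \<in> cs_carrier B"
  using mono unfolding star_mono_def star_hom_def by blast

text \<open>Oriented so that expressions in images collapse to a single outer \<open>f\<close>;
  membership and equality are then pulled back by \<open>f_mem\<close> and
  \<open>f_eq\<close>.\<close>

lemma f_simps:
  "\<lbrakk>x \<in> cs_carrier A; y \<in> cs_carrier A\<rbrakk> \<Longrightarrow> cs_add B (f x) (f y) = f (cs_add A x y)"
  "\<lbrakk>x \<in> cs_carrier A; y \<in> cs_carrier A\<rbrakk> \<Longrightarrow> cs_mult B (f x) (f y) = f (cs_mult A x y)"
  "x \<in> cs_carrier A \<Longrightarrow> cs_smult B c (f x) = f (cs_smult A c x)"
  "x \<in> cs_carrier A \<Longrightarrow> cs_star B (f x) = f (cs_star A x)"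
  using mono unfolding star_mono_def star_hom_def by simp_all

lemma f_diff: "\<lbrakk>x \<in> cs_carrier A; y \<in> cs_carrier A\<rbrakk> \<Longrightarrow> cs_diff B (f x) (f y) = f (cs_diff A x y)"
  by (simp add: cs_diff_def f_simps)

lemma f_zero: "cs_zero B = f (cs_zero A)"
  using f_simps(3)[of "cs_zero A" 0] by simp

lemma f_norm: "x \<in> cs_carrier A \<Longrightarrow> cs_norm B (f x) = cs_norm A x"
  by (rule star_mono_isometric[OF S.cstar T.cstar mono])

lemma f_inj: "inj_on f (cs_carrier A)"
  using mono unfolding star_mono_def by blast

lemma f_eq: "\<lbrakk>x \<in> cs_carrier A; y \<in> cs_carrier A\<rbrakk> \<Longrightarrow> f x = f y \<longleftrightarrow> x = y"
  using f_inj by (rule inj_on_eq_iff)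

lemma f_mem: "\<lbrakk>x \<in> cs_carrier A; X \<subseteq> cs_carrier A\<rbrakk> \<Longrightarrow> f x \<in> f ` X \<longleftrightarrow> x \<in> X"
  using f_inj by (rule inj_on_image_mem_iff)

lemma image_sub: "X \<subseteq> cs_carrier A \<Longrightarrow> f ` X \<subseteq> cs_carrier B"
  by auto

lemma image_inj: "\<lbrakk>X \<subseteq> cs_carrier A; Y \<subseteq> cs_carrier A\<rbrakk> \<Longrightarrow> f ` X = f ` Y \<longleftrightarrow> X = Y"
  using inj_on_image_eq_iff[OF f_inj] by blast

text \<open>For a limit of image points, isometry makes the preimages a Cauchy sequence, and
  completeness of \<open>A\<close> supplies a preimage of the limit.\<close>

lemma closure_image:
  assumes X: "X \<subseteq> cs_carrier A"
  shows "cs_closure B (f ` X) = f ` cs_closure A X"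
proof
  show "f ` cs_closure A X \<subseteq> cs_closure B (f ` X)"
  proof
    fix y assume "y \<in> f ` cs_closure A X"
    then obtain x where x: "x \<in> cs_closure A X" "y = f x" by blast
    have xc: "x \<in> cs_carrier A" by (rule S.closure_cl[OF x(1)])
    show "y \<in> cs_closure B (f ` X)"
      unfolding x(2)
    proof (rule T.in_closureI)
      fix e :: real assume "e > 0"
      then obtain s where "s \<in> X" "cs_norm A (cs_diff A x s) < e" using S.in_closureD[OF x(1)] by blast
      then show "\<exists>s\<in>f ` X. cs_norm B (cs_diff B (f x) s) < e"
        using X xc by (auto simp: f_diff f_norm subset_iff intro!: bexI[of _ s])
    qed (use xc in simp)
  qed
  show "cs_closure B (f ` X) \<subseteq> f ` cs_closure A X"
  proof
    fix y assume y: "y \<in> cs_closure B (f ` X)"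
    have yc: "y \<in> cs_carrier B" by (rule T.closure_cl[OF y])
    have "\<exists>x\<in>X. cs_norm B (cs_diff B y (f x)) < 1 / real (Suc n)" for n
      using T.in_closureD[OF y, of "1 / real (Suc n)"] by auto
    then obtain x where x: "\<And>n. x n \<in> X" "\<And>n. cs_norm B (cs_diff B y (f (x n))) < 1 / real (Suc n)" by metis
    have xc: "x n \<in> cs_carrier A" for n using x X by blast
    have small: "\<exists>N. \<forall>n\<ge>N. cs_norm B (cs_diff B y (f (x n))) < e" if e: "e > 0" for e
    proof -
      obtain N where N: "1 / real (Suc N) < e" using nat_approx_posE[OF e] by blast
      have "cs_norm B (cs_diff B y (f (x n))) < e" if "n \<ge> N" for n
      proof -
        have "1 / real (Suc n) \<le> 1 / real (Suc N)" using that by (simp add: frac_le)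
        then show ?thesis using x(2)[of n] N by linarith
      qed
      then show ?thesis by blast
    qed
    obtain z where z: "z \<in> cs_carrier A" "\<And>e. e > 0 \<Longrightarrow> \<exists>N. \<forall>n\<ge>N. cs_norm A (cs_diff A (x n) z) < e"
    proof (rule S.completeD[of x])
      fix e :: real assume "e > 0"
      then obtain N where N: "\<forall>n\<ge>N. cs_norm B (cs_diff B y (f (x n))) < e/2" using small[of "e/2"] by auto
      have "cs_norm A (cs_diff A (x m) (x n)) < e" if mn: "m \<ge> N" "n \<ge> N" for m n
      proof -
        have "cs_norm A (cs_diff A (x m) (x n)) = cs_norm B (cs_diff B (f (x m)) (f (x n)))"
          using xc by (simp add: f_diff f_norm)
        also have "\<dots> \<le> cs_norm B (cs_diff B y (f (x m))) + cs_norm B (cs_diff B y (f (x n)))"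
          using T.nm_triangle[of "f (x m)" y "f (x n)"] T.nm_minus_comm[of "f (x m)" y] xc yc by simp
        also have "\<dots> < e" using N[rule_format, OF mn(1)] N[rule_format, OF mn(2)] by linarith
        finally show ?thesis .
      qed
      then show "\<exists>N. \<forall>m\<ge>N. \<forall>n\<ge>N. cs_norm A (cs_diff A (x m) (x n)) < e" by blast
    qed (use xc in auto)
    have both: "\<exists>n. cs_norm B (cs_diff B y (f (x n))) < e \<and> cs_norm A (cs_diff A (x n) z) < e" if e: "e > 0" for e
    proof -
      obtain N1 where N1: "\<forall>n\<ge>N1. cs_norm B (cs_diff B y (f (x n))) < e" using small[OF e] by blast
      obtain N2 where N2: "\<forall>n\<ge>N2. cs_norm A (cs_diff A (x n) z) < e" using z(2)[OF e] by blast
      show ?thesis using N1 N2 by (intro exI[of _ "max N1 N2"]) simp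
    qed
    have "z \<in> cs_closure A X"
    proof (rule S.in_closureI[OF z(1)])
      fix e :: real assume "e > 0"
      then obtain n where "cs_norm A (cs_diff A (x n) z) < e" using both by blast
      then show "\<exists>s\<in>X. cs_norm A (cs_diff A z s) < e" using x(1) S.nm_minus_comm[OF xc z(1), of n] by auto
    qed
    moreover have "y = f z"
    proof -
      have "cs_norm B (cs_diff B y (f z)) \<le> e" if e: "e > 0" for e
      proof -
        obtain n where n: "cs_norm B (cs_diff B y (f (x n))) < e/2" "cs_norm A (cs_diff A (x n) z) < e/2"
          using both[of "e/2"] e by auto
        have "cs_norm B (cs_diff B (f (x n)) (f z)) < e/2" using n(2) xc z(1) by (simp add: f_diff f_norm)
        then show ?thesis using n(1) T.nm_triangle[of y "f (x n)" "f z"] yc xc z(1) by simp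
      qed
      then have "cs_diff B y (f z) = cs_zero B" using yc z(1) by (intro T.nm_small_eq_0) auto
      then show ?thesis using yc z(1) by (simp add: T.diff_eq_zero)
    qed
    ultimately show "y \<in> f ` cs_closure A X" by blast
  qed
qed

lemma closed_image: "X \<subseteq> cs_carrier A \<Longrightarrow> cs_closure B (f ` X) = f ` X \<longleftrightarrow> cs_closure A X = X"
  unfolding closure_image by (rule image_inj) (use S.closure_cl in auto)

lemma ball_image: "(\<forall>y\<in>f ` X. P y) \<longleftrightarrow> (\<forall>x\<in>X. P (f x))"
  by blast

lemma subalg_image: "X \<subseteq> cs_carrier A \<Longrightarrow> cs_subalg B (f ` X) \<longleftrightarrow> cs_subalg A X"
proof -
  assume X: "X \<subseteq> cs_carrier A"
  then have c: "x \<in> X \<Longrightarrow> x \<in> cs_carrier A" for x by blast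
  show ?thesis
    unfolding cs_subalg_def closed_image[OF X] ball_image f_zero
    using image_sub[OF X] X by (simp add: f_simps f_mem c cong: ball_cong_simp)
qed

lemma ideal_image:
  assumes X: "X \<subseteq> cs_carrier A" and J: "J \<subseteq> X"
  shows "closed_ideal_in B (f ` X) (f ` J) \<longleftrightarrow> closed_ideal_in A X J"
proof -
  have J': "J \<subseteq> cs_carrier A" using X J by blast
  have c: "x \<in> X \<Longrightarrow> x \<in> cs_carrier A" "x \<in> J \<Longrightarrow> x \<in> cs_carrier A" for x using X J by auto
  show ?thesis
    unfolding closed_ideal_in_def closed_image[OF J'] ball_image f_zero
    using J J' by (simp add: f_simps f_mem c image_mono cong: ball_cong_simp)
qed

lemma iip_image:
  assumes X: "X \<subseteq> cs_carrier A" and Y: "Y \<subseteq> cs_carrier A"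
  shows "iip B (f ` X) (f ` Y) \<longleftrightarrow> iip A X Y"
proof -
  have z: "{cs_zero B} = f ` {cs_zero A}" by (simp add: f_zero)
  have int: "f ` J \<inter> f ` Y = {cs_zero B} \<longleftrightarrow> J \<inter> Y = {cs_zero A}" if "J \<subseteq> X" for J
  proof -
    have "f ` J \<inter> f ` Y = f ` (J \<inter> Y)" using f_inj that X Y by (intro inj_on_image_Int[symmetric]) auto
    then show ?thesis unfolding z using that X Y by (simp only:) (rule image_inj, auto)
  qed
  have zero: "f ` J = {cs_zero B} \<longleftrightarrow> J = {cs_zero A}" if "J \<subseteq> X" for J
    unfolding z using that X by (intro image_inj) auto
  show ?thesis
  proof
    assume i: "iip B (f ` X) (f ` Y)"
    show "iip A X Y"
      unfolding iip_def
    proof (intro allI impI)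
      fix J assume J: "closed_ideal_in A X J \<and> J \<noteq> {cs_zero A}"
      then have JX: "J \<subseteq> X" by (simp add: closed_ideal_in_def)
      then show "J \<inter> Y \<noteq> {cs_zero A}"
        using J i ideal_image[OF X JX] zero[OF JX] int[OF JX] unfolding iip_def by metis
    qed
  next
    assume i: "iip A X Y"
    show "iip B (f ` X) (f ` Y)"
      unfolding iip_def
    proof (intro allI impI)
      fix J' assume J': "closed_ideal_in B (f ` X) J' \<and> J' \<noteq> {cs_zero B}"
      then have "J' \<subseteq> f ` X" by (simp add: closed_ideal_in_def)
      then obtain J where J: "J \<subseteq> X" "J' = f ` J" by (rule subset_imageE)
      show "J' \<inter> f ` Y \<noteq> {cs_zero B}"
        using J' i ideal_image[OF X J(1)] zero[OF J(1)] int[OF J(1)] unfolding J(2) iip_def by metis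
    qed
  qed
qed

lemma normalizers_image:
  assumes X: "X \<subseteq> cs_carrier A"
  shows "f ` cs_carrier A \<inter> normalizers B (f ` X) = f ` normalizers A X"
proof -
  have c: "x \<in> X \<Longrightarrow> x \<in> cs_carrier A" for x using X by blast
  have "f v \<in> normalizers B (f ` X) \<longleftrightarrow> v \<in> normalizers A X" if "v \<in> cs_carrier A" for v
    unfolding normalizers_def mem_Collect_eq ball_image
    using that X by (simp add: f_simps f_mem c cong: ball_cong_simp)
  then show ?thesis unfolding normalizers_def[of A] by (auto simp: normalizers_def[of A])
qed

lemma relcomm_image:
  assumes X: "X \<subseteq> cs_carrier A"
  shows "f ` cs_carrier A \<inter> relcomm B (f ` X) = f ` relcomm A X"
proof -
  have c: "x \<in> X \<Longrightarrow> x \<in> cs_carrier A" for x using X by blast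
  have "f v \<in> relcomm B (f ` X) \<longleftrightarrow> v \<in> relcomm A X" if "v \<in> cs_carrier A" for v
    unfolding relcomm_def mem_Collect_eq ball_image
    using that by (simp add: f_simps f_eq c cong: ball_cong_simp)
  then show ?thesis unfolding relcomm_def[of A] by (auto simp: relcomm_def[of A])
qed

lemma abelian_image: "X \<subseteq> cs_carrier A \<Longrightarrow> cs_abelian B (f ` X) \<longleftrightarrow> cs_abelian A X"
proof -
  assume X: "X \<subseteq> cs_carrier A"
  then have c: "x \<in> X \<Longrightarrow> x \<in> cs_carrier A" for x by blast
  show ?thesis unfolding cs_abelian_def ball_image by (simp add: f_simps f_eq c cong: ball_cong_simp)
qed

lemma span_cl: "X \<subseteq> cs_carrier A \<Longrightarrow> x \<in> cs_span A X \<Longrightarrow> x \<in> cs_carrier A"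
  by (erule cs_span.induct) auto

lemma span_image: "X \<subseteq> cs_carrier A \<Longrightarrow> cs_span B (f ` X) = f ` cs_span A X"
proof
  assume X: "X \<subseteq> cs_carrier A"
  show "cs_span B (f ` X) \<subseteq> f ` cs_span A X"
  proof
    fix y assume "y \<in> cs_span B (f ` X)"
    then show "y \<in> f ` cs_span A X"
    proof (induction rule: cs_span.induct)
      case (span_add x y)
      then obtain u v where "u \<in> cs_span A X" "x = f u" "v \<in> cs_span A X" "y = f v" by blast
      then show ?case using span_cl[OF X] cs_span.span_add[of u A X v] by (simp add: f_simps)
    next
      case (span_smult x c)
      then obtain u where "u \<in> cs_span A X" "x = f u" by blast
      then show ?case using span_cl[OF X] cs_span.span_smult[of u A X c] by (simp add: f_simps)
    qed (auto simp: f_zero intro: cs_span.intros)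
  qed
  have "f x \<in> cs_span B (f ` X)" if "x \<in> cs_span A X" for x
    using that
  proof (induction rule: cs_span.induct)
    case (span_add x y)
    then show ?case
      using cs_span.span_add[of "f x" B "f ` X" "f y"] span_cl[OF X] by (simp add: f_simps)
  next
    case (span_smult x c)
    then show ?case
      using cs_span.span_smult[of "f x" B "f ` X" c] span_cl[OF X] by (simp add: f_simps)
  qed (auto simp: f_zero[symmetric] intro: cs_span.intros)
  then show "f ` cs_span A X \<subseteq> cs_span B (f ` X)" by blast
qed

lemma regular_image:
  assumes X: "X \<subseteq> cs_carrier A"
  shows "cs_closure B (cs_span B (f ` cs_carrier A \<inter> normalizers B (f ` X))) = f ` cs_carrier A \<longleftrightarrow> regular_incl A X"
proof -
  have N: "normalizers A X \<subseteq> cs_carrier A" unfolding normalizers_def by blast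
  have s: "cs_span A (normalizers A X) \<subseteq> cs_carrier A" using span_cl[OF N] by blast
  have "cs_closure A (cs_span A (normalizers A X)) \<subseteq> cs_carrier A" using S.closure_cl by blast
  then show ?thesis
    unfolding regular_incl_def normalizers_image[OF X] span_image[OF N] closure_image[OF s]
    by (intro image_inj) auto
qed

text \<open>Normalizers and commutants formed in \<open>B\<close> may be larger than the images of
  those in \<open>A\<close>, hence the intersections with the image of the carrier. In this form the
  notion can be handled entirely inside the ambient algebra.\<close>

lemma pseudo_cartan_image:
  assumes X: "X \<subseteq> cs_carrier A"
  shows "pseudo_cartan A X \<longleftrightarrow> cs_subalg B (f ` X) \<and>
     cs_closure B (cs_span B (f ` cs_carrier A \<inter> normalizers B (f ` X))) = f ` cs_carrier A \<and>
     cs_abelian B (f ` X) \<and> cs_abelian B (f ` cs_carrier A \<inter> relcomm B (f ` X)) \<and>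
     iip B (f ` cs_carrier A) (f ` cs_carrier A \<inter> relcomm B (f ` X)) \<and>
     iip B (f ` cs_carrier A \<inter> relcomm B (f ` X)) (f ` X)"
proof -
  have R: "relcomm A X \<subseteq> cs_carrier A" unfolding relcomm_def by blast
  show ?thesis
    unfolding pseudo_cartan_def regular_image[OF X] relcomm_image[OF X] subalg_image[OF X] abelian_image[OF X]
      abelian_image[OF R] iip_image[OF order_refl R] iip_image[OF R X]
    using S.cstar by blast
qed

abbreviation "finv \<equiv> the_inv_into (cs_carrier A) f"

lemma finv_f [simp]: "x \<in> cs_carrier A \<Longrightarrow> finv (f x) = x"
  by (rule the_inv_into_f_f[OF f_inj])

lemma f_finv: "y \<in> f ` cs_carrier A \<Longrightarrow> f (finv y) = y"
  by (rule f_the_inv_into_f[OF f_inj])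

end

lemma cond_expD:
  assumes "cond_exp A D E"
  shows "x \<in> cs_carrier A \<Longrightarrow> E x \<in> D" "d \<in> D \<Longrightarrow> E d = d"
    "x \<in> cs_carrier A \<Longrightarrow> y \<in> cs_carrier A \<Longrightarrow> E (cs_add A x y) = cs_add A (E x) (E y)"
    "x \<in> cs_carrier A \<Longrightarrow> E (cs_smult A c x) = cs_smult A c (E x)"
    "x \<in> cs_carrier A \<Longrightarrow> d \<in> D \<Longrightarrow> d' \<in> D \<Longrightarrow> E (cs_mult A (cs_mult A d x) d') = cs_mult A (cs_mult A d (E x)) d'"
    "x \<in> cs_carrier A \<Longrightarrow> cs_positive A x \<Longrightarrow> cs_positive A (E x)"
    "x \<in> cs_carrier A \<Longrightarrow> cs_norm A (E x) \<le> cs_norm A x"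
  using assms unfolding cond_exp_def by blast+

locale iso_umono = iso_mono A B f + T: ucst B one
  for A :: "'a cstar" and B :: "'b cstar" and f :: "'a \<Rightarrow> 'b" and one
begin

lemma rce_image:
  assumes X: "X \<subseteq> cs_carrier A" and F: "cond_exp A X F"
  shows "T.rce (f ` cs_carrier A) (f ` X) (\<lambda>y. f (F (finv y)))"
proof -
  have c: "x \<in> X \<Longrightarrow> x \<in> cs_carrier A" for x using X by blast
  note FD = cond_expD[OF F]
  show ?thesis
    unfolding T.rce_def ball_image
    by (simp add: f_simps f_norm c FD)
qed

lemma rce_image_pos:
  assumes X: "X \<subseteq> cs_carrier A" and F: "cond_exp A X F" and y: "y \<in> f ` cs_carrier A"
  shows "T.pos (f (F (finv (cs_mult B (cs_star B y) y))))"
proof -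
  obtain x where x: "x \<in> cs_carrier A" "y = f x" using y by blast
  have "cs_positive A (F (cs_mult A (cs_star A x) x))"
    using x(1) by (intro cond_expD(6)[OF F]) (auto simp: cs_positive_def)
  then obtain z where z: "z \<in> cs_carrier A" "F (cs_mult A (cs_star A x) x) = cs_mult A (cs_star A z) z"
    unfolding cs_positive_def by blast
  have "f (F (finv (cs_mult B (cs_star B y) y))) = cs_mult B (cs_star B (f z)) (f z)"
    unfolding x(2) using x(1) z by (simp add: f_simps)
  then show ?thesis using T.pos_star_mult[of "f z"] z(1) by simp
qed

text \<open>Positivity in \<open>A\<close> demands a factorization within \<open>A\<close>. A
  positive value has a square root in the closed subalgebra that is the image of \<open>X\<close>,
  and this root is pulled back along \<open>f\<close>.\<close>

lemma cond_exp_of_rce: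
  assumes X: "X \<subseteq> cs_carrier A" "cs_subalg A X" and G: "T.rce (f ` cs_carrier A) (f ` X) G"
    and pos: "\<And>y. y \<in> f ` cs_carrier A \<Longrightarrow> T.pos (G (cs_mult B (cs_star B y) y))"
  shows "cond_exp A X (\<lambda>x. finv (G (f x)))"
proof -
  have c: "x \<in> X \<Longrightarrow> x \<in> cs_carrier A" for x using X by blast
  define E where "E x = finv (G (f x))" for x
  note GD = T.rceD[OF G]
  have GX: "\<exists>d\<in>X. G (f x) = f d" if "x \<in> cs_carrier A" for x using GD(1)[of "f x"] that by blast
  then have EX: "E x \<in> X" if "x \<in> cs_carrier A" for x using that c unfolding E_def by fastforce
  have fE: "f (E x) = G (f x)" if "x \<in> cs_carrier A" for x
    unfolding E_def using GX[OF that] c by (intro f_finv) auto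
  have eqI: "E x = y" if "x \<in> cs_carrier A" "y \<in> cs_carrier A" "G (f x) = f y" for x y
    unfolding E_def using that by simp
  have Ec: "E x \<in> cs_carrier A" if "x \<in> cs_carrier A" for x using EX[OF that] c by blast
  have "cond_exp A X E"
    unfolding cond_exp_def
  proof (intro conjI ballI allI impI)
    show "E ` cs_carrier A \<subseteq> X" using EX by blast
    show "E d = d" if "d \<in> X" for d using that c GD(2)[of "f d"] by (intro eqI) auto
    show "E (cs_add A x y) = cs_add A (E x) (E y)" if "x \<in> cs_carrier A" "y \<in> cs_carrier A" for x y
      using that GD(3)[of "f x" "f y"] by (intro eqI) (simp_all add: Ec f_simps flip: fE)
    show "E (cs_smult A c x) = cs_smult A c (E x)" if "x \<in> cs_carrier A" for x c
      using that GD(4)[of "f x" c] by (intro eqI) (simp_all add: Ec f_simps flip: fE)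
    show "E (cs_mult A (cs_mult A d x) d') = cs_mult A (cs_mult A d (E x)) d'"
      if "x \<in> cs_carrier A" "d \<in> X" "d' \<in> X" for x d d'
      using that c GD(5)[of "f x" "f d" "f d'"] by (intro eqI) (simp_all add: Ec f_simps flip: fE)
    show "cs_norm A (E x) \<le> cs_norm A x" if "x \<in> cs_carrier A" for x
      using that GD(6)[of "f x"] by (simp add: f_norm Ec flip: fE)
    fix x assume x: "x \<in> cs_carrier A" "cs_positive A x"
    then obtain y where y: "y \<in> cs_carrier A" "x = cs_mult A (cs_star A y) y" unfolding cs_positive_def by blast
    have fx: "f x = cs_mult B (cs_star B (f y)) (f y)" unfolding y(2) using y(1) by (simp add: f_simps)
    have "T.pos (f (E x))" unfolding fE[OF x(1)] fx using y(1) by (intro pos) simp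
    moreover have "cs_subalg B (f ` X)" using X subalg_image by blast
    moreover have "f (E x) \<in> f ` X" using EX[OF x(1)] by blast
    ultimately obtain r where r: "r \<in> f ` X" "T.sa r" "f (E x) = cs_mult B r r" using T.pos_root by blast
    then obtain s where s: "s \<in> X" "r = f s" by blast
    have "f (E x) = cs_mult B (cs_star B (f s)) (f s)" using r(2,3) T.sa_star[OF r(2)] s(2) by simp
    also have "\<dots> = f (cs_mult A (cs_star A s) s)" using c[OF s(1)] by (simp add: f_simps)
    finally have "E x = cs_mult A (cs_star A s) s" using Ec[OF x(1)] c[OF s(1)] by (simp add: f_eq)
    then show "cs_positive A (E x)" using c[OF s(1)] unfolding cs_positive_def by blast
  qed
  then show ?thesis by (simp add: E_def[abs_def])
qed

end

section \<open>The inductive limit\<close>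

lemma star_mono_comp:
  assumes "star_mono A B f" "star_mono B C g"
  shows "star_mono A C (\<lambda>x. g (f x))"
proof -
  have f: "star_hom A B f" "inj_on f (cs_carrier A)" and g: "star_hom B C g" "inj_on g (cs_carrier B)"
    using assms unfolding star_mono_def by auto
  have cl: "f ` cs_carrier A \<subseteq> cs_carrier B" using f(1) unfolding star_hom_def by blast
  have "inj_on (g \<circ> f) (cs_carrier A)" using f(2) g(2) cl by (intro comp_inj_on) (auto intro: inj_on_subset)
  moreover have "star_hom A C (\<lambda>x. g (f x))"
    using f(1) g(1) cl unfolding star_hom_def by (auto simp: subset_iff)
  ultimately show ?thesis unfolding star_mono_def by (simp add: comp_def)
qed

locale pc_limit =
  fixes I :: "'i set" and le :: "'i \<Rightarrow> 'i \<Rightarrow> bool"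
    and C :: "'i \<Rightarrow> 'a cstar" and D :: "'i \<Rightarrow> 'a set" and \<alpha> :: "'i \<Rightarrow> 'i \<Rightarrow> 'a \<Rightarrow> 'a"
    and L :: "'b cstar" and \<beta> :: "'i \<Rightarrow> 'a \<Rightarrow> 'b"
  assumes sys: "pc_system I le C D \<alpha>"
    and lim: "is_ind_limit I le C \<alpha> L \<beta>"
begin

abbreviation "U \<equiv> unitz L"
abbreviation "uone \<equiv> (cs_zero L, 1 :: complex)"
abbreviation emb :: "'b \<Rightarrow> 'b \<times> complex" where "emb \<equiv> \<lambda>x. (x, 0)"
abbreviation "Dl \<equiv> limit_sub I D L \<beta>"

definition \<gamma> :: "'i \<Rightarrow> 'a \<Rightarrow> 'b \<times> complex" where "\<gamma> i x = emb (\<beta> i x)"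

lemma L_cstar: "cstar_alg L"
  using lim unfolding is_ind_limit_def by blast

sublocale L: cst L
  by unfold_locales (rule L_cstar)

lemma emb_mono: "star_mono L U emb"
  unfolding star_mono_def star_hom_def by (auto simp: L.unitz_sel inj_on_def)

sublocale U: ucst U uone
  by (rule L.unitz_ucst)

sublocale E: iso_umono L U emb uone
  by unfold_locales (rule emb_mono)

lemma dirI: "directed_set I le"
  using sys unfolding pc_system_def by blast

lemma pcI: "i \<in> I \<Longrightarrow> pseudo_cartan (C i) (D i)"
  using sys unfolding pc_system_def by blast

lemma expI: "\<lbrakk>i \<in> I; j \<in> I; le i j\<rbrakk> \<Longrightarrow> regular_exp (C j) (D j) (\<alpha> j i) (C i) (D i) \<and> essential_exp (C j) (D j) (\<alpha> j i) (C i) (D i)"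
  using sys unfolding pc_system_def by blast

lemma \<beta>_mono: "i \<in> I \<Longrightarrow> star_mono (C i) L (\<beta> i)"
  using lim unfolding is_ind_limit_def by blast

lemma \<beta>_\<alpha>: "\<lbrakk>i \<in> I; j \<in> I; le i j; x \<in> cs_carrier (C i)\<rbrakk> \<Longrightarrow> \<beta> j (\<alpha> j i x) = \<beta> i x"
  using lim unfolding is_ind_limit_def by blast

lemma \<gamma>_\<alpha>: "\<lbrakk>i \<in> I; j \<in> I; le i j; x \<in> cs_carrier (C i)\<rbrakk> \<Longrightarrow> \<gamma> j (\<alpha> j i x) = \<gamma> i x"
  by (simp add: \<gamma>_def \<beta>_\<alpha>)

lemma C_cstar: "i \<in> I \<Longrightarrow> cstar_alg (C i)"
  using pcI unfolding pseudo_cartan_def by blast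

lemma DC: "i \<in> I \<Longrightarrow> D i \<subseteq> cs_carrier (C i)"
  using pcI unfolding pseudo_cartan_def cs_subalg_def by blast

lemma \<gamma>_iso: "i \<in> I \<Longrightarrow> iso_umono (C i) U (\<gamma> i) uone"
proof -
  assume i: "i \<in> I"
  have "star_mono (C i) U (\<gamma> i)"
    using star_mono_comp[OF \<beta>_mono[OF i] emb_mono] by (simp add: \<gamma>_def[abs_def])
  then show ?thesis
    by (intro iso_umono.intro iso_mono.intro iso_mono_axioms.intro cst.intro C_cstar[OF i] U.cstar U.ucst_axioms)
qed

lemma \<alpha>_cl: "\<lbrakk>i \<in> I; j \<in> I; le i j; x \<in> cs_carrier (C i)\<rbrakk> \<Longrightarrow> \<alpha> j i x \<in> cs_carrier (C j)"
  using expI unfolding regular_exp_def expansion_def star_mono_def star_hom_def by blast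

abbreviation "gS i \<equiv> \<gamma> i ` cs_carrier (C i)"
abbreviation "gB i \<equiv> \<gamma> i ` D i"

lemma pc_U:
  assumes i: "i \<in> I"
  shows "cs_subalg U (gB i)" "cs_closure U (cs_span U (gS i \<inter> normalizers U (gB i))) = gS i"
    "cs_abelian U (gB i)" "cs_abelian U (gS i \<inter> relcomm U (gB i))"
    "iip U (gS i) (gS i \<inter> relcomm U (gB i))" "iip U (gS i \<inter> relcomm U (gB i)) (gB i)" "cs_subalg U (gS i)"
proof -
  interpret G: iso_umono "C i" U "\<gamma> i" uone by (rule \<gamma>_iso[OF i])
  show "cs_subalg U (gB i)" "cs_closure U (cs_span U (gS i \<inter> normalizers U (gB i))) = gS i"
    "cs_abelian U (gB i)" "cs_abelian U (gS i \<inter> relcomm U (gB i))"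
    "iip U (gS i) (gS i \<inter> relcomm U (gB i))" "iip U (gS i \<inter> relcomm U (gB i)) (gB i)"
    using G.pseudo_cartan_image[OF DC[OF i]] pcI[OF i] by blast+
  have "cs_subalg (C i) (cs_carrier (C i))"
    unfolding cs_subalg_def using G.S.closed_carrier by simp
  then show "cs_subalg U (gS i)" using G.subalg_image[OF order_refl] by blast
qed

text \<open>The compatibility \<open>\<gamma>_\<alpha>\<close> turns the connecting maps into
  inclusions of images, and each notion is transported along the injective maps
  \<open>\<gamma>\<close>.\<close>

sublocale P: dsys U uone I le gS gB
proof unfold_locales
  show "directed_set I le" by (rule dirI)
  fix i assume i: "i \<in> I"
  show "gB i \<subseteq> gS i" using DC[OF i] by blast
  fix j assume j: "j \<in> I" and le: "le i j"
  interpret G: iso_umono "C i" U "\<gamma> i" uone by (rule \<gamma>_iso[OF i])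
  interpret H: iso_umono "C j" U "\<gamma> j" uone by (rule \<gamma>_iso[OF j])
  have ex: "\<alpha> j i ` D i \<subseteq> D j" "\<alpha> j i ` normalizers (C i) (D i) \<subseteq> normalizers (C j) (D j)" "iip (C j) (D j) (\<alpha> j i ` D i)"
    using expI[OF i j le] unfolding regular_exp_def essential_exp_def expansion_def by auto
  have g: "\<gamma> i ` X = \<gamma> j ` \<alpha> j i ` X" if "X \<subseteq> cs_carrier (C i)" for X
    using that \<gamma>_\<alpha>[OF i j le] unfolding image_image by (intro image_cong) auto
  have "normalizers (C i) (D i) \<subseteq> cs_carrier (C i)" unfolding normalizers_def by blast
  then have n: "\<gamma> i ` normalizers (C i) (D i) \<subseteq> \<gamma> j ` normalizers (C j) (D j)" using g ex(2) by (simp add: image_mono)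
  have "\<alpha> j i ` cs_carrier (C i) \<subseteq> cs_carrier (C j)" using \<alpha>_cl[OF i j le] by blast
  then show "gS i \<subseteq> gS j" using g[OF order_refl] by (simp add: image_mono)
  show "gB i \<subseteq> gB j" using g[OF DC[OF i]] ex(1) by (simp add: image_mono)
  show "gS i \<inter> normalizers U (gB i) \<subseteq> normalizers U (gB j)"
    unfolding G.normalizers_image[OF DC[OF i]]
    by (rule order_trans[OF n]) (unfold H.normalizers_image[OF DC[OF j], symmetric], rule Int_lower2)
  show "iip U (gB j) (gB i)"
    using H.iip_image[OF DC[OF j], of "\<alpha> j i ` D i"] ex DC[OF j] g[OF DC[OF i]] by auto
qed (use pc_U in blast)+

section \<open>Returning from the unitization to the limit algebra\<close>

lemma limit_carrier: "P.C = emb ` cs_carrier L"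
proof -
  have sub: "(\<Union>i\<in>I. \<beta> i ` cs_carrier (C i)) \<subseteq> cs_carrier L"
    using \<beta>_mono unfolding star_mono_def star_hom_def by blast
  have "(\<Union>i\<in>I. gS i) = emb ` (\<Union>i\<in>I. \<beta> i ` cs_carrier (C i))"
    by (auto simp: \<gamma>_def)
  then show ?thesis
    unfolding P.C_def using E.closure_image[OF sub] lim unfolding is_ind_limit_def by simp
qed

lemma limit_sub_image: "P.D = emb ` Dl"
proof -
  have sub: "(\<Union>i\<in>I. \<beta> i ` D i) \<subseteq> cs_carrier L"
    using \<beta>_mono DC unfolding star_mono_def star_hom_def by blast
  have "(\<Union>i\<in>I. gB i) = emb ` (\<Union>i\<in>I. \<beta> i ` D i)"
    by (auto simp: \<gamma>_def)
  then show ?thesis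
    unfolding P.D_def limit_sub_def using E.closure_image[OF sub] by simp
qed

lemma Dl_sub: "Dl \<subseteq> cs_carrier L"
  unfolding limit_sub_def using L.closure_cl by blast

lemma limit_pseudo_cartan: "pseudo_cartan L Dl"
  unfolding E.pseudo_cartan_image[OF Dl_sub] limit_carrier[symmetric] limit_sub_image[symmetric]
  using P.D_subalg P.C_reg P.D_abelian P.Dcom_abelian P.C_iip P.Dcom_iip by blast

lemma \<beta>D: "i \<in> I \<Longrightarrow> \<beta> i ` D i \<subseteq> Dl"
proof -
  assume i: "i \<in> I"
  have "(\<Union>i\<in>I. \<beta> i ` D i) \<subseteq> cs_carrier L"
    using \<beta>_mono DC unfolding star_mono_def star_hom_def by blast
  from L.closure_sub[OF this] show ?thesis unfolding limit_sub_def using i by blast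
qed

lemma limit_expansion: "i \<in> I \<Longrightarrow> expansion L Dl (\<beta> i) (C i) (D i)"
  unfolding expansion_def using \<beta>_mono \<beta>D by blast

lemma limit_regular_exp: "i \<in> I \<Longrightarrow> regular_exp L Dl (\<beta> i) (C i) (D i)"
proof -
  assume i: "i \<in> I"
  interpret G: iso_umono "C i" U "\<gamma> i" uone by (rule \<gamma>_iso[OF i])
  have "\<beta> i v \<in> normalizers L Dl" if v: "v \<in> normalizers (C i) (D i)" for v
  proof -
    have "\<gamma> i v \<in> gS i \<inter> normalizers U (gB i)" using G.normalizers_image[OF DC[OF i]] v by blast
    then have "\<gamma> i v \<in> emb ` cs_carrier L \<inter> normalizers U (emb ` Dl)"
      using P.normalizers_limit[OF i] P.SC[OF i] unfolding limit_carrier limit_sub_image by blast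
    then show ?thesis unfolding E.normalizers_image[OF Dl_sub] by (auto simp: \<gamma>_def)
  qed
  then show ?thesis unfolding regular_exp_def using limit_expansion[OF i] by blast
qed

lemma limit_essential_exp: "i \<in> I \<Longrightarrow> essential_exp L Dl (\<beta> i) (C i) (D i)"
proof -
  assume i: "i \<in> I"
  have "gB i = emb ` (\<beta> i ` D i)" by (auto simp: \<gamma>_def)
  then have "iip U (emb ` Dl) (emb ` (\<beta> i ` D i))" using P.DB_iip[OF i] by (simp add: limit_sub_image)
  moreover have "\<beta> i ` D i \<subseteq> cs_carrier L" using \<beta>D[OF i] Dl_sub by blast
  ultimately have "iip L Dl (\<beta> i ` D i)" using E.iip_image[OF Dl_sub] by blast
  then show ?thesis unfolding essential_exp_def using limit_expansion[OF i] by blast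
qed

text \<open>An expectation comes from \<open>rce_limit\<close> and is faithful by
  \<open>rce_faithful\<close>. An abelian algebra containing \<open>Dl\<close> lies in the relative
  commutant, which \<open>rce_masa\<close> places inside \<open>Dl\<close>. The second claim
  concerns an arbitrary expectation \<open>E\<close>, since \<open>rce_unique\<close> fixes the
  values of every one of them on the image of each \<open>C i\<close>.\<close>

lemma limit_cartan:
  assumes \<Delta>: "\<And>i. i \<in> I \<Longrightarrow> cond_exp (C i) (D i) (\<Delta> i)"
  shows "cartan L Dl"
    and "\<lbrakk>cond_exp L Dl E; i \<in> I; x \<in> cs_carrier (C i)\<rbrakk> \<Longrightarrow> E (\<beta> i x) = \<beta> i (\<Delta> i x)"
proof -
  define F where "F i y = \<gamma> i (\<Delta> i (the_inv_into (cs_carrier (C i)) (\<gamma> i) y))" for i y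
  have rF: "U.rce (gS i) (gB i) (F i)" if i: "i \<in> I" for i
  proof -
    interpret G: iso_umono "C i" U "\<gamma> i" uone by (rule \<gamma>_iso[OF i])
    show ?thesis using G.rce_image[OF DC[OF i] \<Delta>[OF i]] by (simp add: F_def[abs_def])
  qed
  have pF: "U.pos (F i (cs_mult U (cs_star U y) y))" if i: "i \<in> I" "y \<in> gS i" for i y
  proof -
    interpret G: iso_umono "C i" U "\<gamma> i" uone by (rule \<gamma>_iso[OF i(1)])
    show ?thesis using G.rce_image_pos[OF DC[OF i(1)] \<Delta>[OF i(1)] i(2)] by (simp add: F_def)
  qed
  have Dl_subalg: "cs_subalg L Dl" using limit_pseudo_cartan unfolding pseudo_cartan_def by blast
  obtain H where H: "U.rce P.C P.D H" "\<And>y. y \<in> P.C \<Longrightarrow> U.pos (H (cs_mult U (cs_star U y) y))"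
    using P.rce_limit[of F, OF rF pF] by blast
  define K where "K x = E.finv (H (emb x))" for x
  have K: "cond_exp L Dl K"
    unfolding K_def using H unfolding limit_carrier limit_sub_image
    by (intro E.cond_exp_of_rce[OF Dl_sub Dl_subalg]) auto
  have HD: "H (emb x) = emb (K x)" if "x \<in> cs_carrier L" for x
  proof -
    have "H (emb x) \<in> emb ` Dl" using U.rceD(1)[OF H(1)] that unfolding limit_carrier limit_sub_image by blast
    then show ?thesis unfolding K_def using Dl_sub by (intro E.f_finv[symmetric]) blast
  qed
  have "x = cs_zero L" if x: "x \<in> cs_carrier L" "K (cs_mult L (cs_star L x) x) = cs_zero L" for x
  proof -
    have h0: "H (cs_mult U (cs_star U (emb x)) (emb x)) = cs_zero U"
      using x HD[of "cs_mult L (cs_star L x) x"] by (simp add: E.f_simps E.f_zero)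
    have "emb x \<in> P.C" unfolding limit_carrier using x(1) by (rule imageI)
    from P.rce_faithful[OF H(1) this h0] have "emb x = cs_zero U" .
    then show ?thesis by (simp add: E.f_zero)
  qed
  then have fK: "faithful_cond_exp L Dl K" unfolding faithful_cond_exp_def using K by blast
  have "max_abelian L Dl"
    unfolding max_abelian_def
  proof (intro conjI allI impI)
    show "cs_abelian L Dl" using limit_pseudo_cartan unfolding pseudo_cartan_def by blast
    fix M assume M: "cs_subalg L M \<and> cs_abelian L M \<and> Dl \<subseteq> M"
    have "x \<in> Dl" if x: "x \<in> M" for x
    proof -
      have xc: "x \<in> cs_carrier L" using M x unfolding cs_subalg_def by blast
      have "x \<in> relcomm L Dl" using M x xc unfolding relcomm_def cs_abelian_def by blast
      then have "emb x \<in> P.Dcom" unfolding limit_carrier limit_sub_image E.relcomm_image[OF Dl_sub] by blast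
      then have "emb x \<in> emb ` Dl" using P.rce_masa[OF H(1)] by (simp add: limit_sub_image)
      then show ?thesis by blast
    qed
    then show "M = Dl" using M by blast
  qed
  then show "cartan L Dl"
    unfolding cartan_def using limit_pseudo_cartan fK unfolding pseudo_cartan_def by blast
  assume E: "cond_exp L Dl E" and i: "i \<in> I" and x: "x \<in> cs_carrier (C i)"
  interpret G: iso_umono "C i" U "\<gamma> i" uone by (rule \<gamma>_iso[OF i])
  have bx: "\<beta> i x \<in> cs_carrier L" using \<beta>_mono[OF i] x unfolding star_mono_def star_hom_def by blast
  have "U.rce P.C P.D (\<lambda>y. emb (E (E.finv y)))"
    unfolding limit_carrier limit_sub_image by (rule E.rce_image[OF Dl_sub E])
  from P.rce_unique[OF this i _ rF[OF i], of "\<gamma> i x"]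
  have "emb (E (E.finv (\<gamma> i x))) = F i (\<gamma> i x)" using x by simp
  also have "F i (\<gamma> i x) = emb (\<beta> i (\<Delta> i x))" unfolding F_def using x by (simp add: \<gamma>_def[of i "\<Delta> i x"])
  also have "E.finv (\<gamma> i x) = \<beta> i x" unfolding \<gamma>_def using bx by simp
  finally show "E (\<beta> i x) = \<beta> i (\<Delta> i x)" by simp
qed

end

theorem theorem6p2p5:
  fixes I :: "'i set" and le :: "'i \<Rightarrow> 'i \<Rightarrow> bool"
    and C :: "'i \<Rightarrow> 'a cstar" and D :: "'i \<Rightarrow> 'a set" and \<alpha> :: "'i \<Rightarrow> 'i \<Rightarrow> 'a \<Rightarrow> 'a"
    and L :: "'b cstar" and \<beta> :: "'i \<Rightarrow> 'a \<Rightarrow> 'b"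
  assumes sys: "pc_system I le C D \<alpha>"
    and lim: "is_ind_limit I le C \<alpha> L \<beta>"
  shows "(pseudo_cartan L (limit_sub I D L \<beta>) \<and>
          (\<forall>l\<in>I. regular_exp L (limit_sub I D L \<beta>) (\<beta> l) (C l) (D l) \<and>
                  essential_exp L (limit_sub I D L \<beta>) (\<beta> l) (C l) (D l)))
       \<and> (\<forall>\<Delta> :: 'i \<Rightarrow> 'a \<Rightarrow> 'a.
            (\<forall>l\<in>I. cartan (C l) (D l) \<and> faithful_cond_exp (C l) (D l) (\<Delta> l)) \<longrightarrow>
            cartan L (limit_sub I D L \<beta>) \<and>
            (\<forall>E. faithful_cond_exp L (limit_sub I D L \<beta>) E \<longrightarrow>
                 (\<forall>l\<in>I. \<forall>x\<in>cs_carrier (C l). E (\<beta> l x) = \<beta> l (\<Delta> l x))))"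
proof -
  interpret pc_limit I le C D \<alpha> L \<beta> using sys lim by unfold_locales
  show ?thesis
  proof (intro conjI ballI allI impI)
    fix \<Delta> :: "'i \<Rightarrow> 'a \<Rightarrow> 'a"
    assume "\<forall>l\<in>I. cartan (C l) (D l) \<and> faithful_cond_exp (C l) (D l) (\<Delta> l)"
    then have \<Delta>: "l \<in> I \<Longrightarrow> cond_exp (C l) (D l) (\<Delta> l)" for l
      unfolding faithful_cond_exp_def by blast
    show "cartan L Dl" by (rule limit_cartan(1)[of \<Delta>]) (rule \<Delta>)
    fix E l x assume "faithful_cond_exp L Dl E" "l \<in> I" "x \<in> cs_carrier (C l)"
    then show "E (\<beta> l x) = \<beta> l (\<Delta> l x)"
      unfolding faithful_cond_exp_def by (intro limit_cartan(2)) (auto intro: \<Delta>)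
  qed (fact limit_pseudo_cartan, erule limit_regular_exp, erule limit_essential_exp)
qed

end
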